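(* Let $\varepsilon>0$, $T>0$. Given initial data $\Phi(\cdot,t=0)\in C^6_{\rm per}(\Omega)$, suppose the point-wise positive, $\Omega$-periodic solution $\Phi$ of the PDE $$\partial_t\phi=\Delta\mu,\qquad \mu=-\frac83(\phi^{-9}-\phi^{-3})-\varepsilon^2\Delta\phi$$ is in the regularity class $$\mathcal{R}:=H^{2}(0,T;C_{\rm per}(\Omega))\cap H^1(0,T;C^{2}_{\rm per}(\Omega))\cap L^{\infty}(0,T;C^{6}_{\rm per}(\Omega)).$$ Let $\phi^0=\mathcal{P}_h\Phi_N(\cdot,t=0)$ and let $\phi^{n+1}\in\mathcal{C}_{\rm per}$, $n\ge0$, be the point-wise positive numerical solution of $$\frac{\phi^{n+1}-\phi^{n}}{\Delta t}=\Delta_h \mu^{n+1},\qquad \mu^{n+1}=-\frac{8}{3}(\phi^{n+1})^{-9}+\frac{8}{3}(\phi^{n})^{-3}-\varepsilon^2\Delta_h\phi^{n+1}.$$ Set $t_m=m\Delta t$ and $\tilde\phi^m:=\mathcal{P}_h\Phi_N(\cdot,t_m)-\phi^m$. Then, provided $\Delta t$ and $h$ are sufficiently small, for all positive integers $n$ such that $t_n\le T$, $$\|\tilde\phi^n\|_{-1,h}+\left(\varepsilon^2\Delta t\sum_{m=1}^n\|\nabla_h\tilde\phi^m\|_2^2\right)^{1/2}\le C(\Delta t+h^2),$$ where $C>0$ is independent of $n$, $\Delta t$ and $h$.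
   Context: Let $\Omega=(0,L)^3$, $L>0$, $N=2K+1$ with $K\in\mathbb{N}$, $h=L/N$. $C^k_{\rm per}(\Omega)$ denotes $\Omega$-periodic $C^k$ functions. $\mathcal{C}_{\rm per}$ is the space of real grid functions $\upsilon=(\upsilon_{i,j,k})_{i,j,k\in\mathbb{Z}}$ that are $N$-periodic in each index, where $\upsilon_{i,j,k}=\upsilon(p_i,p_j,p_k)$, $p_i=(i-\tfrac12)h$. The mean is $\overline{\upsilon}=\frac{h^3}{|\Omega|}\sum_{i,j,k=1}^N\upsilon_{i,j,k}$. The discrete Laplacian is $$\Delta_h\upsilon_{i,j,k}=\frac1{h^2}(\upsilon_{i+1,j,k}+\upsilon_{i-1,j,k}+\upsilon_{i,j+1,k}+\upsilon_{i,j-1,k}+\upsilon_{i,j,k+1}+\upsilon_{i,j,k-1}-6\upsilon_{i,j,k}).$$ The grid inner product is $\langle\upsilon,\xi\rangle_\Omega=h^3\sum_{i,j,k=1}^N\upsilon_{i,j,k}\xi_{i,j,k}$, and $$\|\nabla_h\upsilon\|_2^2=h^3\sum_{i,j,k=1}^N\frac{(\upsilon_{i+1,j,k}-\upsilon_{i,j,k})^2+(\upsilon_{i,j+1,k}-\upsilon_{i,j,k})^2+(\upsilon_{i,j,k+1}-\upsilon_{i,j,k})^2}{h^2}.$$ For $f\in\mathcal{C}_{\rm per}$ with $\overline f=0$, $(-\Delta_h)^{-1}f$ is the unique $\psi\in\mathcal{C}_{\rm per}$ with $-\Delta_h\psi=f$, $\overline\psi=0$, and $\|f\|_{-1,h}=\langle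 f,(-\Delta_h)^{-1}f\rangle_\Omega^{1/2}$. Powers of grid functions are taken point-wise. $\Phi_N(\cdot,t)=\mathcal{P}_N\Phi(\cdot,t)$, where $\mathcal{P}_N$ is the spatial Fourier projection onto trigonometric polynomials of degree up to and including $K$: $\mathcal{P}_Nf(\mathbf{x})=\sum_{\|\mathbf{k}\|_1\le K}\hat f_{\mathbf{k}}\exp\left(\frac{2\pi\mathfrak{i}}{L}\mathbf{k}\cdot\mathbf{x}\right)$, $\hat f_{\mathbf{k}}=\frac1{L^3}\int_\Omega f(\mathbf{x})\exp\left(-\frac{2\pi\mathfrak{i}}{L}\mathbf{k}\cdot\mathbf{x}\right)d\mathbf{x}$. $\mathcal{P}_h$ is the grid projection: $(\mathcal{P}_hf)_{i,j,k}=f(p_i,p_j,p_k)$ for continuous periodic $f$. The error grid functions $\tilde\phi^m$ have zero mean. For $\phi^n>0$ point-wise, the scheme has a unique point-wise positive solution $\phi^{n+1}$ with $\overline{\phi^{n+1}}=\overline{\phi^n}$; this is the numerical solution meant. *)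

theory Defs
  imports "HOL-Analysis.Analysis"
begin

section \<open>Periodic functions of class C^m on R^3\<close>

definition cube :: "real \<Rightarrow> (real^3) set" where
  "cube L = {x. \<forall>i. 0 < x $ i \<and> x $ i < L}"

definition pd :: "3 \<Rightarrow> (real^3 \<Rightarrow> real) \<Rightarrow> real^3 \<Rightarrow> real" where
  "pd i f x = deriv (\<lambda>s. f (x + s *\<^sub>R axis i 1)) 0"

definition laplacian :: "(real^3 \<Rightarrow> real) \<Rightarrow> real^3 \<Rightarrow> real" where
  "laplacian f x = (\<Sum>i\<in>UNIV. pd i (pd i f) x)"

primrec class_C :: "nat \<Rightarrow> (real^3 \<Rightarrow> real) \<Rightarrow> bool" where
  "class_C 0 f \<longleftrightarrow> continuous_on UNIV f"
| "class_C (Suc m) f \<longleftrightarrow> f differentiable_on UNIV \<and> (\<forall>i. class_C m (pd i f))"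

definition C_per :: "real \<Rightarrow> nat \<Rightarrow> (real^3 \<Rightarrow> real) set" where
  "C_per L m = {f. class_C m f \<and> (\<forall>x i. f (x + axis i L) = f x)}"

text \<open>The maximum of the sup norms of all partial derivatives of order at most \<open>m\<close>. A derivative
  is given by the list of the directions of differentiation. Meaningful on \<open>C_per L m\<close>.\<close>
definition C_norm :: "nat \<Rightarrow> (real^3 \<Rightarrow> real) \<Rightarrow> real" where
  "C_norm m f = (SUP p\<in>{ds. length ds \<le> m} \<times> UNIV. \<bar>foldr pd (fst p) f (snd p)\<bar>)"


section \<open>Spaces of functions of time with values in the Banach space C_per L m\<close>

text \<open>The integration theory of HOL-Analysis is for values in a Banach space given as a type, so
  that the Bochner notions are spelled out here for \<open>C_per L m\<close> with the norm \<open>C_norm m\<close>.\<close>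

definition simple_fun :: "real \<Rightarrow> nat \<Rightarrow> real \<Rightarrow> (real \<Rightarrow> real^3 \<Rightarrow> real) \<Rightarrow> bool" where
  "simple_fun L m T s \<longleftrightarrow>
     simple_function (lebesgue_on {0<..<T}) s \<and> (\<forall>t\<in>{0<..<T}. s t \<in> C_per L m)"

definition simple_integral :: "real \<Rightarrow> (real \<Rightarrow> real^3 \<Rightarrow> real) \<Rightarrow> real^3 \<Rightarrow> real" where
  "simple_integral T s x =
     (\<Sum>y\<in>s ` {0<..<T}. measure lebesgue {t\<in>{0<..<T}. s t = y} * y x)"

definition strongly_measurable :: "real \<Rightarrow> nat \<Rightarrow> real \<Rightarrow> (real \<Rightarrow> real^3 \<Rightarrow> real) \<Rightarrow> bool" where
  "strongly_measurable L m T u \<longleftrightarrow>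
     (AE t in lebesgue_on {0<..<T}. u t \<in> C_per L m) \<and>
     (\<exists>s. (\<forall>n. simple_fun L m T (s n)) \<and>
       (AE t in lebesgue_on {0<..<T}. (\<lambda>n. C_norm m (\<lambda>x. u t x - s n t x)) \<longlonglongrightarrow> 0))"

definition has_bochner :: "real \<Rightarrow> nat \<Rightarrow> real \<Rightarrow> (real \<Rightarrow> real^3 \<Rightarrow> real) \<Rightarrow> (real^3 \<Rightarrow> real) \<Rightarrow> bool" where
  "has_bochner L m T u w \<longleftrightarrow>
     strongly_measurable L m T u \<and> w \<in> C_per L m \<and>
     (\<exists>s. (\<forall>n. simple_fun L m T (s n)) \<and>
       (\<lambda>n. \<integral>\<^sup>+t. ennreal (C_norm m (\<lambda>x. u t x - s n t x)) \<partial>lebesgue_on {0<..<T}) \<longlonglongrightarrow> 0 \<and>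
       (\<lambda>n. C_norm m (\<lambda>x. w x - simple_integral T (s n) x)) \<longlonglongrightarrow> 0)"

definition L2_time :: "real \<Rightarrow> nat \<Rightarrow> real \<Rightarrow> (real \<Rightarrow> real^3 \<Rightarrow> real) set" where
  "L2_time L m T = {u. strongly_measurable L m T u \<and>
     (\<integral>\<^sup>+t. ennreal ((C_norm m (u t))\<^sup>2) \<partial>lebesgue_on {0<..<T}) < \<infinity>}"

definition Linf_time :: "real \<Rightarrow> nat \<Rightarrow> real \<Rightarrow> (real \<Rightarrow> real^3 \<Rightarrow> real) set" where
  "Linf_time L m T = {u. strongly_measurable L m T u \<and>
     (\<exists>B. AE t in lebesgue_on {0<..<T}. C_norm m (u t) \<le> B)}"

definition test_fun :: "real \<Rightarrow> (real \<Rightarrow> real) \<Rightarrow> bool" where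
  "test_fun T \<eta> \<longleftrightarrow>
     (\<forall>k t. (deriv ^^ k) \<eta> field_differentiable (at t)) \<and>
     compact (closure {t. \<eta> t \<noteq> 0}) \<and> closure {t. \<eta> t \<noteq> 0} \<subseteq> {0<..<T}"

definition weak_time_deriv ::
  "real \<Rightarrow> nat \<Rightarrow> real \<Rightarrow> (real \<Rightarrow> real^3 \<Rightarrow> real) \<Rightarrow> (real \<Rightarrow> real^3 \<Rightarrow> real) \<Rightarrow> bool" where
  "weak_time_deriv L m T u v \<longleftrightarrow>
     (\<forall>\<eta>. test_fun T \<eta> \<longrightarrow>
       (\<exists>w. has_bochner L m T (\<lambda>t x. deriv \<eta> t * u t x) w \<and>
            has_bochner L m T (\<lambda>t x. \<eta> t * v t x) (\<lambda>x. - w x)))"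

text \<open>\<open>H_time k L m T\<close> is \<open>H\<^sup>k(0,T; C\<^sup>m\<^sub>p\<^sub>e\<^sub>r)\<close>. As usual, it is \<open>L\<^sup>2\<close> for \<open>k = 0\<close>.\<close>
primrec H_time :: "nat \<Rightarrow> real \<Rightarrow> nat \<Rightarrow> real \<Rightarrow> (real \<Rightarrow> real^3 \<Rightarrow> real) set" where
  "H_time 0 L m T = L2_time L m T"
| "H_time (Suc k) L m T =
     {u \<in> L2_time L m T. \<exists>v \<in> H_time k L m T. weak_time_deriv L m T u v}"

definition C_time :: "real \<Rightarrow> nat \<Rightarrow> real \<Rightarrow> (real \<Rightarrow> real^3 \<Rightarrow> real) set" where
  "C_time L m T = {u. \<forall>t\<in>{0..T}. u t \<in> C_per L m \<and>
     ((\<lambda>s. C_norm m (\<lambda>x. u s x - u t x)) \<longlongrightarrow> 0) (at t within {0..T})}"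

text \<open>An element of \<open>H_time 2 L 0 T\<close> is only determined up to null sets of times. Values at single
  times are those of its continuous representative, which \<open>C_time\<close> selects.\<close>
definition reg_class :: "real \<Rightarrow> real \<Rightarrow> (real \<Rightarrow> real^3 \<Rightarrow> real) set" where
  "reg_class L T = H_time 2 L 0 T \<inter> H_time 1 L 2 T \<inter> Linf_time L 6 T \<inter> C_time L 0 T"


section \<open>The equation\<close>

definition chem_pot :: "real \<Rightarrow> (real^3 \<Rightarrow> real) \<Rightarrow> real^3 \<Rightarrow> real" where
  "chem_pot \<epsilon> f x = - (8/3) * (f x powi (-9) - f x powi (-3)) - \<epsilon>\<^sup>2 * laplacian f x"

definition pde_solution :: "real \<Rightarrow> real \<Rightarrow> (real \<Rightarrow> real^3 \<Rightarrow> real) \<Rightarrow> bool" where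
  "pde_solution \<epsilon> T \<Phi> \<longleftrightarrow>
     (AE t in lebesgue_on {0<..<T}. \<forall>x.
        ((\<lambda>s. \<Phi> s x) has_real_derivative laplacian (chem_pot \<epsilon> (\<Phi> t)) x) (at t))"


section \<open>Fourier projection\<close>

definition phase :: "real \<Rightarrow> int^3 \<Rightarrow> real^3 \<Rightarrow> real" where
  "phase L k x = 2 * pi / L * (\<Sum>i\<in>UNIV. of_int (k $ i) * x $ i)"

definition fourier_coeff :: "real \<Rightarrow> (real^3 \<Rightarrow> real) \<Rightarrow> int^3 \<Rightarrow> complex" where
  "fourier_coeff L f k = complex_of_real (1 / L^3) *
     (LINT x:cube L|lebesgue. complex_of_real (f x) * exp (- \<i> * complex_of_real (phase L k x)))"

text \<open>The sum is real for real \<open>f\<close>, because the index set is symmetric; \<open>Re\<close> only changes its type.\<close>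
definition fourier_proj :: "real \<Rightarrow> nat \<Rightarrow> (real^3 \<Rightarrow> real) \<Rightarrow> real^3 \<Rightarrow> real" where
  "fourier_proj L K f x =
     Re (\<Sum>k\<in>{k. (\<Sum>i\<in>UNIV. \<bar>k $ i\<bar>) \<le> int K}.
           fourier_coeff L f k * exp (\<i> * complex_of_real (phase L k x)))"


section \<open>Grid functions\<close>

type_synonym grid_fun = "int \<Rightarrow> int \<Rightarrow> int \<Rightarrow> real"

definition grid_per :: "nat \<Rightarrow> grid_fun set" where
  "grid_per N = {v. \<forall>i j k. v (i + int N) j k = v i j k \<and> v i (j + int N) k = v i j k \<and>
                            v i j (k + int N) = v i j k}"

definition mesh :: "real \<Rightarrow> nat \<Rightarrow> real" where
  "mesh L N = L / real N"

definition node :: "real \<Rightarrow> int \<Rightarrow> real" where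
  "node h i = (of_int i - 1/2) * h"

definition grid_proj :: "real \<Rightarrow> (real^3 \<Rightarrow> real) \<Rightarrow> grid_fun" where
  "grid_proj h f i j k = f (vector [node h i, node h j, node h k])"

definition grid_mean :: "real \<Rightarrow> nat \<Rightarrow> grid_fun \<Rightarrow> real" where
  "grid_mean L N v = (mesh L N)^3 / L^3 *
     (\<Sum>i=1..int N. \<Sum>j=1..int N. \<Sum>k=1..int N. v i j k)"

definition grid_lap :: "real \<Rightarrow> grid_fun \<Rightarrow> grid_fun" where
  "grid_lap h v i j k = 1 / h\<^sup>2 *
     (v (i+1) j k + v (i-1) j k + v i (j+1) k + v i (j-1) k + v i j (k+1) + v i j (k-1)
      - 6 * v i j k)"

definition grid_inner :: "real \<Rightarrow> nat \<Rightarrow> grid_fun \<Rightarrow> grid_fun \<Rightarrow> real" where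
  "grid_inner L N v w = (mesh L N)^3 *
     (\<Sum>i=1..int N. \<Sum>j=1..int N. \<Sum>k=1..int N. v i j k * w i j k)"

definition grid_grad_sq :: "real \<Rightarrow> nat \<Rightarrow> grid_fun \<Rightarrow> real" where
  "grid_grad_sq L N v = (mesh L N)^3 *
     (\<Sum>i=1..int N. \<Sum>j=1..int N. \<Sum>k=1..int N.
        ((v (i+1) j k - v i j k)\<^sup>2 + (v i (j+1) k - v i j k)\<^sup>2 + (v i j (k+1) - v i j k)\<^sup>2)
          / (mesh L N)\<^sup>2)"

definition inv_neg_lap :: "real \<Rightarrow> nat \<Rightarrow> grid_fun \<Rightarrow> grid_fun" where
  "inv_neg_lap L N f =
     (THE \<psi>. \<psi> \<in> grid_per N \<and> (\<forall>i j k. - grid_lap (mesh L N) \<psi> i j k = f i j k) \<and>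
             grid_mean L N \<psi> = 0)"

definition neg_norm :: "real \<Rightarrow> nat \<Rightarrow> grid_fun \<Rightarrow> real" where
  "neg_norm L N f = sqrt (grid_inner L N f (inv_neg_lap L N f))"


section \<open>The scheme\<close>

definition grid_chem_pot :: "real \<Rightarrow> real \<Rightarrow> grid_fun \<Rightarrow> grid_fun \<Rightarrow> grid_fun" where
  "grid_chem_pot \<epsilon> h new old i j k =
     - (8/3) * new i j k powi (-9) + (8/3) * old i j k powi (-3) - \<epsilon>\<^sup>2 * grid_lap h new i j k"

definition scheme_solution :: "real \<Rightarrow> real \<Rightarrow> nat \<Rightarrow> real \<Rightarrow> (nat \<Rightarrow> grid_fun) \<Rightarrow> bool" where
  "scheme_solution \<epsilon> L N \<Delta>t \<phi> \<longleftrightarrow>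
     (\<forall>n. \<phi> (Suc n) \<in> grid_per N \<and> (\<forall>i j k. \<phi> (Suc n) i j k > 0) \<and>
          grid_mean L N (\<phi> (Suc n)) = grid_mean L N (\<phi> n) \<and>
          (\<forall>i j k. (\<phi> (Suc n) i j k - \<phi> n i j k) / \<Delta>t
             = grid_lap (mesh L N) (grid_chem_pot \<epsilon> (mesh L N) (\<phi> (Suc n)) (\<phi> n)) i j k))"

definition err :: "real \<Rightarrow> nat \<Rightarrow> real \<Rightarrow> (real \<Rightarrow> real^3 \<Rightarrow> real) \<Rightarrow> (nat \<Rightarrow> grid_fun) \<Rightarrow> nat \<Rightarrow> grid_fun"
where
  "err L K \<Delta>t \<Phi> \<phi> m i j k =
     grid_proj (mesh L (2*K+1)) (fourier_proj L K (\<Phi> (real m * \<Delta>t))) i j k - \<phi> m i j k"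

end

theory Submission
  imports Defs
begin

text \<open>The scheme is compared with the exact solution itself rather than with its Fourier projection. The
  grid function of \<open>\<Phi>(t\<^sub>m)\<close> has a mean slightly different from that of
  \<open>\<phi>\<^sup>m\<close>, so a constant of size \<open>O(h\<^sup>2)\<close> is subtracted
  from it; the result is called \<open>comparison m\<close>, and \<open>gap m = comparison m -
  \<phi>\<^sup>m\<close> has mean zero. The constant is a single number at each time level, so that
  it disappears under \<open>\<Delta>\<^sub>h\<close> and in every pairing with a function of mean
  zero. The rest of the error, \<open>proj_gap m\<close>, is \<open>O(h\<^sup>2)\<close> together
  with its difference quotients, because the Fourier coefficients of a \<open>C\<^sup>6\<close>
  function decay like the inverse sixth power of the frequency (\<open>fourier_proj_error\<close>).
  Its mean vanishes because trigonometric polynomials of degree at most \<open>K\<close> are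
  averaged exactly on \<open>2 K + 1\<close> nodes and because the equation conserves mass
  (\<open>grid_mean_fourier_proj\<close>, \<open>mass_conservation\<close>).

  Consistency. The increment of \<open>\<Phi>\<close> over a time step is governed by
  \<open>\<Delta>\<mu>\<close>. At the nodes \<open>\<Delta>\<mu>\<close> is
  \<open>\<Delta>\<^sub>h\<mu>\<close> up to \<open>O(h\<^sup>2)\<close>, and \<open>\<mu>\<close>
  differs by \<open>O(\<Delta>t + h\<^sup>2)\<close> from the discrete chemical potential of the
  comparison functions. The second part of the residual thus has the form \<open>\<Delta>\<^sub>h
  r\<close> with a small \<open>r\<close>. The error equation is tested with \<open>\<psi> =
  (-\<Delta>\<^sub>h)\<^sup>-\<^sup>1 gap\<close>, which turns \<open>\<Delta>\<^sub>h r\<close>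
  into \<open>r\<close> paired with \<open>gap\<close>; no difference quotient of \<open>r\<close>
  has to be estimated (\<open>consistency\<close>, \<open>energy_inequality\<close>).

  Stability. Testing produces the increment of the squared \<open>-1\<close> norm, the term
  \<open>\<epsilon>\<^sup>2 \<parallel>\<nabla>\<^sub>h gap\<parallel>\<^sup>2\<close>, and the
  dissipation of the implicit power \<open>-9\<close>, which is monotone. No lower bound for the
  numerical solution that is uniform in the mesh is at hand, so the explicit power \<open>-3\<close>
  is not Lipschitz. But near zero the power \<open>-9\<close> is so much more singular that the
  square of the difference of the powers \<open>-3\<close> is bounded by the density of the
  dissipation plus the squared gap (\<open>explicit_term_controlled\<close>). The explicit term of a
  step is therefore absorbed by the dissipation of the step before, which is why
  \<open>energy\<close> contains that dissipation. The remaining \<open>l\<^sup>2\<close> norms are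
  interpolated between \<open>\<parallel>\<nabla>\<^sub>h \<cdot>\<parallel>\<close> and the
  \<open>-1\<close> norm (\<open>l2_interpolation\<close>), and the discrete Gronwall inequality
  closes the estimate.

  Regularity in time. The equation and the bounds on derivatives hold for almost every time only,
  and the time derivatives of the class \<open>H\<^sup>2\<close> are weak ones, tested with Bochner
  integrals. Evaluating at a fixed point \<open>x\<close> gives a continuous scalar function whose
  distributional second derivative is integrable, hence a function that is \<open>C\<^sup>1\<close>
  on the open time interval (\<open>C1_of_distributional_second_derivative\<close>). Bounds on its
  derivative at almost all times then bound its increments. The scheme sees the solution only
  through finite linear combinations of point values, so this suffices
  (\<open>point_functional_increment\<close>).\<close>

section \<open>Sums over the periodic grid\<close>

definition gsum :: "nat \<Rightarrow> grid_fun \<Rightarrow> real" where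
  "gsum N v = (\<Sum>i=1..int N. \<Sum>j=1..int N. \<Sum>k=1..int N. v i j k)"

lemma gsum_add: "gsum N (\<lambda>i j k. v i j k + w i j k) = gsum N v + gsum N w"
  by (simp add: gsum_def sum.distrib)

lemma gsum_diff: "gsum N (\<lambda>i j k. v i j k - w i j k) = gsum N v - gsum N w"
  by (simp add: gsum_def sum_subtractf)

lemma gsum_cmult: "gsum N (\<lambda>i j k. c * v i j k) = c * gsum N v"
  by (simp add: gsum_def sum_distrib_left)

lemma gsum_uminus: "gsum N (\<lambda>i j k. - v i j k) = - gsum N v"
  by (simp add: gsum_def sum_negf)

lemma gsum_const: "gsum N (\<lambda>i j k. c) = real N ^ 3 * c"
  by (simp add: gsum_def power3_eq_cube)

lemma gsum_mono:
  assumes "\<And>i j k. v i j k \<le> w i j k"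
  shows "gsum N v \<le> gsum N w"
  unfolding gsum_def by (intro sum_mono assms)

lemma gsum_nonneg:
  assumes "\<And>i j k. 0 \<le> v i j k"
  shows "0 \<le> gsum N v"
  unfolding gsum_def by (intro sum_nonneg assms)

lemma gsum_abs: "\<bar>gsum N v\<bar> \<le> gsum N (\<lambda>i j k. \<bar>v i j k\<bar>)"
  unfolding gsum_def by (intro order_trans[OF sum_abs] sum_mono order_refl)

lemma grid_per_shift:
  assumes "v \<in> grid_per N"
  shows "v (i + int N) j k = v i j k" "v i (j + int N) k = v i j k" "v i j (k + int N) = v i j k"
  using assms by (auto simp: grid_per_def)

lemma sum_periodic_shift:
  fixes f :: "int \<Rightarrow> real"
  assumes "\<And>i. f (i + int N) = f i"
  shows "(\<Sum>i=1..int N. f (i + 1)) = (\<Sum>i=1..int N. f i)"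
proof (cases "N = 0")
  case False
  have "(\<Sum>i=1..int N. f (i + 1)) = (\<Sum>i=2..int N + 1. f i)"
    by (rule sum.reindex_bij_witness[of _ "\<lambda>i. i - 1" "\<lambda>i. i + 1"]) auto
  also have "{2..int N + 1} = insert (int N + 1) {2..int N}" using False by auto
  also have "(\<Sum>i\<in>insert (int N + 1) {2..int N}. f i) = f 1 + (\<Sum>i=2..int N. f i)"
    using assms[of 1] by (simp add: add.commute)
  also have "\<dots> = (\<Sum>i\<in>insert 1 {2..int N}. f i)" by simp
  also have "insert 1 {2..int N} = {1..int N}" using False by auto
  finally show ?thesis .
qed simp

lemma gsum_shift:
  assumes "v \<in> grid_per N"
  shows "gsum N (\<lambda>i j k. v (i + 1) j k) = gsum N v"
    and "gsum N (\<lambda>i j k. v i (j + 1) k) = gsum N v"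
    and "gsum N (\<lambda>i j k. v i j (k + 1)) = gsum N v"
proof -
  show "gsum N (\<lambda>i j k. v (i + 1) j k) = gsum N v"
    unfolding gsum_def
    by (rule sum_periodic_shift[where f = "\<lambda>i. \<Sum>j=1..int N. \<Sum>k=1..int N. v i j k"])
      (simp add: grid_per_shift[OF assms])
  show "gsum N (\<lambda>i j k. v i (j + 1) k) = gsum N v"
    unfolding gsum_def
    by (intro sum.cong refl sum_periodic_shift[where f = "\<lambda>j. \<Sum>k=1..int N. v _ j k"])
      (simp add: grid_per_shift[OF assms])
  show "gsum N (\<lambda>i j k. v i j (k + 1)) = gsum N v"
    unfolding gsum_def
    by (intro sum.cong refl sum_periodic_shift[where f = "\<lambda>k. v _ _ k"])
      (simp add: grid_per_shift[OF assms])
qed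

lemma grid_per_shift_minus:
  assumes "v \<in> grid_per N"
  shows "v (i + int N - 1) j k = v (i - 1) j k" "v i (j + int N - 1) k = v i (j - 1) k"
    "v i j (k + int N - 1) = v i j (k - 1)"
    "v (i + int N + 1) j k = v (i + 1) j k" "v i (j + int N + 1) k = v i (j + 1) k"
    "v i j (k + int N + 1) = v i j (k + 1)"
  using grid_per_shift(1)[OF assms, of "i - 1" j k] grid_per_shift(1)[OF assms, of "i + 1" j k]
    grid_per_shift(2)[OF assms, of i "j - 1" k] grid_per_shift(2)[OF assms, of i "j + 1" k]
    grid_per_shift(3)[OF assms, of i j "k - 1"] grid_per_shift(3)[OF assms, of i j "k + 1"]
  by (simp_all add: algebra_simps)

text \<open>Summation by parts on the torus: after shifting indices by one, which periodicity allows, both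
  sides are sums over the edges between neighbouring nodes.\<close>

lemma gsum_by_parts:
  assumes v: "v \<in> grid_per N" and w: "w \<in> grid_per N"
  shows "gsum N (\<lambda>i j k. (v (i+1) j k + v (i-1) j k + v i (j+1) k + v i (j-1) k + v i j (k+1)
            + v i j (k-1) - 6 * v i j k) * w i j k)
     = - gsum N (\<lambda>i j k. (v (i+1) j k - v i j k) * (w (i+1) j k - w i j k)
          + (v i (j+1) k - v i j k) * (w i (j+1) k - w i j k)
          + (v i j (k+1) - v i j k) * (w i j (k+1) - w i j k))"
proof -
  note per = grid_per_shift[OF v] grid_per_shift[OF w] grid_per_shift_minus[OF v] grid_per_shift_minus[OF w]
  let ?a = "\<lambda>i j k. (v i j k - v (i-1) j k) * w i j k"
  let ?b = "\<lambda>i j k. (v i j k - v i (j-1) k) * w i j k"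
  let ?c = "\<lambda>i j k. (v i j k - v i j (k-1)) * w i j k"
  have "?a \<in> grid_per N" "?b \<in> grid_per N" "?c \<in> grid_per N"
    by (simp_all add: grid_per_def per)
  note sh = gsum_shift(1)[OF this(1)] gsum_shift(2)[OF this(2)] gsum_shift(3)[OF this(3)]
  have "gsum N (\<lambda>i j k. (v (i+1) j k + v (i-1) j k + v i (j+1) k + v i (j-1) k + v i j (k+1)
            + v i j (k-1) - 6 * v i j k) * w i j k)
      = gsum N (\<lambda>i j k. (((v (i+1) j k - v i j k) * w i j k - ?a i j k)
                + ((v i (j+1) k - v i j k) * w i j k - ?b i j k))
                + ((v i j (k+1) - v i j k) * w i j k - ?c i j k))"
    by (rule arg_cong[of _ _ "gsum N"], intro ext) (simp add: algebra_simps)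
  also have "\<dots> = gsum N (\<lambda>i j k. (((v (i+1) j k - v i j k) * w i j k - ?a (i+1) j k)
                + ((v i (j+1) k - v i j k) * w i j k - ?b i (j+1) k))
                + ((v i j (k+1) - v i j k) * w i j k - ?c i j (k+1)))"
    unfolding gsum_add gsum_diff using sh by presburger
  also have "\<dots> = gsum N (\<lambda>i j k. - ((v (i+1) j k - v i j k) * (w (i+1) j k - w i j k)
          + (v i (j+1) k - v i j k) * (w i (j+1) k - w i j k)
          + (v i j (k+1) - v i j k) * (w i j (k+1) - w i j k)))"
    by (rule arg_cong[of _ _ "gsum N"], intro ext) (simp add: algebra_simps)
  finally show ?thesis unfolding gsum_uminus .
qed

text \<open>Telescoping and Cauchy-Schwarz, with the segment between the two indices enlarged to a full
  period so that the bound does not depend on them.\<close>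

lemma sq_diff_le_sum_sq_increments:
  fixes w :: "int \<Rightarrow> real"
  assumes "i \<in> {1..int N}" "i' \<in> {1..int N}"
  shows "(w i - w i')\<^sup>2 \<le> real N * (\<Sum>l=1..int N. (w (l+1) - w l)\<^sup>2)"
  using assms
proof (induction i i' rule: linorder_wlog)
  case (le a b)
  have tele: "a + int n \<le> int N \<Longrightarrow> w (a + int n) - w a = (\<Sum>l\<in>{a..<a + int n}. w (l+1) - w l)" for n
  proof (induction n)
    case (Suc n)
    have "{a..<a + int (Suc n)} = insert (a + int n) {a..<a + int n}" by auto
    with Suc show ?case by (simp add: algebra_simps)
  qed simp
  have "w b - w a = (\<Sum>l\<in>{a..<b}. w (l+1) - w l)"
    using tele[of "nat (b - a)"] le by simp
  then have "(w a - w b)\<^sup>2 = (\<Sum>l\<in>{a..<b}. w (l+1) - w l)\<^sup>2"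
    by (metis power2_commute)
  also have "\<dots> \<le> (\<Sum>l\<in>{a..<b}. (w (l+1) - w l)\<^sup>2) * card {a..<b}"
    by (rule sum_squared_le_sum_of_squares)
  also have "\<dots> \<le> (\<Sum>l=1..int N. (w (l+1) - w l)\<^sup>2) * real N"
    using le by (intro mult_mono sum_mono2 sum_nonneg) auto
  finally show ?case by (simp add: mult.commute)
next
  case (sym a b)
  then show ?case by (metis power2_commute)
qed

text \<open>A Poincare inequality with an elementary proof. For mean zero the mean square is half the
  average over all pairs of nodes of the squared differences, and two nodes are joined by a path
  along the three axes, on which Cauchy-Schwarz applies.\<close>

lemma gsum_poincare:
  assumes mean: "gsum N v = 0" and N: "N > 0"
  shows "gsum N (\<lambda>i j k. (v i j k)\<^sup>2) \<le> 3 * (real N)\<^sup>2 *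
    gsum N (\<lambda>i j k. (v (i+1) j k - v i j k)\<^sup>2 + (v i (j+1) k - v i j k)\<^sup>2 + (v i j (k+1) - v i j k)\<^sup>2)"
proof -
  let ?I = "{1..int N}"
  let ?n = "real N"
  define A where "A j k = (\<Sum>l\<in>?I. (v (l+1) j k - v l j k)\<^sup>2)" for j k
  define B where "B i k = (\<Sum>l\<in>?I. (v i (l+1) k - v i l k)\<^sup>2)" for i k
  define C where "C i j = (\<Sum>l\<in>?I. (v i j (l+1) - v i j l)\<^sup>2)" for i j
  \<comment> \<open>The path from \<open>(i, j, k)\<close> to \<open>(i', j', k')\<close> changes one coordinate
     at a time.\<close>
  have pt: "(v i j k - v i' j' k')\<^sup>2 \<le> 3 * ?n * (A j k + B i' k + C i' j')"
    if "i \<in> ?I" "j \<in> ?I" "k \<in> ?I" "i' \<in> ?I" "j' \<in> ?I" "k' \<in> ?I" for i j k i' j' k'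
  proof -
    have sq: "(a + b + c)\<^sup>2 \<le> 3 * (a\<^sup>2 + b\<^sup>2 + c\<^sup>2)" for a b c :: real
      using sum_squares_ge_zero[of "a - b" "b - c"] zero_le_power2[of "c - a"]
      by (simp add: power2_eq_square algebra_simps)
    have "(v i j k - v i' j' k')\<^sup>2
        = ((v i j k - v i' j k) + (v i' j k - v i' j' k) + (v i' j' k - v i' j' k'))\<^sup>2"
      by simp
    also have "\<dots> \<le> 3 * ((v i j k - v i' j k)\<^sup>2 + (v i' j k - v i' j' k)\<^sup>2 + (v i' j' k - v i' j' k')\<^sup>2)"
      by (rule sq)
    also have "\<dots> \<le> 3 * (?n * A j k + ?n * B i' k + ?n * C i' j')"
      unfolding A_def B_def C_def using that
      by (intro mult_left_mono add_mono sq_diff_le_sum_sq_increments[where w = "\<lambda>l. v l j k"]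
          sq_diff_le_sum_sq_increments[where w = "\<lambda>l. v i' l k"]
          sq_diff_le_sum_sq_increments[where w = "\<lambda>l. v i' j' l"]) auto
    finally show ?thesis by (simp add: algebra_simps)
  qed
  have inner: "gsum N (\<lambda>i' j' k'. (x - v i' j' k')\<^sup>2) = ?n^3 * x\<^sup>2 + gsum N (\<lambda>i j k. (v i j k)\<^sup>2)" for x
  proof -
    have "gsum N (\<lambda>i' j' k'. (x - v i' j' k')\<^sup>2)
       = gsum N (\<lambda>i' j' k'. x\<^sup>2 - 2 * x * v i' j' k' + (v i' j' k')\<^sup>2)"
      by (rule arg_cong[of _ _ "gsum N"], intro ext) (simp add: power2_eq_square algebra_simps)
    then show ?thesis by (simp add: gsum_add gsum_diff gsum_cmult gsum_const mean)
  qed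
  have "2 * ?n^3 * gsum N (\<lambda>i j k. (v i j k)\<^sup>2)
      = gsum N (\<lambda>i j k. gsum N (\<lambda>i' j' k'. (v i j k - v i' j' k')\<^sup>2))"
    by (simp add: inner gsum_add gsum_cmult gsum_const)
  also have "\<dots> \<le> gsum N (\<lambda>i j k. gsum N (\<lambda>i' j' k'. 3 * ?n * (A j k + B i' k + C i' j')))"
    unfolding gsum_def by (intro sum_mono pt)
  also have "\<dots> = 3 * ?n * (gsum N (\<lambda>i j k. gsum N (\<lambda>i' j' k'. A j k))
      + gsum N (\<lambda>i j k. gsum N (\<lambda>i' j' k'. B i' k)) + gsum N (\<lambda>i j k. gsum N (\<lambda>i' j' k'. C i' j')))"
    by (simp add: gsum_cmult gsum_add)
  also have "gsum N (\<lambda>i j k. gsum N (\<lambda>i' j' k'. A j k))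
      = ?n^4 * gsum N (\<lambda>i j k. (v (i+1) j k - v i j k)\<^sup>2)"
  proof -
    have "gsum N (\<lambda>i j k. gsum N (\<lambda>i' j' k'. A j k)) = ?n^4 * (\<Sum>j\<in>?I. \<Sum>k\<in>?I. A j k)"
      by (simp add: gsum_const gsum_cmult)
         (simp add: gsum_def power4_eq_xxxx power3_eq_cube)
    also have "(\<Sum>j\<in>?I. \<Sum>k\<in>?I. A j k) = (\<Sum>j\<in>?I. \<Sum>l\<in>?I. \<Sum>k\<in>?I. (v (l+1) j k - v l j k)\<^sup>2)"
      unfolding A_def by (subst (2) sum.swap) simp
    also have "\<dots> = gsum N (\<lambda>i j k. (v (i+1) j k - v i j k)\<^sup>2)"
      unfolding gsum_def by (rule sum.swap)
    finally show ?thesis .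
  qed
  also have "gsum N (\<lambda>i j k. gsum N (\<lambda>i' j' k'. B i' k))
      = ?n^4 * gsum N (\<lambda>i j k. (v i (j+1) k - v i j k)\<^sup>2)"
  proof -
    have "gsum N (\<lambda>i j k. gsum N (\<lambda>i' j' k'. B i' k)) = ?n^4 * (\<Sum>k\<in>?I. \<Sum>i\<in>?I. B i k)"
      by (simp add: gsum_def power4_eq_xxxx sum_distrib_left mult.assoc)
    also have "(\<Sum>k\<in>?I. \<Sum>i\<in>?I. B i k) = (\<Sum>i\<in>?I. \<Sum>k\<in>?I. B i k)" by (rule sum.swap)
    also have "\<dots> = gsum N (\<lambda>i j k. (v i (j+1) k - v i j k)\<^sup>2)"
      unfolding B_def gsum_def by (intro sum.cong refl sum.swap)
    finally show ?thesis .
  qed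
  also have "gsum N (\<lambda>i j k. gsum N (\<lambda>i' j' k'. C i' j'))
      = ?n^4 * gsum N (\<lambda>i j k. (v i j (k+1) - v i j k)\<^sup>2)"
    by (simp add: gsum_const) (simp add: gsum_def C_def power4_eq_xxxx power3_eq_cube sum_distrib_left mult.assoc)
  also have "3 * ?n * (?n^4 * gsum N (\<lambda>i j k. (v (i+1) j k - v i j k)\<^sup>2)
        + ?n^4 * gsum N (\<lambda>i j k. (v i (j+1) k - v i j k)\<^sup>2)
        + ?n^4 * gsum N (\<lambda>i j k. (v i j (k+1) - v i j k)\<^sup>2)) = 2 * ?n^3 * (3/2 * ?n\<^sup>2 *
     gsum N (\<lambda>i j k. (v (i+1) j k - v i j k)\<^sup>2 + (v i (j+1) k - v i j k)\<^sup>2 + (v i j (k+1) - v i j k)\<^sup>2))"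
  proof -
    have "3 * n * (n^4 * X + n^4 * Y + n^4 * Z) = 2 * n^3 * (3/2 * n\<^sup>2 * (X + Y + Z))" for n X Y Z :: real
      by (simp add: algebra_simps eval_nat_numeral)
    then show ?thesis unfolding gsum_add .
  qed
  finally have "2 * ?n^3 * gsum N (\<lambda>i j k. (v i j k)\<^sup>2) \<le> 2 * ?n^3 * (3/2 * ?n\<^sup>2 *
     gsum N (\<lambda>i j k. (v (i+1) j k - v i j k)\<^sup>2 + (v i (j+1) k - v i j k)\<^sup>2 + (v i j (k+1) - v i j k)\<^sup>2))" .
  then have "gsum N (\<lambda>i j k. (v i j k)\<^sup>2) \<le> 3/2 * ?n\<^sup>2 *
     gsum N (\<lambda>i j k. (v (i+1) j k - v i j k)\<^sup>2 + (v i (j+1) k - v i j k)\<^sup>2 + (v i j (k+1) - v i j k)\<^sup>2)"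
    using N by (simp only: mult_le_cancel_left_pos[of "2 * ?n^3"] zero_less_mult_iff zero_less_power of_nat_0_less_iff zero_less_numeral simp_thms)
  also have "\<dots> \<le> 3 * ?n\<^sup>2 *
     gsum N (\<lambda>i j k. (v (i+1) j k - v i j k)\<^sup>2 + (v i (j+1) k - v i j k)\<^sup>2 + (v i j (k+1) - v i j k)\<^sup>2)"
    by (intro mult_right_mono gsum_nonneg) auto
  finally show ?thesis .
qed

lemma grid_fun_residue:
  assumes N: "N > 0" and v: "v \<in> grid_per N"
  shows "\<exists>i'\<in>{1..int N}. \<exists>j'\<in>{1..int N}. \<exists>k'\<in>{1..int N}. v i j k = v i' j' k'"
proof -
  have per1: "f (i + m * int N) = f i" if f: "\<And>i. f (i + int N) = f i" for f :: "int \<Rightarrow> real" and i m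
  proof (induction m rule: int_induct[where k = 0])
    case (step1 m) then show ?case using f[of "i + m * int N"] by (simp add: algebra_simps)
  next
    case (step2 m) then show ?case using f[of "i + (m - 1) * int N"] by (simp add: algebra_simps)
  qed simp
  define r where "r i = 1 + (i - 1) mod int N" for i
  have r1: "r i \<in> {1..int N}" for i
  proof -
    have "0 < int N" using N by simp
    from pos_mod_bound[OF this, of "i - 1"] pos_mod_sign[OF this, of "i - 1"]
    show ?thesis unfolding r_def atLeastAtMost_iff by linarith
  qed
  have r2: "r i = i + (- ((i - 1) div int N)) * int N" for i
    using div_mult_mod_eq[of "i - 1" "int N"] unfolding r_def by linarith
  have "v (i + m * int N) j k = v i j k" for i j k m
    by (rule per1[of "\<lambda>i. v i j k"]) (rule grid_per_shift(1)[OF v])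
  then have "v i j k = v (r i) j k" by (simp only: r2[of i])
  have shj: "v i (j + m * int N) k = v i j k" for i j k m
    by (rule per1[of "\<lambda>j. v i j k"]) (rule grid_per_shift(2)[OF v])
  note eq1 = \<open>v i j k = v (r i) j k\<close>
  have eq2: "v (r i) j k = v (r i) (r j) k" using shj[of "r i" j _ k] by (simp only: r2[of j])
  have shk: "v i j (k + m * int N) = v i j k" for i j k m
    by (rule per1[of "\<lambda>k. v i j k"]) (rule grid_per_shift(3)[OF v])
  have "v (r i) (r j) k = v (r i) (r j) (r k)" using shk[of "r i" "r j" k] by (simp only: r2[of k])
  with eq1 eq2 show ?thesis using r1 by metis
qed

lemma gsum_ge_entry:
  assumes N: "N > 0" and v: "v \<in> grid_per N" and nonneg: "\<And>i j k. v i j k \<ge> 0"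
  shows "v i j k \<le> gsum N v"
proof -
  obtain i' j' k' where r: "i' \<in> {1..int N}" "j' \<in> {1..int N}" "k' \<in> {1..int N}" "v i j k = v i' j' k'"
    using grid_fun_residue[OF N v] by blast
  have "v i' j' k' \<le> (\<Sum>k=1..int N. v i' j' k)"
    using r nonneg by (intro member_le_sum) auto
  also have "\<dots> \<le> (\<Sum>j=1..int N. \<Sum>k=1..int N. v i' j k)"
    using r nonneg by (intro member_le_sum[where f = "\<lambda>j. \<Sum>k=1..int N. v i' j k"] sum_nonneg) auto
  also have "\<dots> \<le> gsum N v"
    unfolding gsum_def using r nonneg
    by (intro member_le_sum[where f = "\<lambda>i. \<Sum>j=1..int N. \<Sum>k=1..int N. v i j k"] sum_nonneg) auto
  finally show ?thesis using r by simp
qed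

lemma sq_le_sq_of_abs_le: "\<bar>x\<bar> \<le> B \<Longrightarrow> x\<^sup>2 \<le> B\<^sup>2" for x B :: real
  using power_mono[of "\<bar>x\<bar>" B 2] by simp

section \<open>The discrete negative norm\<close>

text \<open>The factor \<open>h = h\<^sup>3 / h\<^sup>2\<close> combines the volume of a cell with the two
  difference quotients.\<close>

definition grid_grad_inner :: "real \<Rightarrow> nat \<Rightarrow> grid_fun \<Rightarrow> grid_fun \<Rightarrow> real" where
  "grid_grad_inner L N v w = mesh L N *
     gsum N (\<lambda>i j k. (v (i+1) j k - v i j k) * (w (i+1) j k - w i j k)
          + (v i (j+1) k - v i j k) * (w i (j+1) k - w i j k)
          + (v i j (k+1) - v i j k) * (w i j (k+1) - w i j k))"

lemma grid_inner_gsum: "grid_inner L N v w = (mesh L N)^3 * gsum N (\<lambda>i j k. v i j k * w i j k)"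
  by (simp add: grid_inner_def gsum_def)

lemma grid_mean_gsum: "grid_mean L N v = (mesh L N)^3 / L^3 * gsum N v"
  by (simp add: grid_mean_def gsum_def)

lemma young_weighted:
  fixes a b \<theta> :: real
  assumes "\<theta> > 0"
  shows "a * b \<le> \<theta> / 2 * a\<^sup>2 + 1 / (2 * \<theta>) * b\<^sup>2"
proof -
  have "0 \<le> (\<theta> * a - b)\<^sup>2 / (2 * \<theta>)" using assms by simp
  also have "\<dots> = \<theta> / 2 * a\<^sup>2 + 1 / (2 * \<theta>) * b\<^sup>2 - a * b"
    using assms by (simp add: field_simps power2_eq_square)
  finally show ?thesis by simp
qed

lemma grid_lap_in_grid_per:
  assumes "v \<in> grid_per N" shows "grid_lap h v \<in> grid_per N"
  using grid_per_shift[OF assms] grid_per_shift_minus[OF assms]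
  by (simp add: grid_per_def grid_lap_def)

lemma gsum_grid_lap:
  assumes "v \<in> grid_per N" shows "gsum N (grid_lap h v) = 0"
proof -
  have "(\<lambda>i j k. 1) \<in> grid_per N" by (simp add: grid_per_def)
  from gsum_by_parts[OF assms this]
  have "gsum N (\<lambda>i j k. v (i+1) j k + v (i-1) j k + v i (j+1) k + v i (j-1) k + v i j (k+1)
            + v i j (k-1) - 6 * v i j k) = 0" by (simp add: gsum_const)
  then show ?thesis
    using gsum_cmult[of N "1 / h\<^sup>2" "\<lambda>i j k. v (i+1) j k + v (i-1) j k + v i (j+1) k + v i (j-1) k + v i j (k+1)
            + v i j (k-1) - 6 * v i j k"]
    by (simp add: grid_lap_def[abs_def])
qed

lemma grid_lap_lin:
  "grid_lap h (\<lambda>i j k. v i j k + w i j k) i j k = grid_lap h v i j k + grid_lap h w i j k"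
  "grid_lap h (\<lambda>i j k. v i j k - w i j k) i j k = grid_lap h v i j k - grid_lap h w i j k"
  "grid_lap h (\<lambda>i j k. c * v i j k) i j k = c * grid_lap h v i j k"
  by (auto simp: grid_lap_def algebra_simps)

context
  fixes L :: real and N :: nat
  assumes L: "L > 0" and N: "N > 0"
begin

lemma mesh_pos: "mesh L N > 0"
  using L N by (simp add: mesh_def)

lemma mesh_times: "real N * mesh L N = L"
  using N by (simp add: mesh_def)

lemma grid_mean_eq_average: "grid_mean L N v = gsum N v / real N ^ 3"
  using L N by (simp add: grid_mean_gsum mesh_def power_divide)

lemma grid_mean_zero_iff: "grid_mean L N v = 0 \<longleftrightarrow> gsum N v = 0"
  using N by (simp add: grid_mean_eq_average)

lemma grid_grad_sq_eq: "grid_grad_sq L N v = grid_grad_inner L N v v"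
proof -
  have "grid_grad_sq L N v = (mesh L N)^3 * gsum N (\<lambda>i j k. 1 / (mesh L N)\<^sup>2 *
     ((v (i+1) j k - v i j k) * (v (i+1) j k - v i j k)
          + (v i (j+1) k - v i j k) * (v i (j+1) k - v i j k)
          + (v i j (k+1) - v i j k) * (v i j (k+1) - v i j k)))"
    unfolding grid_grad_sq_def gsum_def[symmetric] by (simp add: power2_eq_square)
  then show ?thesis
    unfolding gsum_cmult grid_grad_inner_def using mesh_pos
    by (simp add: power2_eq_square power3_eq_cube)
qed

lemma grid_grad_sq_gsum: "grid_grad_sq L N v = mesh L N * gsum N (\<lambda>i j k.
  (v (i+1) j k - v i j k)\<^sup>2 + (v i (j+1) k - v i j k)\<^sup>2 + (v i j (k+1) - v i j k)\<^sup>2)"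
  by (simp add: grid_grad_sq_eq grid_grad_inner_def power2_eq_square)

lemma grid_grad_sq_nonneg: "grid_grad_sq L N v \<ge> 0"
  unfolding grid_grad_sq_gsum using mesh_pos by (intro mult_nonneg_nonneg gsum_nonneg) auto

lemma grid_inner_lap_left:
  assumes "v \<in> grid_per N" "w \<in> grid_per N"
  shows "grid_inner L N (grid_lap (mesh L N) v) w = - grid_grad_inner L N v w"
proof -
  let ?h = "mesh L N"
  have "grid_inner L N (grid_lap ?h v) w = ?h^3 * gsum N (\<lambda>i j k. 1 / ?h\<^sup>2 *
     ((v (i+1) j k + v (i-1) j k + v i (j+1) k + v i (j-1) k + v i j (k+1)
            + v i j (k-1) - 6 * v i j k) * w i j k))"
    by (simp add: grid_inner_gsum grid_lap_def)
  also have "\<dots> = - grid_grad_inner L N v w"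
    unfolding gsum_cmult gsum_by_parts[OF assms] grid_grad_inner_def using mesh_pos
    by (simp add: power2_eq_square power3_eq_cube)
  finally show ?thesis .
qed

lemma grid_inner_commute: "grid_inner L N v w = grid_inner L N w v"
  by (simp add: grid_inner_gsum mult.commute)

lemma grid_grad_inner_commute: "grid_grad_inner L N v w = grid_grad_inner L N w v"
  by (simp add: grid_grad_inner_def mult.commute)

lemma grid_inner_lap_symmetric:
  assumes "v \<in> grid_per N" "w \<in> grid_per N"
  shows "grid_inner L N (grid_lap (mesh L N) v) w = grid_inner L N v (grid_lap (mesh L N) w)"
  using grid_inner_lap_left[OF assms] grid_inner_lap_left[OF assms(2,1)]
  by (metis grid_inner_commute grid_grad_inner_commute)

lemma grid_inner_young:
  assumes "\<theta> > 0"
  shows "grid_inner L N v w \<le> \<theta> / 2 * grid_inner L N v v + 1 / (2 * \<theta>) * grid_inner L N w w"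
proof -
  have "gsum N (\<lambda>i j k. v i j k * w i j k)
    \<le> gsum N (\<lambda>i j k. \<theta> / 2 * (v i j k * v i j k) + 1 / (2 * \<theta>) * (w i j k * w i j k))"
    by (intro gsum_mono) (metis young_weighted[OF assms] power2_eq_square)
  then show ?thesis
    unfolding grid_inner_gsum gsum_add gsum_cmult
    using mult_left_mono[of _ _ "(mesh L N)^3"] mesh_pos
    by (smt (verit) distrib_left mult.left_commute zero_less_power)
qed

lemma grid_grad_inner_young:
  assumes "\<theta> > 0"
  shows "grid_grad_inner L N v w \<le> \<theta> / 2 * grid_grad_sq L N v + 1 / (2 * \<theta>) * grid_grad_sq L N w"
proof -
  let ?D = "\<lambda>v i j k. (v (i+1) j k - v i j k)\<^sup>2 + (v i (j+1) k - v i j k)\<^sup>2 + (v i j (k+1) - v i j k)\<^sup>2"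
  have "gsum N (\<lambda>i j k. (v (i+1) j k - v i j k) * (w (i+1) j k - w i j k)
          + (v i (j+1) k - v i j k) * (w i (j+1) k - w i j k)
          + (v i j (k+1) - v i j k) * (w i j (k+1) - w i j k))
    \<le> gsum N (\<lambda>i j k. \<theta> / 2 * ?D v i j k + 1 / (2 * \<theta>) * ?D w i j k)"
  proof (intro gsum_mono)
    fix i j k
    show "(v (i+1) j k - v i j k) * (w (i+1) j k - w i j k)
          + (v i (j+1) k - v i j k) * (w i (j+1) k - w i j k)
          + (v i j (k+1) - v i j k) * (w i j (k+1) - w i j k)
        \<le> \<theta> / 2 * ?D v i j k + 1 / (2 * \<theta>) * ?D w i j k"
      using young_weighted[OF assms, of "v (i+1) j k - v i j k" "w (i+1) j k - w i j k"]
        young_weighted[OF assms, of "v i (j+1) k - v i j k" "w i (j+1) k - w i j k"]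
        young_weighted[OF assms, of "v i j (k+1) - v i j k" "w i j (k+1) - w i j k"]
      by (simp only: distrib_left)
  qed
  then have "mesh L N * gsum N (\<lambda>i j k. (v (i+1) j k - v i j k) * (w (i+1) j k - w i j k)
          + (v i (j+1) k - v i j k) * (w i (j+1) k - w i j k)
          + (v i j (k+1) - v i j k) * (w i j (k+1) - w i j k))
    \<le> mesh L N * (\<theta> / 2 * gsum N (?D v) + 1 / (2 * \<theta>) * gsum N (?D w))"
    using mesh_pos by (simp only: gsum_add gsum_cmult mult_le_cancel_left_pos)
  then show ?thesis
    unfolding grid_grad_inner_def grid_grad_sq_gsum by (simp only: distrib_left mult.left_commute)
qed

lemma grid_poincare:
  assumes "gsum N v = 0"
  shows "grid_inner L N v v \<le> 3 * L\<^sup>2 * grid_grad_sq L N v"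
proof -
  have "grid_inner L N v v = (mesh L N)^3 * gsum N (\<lambda>i j k. (v i j k)\<^sup>2)"
    by (simp add: grid_inner_gsum power2_eq_square)
  also have "\<dots> \<le> (mesh L N)^3 * (3 * (real N)\<^sup>2 * gsum N (\<lambda>i j k.
     (v (i+1) j k - v i j k)\<^sup>2 + (v i (j+1) k - v i j k)\<^sup>2 + (v i j (k+1) - v i j k)\<^sup>2))"
    using mesh_pos by (intro mult_left_mono gsum_poincare assms N) auto
  also have "\<dots> = 3 * (real N * mesh L N)\<^sup>2 * grid_grad_sq L N v"
    unfolding grid_grad_sq_gsum by (simp add: power2_eq_square power3_eq_cube)
  finally show ?thesis by (simp add: mesh_times)
qed

lemma grid_zero_of_grad_zero:
  assumes v: "v \<in> grid_per N" and "gsum N v = 0" "grid_grad_sq L N v \<le> 0"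
  shows "v i j k = 0"
proof -
  have "grid_inner L N v v \<le> 3 * L\<^sup>2 * grid_grad_sq L N v" by (rule grid_poincare) fact
  also have "\<dots> \<le> 0" using assms(3) by (intro mult_nonneg_nonpos) auto
  finally have "(mesh L N)^3 * gsum N (\<lambda>i j k. v i j k * v i j k) \<le> 0" by (simp add: grid_inner_gsum)
  then have "gsum N (\<lambda>i j k. v i j k * v i j k) \<le> 0"
    using mesh_pos by (simp add: mult_le_0_iff)
  moreover have "v i j k * v i j k \<le> gsum N (\<lambda>i j k. v i j k * v i j k)"
    by (rule gsum_ge_entry[OF N]) (use v in \<open>auto simp: grid_per_def\<close>)
  ultimately have "v i j k * v i j k \<le> 0" by linarith
  then show ?thesis by (auto simp: mult_le_0_iff)
qed

text \<open>The inverse estimate behind the choice of the relaxation parameter below: the discrete Laplacian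
  is a sum of six one-sided differences.\<close>

lemma grid_lap_norm_le:
  assumes v: "v \<in> grid_per N"
  shows "grid_inner L N (grid_lap (mesh L N) v) (grid_lap (mesh L N) v) \<le> 12 / (mesh L N)\<^sup>2 * grid_grad_sq L N v"
proof -
  let ?h = "mesh L N"
  let ?a = "\<lambda>i j k. (v (i+1) j k - v i j k)\<^sup>2" and ?b = "\<lambda>i j k. (v i (j+1) k - v i j k)\<^sup>2"
    and ?c = "\<lambda>i j k. (v i j (k+1) - v i j k)\<^sup>2"
  have sq6: "(a + b + c - a' - b' - c')\<^sup>2 \<le> 6 * (((a\<^sup>2 + b\<^sup>2) + c\<^sup>2) + ((a'\<^sup>2 + b'\<^sup>2) + c'\<^sup>2))" for a b c a' b' c' :: real
  proof -
    have sq3: "(x + y + z)\<^sup>2 \<le> 3 * (x\<^sup>2 + y\<^sup>2 + z\<^sup>2)" for x y z :: real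
      using sum_squares_ge_zero[of "x - y" "y - z"] zero_le_power2[of "z - x"]
      by (simp add: power2_eq_square algebra_simps)
    have sq2: "(x - y)\<^sup>2 \<le> 2 * (x\<^sup>2 + y\<^sup>2)" for x y :: real
      using zero_le_power2[of "x + y"] by (simp add: power2_eq_square algebra_simps)
    have comb: "P \<le> 6 * (A + B)" if "P \<le> 2 * (X + Y)" "X \<le> 3 * A" "Y \<le> 3 * B" for P X Y A B :: real
      using that by argo
    have "a + b + c - a' - b' - c' = (a + b + c) - (a' + b' + c')" by simp
    then show ?thesis using comb[OF sq2 sq3 sq3] by (simp only:)
  qed
  have "gsum N (\<lambda>i j k. grid_lap ?h v i j k * grid_lap ?h v i j k)
      \<le> gsum N (\<lambda>i j k. 6 / ?h^4 * (((?a i j k + ?b i j k) + ?c i j k)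
            + ((?a (i-1) j k + ?b i (j-1) k) + ?c i j (k-1))))"
  proof (rule gsum_mono)
    fix i j k
    let ?X = "(v (i+1) j k - v i j k) + (v i (j+1) k - v i j k) + (v i j (k+1) - v i j k)
          - (v i j k - v (i-1) j k) - (v i j k - v i (j-1) k) - (v i j k - v i j (k-1))"
    have "grid_lap ?h v i j k = 1 / ?h\<^sup>2 * ?X" by (simp add: grid_lap_def)
    then have "grid_lap ?h v i j k * grid_lap ?h v i j k = (1 / ?h\<^sup>2 * ?X)\<^sup>2"
      by (simp only: power2_eq_square)
    also have "\<dots> = 1 / ?h^4 * ?X\<^sup>2"
      by (simp only: power_mult_distrib power_divide power_mult[symmetric] power_one) simp
    also have "\<dots> \<le> 1 / ?h^4 * (6 * (((?a i j k + ?b i j k) + ?c i j k)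
            + ((?a (i-1) j k + ?b i (j-1) k) + ?c i j (k-1))))"
      using sq6[of "v (i+1) j k - v i j k" "v i (j+1) k - v i j k" "v i j (k+1) - v i j k"
          "v i j k - v (i-1) j k" "v i j k - v i (j-1) k" "v i j k - v i j (k-1)"] mesh_pos
      by (intro mult_left_mono) (simp_all add: power2_commute)
    finally show "grid_lap ?h v i j k * grid_lap ?h v i j k \<le> 6 / ?h^4 * (((?a i j k + ?b i j k) + ?c i j k)
            + ((?a (i-1) j k + ?b i (j-1) k) + ?c i j (k-1)))" by simp
  qed
  also have "\<dots> = 6 / ?h^4 * (2 * gsum N (\<lambda>i j k. ?a i j k + ?b i j k + ?c i j k))"
  proof -
    have per: "(\<lambda>i j k. ?a (i-1) j k) \<in> grid_per N" "(\<lambda>i j k. ?b i (j-1) k) \<in> grid_per N"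
      "(\<lambda>i j k. ?c i j (k-1)) \<in> grid_per N"
      using grid_per_shift[OF v] grid_per_shift_minus[OF v] by (simp_all add: grid_per_def)
    show ?thesis
      unfolding gsum_cmult gsum_add
      using gsum_shift(1)[OF per(1)] gsum_shift(2)[OF per(2)] gsum_shift(3)[OF per(3)] by simp
  qed
  finally have "?h^3 * gsum N (\<lambda>i j k. grid_lap ?h v i j k * grid_lap ?h v i j k)
    \<le> ?h^3 * (6 / ?h^4 * (2 * gsum N (\<lambda>i j k. ?a i j k + ?b i j k + ?c i j k)))"
    using mesh_pos by (intro mult_left_mono) auto
  then show ?thesis
    unfolding grid_inner_gsum grid_grad_sq_gsum using mesh_pos
    by (simp add: power2_eq_square power3_eq_cube power4_eq_xxxx)
qed

end

context
  fixes L :: real and N :: nat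
  assumes L: "L > 0" and N: "N > 0"
begin

lemma grid_inner_add_self: "grid_inner L N (\<lambda>i j k. v i j k + c * w i j k) (\<lambda>i j k. v i j k + c * w i j k)
   = grid_inner L N v v + 2 * c * grid_inner L N v w + c\<^sup>2 * grid_inner L N w w"
proof -
  have "gsum N (\<lambda>i j k. (v i j k + c * w i j k) * (v i j k + c * w i j k))
     = gsum N (\<lambda>i j k. (v i j k * v i j k + (2 * c) * (v i j k * w i j k)) + c\<^sup>2 * (w i j k * w i j k))"
    by (rule arg_cong[of _ _ "gsum N"], intro ext) (simp add: power2_eq_square algebra_simps)
  then show ?thesis unfolding grid_inner_gsum gsum_add gsum_cmult by (simp add: algebra_simps)
qed

text \<open>The step \<open>\<tau> = h\<^sup>2 / 12\<close> is the one for which the inverse estimate makes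
  the quadratic term in \<open>\<tau>\<close> at most half of the linear term. The other half
  contracts by the Poincare inequality.\<close>

lemma grid_relaxation_contracts:
  assumes v: "v \<in> grid_per N" and m: "gsum N v = 0"
  defines "\<tau> \<equiv> (mesh L N)\<^sup>2 / 12"
  shows "grid_inner L N (\<lambda>i j k. v i j k + \<tau> * grid_lap (mesh L N) v i j k)
            (\<lambda>i j k. v i j k + \<tau> * grid_lap (mesh L N) v i j k)
     \<le> (1 - \<tau> / (3 * L\<^sup>2)) * grid_inner L N v v"
proof -
  let ?h = "mesh L N"
  note hp = mesh_pos[OF L N]
  have \<tau>: "\<tau> > 0" using hp by (simp add: \<tau>_def)
  have "grid_inner L N (\<lambda>i j k. v i j k + \<tau> * grid_lap ?h v i j k) (\<lambda>i j k. v i j k + \<tau> * grid_lap ?h v i j k)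
     = grid_inner L N v v - 2 * \<tau> * grid_grad_sq L N v + \<tau>\<^sup>2 * grid_inner L N (grid_lap ?h v) (grid_lap ?h v)"
    unfolding grid_inner_add_self
    using grid_inner_lap_left[OF L N v v] grid_inner_commute[OF L N]
    by (simp add: grid_grad_sq_eq[OF L N])
  also have "\<dots> \<le> grid_inner L N v v - 2 * \<tau> * grid_grad_sq L N v + \<tau>\<^sup>2 * (12 / ?h\<^sup>2 * grid_grad_sq L N v)"
    using grid_lap_norm_le[OF L N v] by (intro add_left_mono mult_left_mono) auto
  also have "\<tau>\<^sup>2 * (12 / ?h\<^sup>2 * grid_grad_sq L N v) = \<tau> * grid_grad_sq L N v"
    using hp by (simp add: \<tau>_def power2_eq_square)
  finally have "grid_inner L N (\<lambda>i j k. v i j k + \<tau> * grid_lap ?h v i j k)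
     (\<lambda>i j k. v i j k + \<tau> * grid_lap ?h v i j k) \<le> grid_inner L N v v - \<tau> * grid_grad_sq L N v" by simp
  moreover have "\<tau> / (3 * L\<^sup>2) * grid_inner L N v v \<le> \<tau> / (3 * L\<^sup>2) * (3 * L\<^sup>2 * grid_grad_sq L N v)"
    using grid_poincare[OF L N m] \<tau> by (intro mult_left_mono) auto
  ultimately show ?thesis using L by (simp add: algebra_simps)
qed

text \<open>The solution is the Neumann series \<open>\<psi> = \<tau> (f + A f + A\<^sup>2 f +
  \<dots>)\<close> with \<open>A = 1 + \<tau> \<Delta>\<^sub>h\<close>, which converges
  geometrically because \<open>A\<close> is a contraction on functions of mean zero.\<close>

lemma ex_inv_neg_lap:
  assumes f: "f \<in> grid_per N" and m: "gsum N f = 0"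
  shows "\<exists>\<psi>. \<psi> \<in> grid_per N \<and> (\<forall>i j k. - grid_lap (mesh L N) \<psi> i j k = f i j k) \<and> gsum N \<psi> = 0"
proof -
  let ?h = "mesh L N"
  note hp = mesh_pos[OF L N]
  define \<tau> where "\<tau> = ?h\<^sup>2 / 12"
  define q where "q = 1 - \<tau> / (3 * L\<^sup>2)"
  define A where "A v = (\<lambda>i j k. v i j k + \<tau> * grid_lap ?h v i j k)" for v :: grid_fun
  define g where "g n = (A ^^ n) f" for n
  have g_Suc: "g (Suc n) i j k = g n i j k + \<tau> * grid_lap ?h (g n) i j k" for n i j k
    by (simp add: g_def A_def)
  have \<tau>: "\<tau> > 0" using hp by (simp add: \<tau>_def)
  have "?h \<le> L" using L N by (simp add: mesh_def divide_le_eq)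
  then have "?h\<^sup>2 \<le> L\<^sup>2" using hp by (intro power_mono) auto
  then have "\<tau> \<le> L\<^sup>2" unfolding \<tau>_def using zero_le_power2[of L] by linarith
  then have "\<tau> \<le> 3 * L\<^sup>2" using zero_le_power2[of L] by linarith
  then have q: "0 \<le> q" "q < 1" using L \<tau> by (simp_all add: q_def divide_le_eq)
  have gp: "g n \<in> grid_per N \<and> gsum N (g n) = 0 \<and> grid_inner L N (g n) (g n) \<le> q ^ n * grid_inner L N f f" for n
  proof (induction n)
    case 0 then show ?case using f m by (simp add: g_def)
  next
    case (Suc n)
    have gS: "g (Suc n) = (\<lambda>i j k. g n i j k + \<tau> * grid_lap ?h (g n) i j k)"
      by (intro ext) (rule g_Suc)
    have "g (Suc n) \<in> grid_per N"
      using Suc grid_lap_in_grid_per[of "g n" N ?h] L N unfolding gS by (simp add: grid_per_def)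
    moreover have "gsum N (g (Suc n)) = 0"
      unfolding gS using Suc gsum_grid_lap[of "g n" N ?h] by (simp add: gsum_add gsum_cmult)
    moreover have "grid_inner L N (g (Suc n)) (g (Suc n)) \<le> q * grid_inner L N (g n) (g n)"
      unfolding gS q_def \<tau>_def using Suc by (intro grid_relaxation_contracts) auto
    moreover have "q * grid_inner L N (g n) (g n) \<le> q * (q ^ n * grid_inner L N f f)"
      using Suc q by (intro mult_left_mono) auto
    ultimately show ?case by (simp add: mult.assoc)
  qed
  define B where "B = sqrt (grid_inner L N f f / ?h^3)"
  have gb: "norm (g n i j k) \<le> B * sqrt q ^ n" for n i j k
  proof -
    have "g n i j k * g n i j k \<le> gsum N (\<lambda>i j k. g n i j k * g n i j k)"
      by (rule gsum_ge_entry[OF N]) (use gp[of n] in \<open>auto simp: grid_per_def\<close>)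
    also have "\<dots> = grid_inner L N (g n) (g n) / ?h^3" using hp by (simp add: grid_inner_gsum)
    also have "\<dots> \<le> q ^ n * grid_inner L N f f / ?h^3"
      using gp[of n] hp by (intro divide_right_mono) auto
    finally have "(g n i j k)\<^sup>2 \<le> q ^ n * (grid_inner L N f f / ?h^3)" by (simp add: power2_eq_square)
    then have "\<bar>g n i j k\<bar> \<le> sqrt (q ^ n * (grid_inner L N f f / ?h^3))" by (rule real_le_rsqrt[of "\<bar>_\<bar>", simplified])
    then show ?thesis
      unfolding B_def real_sqrt_mult real_sqrt_power real_norm_def by (simp only: mult.commute)
  qed
  have "norm (sqrt q) < 1" using q by simp
  then have geo: "summable (\<lambda>n. B * sqrt q ^ n)" by (intro summable_mult summable_geometric)
  have summ: "summable (\<lambda>n. g n i j k)" for i j k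
    by (rule summable_comparison_test'[OF geo, of 0]) (rule gb)
  define \<psi> where "\<psi> = (\<lambda>i j k. \<tau> * (\<Sum>n. g n i j k))"
  define p where "p n = (\<lambda>i j k. \<tau> * (\<Sum>m<n. g m i j k))" for n
  have lim: "(\<lambda>n. p n i j k) \<longlonglongrightarrow> \<psi> i j k" for i j k
    unfolding p_def \<psi>_def using summ by (intro tendsto_mult_left summable_LIMSEQ)
  \<comment> \<open>The partial sums satisfy \<open>\<tau> \<Delta>\<^sub>h = A - 1\<close>, so that the sum
     telescopes.\<close>
  have lap: "grid_lap ?h (p n) i j k = g n i j k - f i j k" for n i j k
  proof (induction n)
    case 0 show ?case by (simp add: p_def grid_lap_def g_def)
  next
    case (Suc n)
    have "p (Suc n) = (\<lambda>i j k. p n i j k + \<tau> * g n i j k)" by (intro ext) (simp add: p_def algebra_simps)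
    then show ?case using Suc g_Suc grid_lap_lin by simp
  qed
  have lim1: "(\<lambda>n. grid_lap ?h (p n) i j k) \<longlonglongrightarrow> grid_lap ?h \<psi> i j k" for i j k
    unfolding grid_lap_def by (intro tendsto_intros lim)
  have lim2: "(\<lambda>n. grid_lap ?h (p n) i j k) \<longlonglongrightarrow> 0 - f i j k" for i j k
    unfolding lap by (intro tendsto_diff tendsto_const summable_LIMSEQ_zero summ)
  have "- grid_lap ?h \<psi> i j k = f i j k" for i j k
    using LIMSEQ_unique[OF lim1 lim2, of i j k] by simp
  moreover have "\<psi> \<in> grid_per N"
    using gp by (simp add: \<psi>_def grid_per_def)
  moreover have "gsum N \<psi> = 0"
  proof -
    have "gsum N (p n) = 0" for n
    proof (induction n)
      case (Suc n)
      have "p (Suc n) = (\<lambda>i j k. p n i j k + \<tau> * g n i j k)" by (intro ext) (simp add: p_def algebra_simps)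
      then show ?case using Suc gp by (simp add: gsum_add gsum_cmult)
    qed (simp add: p_def gsum_const)
    moreover have "(\<lambda>n. gsum N (p n)) \<longlonglongrightarrow> gsum N \<psi>"
      unfolding gsum_def by (intro tendsto_intros lim)
    ultimately show ?thesis by (simp add: LIMSEQ_const_iff)
  qed
  ultimately show ?thesis by blast
qed

lemma inv_neg_lap_spec:
  assumes f: "f \<in> grid_per N" and m: "gsum N f = 0"
  shows "inv_neg_lap L N f \<in> grid_per N" "- grid_lap (mesh L N) (inv_neg_lap L N f) i j k = f i j k"
    "gsum N (inv_neg_lap L N f) = 0"
proof -
  let ?P = "\<lambda>\<psi>. \<psi> \<in> grid_per N \<and> (\<forall>i j k. - grid_lap (mesh L N) \<psi> i j k = f i j k) \<and> grid_mean L N \<psi> = 0"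
  have uniq: "\<psi> = \<psi>'" if "?P \<psi>" "?P \<psi>'" for \<psi> \<psi>'
  proof -
    let ?d = "\<lambda>i j k. \<psi> i j k - \<psi>' i j k"
    have d: "?d \<in> grid_per N" using that by (simp add: grid_per_def)
    have "gsum N ?d = 0" using that grid_mean_zero_iff[OF L N] by (simp add: gsum_diff)
    have "grid_lap (mesh L N) ?d = (\<lambda>i j k. 0)"
    proof (intro ext)
      fix i j k
      have "- grid_lap (mesh L N) \<psi> i j k = - grid_lap (mesh L N) \<psi>' i j k" using that by simp
      then show "grid_lap (mesh L N) ?d i j k = 0" using grid_lap_lin(2) by simp
    qed
    then have "grid_grad_sq L N ?d \<le> 0"
      using grid_inner_lap_left[OF L N d d] by (simp add: grid_grad_sq_eq[OF L N] grid_inner_gsum gsum_const)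
    then have "?d i j k = 0" for i j k
      using grid_zero_of_grad_zero[OF L N d \<open>gsum N ?d = 0\<close>] by blast
    then show ?thesis by (intro ext) simp
  qed
  obtain \<psi> where "?P \<psi>" using ex_inv_neg_lap[OF f m] grid_mean_zero_iff[OF L N] by blast
  then have "?P (inv_neg_lap L N f)"
    unfolding inv_neg_lap_def using uniq by (intro theI[of ?P]) auto
  then show "inv_neg_lap L N f \<in> grid_per N" "- grid_lap (mesh L N) (inv_neg_lap L N f) i j k = f i j k"
    "gsum N (inv_neg_lap L N f) = 0"
    using grid_mean_zero_iff[OF L N] by auto
qed

lemma grid_inner_inv_neg_lap:
  assumes f: "f \<in> grid_per N" "gsum N f = 0" and w: "w \<in> grid_per N"
  shows "grid_inner L N f w = grid_grad_inner L N (inv_neg_lap L N f) w"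
proof -
  note sp = inv_neg_lap_spec[OF f]
  have "f = (\<lambda>i j k. - grid_lap (mesh L N) (inv_neg_lap L N f) i j k)" by (intro ext) (simp add: sp(2))
  then have "grid_inner L N f w = grid_inner L N (\<lambda>i j k. - grid_lap (mesh L N) (inv_neg_lap L N f) i j k) w"
    by (rule arg_cong)
  also have "\<dots> = - grid_inner L N (grid_lap (mesh L N) (inv_neg_lap L N f)) w"
    by (simp add: grid_inner_gsum gsum_uminus)
  finally show ?thesis using grid_inner_lap_left[OF L N sp(1) w] by simp
qed

lemma neg_norm_sq:
  assumes f: "f \<in> grid_per N" "gsum N f = 0"
  shows "(neg_norm L N f)\<^sup>2 = grid_grad_sq L N (inv_neg_lap L N f)"
  unfolding neg_norm_def grid_inner_inv_neg_lap[OF f inv_neg_lap_spec(1)[OF f]]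
  using grid_grad_sq_nonneg[OF L N] by (simp add: grid_grad_sq_eq[OF L N, symmetric])

text \<open>The \<open>l\<^sup>2\<close> norm is the duality pairing between the gradient norm and its dual
  norm.\<close>

lemma l2_interpolation:
  assumes f: "f \<in> grid_per N" "gsum N f = 0" and "\<theta> > 0"
  shows "grid_inner L N f f \<le> \<theta> / 2 * grid_grad_sq L N f + 1 / (2 * \<theta>) * (neg_norm L N f)\<^sup>2"
proof -
  have "grid_inner L N f f = grid_grad_inner L N f (inv_neg_lap L N f)"
    using grid_inner_inv_neg_lap[OF f f(1)] grid_grad_inner_commute[OF L N, of f] by simp
  also have "\<dots> \<le> \<theta> / 2 * grid_grad_sq L N f + 1 / (2 * \<theta>) * grid_grad_sq L N (inv_neg_lap L N f)"
    by (rule grid_grad_inner_young[OF L N assms(3)])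
  finally show ?thesis by (simp add: neg_norm_sq[OF f])
qed

lemma neg_norm_le_l2:
  assumes f: "f \<in> grid_per N" "gsum N f = 0"
  shows "(neg_norm L N f)\<^sup>2 \<le> 3 * L\<^sup>2 * grid_inner L N f f"
proof -
  let ?\<psi> = "inv_neg_lap L N f"
  have p: "0 < 1 / (3 * L\<^sup>2)" using L by simp
  have "grid_grad_sq L N ?\<psi> = grid_inner L N ?\<psi> f"
    using grid_inner_inv_neg_lap[OF f inv_neg_lap_spec(1)[OF f]] grid_inner_commute[OF L N]
    by (simp add: grid_grad_sq_eq[OF L N])
  also have "\<dots> \<le> 1 / (3 * L\<^sup>2) / 2 * grid_inner L N ?\<psi> ?\<psi> + 1 / (2 * (1 / (3 * L\<^sup>2))) * grid_inner L N f f"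
    by (rule grid_inner_young[OF L N p])
  also have "1 / (3 * L\<^sup>2) / 2 * grid_inner L N ?\<psi> ?\<psi> \<le> 1 / (3 * L\<^sup>2) / 2 * (3 * L\<^sup>2 * grid_grad_sq L N ?\<psi>)"
    using grid_poincare[OF L N inv_neg_lap_spec(3)[OF f]] by (intro mult_left_mono) auto
  finally show ?thesis using L by (simp add: neg_norm_sq[OF f])
qed

lemma inv_neg_lap_l2:
  assumes f: "f \<in> grid_per N" "gsum N f = 0"
  shows "grid_inner L N (inv_neg_lap L N f) (inv_neg_lap L N f) \<le> 3 * L\<^sup>2 * (neg_norm L N f)\<^sup>2"
  using grid_poincare[OF L N inv_neg_lap_spec(3)[OF f]] by (simp add: neg_norm_sq[OF f])

lemma grid_inner_diff_left: "grid_inner L N (\<lambda>i j k. u i j k - v i j k) w = grid_inner L N u w - grid_inner L N v w"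
  by (simp add: grid_inner_gsum left_diff_distrib gsum_diff right_diff_distrib)

text \<open>The discrete chain rule for half the squared norm under implicit Euler steps; the inequality
  drops half the squared norm of the increment.\<close>

lemma neg_norm_increment:
  assumes f: "f \<in> grid_per N" "gsum N f = 0" and g: "g \<in> grid_per N" "gsum N g = 0"
  shows "(neg_norm L N f)\<^sup>2 / 2 - (neg_norm L N g)\<^sup>2 / 2
     \<le> grid_inner L N (\<lambda>i j k. f i j k - g i j k) (inv_neg_lap L N f)"
proof -
  let ?\<psi> = "inv_neg_lap L N f" and ?\<chi> = "inv_neg_lap L N g"
  have "grid_inner L N (\<lambda>i j k. f i j k - g i j k) ?\<psi>
     = grid_grad_sq L N ?\<psi> - grid_grad_inner L N ?\<chi> ?\<psi>"
    unfolding grid_inner_diff_left grid_inner_inv_neg_lap[OF f inv_neg_lap_spec(1)[OF f]]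
      grid_inner_inv_neg_lap[OF g inv_neg_lap_spec(1)[OF f]] by (simp add: grid_grad_sq_eq[OF L N])
  moreover have "grid_grad_inner L N ?\<chi> ?\<psi> \<le> 1 / 2 * grid_grad_sq L N ?\<chi> + 1 / (2 * 1) * grid_grad_sq L N ?\<psi>"
    by (rule grid_grad_inner_young[OF L N]) simp
  ultimately show ?thesis by (simp add: neg_norm_sq f g)
qed

lemma grid_grad_sq_add_le:
  "grid_grad_sq L N (\<lambda>i j k. v i j k + w i j k) \<le> 2 * grid_grad_sq L N v + 2 * grid_grad_sq L N w"
proof -
  let ?D = "\<lambda>v i j k. (v (i+1) j k - v i j k)\<^sup>2 + (v i (j+1) k - v i j k)\<^sup>2 + (v i j (k+1) - v i j k)\<^sup>2"
  have sq2: "((x' + y') - (x + y))\<^sup>2 \<le> 2 * (x' - x)\<^sup>2 + 2 * (y' - y)\<^sup>2" for x y x' y' :: real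
    using zero_le_power2[of "(x' - x) - (y' - y)"] by (simp add: power2_eq_square algebra_simps)
  have "gsum N (?D (\<lambda>i j k. v i j k + w i j k)) \<le> gsum N (\<lambda>i j k. 2 * ?D v i j k + 2 * ?D w i j k)"
  proof (rule gsum_mono)
    fix i j k
    show "?D (\<lambda>i j k. v i j k + w i j k) i j k \<le> 2 * ?D v i j k + 2 * ?D w i j k"
      using sq2[of "v (i+1) j k" "w (i+1) j k" "v i j k" "w i j k"]
        sq2[of "v i (j+1) k" "w i (j+1) k" "v i j k" "w i j k"]
        sq2[of "v i j (k+1)" "w i j (k+1)" "v i j k" "w i j k"] by argo
  qed
  then have "mesh L N * gsum N (?D (\<lambda>i j k. v i j k + w i j k))
      \<le> mesh L N * (2 * gsum N (?D v) + 2 * gsum N (?D w))"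
    using mesh_pos[OF L N] by (simp only: gsum_add gsum_cmult mult_le_cancel_left_pos)
  then show ?thesis
    unfolding grid_grad_sq_gsum[OF L N] by (simp only: distrib_left mult.left_commute)
qed

lemma neg_norm_sq_add_le:
  assumes f: "f \<in> grid_per N" "gsum N f = 0" and g: "g \<in> grid_per N" "gsum N g = 0"
  shows "(neg_norm L N (\<lambda>i j k. f i j k + g i j k))\<^sup>2 \<le> 2 * (neg_norm L N f)\<^sup>2 + 2 * (neg_norm L N g)\<^sup>2"
proof -
  let ?s = "\<lambda>i j k. f i j k + g i j k"
  let ?\<psi> = "inv_neg_lap L N f" and ?\<chi> = "inv_neg_lap L N g"
  have s: "?s \<in> grid_per N" "gsum N ?s = 0" using f g by (auto simp: grid_per_def gsum_add)
  have "inv_neg_lap L N ?s = (\<lambda>i j k. ?\<psi> i j k + ?\<chi> i j k)" (is "_ = ?\<sigma>")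
  proof -
    let ?d = "\<lambda>i j k. inv_neg_lap L N ?s i j k - ?\<sigma> i j k"
    note sps = inv_neg_lap_spec[OF s] and spf = inv_neg_lap_spec[OF f] and spg = inv_neg_lap_spec[OF g]
    have d: "?d \<in> grid_per N" using sps(1) spf(1) spg(1) by (simp add: grid_per_def)
    have m: "gsum N ?d = 0" using sps(3) spf(3) spg(3) by (simp add: gsum_diff gsum_add)
    have "grid_lap (mesh L N) ?d i j k = 0" for i j k
      using sps(2)[of i j k] spf(2)[of i j k] spg(2)[of i j k] by (simp add: grid_lap_lin)
    then have "grid_lap (mesh L N) ?d = (\<lambda>i j k. 0)" by (intro ext)
    then have "grid_grad_sq L N ?d \<le> 0"
      using grid_inner_lap_left[OF L N d d] by (simp add: grid_grad_sq_eq[OF L N] grid_inner_gsum gsum_const)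
    from grid_zero_of_grad_zero[OF L N d m this] have "?d i j k = 0" for i j k .
    then show ?thesis by (intro ext) simp
  qed
  then show ?thesis
    unfolding neg_norm_sq[OF s] neg_norm_sq[OF f] neg_norm_sq[OF g]
    using grid_grad_sq_add_le[of ?\<psi> ?\<chi>] by simp
qed

lemma grid_inner_sq_le_sup:
  assumes "\<And>i j k. \<bar>v i j k\<bar> \<le> B"
  shows "grid_inner L N v v \<le> L^3 * B\<^sup>2"
proof -
  have "gsum N (\<lambda>i j k. v i j k * v i j k) \<le> gsum N (\<lambda>i j k. B\<^sup>2)"
    using sq_le_sq_of_abs_le[OF assms] by (intro gsum_mono) (simp add: power2_eq_square)
  then have "(mesh L N)^3 * gsum N (\<lambda>i j k. v i j k * v i j k) \<le> (mesh L N)^3 * (real N^3 * B\<^sup>2)"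
    using mesh_pos[OF L N] unfolding gsum_const by (intro mult_left_mono) auto
  also have "\<dots> = (real N * mesh L N)^3 * B\<^sup>2" by (simp add: power_mult_distrib)
  finally show ?thesis by (simp add: grid_inner_gsum mesh_times[OF L N])
qed

lemma grid_grad_sq_le_sup:
  assumes "\<And>i j k. \<bar>v (i+1) j k - v i j k\<bar> \<le> B * mesh L N" "\<And>i j k. \<bar>v i (j+1) k - v i j k\<bar> \<le> B * mesh L N"
    "\<And>i j k. \<bar>v i j (k+1) - v i j k\<bar> \<le> B * mesh L N"
  shows "grid_grad_sq L N v \<le> 3 * L^3 * B\<^sup>2"
proof -
  have sq: "x\<^sup>2 \<le> (B * mesh L N)\<^sup>2" if "\<bar>x\<bar> \<le> B * mesh L N" for x
    using that by (rule sq_le_sq_of_abs_le)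
  have "gsum N (\<lambda>i j k. (v (i+1) j k - v i j k)\<^sup>2 + (v i (j+1) k - v i j k)\<^sup>2 + (v i j (k+1) - v i j k)\<^sup>2)
     \<le> gsum N (\<lambda>i j k. 3 * (B * mesh L N)\<^sup>2)"
  proof (rule gsum_mono)
    fix i j k
    show "(v (i+1) j k - v i j k)\<^sup>2 + (v i (j+1) k - v i j k)\<^sup>2 + (v i j (k+1) - v i j k)\<^sup>2 \<le> 3 * (B * mesh L N)\<^sup>2"
      using sq[OF assms(1)[of i j k]] sq[OF assms(2)[of i j k]] sq[OF assms(3)[of i j k]] by linarith
  qed
  then have "grid_grad_sq L N v \<le> mesh L N * (real N^3 * (3 * (B * mesh L N)\<^sup>2))"
    unfolding grid_grad_sq_gsum[OF L N] gsum_const using mesh_pos[OF L N] by (intro mult_left_mono) auto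
  also have "\<dots> = 3 * (real N * mesh L N)^3 * B\<^sup>2" by (simp add: power2_eq_square power3_eq_cube)
  finally show ?thesis by (simp add: mesh_times[OF L N])
qed

end

section \<open>Periodic functions with bounded derivatives\<close>

text \<open>A quantitative form of \<^const>\<open>class_C\<close>: one number bounds all derivatives up to
  the order \<open>m\<close>. It carries uniform constants through the calculus rules below
  without referring to suprema.\<close>

primrec bounded_class_C :: "nat \<Rightarrow> real \<Rightarrow> (real^3 \<Rightarrow> real) \<Rightarrow> bool" where
  "bounded_class_C 0 B f \<longleftrightarrow> continuous_on UNIV f \<and> (\<forall>x. \<bar>f x\<bar> \<le> B)"
| "bounded_class_C (Suc m) B f \<longleftrightarrow> f differentiable_on UNIV \<and> (\<forall>x. \<bar>f x\<bar> \<le> B) \<and> (\<forall>i. bounded_class_C m B (pd i f))"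

lemma differentiable_imp_pd:
  assumes "f differentiable_on UNIV"
  shows "((\<lambda>s. f (x + s *\<^sub>R axis i 1)) has_real_derivative pd i f (x + s *\<^sub>R axis i 1)) (at s)"
proof -
  have "f differentiable (at (x + s *\<^sub>R axis i 1))"
    using assms by (simp add: differentiable_on_def)
  then obtain f' where f': "(f has_derivative f') (at (x + s *\<^sub>R axis i 1))"
    by (auto simp: differentiable_def)
  interpret bounded_linear f' by (rule has_derivative_bounded_linear[OF f'])
  have line: "((\<lambda>r. y + r *\<^sub>R axis i 1) has_derivative (\<lambda>r. r *\<^sub>R axis i (1::real))) (at r)" for y :: "real^3" and r
    by (auto intro!: derivative_eq_intros)
  have lin: "(\<lambda>r. f' (r *\<^sub>R axis i 1)) = (*) (f' (axis i 1))"
    by (simp add: scaleR fun_eq_iff)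
  have D1: "((\<lambda>s. f (x + s *\<^sub>R axis i 1)) has_real_derivative f' (axis i 1)) (at s)"
    unfolding has_field_derivative_def lin[symmetric]
    by (rule has_derivative_compose[OF line[of x s] f'])
  have "((\<lambda>r. f (x + s *\<^sub>R axis i 1 + r *\<^sub>R axis i 1)) has_real_derivative f' (axis i 1)) (at 0)"
    unfolding has_field_derivative_def lin[symmetric]
    by (rule has_derivative_compose[OF line[of "x + s *\<^sub>R axis i 1" 0]]) (use f' in simp)
  then have "pd i f (x + s *\<^sub>R axis i 1) = f' (axis i 1)"
    unfolding pd_def by (rule DERIV_imp_deriv)
  with D1 show ?thesis by simp
qed

lemma differentiable_imp_pd0:
  assumes "f differentiable_on UNIV"
  shows "((\<lambda>s. f (x + s *\<^sub>R axis i 1)) has_real_derivative pd i f x) (at 0)"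
  using differentiable_imp_pd[OF assms, of x i 0] by simp

lemma pd_eqI: "((\<lambda>s. f (x + s *\<^sub>R axis i 1)) has_real_derivative D) (at 0) \<Longrightarrow> pd i f x = D"
  unfolding pd_def by (rule DERIV_imp_deriv)

lemma pd_const: "pd i (\<lambda>x. c) = (\<lambda>x. 0)"
  by (intro ext pd_eqI) simp

lemma pd_add:
  assumes "f differentiable_on UNIV" "g differentiable_on UNIV"
  shows "pd i (\<lambda>x. f x + g x) = (\<lambda>x. pd i f x + pd i g x)"
  by (intro ext pd_eqI DERIV_add differentiable_imp_pd0 assms)

lemma pd_cmult:
  assumes "f differentiable_on UNIV"
  shows "pd i (\<lambda>x. c * f x) = (\<lambda>x. c * pd i f x)"
  by (intro ext pd_eqI DERIV_cmult differentiable_imp_pd0 assms)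

lemma pd_mult:
  assumes "f differentiable_on UNIV" "g differentiable_on UNIV"
  shows "pd i (\<lambda>x. f x * g x) = (\<lambda>x. pd i f x * g x + pd i g x * f x)"
proof (intro ext pd_eqI)
  fix x
  show "((\<lambda>s. f (x + s *\<^sub>R axis i 1) * g (x + s *\<^sub>R axis i 1)) has_real_derivative
      pd i f x * g x + pd i g x * f x) (at 0)"
    using DERIV_mult[OF differentiable_imp_pd0[OF assms(1), of x i] differentiable_imp_pd0[OF assms(2), of x i]]
    by simp
qed

lemma pd_powi:
  assumes "f differentiable_on UNIV" "\<And>x. f x \<noteq> 0"
  shows "pd i (\<lambda>x. f x powi n) = (\<lambda>x. of_int n * (f x powi (n - 1) * pd i f x))"
proof (intro ext pd_eqI)
  fix x
  show "((\<lambda>s. f (x + s *\<^sub>R axis i 1) powi n) has_real_derivative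
      of_int n * (f x powi (n - 1) * pd i f x)) (at 0)"
    by (rule derivative_eq_intros differentiable_imp_pd0[OF assms(1), of x i] refl)+ (use assms in auto)
qed

lemma differentiable_powi:
  fixes f :: "real^3 \<Rightarrow> real"
  assumes "f differentiable_on UNIV" "\<And>x. f x \<noteq> 0"
  shows "(\<lambda>x. f x powi n) differentiable_on UNIV"
  using assms by (auto simp: differentiable_on_def intro!: differentiable_power_int)

lemma bounded_class_C_bound: "bounded_class_C m B f \<Longrightarrow> \<bar>f x\<bar> \<le> B"
  by (cases m) auto

lemma bounded_class_C_continuous: "bounded_class_C m B f \<Longrightarrow> continuous_on UNIV f"
  by (cases m) (auto intro: differentiable_imp_continuous_on)

lemma bounded_class_C_mono: "bounded_class_C m B f \<Longrightarrow> B \<le> B' \<Longrightarrow> bounded_class_C m B' f"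
proof (induction m arbitrary: f)
  case 0 then show ?case by (auto intro: order_trans)
next
  case (Suc m) then show ?case by (auto intro: order_trans)
qed

lemma bounded_class_C_Suc: "bounded_class_C (Suc m) B f \<Longrightarrow> bounded_class_C m B f"
proof (induction m arbitrary: f)
  case 0 then show ?case by (auto intro: differentiable_imp_continuous_on)
next
  case (Suc m) then show ?case by auto
qed

lemma bounded_class_C_le: "bounded_class_C m B f \<Longrightarrow> n \<le> m \<Longrightarrow> bounded_class_C n B f"
proof (induction m)
  case (Suc m)
  then show ?case using bounded_class_C_Suc[of m B f] by (cases "n = Suc m") auto
qed simp

lemma bounded_class_C_add:
  "bounded_class_C m A f \<Longrightarrow> bounded_class_C m B g \<Longrightarrow> bounded_class_C m (A + B) (\<lambda>x. f x + g x)"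
proof (induction m arbitrary: f g)
  case 0 then show ?case by (auto intro!: continuous_intros order_trans[OF abs_triangle_ineq] add_mono)
next
  case (Suc m)
  then show ?case
    by (auto simp: pd_add intro!: differentiable_on_add order_trans[OF abs_triangle_ineq] add_mono)
qed

lemma bounded_class_C_cmult:
  "bounded_class_C m B f \<Longrightarrow> bounded_class_C m (\<bar>c\<bar> * B) (\<lambda>x. c * f x)"
proof (induction m arbitrary: f)
  case 0 then show ?case by (auto intro!: continuous_intros mult_left_mono simp: abs_mult)
next
  case (Suc m)
  then show ?case
    by (auto simp: pd_cmult abs_mult intro!: differentiable_on_mult differentiable_on_const mult_left_mono)
qed

lemma bounded_class_C_mult:
  "bounded_class_C m A f \<Longrightarrow> bounded_class_C m B g \<Longrightarrow> bounded_class_C m (2 ^ m * (A * B)) (\<lambda>x. f x * g x)"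
proof (induction m arbitrary: f g)
  case 0 then show ?case by (auto intro!: continuous_intros mult_mono' simp: abs_mult)
next
  case (Suc m)
  have AB: "0 \<le> A" "0 \<le> B"
    using bounded_class_C_bound[OF Suc.prems(1), of 0] bounded_class_C_bound[OF Suc.prems(2), of 0] by auto
  have "bounded_class_C m (2 ^ Suc m * (A * B)) (pd i (\<lambda>x. f x * g x))" for i
  proof -
    have "bounded_class_C m (2 ^ m * (A * B)) (\<lambda>x. pd i f x * g x)"
      using Suc.prems bounded_class_C_Suc by (intro Suc.IH) auto
    moreover have "bounded_class_C m (2 ^ m * (B * A)) (\<lambda>x. pd i g x * f x)"
      using Suc.prems bounded_class_C_Suc[of m A f] Suc.IH[of "\<lambda>x. f x" "pd i g"]
      by (simp add: mult.commute)
    ultimately have "bounded_class_C m (2 ^ m * (A * B) + 2 ^ m * (B * A)) (\<lambda>x. pd i f x * g x + pd i g x * f x)"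
      by (rule bounded_class_C_add)
    moreover have "2 ^ m * (A * B) + 2 ^ m * (B * A) = 2 ^ Suc m * (A * B)" by simp
    ultimately show ?thesis using Suc.prems by (simp add: pd_mult)
  qed
  moreover have "\<bar>f x * g x\<bar> \<le> 2 ^ Suc m * (A * B)" for x
  proof -
    have "\<bar>f x * g x\<bar> \<le> 1 * (A * B)"
      using Suc.prems AB by (auto simp: abs_mult intro!: mult_mono')
    also have "\<dots> \<le> 2 ^ Suc m * (A * B)" using AB by (intro mult_right_mono) (simp_all add: self_le_power one_le_power del: power_Suc)
    finally show ?thesis .
  qed
  ultimately show ?case using Suc.prems by (auto intro!: differentiable_on_mult)
qed

lemma powi_nonpos_bound:
  fixes x \<delta> :: real
  assumes "0 < \<delta>" "\<delta> \<le> x" "n \<le> 0"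
  shows "\<bar>x powi n\<bar> \<le> \<delta> powi n"
proof -
  have "inverse (x ^ nat (-n)) \<le> inverse (\<delta> ^ nat (-n))"
    using assms by (intro le_imp_inverse_le power_mono) auto
  then show ?thesis using assms by (simp add: power_int_def power_inverse)
qed

text \<open>The constant depends on \<open>f\<close> only through the bounds \<open>\<delta>\<close> and
  \<open>B\<close>. It must, since it is used with \<open>f = \<Phi> t\<close> for all
  \<open>t\<close> at once.\<close>

lemma bounded_class_C_powi:
  assumes "\<delta> > 0" "n \<le> 0"
  shows "\<exists>C\<ge>0. \<forall>f. bounded_class_C m B f \<longrightarrow> (\<forall>x. \<delta> \<le> f x) \<longrightarrow> bounded_class_C m C (\<lambda>x. f x powi n)"
  using assms(2)
proof (induction m arbitrary: n)
  case 0
  have ne: "f x \<noteq> 0" if "\<forall>x. \<delta> \<le> f x" for f :: "real^3 \<Rightarrow> real" and x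
    using that assms(1) by (metis not_le)
  have bd: "\<bar>f x powi n\<bar> \<le> \<delta> powi n" if "\<forall>x. \<delta> \<le> f x" for f :: "real^3 \<Rightarrow> real" and x
    using powi_nonpos_bound[OF assms(1), of "f x" n] that 0 by blast
  show ?case using bd assms(1) ne
    by (intro exI[of _ "\<delta> powi n"]) (auto intro!: continuous_on_power_int)
next
  case (Suc m)
  have ne: "f x \<noteq> 0" if "\<forall>x. \<delta> \<le> f x" for f :: "real^3 \<Rightarrow> real" and x
    using that assms(1) by (metis not_le)
  obtain C where C: "C \<ge> 0" "\<And>f. bounded_class_C m B f \<Longrightarrow> (\<forall>x. \<delta> \<le> f x) \<Longrightarrow> bounded_class_C m C (\<lambda>x. f x powi (n - 1))"
    using Suc.IH[of "n - 1"] Suc.prems by auto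
  define D where "D = max (\<delta> powi n) (\<bar>of_int n\<bar> * (2 ^ m * (C * B)))"
  have "bounded_class_C (Suc m) D (\<lambda>x. f x powi n)" if f: "bounded_class_C (Suc m) B f" "\<forall>x. \<delta> \<le> f x" for f
  proof -
    have "bounded_class_C m D (\<lambda>x. of_int n * (f x powi (n - 1) * pd i f x))" for i
      using f bounded_class_C_Suc[OF f(1)]
      by (intro bounded_class_C_mono[OF bounded_class_C_cmult[OF bounded_class_C_mult[OF C(2)]]]) (auto simp: D_def)
    then show ?thesis
      using f ne powi_nonpos_bound[OF assms(1) _ Suc.prems]
      by (auto simp: pd_powi differentiable_powi) (simp add: D_def le_max_iff_disj)
  qed
  moreover have "D \<ge> 0" using assms(1) by (simp add: D_def le_max_iff_disj)
  ultimately show ?case by blast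
qed

lemma bounded_class_C_sum:
  assumes "finite S" "\<And>i. i \<in> S \<Longrightarrow> bounded_class_C m B (f i)"
  shows "bounded_class_C m (real (card S) * B) (\<lambda>x. \<Sum>i\<in>S. f i x)"
  using assms
proof (induction S rule: finite_induct)
  case empty
  have "bounded_class_C m 0 (\<lambda>x. 0)" by (induction m) (auto simp: pd_const)
  then show ?case by simp
next
  case (insert i S)
  then show ?case
    using bounded_class_C_add[of m B "f i" "real (card S) * B" "\<lambda>x. \<Sum>i\<in>S. f i x"]
    by (simp add: algebra_simps)
qed

lemma bounded_class_C_laplacian:
  assumes "bounded_class_C (Suc (Suc m)) B f"
  shows "bounded_class_C m (3 * B) (laplacian f)"
  using bounded_class_C_sum[of UNIV m B "\<lambda>i. pd i (pd i f)"] assms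
  by (simp add: laplacian_def[abs_def])

lemma bounded_class_C_chem_pot:
  assumes "\<delta> > 0"
  shows "\<exists>C\<ge>0. \<forall>f. bounded_class_C 6 B f \<longrightarrow> (\<forall>x. \<delta> \<le> f x) \<longrightarrow> bounded_class_C 4 C (chem_pot \<epsilon> f)"
proof -
  obtain C9 where C9: "\<And>f. bounded_class_C 4 B f \<Longrightarrow> (\<forall>x. \<delta> \<le> f x) \<Longrightarrow> bounded_class_C 4 C9 (\<lambda>x. f x powi (-9))"
    using bounded_class_C_powi[OF assms, of "-9" 4 B] by auto
  obtain C3 where C3: "\<And>f. bounded_class_C 4 B f \<Longrightarrow> (\<forall>x. \<delta> \<le> f x) \<Longrightarrow> bounded_class_C 4 C3 (\<lambda>x. f x powi (-3))"
    using bounded_class_C_powi[OF assms, of "-3" 4 B] by auto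
  define C where "C = \<bar>-(8/3)\<bar> * (C9 + \<bar>-1\<bar> * C3) + \<bar>-\<epsilon>\<^sup>2\<bar> * (3 * B)"
  have "bounded_class_C 4 C (chem_pot \<epsilon> f)" if f: "bounded_class_C 6 B f" "\<forall>x. \<delta> \<le> f x" for f
  proof -
    have f4: "bounded_class_C 4 B f" using bounded_class_C_le[OF f(1)] by simp
    have "bounded_class_C (Suc (Suc 4)) B f" using f(1) by (simp add: eval_nat_numeral)
    then have lap: "bounded_class_C 4 (3 * B) (laplacian f)" by (rule bounded_class_C_laplacian)
    have "bounded_class_C 4 C (\<lambda>x. -(8/3) * (f x powi (-9) + (-1) * f x powi (-3)) + (-\<epsilon>\<^sup>2) * laplacian f x)"
      unfolding C_def by (intro bounded_class_C_add bounded_class_C_cmult C9 C3 f4 f(2) lap)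
    then show ?thesis by (simp add: chem_pot_def[abs_def])
  qed
  then show ?thesis
    using bounded_class_C_mono[of 4 C _ "max 0 C"]
    by (intro exI[of _ "max 0 C"]) (auto simp del: bounded_class_C.simps)
qed

lemma iterated_pd_Maclaurin:
  assumes f: "bounded_class_C n B f" and n: "n > 0" and h: "h > 0"
  shows "\<bar>f (x + h *\<^sub>R axis i 1) - (\<Sum>m<n. (pd i ^^ m) f x / fact m * h ^ m)\<bar> \<le> B * h ^ n / fact n"
    and "\<bar>f (x - h *\<^sub>R axis i 1) - (\<Sum>m<n. (pd i ^^ m) f x / fact m * (- h) ^ m)\<bar> \<le> B * h ^ n / fact n"
proof -
  have cl: "bounded_class_C (n - m) B ((pd i ^^ m) f)" if "m \<le> n" for m
    using that
  proof (induction m)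
    case (Suc m)
    then have "bounded_class_C (Suc (n - Suc m)) B ((pd i ^^ m) f)" by (simp add: Suc_diff_Suc)
    then show ?case by simp
  qed (use f in simp)
  have der: "((\<lambda>s. (pd i ^^ m) f (x + s *\<^sub>R axis i 1)) has_real_derivative (pd i ^^ Suc m) f (x + s *\<^sub>R axis i 1)) (at s)"
    if "m < n" for m s
  proof -
    have "bounded_class_C (Suc (n - Suc m)) B ((pd i ^^ m) f)" using cl[of m] that by (simp add: Suc_diff_Suc)
    then have "(pd i ^^ m) f differentiable_on UNIV" by simp
    from differentiable_imp_pd[OF this, of x i s] show ?thesis by simp
  qed
  have bd: "\<bar>(pd i ^^ n) f y\<bar> \<le> B" for y using bounded_class_C_bound[OF cl[of n]] by simp
  let ?d = "\<lambda>m s. (pd i ^^ m) f (x + s *\<^sub>R axis i 1)"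
  have rem: "\<bar>?d n t / fact n * c ^ n\<bar> \<le> B * h ^ n / fact n" if "\<bar>c\<bar> = h" for t c :: real
  proof -
    have "\<bar>?d n t / fact n * c ^ n\<bar> = \<bar>?d n t\<bar> * (h ^ n / fact n)" using that by (simp add: abs_mult power_abs)
    also have "\<dots> \<le> B * (h ^ n / fact n)" using bd h by (intro mult_right_mono) auto
    finally show ?thesis by simp
  qed
  have "\<exists>t>0. t < h \<and> ?d 0 h = (\<Sum>m<n. ?d m 0 / fact m * h ^ m) + ?d n t / fact n * h ^ n"
    by (rule Maclaurin) (use n h der in auto)
  then show "\<bar>f (x + h *\<^sub>R axis i 1) - (\<Sum>m<n. (pd i ^^ m) f x / fact m * h ^ m)\<bar> \<le> B * h ^ n / fact n"
    using rem[of h] h by auto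
  have "\<exists>t. - h < t \<and> t < 0 \<and> ?d 0 (- h) = (\<Sum>m<n. ?d m 0 / fact m * (- h) ^ m) + ?d n t / fact n * (- h) ^ n"
    by (rule Maclaurin_minus) (use n h der in auto)
  then show "\<bar>f (x - h *\<^sub>R axis i 1) - (\<Sum>m<n. (pd i ^^ m) f x / fact m * (- h) ^ m)\<bar> \<le> B * h ^ n / fact n"
    using rem[of "- h"] h by auto
qed

lemma second_difference_bound:
  assumes f: "bounded_class_C 2 B f" and h: "h > 0"
  shows "\<bar>f (x + h *\<^sub>R axis i 1) + f (x - h *\<^sub>R axis i 1) - 2 * f x\<bar> \<le> B * h\<^sup>2"
proof -
  have "\<bar>f (x + h *\<^sub>R axis i 1) - (f x + pd i f x * h)\<bar> \<le> B * h\<^sup>2 / 2"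
    using iterated_pd_Maclaurin(1)[OF f _ h, of x i] by (simp add: eval_nat_numeral)
  moreover have "\<bar>f (x - h *\<^sub>R axis i 1) - (f x - pd i f x * h)\<bar> \<le> B * h\<^sup>2 / 2"
    using iterated_pd_Maclaurin(2)[OF f _ h, of x i] by (simp add: eval_nat_numeral)
  ultimately show ?thesis by linarith
qed

lemma second_difference_error:
  assumes f: "bounded_class_C 4 B f" and h: "h > 0"
  shows "\<bar>f (x + h *\<^sub>R axis i 1) + f (x - h *\<^sub>R axis i 1) - 2 * f x - h\<^sup>2 * pd i (pd i f) x\<bar> \<le> B * h ^ 4"
proof -
  have "0 \<le> B * h ^ 4" using bounded_class_C_bound[OF f, of 0] h by (intro mult_nonneg_nonneg) auto
  moreover have "\<bar>f (x + h *\<^sub>R axis i 1) - (f x + pd i f x * h + pd i (pd i f) x / 2 * h\<^sup>2 + pd i (pd i (pd i f)) x / 6 * h ^ 3)\<bar>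
      \<le> B * h ^ 4 / 24"
    using iterated_pd_Maclaurin(1)[OF f _ h, of x i] by (simp add: eval_nat_numeral)
  moreover have "\<bar>f (x - h *\<^sub>R axis i 1) - (f x - pd i f x * h + pd i (pd i f) x / 2 * h\<^sup>2 - pd i (pd i (pd i f)) x / 6 * h ^ 3)\<bar>
      \<le> B * h ^ 4 / 24"
    using iterated_pd_Maclaurin(2)[OF f _ h, of x i] by (simp add: eval_nat_numeral)
  moreover have "\<bar>P + Q - 2 * a - c\<bar> \<le> M" if "0 \<le> M" "\<bar>P - (a + b + c / 2 + d)\<bar> \<le> M / 24" "\<bar>Q - (a - b + c / 2 - d)\<bar> \<le> M / 24"
    for P Q a b c d M :: real using that by linarith
  ultimately show ?thesis by (simp add: mult.commute)
qed

text \<open>The discrete Laplacian with its stencil centred at an arbitrary point instead of a node.\<close>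

definition lap_diff :: "real \<Rightarrow> (real^3 \<Rightarrow> real) \<Rightarrow> real^3 \<Rightarrow> real" where
  "lap_diff h f x = (\<Sum>i\<in>UNIV. f (x + h *\<^sub>R axis i 1) + f (x - h *\<^sub>R axis i 1) - 2 * f x) / h\<^sup>2"

lemma lap_diff_bound:
  assumes f: "bounded_class_C 2 B f" and h: "h > 0"
  shows "\<bar>lap_diff h f x\<bar> \<le> 3 * B"
proof -
  have "\<bar>\<Sum>i\<in>UNIV. f (x + h *\<^sub>R axis i 1) + f (x - h *\<^sub>R axis i 1) - 2 * f x\<bar> \<le> (\<Sum>i\<in>(UNIV::3 set). B * h\<^sup>2)"
    by (intro order_trans[OF sum_abs] sum_mono second_difference_bound[OF f h])
  then show ?thesis using h by (simp add: lap_diff_def divide_le_eq)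
qed

lemma lap_diff_error:
  assumes f: "bounded_class_C 4 B f" and h: "h > 0"
  shows "\<bar>lap_diff h f x - laplacian f x\<bar> \<le> 3 * B * h\<^sup>2"
proof -
  have "lap_diff h f x - laplacian f x
     = (\<Sum>i\<in>UNIV. f (x + h *\<^sub>R axis i 1) + f (x - h *\<^sub>R axis i 1) - 2 * f x - h\<^sup>2 * pd i (pd i f) x) / h\<^sup>2"
    using h by (simp add: lap_diff_def laplacian_def sum_subtractf sum_distrib_left[symmetric] diff_divide_distrib)
  moreover have "\<bar>\<Sum>i\<in>UNIV. f (x + h *\<^sub>R axis i 1) + f (x - h *\<^sub>R axis i 1) - 2 * f x - h\<^sup>2 * pd i (pd i f) x\<bar>
      \<le> (\<Sum>i\<in>(UNIV::3 set). B * h ^ 4)"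
    by (intro order_trans[OF sum_abs] sum_mono second_difference_error[OF f h])
  ultimately show ?thesis using h
    by (simp add: divide_le_eq) (simp add: power2_eq_square power4_eq_xxxx mult.assoc)
qed

lemma grid_node_shift:
  "(vector [node h (i + 1), node h j, node h k] :: real^3) = vector [node h i, node h j, node h k] + h *\<^sub>R axis 1 1"
  "(vector [node h (i - 1), node h j, node h k] :: real^3) = vector [node h i, node h j, node h k] - h *\<^sub>R axis 1 1"
  "(vector [node h i, node h (j + 1), node h k] :: real^3) = vector [node h i, node h j, node h k] + h *\<^sub>R axis 2 1"
  "(vector [node h i, node h (j - 1), node h k] :: real^3) = vector [node h i, node h j, node h k] - h *\<^sub>R axis 2 1"
  "(vector [node h i, node h j, node h (k + 1)] :: real^3) = vector [node h i, node h j, node h k] + h *\<^sub>R axis 3 1"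
  "(vector [node h i, node h j, node h (k - 1)] :: real^3) = vector [node h i, node h j, node h k] - h *\<^sub>R axis 3 1"
  by (simp_all add: vec_eq_iff forall_3 axis_def node_def algebra_simps)

lemma grid_lap_grid_proj:
  "grid_lap h (grid_proj h f) i j k = lap_diff h f (vector [node h i, node h j, node h k])"
  by (simp add: grid_lap_def grid_proj_def lap_diff_def sum_3 grid_node_shift)

subsection \<open>Periodicity\<close>

lemma periodic_lattice_shift:
  fixes f :: "real^3 \<Rightarrow> 'a"
  assumes "\<And>x i. f (x + axis i L) = f x"
  shows "f (x + (\<Sum>i\<in>UNIV. of_int (n i) *\<^sub>R axis i L)) = f x"
proof -
  have nat1: "f (x + real m *\<^sub>R axis i L) = f x" for x m i
  proof (induction m)
    case (Suc m)
    then show ?case using assms[of "x + real m *\<^sub>R axis i L" i] by (simp add: algebra_simps)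
  qed simp
  have int1: "f (x + of_int m *\<^sub>R axis i L) = f x" for x m i
  proof (cases "m \<ge> 0")
    case True then show ?thesis using nat1[of x "nat m" i] by simp
  next
    case False then show ?thesis
      using nat1[of "x + of_int m *\<^sub>R axis i L" "nat (- m)" i] by (simp add: algebra_simps)
  qed
  have "f (x + (\<Sum>i\<in>S. of_int (n i) *\<^sub>R axis i L)) = f x" if "finite S" for S :: "3 set"
    using that
  proof (induction S rule: finite_induct)
    case (insert i S)
    then show ?case
      using int1[of "x + (\<Sum>i\<in>S. of_int (n i) *\<^sub>R axis i L)" "n i" i] by (simp add: algebra_simps)
  qed simp
  then show ?thesis by simp
qed

lemma periodic_reduce_to_cell:
  assumes "L > 0"
  obtains y where "y \<in> cbox (0::real^3) (\<chi> i. L)" "\<And>i. y $ i < L"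
    "\<And>f :: real^3 \<Rightarrow> 'a. (\<And>x i. f (x + axis i L) = f x) \<Longrightarrow> f y = f x"
proof -
  let ?y = "x + (\<Sum>i\<in>UNIV. of_int (- \<lfloor>x $ i / L\<rfloor>) *\<^sub>R axis i L)"
  have comp: "?y $ j = x $ j - of_int \<lfloor>x $ j / L\<rfloor> * L" for j
  proof -
    have "(\<Sum>i\<in>UNIV. of_int (- \<lfloor>x $ i / L\<rfloor>) *\<^sub>R axis i L) $ j
        = (\<Sum>i\<in>UNIV. (of_int (- \<lfloor>x $ i / L\<rfloor>) *\<^sub>R axis i L) $ j)"
      by (rule sum_component)
    also have "\<dots> = (\<Sum>i\<in>UNIV. if i = j then of_int (- \<lfloor>x $ i / L\<rfloor>) * L else 0)"
      by (intro sum.cong refl) (simp add: axis_def)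
    also have "\<dots> = of_int (- \<lfloor>x $ j / L\<rfloor>) * L" by (subst sum.delta) auto
    finally show ?thesis by simp
  qed
  have a: "0 \<le> ?y $ j \<and> ?y $ j < L" for j
  proof -
    have "of_int \<lfloor>x $ j / L\<rfloor> * L \<le> x $ j" "x $ j < (of_int \<lfloor>x $ j / L\<rfloor> + 1) * L"
      using assms by (rule floor_divide_lower, rule floor_divide_upper)
    then show ?thesis unfolding comp by (simp add: algebra_simps)
  qed
  show ?thesis
  proof (rule that)
    show "?y \<in> cbox 0 (\<chi> i. L)" using a by (auto simp: mem_box_cart less_imp_le)
    show "?y $ i < L" for i using a by blast
    show "f ?y = f x" if "\<And>x i. f (x + axis i L) = f x" for f :: "real^3 \<Rightarrow> 'a"
      by (rule periodic_lattice_shift) (rule that)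
  qed
qed

lemma periodic_continuous_bounded:
  fixes f :: "real^3 \<Rightarrow> real"
  assumes L: "L > 0" and c: "continuous_on UNIV f" and p: "\<And>x i. f (x + axis i L) = f x"
  shows "\<exists>B. \<forall>x. \<bar>f x\<bar> \<le> B"
proof -
  have "bounded (f ` cbox 0 (\<chi> i. L))"
    by (intro compact_imp_bounded compact_continuous_image continuous_on_subset[OF c]) auto
  then obtain B where B: "\<And>x. x \<in> cbox 0 (\<chi> i. L) \<Longrightarrow> \<bar>f x\<bar> \<le> B"
    unfolding bounded_iff by auto
  have "\<bar>f x\<bar> \<le> B" for x
  proof -
    obtain y where "y \<in> cbox (0::real^3) (\<chi> i. L)" "f y = f x"
      by (rule periodic_reduce_to_cell[OF L, where x = x and 'a = real]) (use p in blast)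
    then show ?thesis using B by metis
  qed
  then show ?thesis by blast
qed

lemma C_per_pd: "f \<in> C_per L (Suc m) \<Longrightarrow> pd i f \<in> C_per L m"
proof -
  assume f: "f \<in> C_per L (Suc m)"
  have "pd i f (x + axis j L) = pd i f x" for x j
  proof -
    have "f (x + axis j L + s *\<^sub>R axis i 1) = f (x + s *\<^sub>R axis i 1)" for s
    proof -
      have p: "f (y + axis j L) = f y" for y using f by (simp add: C_per_def)
      have "x + axis j L + s *\<^sub>R axis i 1 = (x + s *\<^sub>R axis i 1) + axis j L" by (simp add: add_ac)
      then show ?thesis by (simp only: p)
    qed
    then show ?thesis by (simp add: pd_def)
  qed
  then show ?thesis using f by (simp add: C_per_def)
qed

lemma C_per_foldr_pd: "f \<in> C_per L m \<Longrightarrow> length ds \<le> m \<Longrightarrow> foldr pd ds f \<in> C_per L (m - length ds)"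
proof (induction ds)
  case (Cons d ds)
  then have "foldr pd ds f \<in> C_per L (Suc (m - length (d # ds)))" by (simp add: Suc_diff_Suc)
  then show ?case by (simp add: C_per_pd)
qed simp

lemma class_C_continuous: "class_C m f \<Longrightarrow> continuous_on UNIV f"
  by (cases m) (auto intro: differentiable_imp_continuous_on)

lemma C_per_continuous: "f \<in> C_per L m \<Longrightarrow> continuous_on UNIV f"
  by (auto simp: C_per_def intro: class_C_continuous)

lemma C_norm_bound:
  assumes L: "L > 0" and f: "f \<in> C_per L m" and ds: "length ds \<le> m"
  shows "\<bar>foldr pd ds f x\<bar> \<le> C_norm m f"
proof -
  have fin: "finite {ds :: 3 list. length ds \<le> m}"
    using finite_lists_length_le[of "UNIV :: 3 set" m] by simp
  have ex: "\<exists>B. \<forall>x. \<bar>foldr pd ds f x\<bar> \<le> B" if "length ds \<le> m" for ds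
    by (rule periodic_continuous_bounded[OF L])
      (use C_per_foldr_pd[OF f that] in \<open>auto simp: C_per_def intro: class_C_continuous\<close>)
  then have "\<forall>ds. \<exists>B. length ds \<le> m \<longrightarrow> (\<forall>x. \<bar>foldr pd ds f x\<bar> \<le> B)" by blast
  from choice[OF this] obtain B where B: "\<And>ds x. length ds \<le> m \<Longrightarrow> \<bar>foldr pd ds f x\<bar> \<le> B ds" by blast
  have "\<bar>foldr pd ds f x\<bar> \<le> (\<Sum>es\<in>{ds. length ds \<le> m}. \<bar>B es\<bar>)" if "length ds \<le> m" for ds x
  proof -
    have "\<bar>foldr pd ds f x\<bar> \<le> \<bar>B ds\<bar>" using B[OF that, of x] by linarith
    also have "\<dots> \<le> (\<Sum>es\<in>{ds. length ds \<le> m}. \<bar>B es\<bar>)"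
      using fin that by (intro member_le_sum) auto
    finally show ?thesis .
  qed
  then have "bdd_above ((\<lambda>p. \<bar>foldr pd (fst p) f (snd p)\<bar>) ` ({ds. length ds \<le> m} \<times> UNIV))"
    by (intro bdd_aboveI2[of _ _ "\<Sum>es\<in>{ds. length ds \<le> m}. \<bar>B es\<bar>"]) auto
  then show ?thesis
    unfolding C_norm_def using ds by (intro cSUP_upper2[where x = "(ds, x)"]) auto
qed

lemma C_per_imp_bounded_class_C:
  assumes L: "L > 0" and f: "f \<in> C_per L m" and B: "C_norm m f \<le> B"
  shows "bounded_class_C m B f"
proof -
  have "bounded_class_C m B f" if "class_C m f" "\<And>ds x. length ds \<le> m \<Longrightarrow> \<bar>foldr pd ds f x\<bar> \<le> B" for m f
    using that
  proof (induction m arbitrary: f)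
    case 0 from 0(1) 0(2)[of "[]"] show ?case by simp
  next
    case (Suc m)
    have "bounded_class_C m B (pd i f)" for i
    proof (rule Suc.IH)
      show "class_C m (pd i f)" using Suc.prems by simp
      show "\<bar>foldr pd ds (pd i f) x\<bar> \<le> B" if "length ds \<le> m" for ds x
        using Suc.prems(2)[of "ds @ [i]" x] that by simp
    qed
    then show ?case using Suc.prems(1) Suc.prems(2)[of "[]"] by simp
  qed
  moreover have "class_C m f" using f by (simp add: C_per_def)
  moreover have "\<bar>foldr pd ds f x\<bar> \<le> B" if "length ds \<le> m" for ds x
    using C_norm_bound[OF L f that, of x] B by linarith
  ultimately show ?thesis by blast
qed

section \<open>Integration over the periodic cell\<close>

definition cell_integral :: "real \<Rightarrow> (real^3 \<Rightarrow> real) \<Rightarrow> real" where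
  "cell_integral L f = integral (cbox 0 (\<chi> i. L)) f"

lemma integrable_on_cell: "continuous_on UNIV f \<Longrightarrow> (f :: real^3 \<Rightarrow> real) integrable_on cbox a b"
  by (intro integrable_continuous) (rule continuous_on_subset, auto)

lemma cell_integral_add:
  "continuous_on UNIV f \<Longrightarrow> continuous_on UNIV g \<Longrightarrow>
    cell_integral L (\<lambda>x. f x + g x) = cell_integral L f + cell_integral L g"
  unfolding cell_integral_def by (intro integral_add integrable_on_cell)

lemma cell_integral_diff:
  "continuous_on UNIV f \<Longrightarrow> continuous_on UNIV g \<Longrightarrow>
    cell_integral L (\<lambda>x. f x - g x) = cell_integral L f - cell_integral L g"
  unfolding cell_integral_def by (intro integral_diff integrable_on_cell)

lemma cell_integral_cmult: "cell_integral L (\<lambda>x. c * f x) = c * cell_integral L f"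
  unfolding cell_integral_def by simp

lemma cell_integral_sum:
  "finite S \<Longrightarrow> (\<And>k. k \<in> S \<Longrightarrow> continuous_on UNIV (f k)) \<Longrightarrow>
    cell_integral L (\<lambda>x. \<Sum>k\<in>S. f k x) = (\<Sum>k\<in>S. cell_integral L (f k))"
  unfolding cell_integral_def by (intro integral_sum integrable_on_cell) auto

lemma cell_content: "L > 0 \<Longrightarrow> measure lborel (cbox (0::real^3) (\<chi> i. L)) = L ^ 3"
proof -
  assume "L > 0"
  then have "(0::real^3) \<in> cbox 0 (\<chi> i. L)" by (simp add: mem_box_cart)
  then have "cbox (0::real^3) (\<chi> i. L) \<noteq> {}" by blast
  then show ?thesis by (simp add: content_cbox_cart)
qed

lemma cell_integral_const: "L > 0 \<Longrightarrow> cell_integral L (\<lambda>x. c) = L ^ 3 * c"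
  by (simp add: cell_integral_def cell_content)

lemma cell_integral_mono:
  assumes "continuous_on UNIV f" "continuous_on UNIV g" "\<And>x. x \<in> cbox 0 (\<chi> i. L) \<Longrightarrow> f x \<le> g x"
  shows "cell_integral L f \<le> cell_integral L g"
  unfolding cell_integral_def by (intro integral_le integrable_on_cell assms)

lemma cell_integral_bound:
  assumes L: "L > 0" and f: "continuous_on UNIV f" and B: "\<And>x. \<bar>f x\<bar> \<le> B"
  shows "\<bar>cell_integral L f\<bar> \<le> L ^ 3 * B"
proof -
  have "cell_integral L f \<le> cell_integral L (\<lambda>x. B)"
    using B by (intro cell_integral_mono f) (auto simp: abs_le_iff)
  moreover have "cell_integral L (\<lambda>x. - B) \<le> cell_integral L f"
  proof (intro cell_integral_mono f)
    show "- B \<le> f x" for x using B[of x] by linarith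
  qed auto
  ultimately show ?thesis using cell_integral_const[OF L, of B] cell_integral_const[OF L, of "- B"] by simp
qed

text \<open>The translated cell is cut at the face of the original one; periodicity moves the piece that
  sticks out back to the opposite side.\<close>

lemma cell_integral_translate:
  assumes L: "L > 0" and g: "continuous_on UNIV g" "\<And>x i. g (x + axis i L) = g x" and s: "s \<in> {0..L}"
  shows "cell_integral L (\<lambda>x. g (x + s *\<^sub>R axis i 1)) = cell_integral L g"
proof -
  define l where "l = ((\<chi> i. L) :: real^3)"
  define e where "e = (axis i 1 :: real^3)"
  define u where "u = ((\<chi> j. if j = i then s else L) :: real^3)"
  have shift: "integral (cbox a b) (\<lambda>x. g (x + c)) = integral (cbox (a + c) (b + c)) g" for a b c
    using has_integral_shift_cbox_iff[of g c "integral (cbox (a + c) (b + c)) g" a b]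
      integrable_integral[OF integrable_on_cell[OF g(1), of "a + c" "b + c"]]
    by (auto simp: o_def add.commute intro: integral_unique)
  have split: "integral (cbox a b) g = integral (cbox a b \<inter> {x. x \<bullet> e \<le> c}) g + integral (cbox a b \<inter> {x. x \<bullet> e \<ge> c}) g" for a b c
    by (intro integral_split integrable_on_cell g) (auto simp: e_def axis_in_Basis_iff)
  have s': "0 \<le> s" "s \<le> L" using s by auto
  have nth: "x \<bullet> e = x $ i" for x by (simp add: e_def inner_axis)
  have en: "(s *\<^sub>R e) $ j = (if j = i then s else 0)" "axis i L $ j = (if j = i then L else 0)" for j
    by (simp_all add: e_def axis_def)
  have "cell_integral L g = integral (cbox 0 l \<inter> {x. x \<bullet> e \<le> s}) g + integral (cbox 0 l \<inter> {x. x \<bullet> e \<ge> s}) g"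
    unfolding cell_integral_def l_def by (rule split)
  also have "cbox 0 l \<inter> {x. x \<bullet> e \<le> s} = cbox 0 u"
    using s by (auto simp: nth l_def u_def mem_box_cart split: if_splits) (metis order.trans)
  also have "cbox 0 l \<inter> {x. x \<bullet> e \<ge> s} = cbox (s *\<^sub>R e) l"
  proof -
    have "x \<in> cbox 0 l \<inter> {x. x \<bullet> e \<ge> s} \<longleftrightarrow> x \<in> cbox (s *\<^sub>R e) l" for x
      using s' unfolding Int_iff mem_Collect_eq nth mem_box_cart en l_def vec_lambda_beta zero_index
      by (smt (verit))
    then show ?thesis by blast
  qed
  finally have A: "cell_integral L g = integral (cbox 0 u) g + integral (cbox (s *\<^sub>R e) l) g" .
  have "cell_integral L (\<lambda>x. g (x + s *\<^sub>R axis i 1)) = integral (cbox (s *\<^sub>R e) (l + s *\<^sub>R e)) g"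
    unfolding cell_integral_def shift by (simp add: l_def e_def)
  also have "\<dots> = integral (cbox (s *\<^sub>R e) (l + s *\<^sub>R e) \<inter> {x. x \<bullet> e \<le> L}) g
      + integral (cbox (s *\<^sub>R e) (l + s *\<^sub>R e) \<inter> {x. x \<bullet> e \<ge> L}) g" by (rule split)
  also have "cbox (s *\<^sub>R e) (l + s *\<^sub>R e) \<inter> {x. x \<bullet> e \<le> L} = cbox (s *\<^sub>R e) l"
  proof -
    have "x \<in> cbox (s *\<^sub>R e) (l + s *\<^sub>R e) \<inter> {x. x \<bullet> e \<le> L} \<longleftrightarrow> x \<in> cbox (s *\<^sub>R e) l" for x
      using s' unfolding Int_iff mem_Collect_eq nth mem_box_cart vector_add_component en l_def vec_lambda_beta
      by (smt (verit))
    then show ?thesis by blast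
  qed
  also have "cbox (s *\<^sub>R e) (l + s *\<^sub>R e) \<inter> {x. x \<bullet> e \<ge> L} = cbox (0 + axis i L) (u + axis i L)"
  proof -
    have "x \<in> cbox (s *\<^sub>R e) (l + s *\<^sub>R e) \<inter> {x. x \<bullet> e \<ge> L}
        \<longleftrightarrow> x \<in> cbox (0 + axis i L) (u + axis i L)" for x
      using s' unfolding Int_iff mem_Collect_eq nth mem_box_cart vector_add_component en l_def u_def
        vec_lambda_beta zero_index by (smt (verit))
    then show ?thesis by blast
  qed
  also have "integral (cbox (0 + axis i L) (u + axis i L)) g = integral (cbox 0 u) g"
    unfolding shift[symmetric] by (simp add: g(2))
  finally show ?thesis using A by simp
qed

text \<open>The integral of the translates is constant, and differentiating it with respect to the
  translation gives the integral of the derivative. This avoids boundary terms.\<close>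

lemma cell_integral_pd:
  assumes L: "L > 0" and g: "g differentiable_on UNIV" "continuous_on UNIV (pd i g)"
    and per: "\<And>x i. g (x + axis i L) = g x"
  shows "cell_integral L (pd i g) = 0"
proof -
  have cg: "continuous_on UNIV g" using g(1) by (rule differentiable_imp_continuous_on)
  have "((\<lambda>s. integral (cbox 0 (\<chi> i. L)) (\<lambda>x. g (x + s *\<^sub>R axis i 1))) has_field_derivative
      integral (cbox 0 (\<chi> i. L)) (\<lambda>x. pd i g (x + 0 *\<^sub>R axis i 1))) (at 0 within {0..L})"
  proof (rule leibniz_rule_field_derivative)
    show "((\<lambda>s. g (x + s *\<^sub>R axis i 1)) has_field_derivative pd i g (x + s *\<^sub>R axis i 1)) (at s within {0..L})" for s x
      using differentiable_imp_pd[OF g(1)] by (rule DERIV_subset) simp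
    show "(\<lambda>x. g (x + s *\<^sub>R axis i 1)) integrable_on cbox 0 (\<chi> i. L)" for s
      by (intro integrable_on_cell continuous_on_compose2[OF cg] continuous_intros) auto
    show "continuous_on ({0..L} \<times> cbox 0 (\<chi> i. L)) (\<lambda>(s, x). pd i g (x + s *\<^sub>R axis i 1))"
      unfolding case_prod_beta by (intro continuous_on_compose2[OF g(2)] continuous_intros) auto
  qed (use L in auto)
  then have D1: "((\<lambda>s. cell_integral L (\<lambda>x. g (x + s *\<^sub>R axis i 1))) has_real_derivative cell_integral L (pd i g)) (at 0 within {0..L})"
    by (simp add: cell_integral_def)
  have D2: "((\<lambda>s. cell_integral L (\<lambda>x. g (x + s *\<^sub>R axis i 1))) has_real_derivative 0) (at 0 within {0..L})"
  proof (rule has_field_derivative_transform_within[where d = 1])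
    show "((\<lambda>s. cell_integral L g) has_real_derivative 0) (at 0 within {0..L})" by simp
    show "cell_integral L g = cell_integral L (\<lambda>x. g (x + s *\<^sub>R axis i 1))" if "s \<in> {0..L}" for s
      by (rule cell_integral_translate[OF L cg per that, symmetric])
  qed (use L in auto)
  have "at (0::real) within {0..L} \<noteq> bot"
    using L by (simp add: trivial_limit_within islimpt_Icc)
  from vector_derivative_unique_within[OF this D1[unfolded has_real_derivative_iff_has_vector_derivative]
      D2[unfolded has_real_derivative_iff_has_vector_derivative]]
  show ?thesis .
qed

text \<open>Isolates the contribution of a box where the integrand is large. In the uniqueness theorem below
  it makes the integral positive.\<close>

lemma cell_integral_lower_bound:
  assumes L: "L > 0" and f: "continuous_on UNIV f" "\<And>x. x \<in> cbox a b \<Longrightarrow> c \<le> f x"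
    and g: "\<And>x. x \<in> cbox 0 (\<chi> i. L) - cbox a b \<Longrightarrow> - d \<le> f x"
    and sub: "cbox a b \<subseteq> cbox (0::real^3) (\<chi> i. L)" and d: "d \<ge> 0" and c: "c \<ge> 0"
  shows "measure lborel (cbox a b) * c - L ^ 3 * d \<le> cell_integral L f"
proof -
  let ?Q = "cbox (0::real^3) (\<chi> i. L)"
  let ?w = "\<lambda>x. (if x \<in> cbox a b then c + d else 0) - d"
  have i1: "((\<lambda>x. c + d) has_integral measure lborel (cbox a b) *\<^sub>R (c + d)) (cbox a b)" by (rule has_integral_const)
  then have "((\<lambda>x. if x \<in> cbox a b then c + d else 0) has_integral measure lborel (cbox a b) *\<^sub>R (c + d)) ?Q"
    using sub by (subst has_integral_restrict) auto
  moreover have "((\<lambda>x. d) has_integral measure lborel ?Q *\<^sub>R d) ?Q" by (rule has_integral_const)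
  ultimately have w: "(?w has_integral measure lborel (cbox a b) *\<^sub>R (c + d) - measure lborel ?Q *\<^sub>R d) ?Q"
    by (rule has_integral_diff)
  have "measure lborel (cbox a b) *\<^sub>R (c + d) - measure lborel ?Q *\<^sub>R d \<le> cell_integral L f"
    unfolding cell_integral_def
    by (rule has_integral_le[OF w integrable_integral[OF integrable_on_cell[OF f(1)]]])
       (use f(2) g in \<open>auto split: if_splits\<close>)
  moreover have "measure lborel (cbox a b) * c \<le> measure lborel (cbox a b) * (c + d)" using d by (intro mult_left_mono) auto
  ultimately show ?thesis using cell_content[OF L] by simp
qed

section \<open>Fourier series of smooth periodic functions\<close>

definition cos_mode :: "real \<Rightarrow> int^3 \<Rightarrow> real^3 \<Rightarrow> real" where
  "cos_mode L k x = cos (phase L k x)"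

definition sin_mode :: "real \<Rightarrow> int^3 \<Rightarrow> real^3 \<Rightarrow> real" where
  "sin_mode L k x = sin (phase L k x)"

definition cos_coeff :: "real \<Rightarrow> (real^3 \<Rightarrow> real) \<Rightarrow> int^3 \<Rightarrow> real" where
  "cos_coeff L f k = cell_integral L (\<lambda>x. f x * cos_mode L k x)"

definition sin_coeff :: "real \<Rightarrow> (real^3 \<Rightarrow> real) \<Rightarrow> int^3 \<Rightarrow> real" where
  "sin_coeff L f k = cell_integral L (\<lambda>x. f x * sin_mode L k x)"

definition l1_norm :: "int^3 \<Rightarrow> int" where
  "l1_norm k = (\<Sum>i\<in>UNIV. \<bar>k $ i\<bar>)"

text \<open>The real part of the term with frequency \<open>k\<close> in the complex Fourier series.\<close>

definition fourier_term :: "real \<Rightarrow> (real^3 \<Rightarrow> real) \<Rightarrow> int^3 \<Rightarrow> real^3 \<Rightarrow> real" where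
  "fourier_term L f k x = (cos_coeff L f k * cos_mode L k x + sin_coeff L f k * sin_mode L k x) / L ^ 3"

lemma phase_add: "phase L k (x + y) = phase L k x + phase L k y"
  by (simp add: phase_def distrib_left sum.distrib)

lemma phase_axis: "phase L k (s *\<^sub>R axis i 1) = 2 * pi / L * of_int (k $ i) * s"
proof -
  have "(\<Sum>j\<in>UNIV. of_int (k $ j) * (s *\<^sub>R axis i 1) $ j) = (\<Sum>j\<in>UNIV. if j = i then of_int (k $ j) * s else (0::real))"
    by (intro sum.cong refl) (simp add: axis_def)
  then show ?thesis by (simp add: phase_def)
qed

lemma phase_freq_add: "phase L (k + l) x = phase L k x + phase L l x"
  by (simp add: phase_def distrib_left distrib_right sum.distrib)

lemma phase_freq_diff: "phase L (k - l) x = phase L k x - phase L l x"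
  by (simp add: phase_def right_diff_distrib left_diff_distrib sum_subtractf)

lemma phase_freq_uminus: "phase L (- k) x = - phase L k x"
  by (simp add: phase_def sum_negf)

lemma phase_zero: "phase L 0 x = 0"
  by (simp add: phase_def)

lemma continuous_phase: "continuous_on S (phase L k)"
  unfolding phase_def by (intro continuous_intros)

lemma modes_continuous: "continuous_on S (cos_mode L k)" "continuous_on S (sin_mode L k)"
  unfolding cos_mode_def sin_mode_def by (intro continuous_intros continuous_phase)+

lemma modes_periodic:
  assumes "L > 0"
  shows "cos_mode L k (x + axis i L) = cos_mode L k x" "sin_mode L k (x + axis i L) = sin_mode L k x"
proof -
  have "axis i L = L *\<^sub>R (axis i 1 :: real^3)" by (simp add: vec_eq_iff axis_def)
  then have "phase L k (x + axis i L) = phase L k x + 2 * pi * of_int (k $ i)"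
    using assms by (simp add: phase_add phase_axis)
  then show "cos_mode L k (x + axis i L) = cos_mode L k x" "sin_mode L k (x + axis i L) = sin_mode L k x"
    by (simp_all add: cos_mode_def sin_mode_def cos_add sin_add)
qed

lemma phase_derivative:
  "((\<lambda>s. phase L k (x + s *\<^sub>R axis i 1)) has_real_derivative 2 * pi / L * of_int (k $ i)) (at s)"
proof -
  have "((\<lambda>s. a + c * s) has_real_derivative c) (at s)" for a c :: real
    by (auto intro!: derivative_eq_intros)
  then show ?thesis unfolding phase_add phase_axis .
qed

lemma phase_has_derivative: "((phase L k) has_derivative phase L k) (at x)"
proof -
  have "bounded_linear (phase L k)"
    unfolding phase_def
    by (intro bounded_linear_const_mult bounded_linear_sum bounded_linear_vec_nth)
  then show ?thesis by (rule bounded_linear_imp_has_derivative)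
qed

lemma modes_differentiable: "cos_mode L k differentiable_on UNIV" "sin_mode L k differentiable_on UNIV"
  unfolding cos_mode_def[abs_def] sin_mode_def[abs_def] differentiable_on_def differentiable_def
  by (blast intro: has_derivative_cos has_derivative_sin phase_has_derivative)+

lemma pd_modes:
  "pd i (cos_mode L k) = (\<lambda>x. - (2 * pi / L * of_int (k $ i)) * sin_mode L k x)"
  "pd i (sin_mode L k) = (\<lambda>x. 2 * pi / L * of_int (k $ i) * cos_mode L k x)"
proof -
  have c: "((\<lambda>s. cos (phase L k (x + s *\<^sub>R axis i 1))) has_real_derivative
      - (2 * pi / L * of_int (k $ i)) * sin (phase L k x)) (at 0)" for x
    using DERIV_fun_cos[OF phase_derivative, of L k x i 0] by (simp add: mult.commute)
  have s: "((\<lambda>s. sin (phase L k (x + s *\<^sub>R axis i 1))) has_real_derivative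
      2 * pi / L * of_int (k $ i) * cos (phase L k x)) (at 0)" for x
    using DERIV_fun_sin[OF phase_derivative, of L k x i 0] by (simp add: mult.commute)
  show "pd i (cos_mode L k) = (\<lambda>x. - (2 * pi / L * of_int (k $ i)) * sin_mode L k x)"
    unfolding cos_mode_def[abs_def] sin_mode_def[abs_def] by (intro ext pd_eqI c)
  show "pd i (sin_mode L k) = (\<lambda>x. 2 * pi / L * of_int (k $ i) * cos_mode L k x)"
    unfolding cos_mode_def[abs_def] sin_mode_def[abs_def] by (intro ext pd_eqI s)
qed

lemma coeffs_pd:
  assumes L: "L > 0" and f: "f differentiable_on UNIV" "continuous_on UNIV (pd i f)"
    and per: "\<And>x i. f (x + axis i L) = f x"
  shows "cos_coeff L (pd i f) k = 2 * pi / L * of_int (k $ i) * sin_coeff L f k"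
    "sin_coeff L (pd i f) k = - (2 * pi / L * of_int (k $ i)) * cos_coeff L f k"
proof -
  define \<kappa> where "\<kappa> = 2 * pi / L * of_int (k $ i)"
  note pdm = pd_modes[of i L k, folded \<kappa>_def]
  have cf: "continuous_on UNIV f" using f(1) by (rule differentiable_imp_continuous_on)
  note cont = cf f(2) modes_continuous
  have "cell_integral L (pd i (\<lambda>x. f x * cos_mode L k x)) = 0"
    by (rule cell_integral_pd[OF L differentiable_on_mult[OF f(1) modes_differentiable(1)]])
      (use L in \<open>auto simp: pd_mult f(1) modes_differentiable pdm per modes_periodic intro!: continuous_intros cont\<close>)
  also have "pd i (\<lambda>x. f x * cos_mode L k x) = (\<lambda>x. pd i f x * cos_mode L k x - \<kappa> * (f x * sin_mode L k x))"
    by (simp add: pd_mult f(1) modes_differentiable pdm algebra_simps)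
  also have "cell_integral L \<dots> = cos_coeff L (pd i f) k - \<kappa> * sin_coeff L f k"
    using L by (subst cell_integral_diff) (auto simp: cell_integral_cmult cos_coeff_def sin_coeff_def intro!: continuous_intros cont)
  finally show "cos_coeff L (pd i f) k = 2 * pi / L * of_int (k $ i) * sin_coeff L f k" unfolding \<kappa>_def by simp
  have "cell_integral L (pd i (\<lambda>x. f x * sin_mode L k x)) = 0"
    by (rule cell_integral_pd[OF L differentiable_on_mult[OF f(1) modes_differentiable(2)]])
      (use L in \<open>auto simp: pd_mult f(1) modes_differentiable pdm per modes_periodic intro!: continuous_intros cont\<close>)
  also have "pd i (\<lambda>x. f x * sin_mode L k x) = (\<lambda>x. pd i f x * sin_mode L k x + \<kappa> * (f x * cos_mode L k x))"
    by (simp add: pd_mult f(1) modes_differentiable pdm algebra_simps)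
  also have "cell_integral L \<dots> = sin_coeff L (pd i f) k + \<kappa> * cos_coeff L f k"
    using L by (subst cell_integral_add) (auto simp: cell_integral_cmult cos_coeff_def sin_coeff_def intro!: continuous_intros cont)
  finally show "sin_coeff L (pd i f) k = - (2 * pi / L * of_int (k $ i)) * cos_coeff L f k" unfolding \<kappa>_def by simp
qed

lemma coeffs_bound:
  assumes L: "L > 0" and f: "continuous_on UNIV f" "\<And>x. \<bar>f x\<bar> \<le> B"
  shows "\<bar>cos_coeff L f k\<bar> \<le> L ^ 3 * B" "\<bar>sin_coeff L f k\<bar> \<le> L ^ 3 * B"
proof -
  have "0 \<le> B" using f(2)[of 0] by linarith
  then have "\<bar>f x * cos_mode L k x\<bar> \<le> B * 1" for x
    unfolding abs_mult cos_mode_def by (intro mult_mono f(2) abs_cos_le_one abs_ge_zero)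
  moreover have "\<bar>f x * sin_mode L k x\<bar> \<le> B * 1" for x
    unfolding abs_mult sin_mode_def using \<open>0 \<le> B\<close> by (intro mult_mono f(2) abs_sin_le_one abs_ge_zero)
  ultimately show "\<bar>cos_coeff L f k\<bar> \<le> L ^ 3 * B" "\<bar>sin_coeff L f k\<bar> \<le> L ^ 3 * B"
    unfolding cos_coeff_def sin_coeff_def
    by (auto intro!: cell_integral_bound[OF L] continuous_intros f modes_continuous)
qed

text \<open>Each integration by parts in direction \<open>i\<close> exchanges the two coefficients and
  produces one factor of the frequency.\<close>

lemma coeffs_decay:
  assumes L: "L > 0" and f: "bounded_class_C n B f" and per: "\<And>x i. f (x + axis i L) = f x"
  shows "\<bar>cos_coeff L f k\<bar> * \<bar>2 * pi / L * of_int (k $ i)\<bar> ^ n \<le> L ^ 3 * B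
    \<and> \<bar>sin_coeff L f k\<bar> * \<bar>2 * pi / L * of_int (k $ i)\<bar> ^ n \<le> L ^ 3 * B"
  using f per
proof (induction n arbitrary: f)
  case 0
  then show ?case using coeffs_bound[OF L, of f B k] by simp
next
  case (Suc n)
  let ?\<kappa> = "2 * pi / L * of_int (k $ i)"
  have g: "f differentiable_on UNIV" "bounded_class_C n B (pd i f)" using Suc.prems(1) by auto
  have "pd i f (x + axis j L) = pd i f x" for x j
  proof -
    have "x + axis j L + s *\<^sub>R axis i 1 = (x + s *\<^sub>R axis i 1) + axis j L" for s by (simp add: add_ac)
    then have "f (x + axis j L + s *\<^sub>R axis i 1) = f (x + s *\<^sub>R axis i 1)" for s by (simp only: Suc.prems(2))
    then show ?thesis by (simp only: pd_def)
  qed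
  from Suc.IH[OF g(2) this]
  have IH: "\<bar>cos_coeff L (pd i f) k\<bar> * \<bar>?\<kappa>\<bar> ^ n \<le> L ^ 3 * B \<and> \<bar>sin_coeff L (pd i f) k\<bar> * \<bar>?\<kappa>\<bar> ^ n \<le> L ^ 3 * B" .
  have c: "cos_coeff L (pd i f) k = ?\<kappa> * sin_coeff L f k"
    "sin_coeff L (pd i f) k = - ?\<kappa> * cos_coeff L f k"
    by (rule coeffs_pd[OF L g(1) bounded_class_C_continuous[OF g(2)] Suc.prems(2)])+
  have e: "\<bar>?\<kappa> * a\<bar> * \<bar>?\<kappa>\<bar> ^ n = \<bar>a\<bar> * \<bar>?\<kappa>\<bar> ^ Suc n" "\<bar>- ?\<kappa> * a\<bar> * \<bar>?\<kappa>\<bar> ^ n = \<bar>a\<bar> * \<bar>?\<kappa>\<bar> ^ Suc n" for a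
    by (simp_all add: abs_mult)
  show ?case using IH unfolding c e by blast
qed

lemma l1_norm_ge_component: "\<bar>k $ i\<bar> \<le> l1_norm k"
  unfolding l1_norm_def by (rule member_le_sum) auto

text \<open>Some component of \<open>k\<close> is at least a third of the \<open>l\<^sup>1\<close> norm, and
  the factor \<open>2 \<pi>\<close> outweighs this third.\<close>

lemma fourier_term_coeff_bound:
  assumes L: "L > 0" and f: "bounded_class_C 6 B f" and per: "\<And>x i. f (x + axis i L) = f x"
    and k: "l1_norm k \<ge> 1"
  shows "\<bar>cos_coeff L f k\<bar> \<le> L ^ 3 * B * L ^ 6 / of_int (l1_norm k) ^ 6"
    "\<bar>sin_coeff L f k\<bar> \<le> L ^ 3 * B * L ^ 6 / of_int (l1_norm k) ^ 6"
proof -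
  let ?n = "of_int (l1_norm k) :: real"
  have "\<exists>i. l1_norm k \<le> 3 * \<bar>k $ i\<bar>"
  proof (rule ccontr)
    assume "\<nexists>i. l1_norm k \<le> 3 * \<bar>k $ i\<bar>"
    then have "3 * \<bar>k $ i\<bar> < l1_norm k" for i by (simp add: not_le)
    from this[of 1] this[of 2] this[of 3] show False by (simp add: l1_norm_def sum_3)
  qed
  then obtain i where i: "l1_norm k \<le> 3 * \<bar>k $ i\<bar>" by blast
  have "?n \<le> of_int (3 * \<bar>k $ i\<bar>)" using i by (simp only: of_int_le_iff)
  then have "?n \<le> 3 * \<bar>of_int (k $ i)\<bar>" by simp
  also have "\<dots> \<le> 2 * pi * \<bar>of_int (k $ i)\<bar>" using pi_gt3 by (intro mult_right_mono) auto
  finally have "?n / L \<le> \<bar>2 * pi / L * of_int (k $ i)\<bar>"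
    using L by (simp add: abs_mult divide_right_mono)
  then have pw: "(?n / L) ^ 6 \<le> \<bar>2 * pi / L * of_int (k $ i)\<bar> ^ 6"
    using L k by (intro power_mono) auto
  have pos: "(?n / L) ^ 6 > 0" using L k by simp
  have fin: "a \<le> L ^ 3 * B * L ^ 6 / ?n ^ 6" if "a \<ge> 0" "a * \<bar>2 * pi / L * of_int (k $ i)\<bar> ^ 6 \<le> L ^ 3 * B" for a
  proof -
    have "a * (?n / L) ^ 6 \<le> L ^ 3 * B"
      using mult_left_mono[OF pw that(1)] that(2) by linarith
    then have "a \<le> L ^ 3 * B / (?n / L) ^ 6" using pos by (simp only: pos_le_divide_eq)
    then show ?thesis by (simp add: power_divide)
  qed
  show "\<bar>cos_coeff L f k\<bar> \<le> L ^ 3 * B * L ^ 6 / ?n ^ 6" "\<bar>sin_coeff L f k\<bar> \<le> L ^ 3 * B * L ^ 6 / ?n ^ 6"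
    using coeffs_decay[OF L f per, of k i] by (auto intro!: fin)
qed

lemma finite_l1_ball: "finite {k. l1_norm k \<le> n}"
proof (rule finite_subset)
  let ?S = "{-n..n} :: int set"
  have "finite ((\<lambda>(a, b, c). vector [a, b, c] :: int^3) ` (?S \<times> ?S \<times> ?S))" by simp
  then show "finite ((\<lambda>(a, b, c). vector [a, b, c] :: int^3) ` (?S \<times> ?S \<times> ?S))" .
  show "{k. l1_norm k \<le> n} \<subseteq> (\<lambda>(a, b, c). vector [a, b, c] :: int^3) ` (?S \<times> ?S \<times> ?S)"
  proof
    fix k :: "int^3" assume "k \<in> {k. l1_norm k \<le> n}"
    then have "\<bar>k $ i\<bar> \<le> n" for i using l1_norm_ge_component[of k i] by simp
    then have "(k $ 1, k $ 2, k $ 3) \<in> ?S \<times> ?S \<times> ?S" by (auto simp: abs_le_iff minus_le_iff)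
    moreover have "k = vector [k $ 1, k $ 2, k $ 3]" by (simp add: vec_eq_iff forall_3)
    ultimately show "k \<in> (\<lambda>(a, b, c). vector [a, b, c] :: int^3) ` (?S \<times> ?S \<times> ?S)" by force
  qed
qed

text \<open>The first two components determine the third up to its sign.\<close>

lemma card_l1_sphere:
  assumes "n \<ge> 1"
  shows "real (card {k. l1_norm k = int n}) \<le> 18 * real n ^ 2"
proof -
  let ?S = "{- int n..int n}"
  let ?f = "\<lambda>k :: int^3. (k $ 1, k $ 2, k $ 3 \<ge> 0)"
  have "inj_on ?f {k. l1_norm k = int n}"
  proof (rule inj_onI)
    fix k l :: "int^3" assume a: "k \<in> {k. l1_norm k = int n}" "l \<in> {k. l1_norm k = int n}" "?f k = ?f l"
    then have "k $ 3 = l $ 3" by (auto simp: l1_norm_def sum_3 abs_if split: if_splits)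
    then show "k = l" using a by (simp add: vec_eq_iff forall_3)
  qed
  moreover have "?f ` {k. l1_norm k = int n} \<subseteq> ?S \<times> ?S \<times> UNIV"
  proof -
    have "\<bar>k $ i\<bar> \<le> int n" if "l1_norm k = int n" for k i using l1_norm_ge_component[of k i] that by simp
    then show ?thesis by (auto simp: abs_le_iff minus_le_iff)
  qed
  ultimately have "card {k. l1_norm k = int n} \<le> card (?S \<times> ?S \<times> (UNIV :: bool set))"
    by (intro card_inj_on_le) auto
  also have "\<dots> = 2 * (2 * n + 1)\<^sup>2"
    by (simp add: card_cartesian_product power2_eq_square algebra_simps nat_add_distrib nat_mult_distrib)
  finally have "real (card {k. l1_norm k = int n}) \<le> real (2 * (2 * n + 1)\<^sup>2)" by (simp only: of_nat_le_iff)
  also have "\<dots> = 2 * (2 * real n + 1)\<^sup>2" by simp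
  also have "\<dots> \<le> 2 * (3 * real n)\<^sup>2" using assms by (intro mult_left_mono power_mono) auto
  also have "\<dots> = 18 * real n ^ 2" by (simp add: power2_eq_square)
  finally show ?thesis .
qed

lemma cube_eq_box: "cube L = box (0::real^3) (\<chi> i. L)"
  by (auto simp: cube_def mem_box_cart)

lemma fourier_proj_eq_sum_terms:
  assumes L: "L > 0" and f: "continuous_on UNIV f"
  shows "fourier_proj L K f x = (\<Sum>k\<in>{k. l1_norm k \<le> int K}. fourier_term L f k x)"
proof -
  have coeff: "fourier_coeff L f k = complex_of_real (1 / L ^ 3) * Complex (cos_coeff L f k) (- sin_coeff L f k)" for k
  proof -
    let ?g = "\<lambda>x. complex_of_real (f x) * exp (- \<i> * complex_of_real (phase L k x))"
    have gc: "continuous_on UNIV ?g"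
      by (intro continuous_intros f continuous_phase)
    then have "?g absolutely_integrable_on cbox 0 (\<chi> i. L)"
      by (intro absolutely_integrable_continuous continuous_on_subset[OF gc]) auto
    then have "set_integrable lebesgue (cube L) ?g"
      by (rule set_integrable_subset) (auto simp: cube_eq_box box_subset_cbox)
    from set_lebesgue_integral_eq_integral(2)[OF this]
    have "(LINT x:cube L|lebesgue. ?g x) = integral (cbox 0 (\<chi> i. L)) ?g"
      by (simp only: cube_eq_box integral_open_interval)
    also have "\<dots> = complex_of_real (cos_coeff L f k) - \<i> * complex_of_real (sin_coeff L f k)"
    proof -
      have g: "?g = (\<lambda>x. complex_of_real (f x * cos_mode L k x) - \<i> * complex_of_real (f x * sin_mode L k x))"
        by (auto simp: fun_eq_iff cos_mode_def sin_mode_def complex_eq_iff Re_exp Im_exp)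
      have i1: "((\<lambda>x. f x * cos_mode L k x) has_integral cos_coeff L f k) (cbox 0 (\<chi> i. L))"
        unfolding cos_coeff_def cell_integral_def
        by (intro integrable_integral integrable_on_cell continuous_intros f modes_continuous)
      have i2: "((\<lambda>x. f x * sin_mode L k x) has_integral sin_coeff L f k) (cbox 0 (\<chi> i. L))"
        unfolding sin_coeff_def cell_integral_def
        by (intro integrable_integral integrable_on_cell continuous_intros f modes_continuous)
      show ?thesis unfolding g
        by (intro integral_unique has_integral_diff has_integral_mult_right has_integral_of_real i1 i2)
    qed
    finally show ?thesis
      unfolding fourier_coeff_def by (simp add: complex_eq_iff del: of_real_mult)
  qed
  have "fourier_proj L K f x = (\<Sum>k\<in>{k. l1_norm k \<le> int K}. Re (fourier_coeff L f k * exp (\<i> * complex_of_real (phase L k x))))"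
    unfolding fourier_proj_def l1_norm_def by simp
  also have "\<dots> = (\<Sum>k\<in>{k. l1_norm k \<le> int K}. fourier_term L f k x)"
    unfolding coeff
    by (intro sum.cong refl) (simp add: fourier_term_def cos_mode_def sin_mode_def Re_exp Im_exp add_divide_distrib)
  finally show ?thesis .
qed

subsection \<open>Uniqueness of Fourier coefficients\<close>

text \<open>Closed under products, hence under powers: that is what the uniqueness proof exploits.\<close>

inductive trig_poly :: "real \<Rightarrow> (real^3 \<Rightarrow> real) \<Rightarrow> bool" for L where
  cos: "trig_poly L (cos_mode L k)"
| sin: "trig_poly L (sin_mode L k)"
| add: "trig_poly L f \<Longrightarrow> trig_poly L g \<Longrightarrow> trig_poly L (\<lambda>x. f x + g x)"
| cmult: "trig_poly L f \<Longrightarrow> trig_poly L (\<lambda>x. c * f x)"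

lemma modes_mult:
  "cos_mode L k x * cos_mode L l x = 1/2 * cos_mode L (k - l) x + 1/2 * cos_mode L (k + l) x"
  "cos_mode L k x * sin_mode L l x = 1/2 * sin_mode L (l + k) x + 1/2 * sin_mode L (l - k) x"
  "sin_mode L k x * cos_mode L l x = 1/2 * sin_mode L (k + l) x + 1/2 * sin_mode L (k - l) x"
  "sin_mode L k x * sin_mode L l x = 1/2 * cos_mode L (k - l) x + (- 1/2) * cos_mode L (k + l) x"
  by (simp_all add: cos_mode_def sin_mode_def phase_freq_add phase_freq_diff cos_add cos_diff sin_add sin_diff field_simps)

lemma trig_poly_mult:
  assumes "trig_poly L f" "trig_poly L g"
  shows "trig_poly L (\<lambda>x. f x * g x)"
  using assms(1)
proof induction
  case (cos k)
  show ?case using assms(2)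
  proof induction
    case (add f g)
    then show ?case using trig_poly.add[OF add.IH] by (simp add: distrib_left)
  next
    case (cmult f c)
    then show ?case using trig_poly.cmult[OF cmult.IH, of c] by (simp add: mult.left_commute)
  qed (unfold modes_mult, intro trig_poly.intros, intro trig_poly.intros)
next
  case (sin k)
  show ?case using assms(2)
  proof induction
    case (add f g)
    then show ?case using trig_poly.add[OF add.IH] by (simp add: distrib_left)
  next
    case (cmult f c)
    then show ?case using trig_poly.cmult[OF cmult.IH, of c] by (simp add: mult.left_commute)
  qed (unfold modes_mult, intro trig_poly.intros, intro trig_poly.intros)
next
  case (add f1 f2)
  then show ?case using trig_poly.add[OF add.IH] by (simp add: distrib_right)
next
  case (cmult f c)
  then show ?case using trig_poly.cmult[OF cmult.IH, of c] by (simp add: mult.assoc)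
qed

lemma trig_poly_const: "trig_poly L (\<lambda>x. c)"
  using trig_poly.cmult[OF trig_poly.cos[of L 0], of c] by (simp add: cos_mode_def phase_zero)

lemma trig_poly_power: "trig_poly L f \<Longrightarrow> trig_poly L (\<lambda>x. f x ^ n)"
proof (induction n)
  case 0 then show ?case using trig_poly_const[of L 1] by simp
next
  case (Suc n) then show ?case using trig_poly_mult[of L f "\<lambda>x. f x ^ n"] by simp
qed

lemma trig_poly_continuous: "trig_poly L f \<Longrightarrow> continuous_on S f"
  by (induction rule: trig_poly.induct) (auto intro!: continuous_intros modes_continuous)

lemma trig_poly_annihilated:
  assumes D: "continuous_on UNIV D" "\<And>k. cos_coeff L D k = 0" "\<And>k. sin_coeff L D k = 0"
    and g: "trig_poly L g"
  shows "cell_integral L (\<lambda>x. D x * g x) = 0"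
  using g
proof induction
  case (cos k) then show ?case using D(2)[of k] by (simp add: cos_coeff_def)
next
  case (sin k) then show ?case using D(3)[of k] by (simp add: sin_coeff_def)
next
  case (add f g)
  then show ?case
    using cell_integral_add[of "\<lambda>x. D x * f x" "\<lambda>x. D x * g x" L] trig_poly_continuous D(1)
    by (simp add: distrib_left continuous_on_mult)
next
  case (cmult f c)
  then show ?case using cell_integral_cmult[of L c "\<lambda>x. D x * f x"] by (simp add: mult.left_commute)
qed

lemma cos_le_cos_of_arc:
  assumes "0 \<le> a" "a \<le> pi" "a \<le> \<bar>t\<bar>" "\<bar>t\<bar> \<le> 2 * pi - a"
  shows "cos t \<le> cos a"
proof (cases "\<bar>t\<bar> \<le> pi")
  case True
  then have "cos \<bar>t\<bar> \<le> cos a" using assms by (intro cos_monotone_0_pi_le) auto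
  then show ?thesis by simp
next
  case False
  then have "cos (2 * pi - \<bar>t\<bar>) \<le> cos a" using assms by (intro cos_monotone_0_pi_le) auto
  then show ?thesis by (simp add: cos_diff)
qed

text \<open>The classical uniqueness argument. If \<open>D x0 > 0\<close>, then \<open>D\<close> is positive
  in a box around \<open>x0\<close>. The trigonometric polynomial \<open>1 - q + Q\<close> exceeds
  a number \<open>\<beta> > 1\<close> near \<open>x0\<close> and lies between \<open>0\<close> and
  \<open>1\<close> outside that box, so that the integral of \<open>D\<close> against its
  \<open>n\<close>-th power grows at least like \<open>\<beta>\<^sup>n\<close>. But this integral
  vanishes for every \<open>n\<close>.\<close>

lemma nonpos_of_vanishing_coeffs:
  assumes L: "L > 0" and D: "continuous_on UNIV D" "\<And>k. cos_coeff L D k = 0" "\<And>k. sin_coeff L D k = 0"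
    and M: "\<And>x. \<bar>D x\<bar> \<le> M" and x0: "\<And>i. 0 < x0 $ i \<and> x0 $ i < L"
  shows "D x0 \<le> 0"
proof (rule ccontr)
  assume "\<not> D x0 \<le> 0"
  define c where "c = D x0 / 2"
  have c: "c > 0" "D x0 > c" using \<open>\<not> D x0 \<le> 0\<close> by (auto simp: c_def)
  have small_box: "\<exists>r>0. \<forall>x. (\<forall>i. \<bar>x $ i - x0 $ i\<bar> \<le> r) \<longrightarrow> a < F x"
    if F: "continuous_on UNIV F" "a < F x0" for F :: "real^3 \<Rightarrow> real" and a
  proof -
    have "open {x. a < F x}" using F(1) by (intro open_Collect_less continuous_intros)
    then obtain e where e: "e > 0" "ball x0 e \<subseteq> {x. a < F x}" using F(2) openE by blast
    have "a < F x" if x: "\<forall>i. \<bar>x $ i - x0 $ i\<bar> \<le> e / 4" for x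
    proof -
      have "dist x0 x \<le> (\<Sum>i\<in>UNIV. \<bar>(x0 - x) $ i\<bar>)" unfolding dist_norm by (rule norm_le_l1_cart)
      also have "\<dots> \<le> (\<Sum>i\<in>(UNIV::3 set). e / 4)" using x by (intro sum_mono) (simp add: abs_minus_commute)
      also have "\<dots> < e" using e(1) by simp
      finally show ?thesis using e(2) by auto
    qed
    then show ?thesis using e(1) by (intro exI[of _ "e / 4"]) auto
  qed
  obtain r1 where r1: "r1 > 0" "\<And>x. (\<forall>i. \<bar>x $ i - x0 $ i\<bar> \<le> r1) \<Longrightarrow> c < D x"
    using small_box[OF D(1) c(2)] by blast
  \<comment> \<open>Small enough for the box around \<open>x0\<close> to lie in the cell and in the region
     \<open>c < D\<close>, and for \<open>2 \<pi> r / L\<close> to be less than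
     \<open>\<pi>\<close>, where the cosine decreases.\<close>
  define r where "r = Min ({r1, L / 4} \<union> range (\<lambda>i. x0 $ i) \<union> range (\<lambda>i. L - x0 $ i))"
  have fin: "finite ({r1, L / 4} \<union> range (\<lambda>i. x0 $ i) \<union> range (\<lambda>i. L - x0 $ i))" by simp
  have r0: "0 < r" using r1(1) L x0 by (auto simp: r_def Min_gr_iff)
  have r': "r \<le> r1" "r \<le> L / 4" "r \<le> x0 $ i" "r \<le> L - x0 $ i" for i
    unfolding r_def by (rule Min_le[OF fin], simp)+
  note r = r0 r'
  define q where "q = (1 + cos (2 * pi / L * r)) / 2"
  \<comment> \<open>A factor with values in \<open>[0, 1]\<close> that peaks where the coordinate agrees with
     that of \<open>x0\<close>; \<open>q\<close> bounds it from above at points of the cell where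
     the coordinates differ by more than \<open>r\<close>.\<close>
  define w where "w i x = (1 + cos (2 * pi / L * (x $ i - x0 $ i))) / 2" for i :: 3 and x :: "real^3"
  have w: "0 \<le> w i x" "w i x \<le> 1" for i x
    unfolding w_def using cos_ge_minus_one[of "2 * pi / L * (x $ i - x0 $ i)"] cos_le_one[of "2 * pi / L * (x $ i - x0 $ i)"]
    by (auto simp del: cos_ge_minus_one cos_le_one)
  define Q where "Q x = w 1 x * w 2 x * w 3 x" for x
  have Q: "0 \<le> Q x" "Q x \<le> w i x" for x i
  proof -
    show "0 \<le> Q x" unfolding Q_def using w by simp
    have p: "a * b \<le> a" "a * b \<le> b" if "0 \<le> a" "0 \<le> b" "a \<le> 1" "b \<le> 1" for a b :: real
      using that by (simp_all add: mult_left_le mult_right_le_one_le mult_left_le_one_le)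
    have w12: "0 \<le> w 1 x * w 2 x" "w 1 x * w 2 x \<le> 1" using w by (simp_all add: mult_le_one)
    have "Q x \<le> w 1 x" "Q x \<le> w 2 x" "Q x \<le> w 3 x"
      unfolding Q_def using p[OF w12(1) w(1) w12(2) w(2), of 3 x] p[OF w(1) w(1) w(2) w(2), of 1 x 2 x] by linarith+
    then show "Q x \<le> w i x" using exhaust_3[of i] by auto
  qed
  have rL: "0 < 2 * pi / L * r" "2 * pi / L * r < pi"
  proof -
    have "2 * pi / L * r \<le> 2 * pi / L * (L / 4)" using r(3) L by (intro mult_left_mono) auto
    also have "\<dots> < pi" using L pi_gt_zero by simp
    finally show "2 * pi / L * r < pi" .
    show "0 < 2 * pi / L * r" using r(1) L by simp
  qed
  have "cos (2 * pi / L * r) < cos 0" using rL by (intro cos_monotone_0_pi) auto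
  then have q: "q < 1" by (simp add: q_def)
  have far: "Q x \<le> q" if x: "\<And>i. 0 \<le> x $ i \<and> x $ i \<le> L" and i: "\<bar>x $ i - x0 $ i\<bar> > r" for x i
  proof -
    have "\<bar>x $ i - x0 $ i\<bar> \<le> L - r" using x[of i] r(4)[of i] r(5)[of i] by linarith
    then have "2 * pi / L * \<bar>x $ i - x0 $ i\<bar> \<le> 2 * pi / L * (L - r)" using L by (intro mult_left_mono) auto
    moreover have "2 * pi / L * (L - r) = 2 * pi - 2 * pi / L * r" using L by (simp add: field_simps)
    moreover have "2 * pi / L * r \<le> 2 * pi / L * \<bar>x $ i - x0 $ i\<bar>" using i L by (intro mult_left_mono) auto
    moreover have "\<bar>2 * pi / L * (x $ i - x0 $ i)\<bar> = 2 * pi / L * \<bar>x $ i - x0 $ i\<bar>" using L by (simp add: abs_mult)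
    ultimately have "cos (2 * pi / L * (x $ i - x0 $ i)) \<le> cos (2 * pi / L * r)"
      using rL by (intro cos_le_cos_of_arc) auto
    then have "w i x \<le> q" by (simp add: w_def q_def)
    with Q(2)[of x i] show ?thesis by linarith
  qed
  have tw: "trig_poly L (w i)" for i
  proof -
    have "phase L (axis i 1) x = 2 * pi / L * x $ i" for x
    proof -
      have "(\<Sum>j\<in>UNIV. of_int (axis i 1 $ j) * x $ j) = (\<Sum>j\<in>UNIV. if j = i then x $ j else 0)"
        by (intro sum.cong refl) (simp add: axis_def)
      then show ?thesis by (simp add: phase_def)
    qed
    then have ph: "phase L (axis i 1) = (\<lambda>x. 2 * pi / L * x $ i)" by (intro ext)
    have alg: "(1 + (ca * cb + sa * sb)) / 2 = 1 / 2 + (cb / 2 * ca + sb / 2 * sa)" for ca cb sa sb :: real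
      by (simp add: field_simps)
    have "w i = (\<lambda>x. 1 / 2 + ((cos (2 * pi / L * x0 $ i) / 2) * cos_mode L (axis i 1) x
        + (sin (2 * pi / L * x0 $ i) / 2) * sin_mode L (axis i 1) x))"
      unfolding w_def cos_mode_def sin_mode_def ph right_diff_distrib cos_diff alg ..
    then show ?thesis by (simp only:) (intro trig_poly.intros trig_poly_const)
  qed
  have tQ: "trig_poly L Q" unfolding Q_def by (intro trig_poly_mult tw)
  have "(1 + q) / 2 < Q x0" using q by (simp add: Q_def w_def)
  with small_box[OF trig_poly_continuous[OF tQ]] obtain r2 where
    r2: "r2 > 0" "\<And>x. (\<forall>i. \<bar>x $ i - x0 $ i\<bar> \<le> r2) \<Longrightarrow> (1 + q) / 2 < Q x" by blast
  define \<rho> where "\<rho> = min r r2"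
  define V where "V = cbox (x0 - (\<chi> i. \<rho>)) (x0 + (\<chi> i. \<rho>))"
  have V: "x \<in> V \<longleftrightarrow> (\<forall>i. \<bar>x $ i - x0 $ i\<bar> \<le> \<rho>)" for x
    by (auto simp: V_def mem_box_cart abs_le_iff algebra_simps)
  have \<rho>: "0 < \<rho>" "\<rho> \<le> r" "\<rho> \<le> r2" using r(1) r2(1) by (auto simp: \<rho>_def)
  have VQ: "V \<subseteq> cbox 0 (\<chi> i. L)"
  proof
    fix x assume "x \<in> V"
    then have "\<bar>x $ i - x0 $ i\<bar> \<le> r" for i using V \<rho>(2) order_trans by blast
    then have "0 \<le> x $ i \<and> x $ i \<le> L" for i using r(4)[of i] r(5)[of i] by (smt (verit))
    then show "x \<in> cbox 0 (\<chi> i. L)" by (simp add: mem_box_cart)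
  qed
  have "x0 \<in> V" using V \<rho>(1) by simp
  then have cV: "measure lborel V > 0"
    unfolding V_def using \<rho>(1) by (subst content_cbox_cart) (auto intro!: prod_pos)
  define \<beta> where "\<beta> = 1 + (1 - q) / 2"
  have \<beta>: "\<beta> > 1" using q by (simp add: \<beta>_def)
  have M0: "M \<ge> 0" using M[of 0] by linarith
  have key: "measure lborel V * (c * \<beta> ^ n) - L ^ 3 * M \<le> 0" for n
  proof -
    let ?T = "\<lambda>x. (1 - q + Q x) ^ n"
    have tT: "trig_poly L ?T" by (intro trig_poly_power trig_poly.add trig_poly_const tQ)
    have T0: "?T x \<ge> 0" for x using q Q(1)[of x] by simp
    have "measure lborel V * (c * \<beta> ^ n) - L ^ 3 * M \<le> cell_integral L (\<lambda>x. D x * ?T x)"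
      unfolding V_def
    proof (rule cell_integral_lower_bound[OF L])
      show "continuous_on UNIV (\<lambda>x. D x * ?T x)" by (intro continuous_intros D(1) trig_poly_continuous[OF tT] trig_poly_continuous[OF tQ])
      show "c * \<beta> ^ n \<le> D x * ?T x" if "x \<in> cbox (x0 - (\<chi> i. \<rho>)) (x0 + (\<chi> i. \<rho>))" for x
      proof -
        have x: "\<forall>i. \<bar>x $ i - x0 $ i\<bar> \<le> \<rho>" using that V by (simp add: V_def)
        have "c \<le> D x" using r1(2)[of x] x \<rho>(2) r(2) by (meson less_imp_le order_trans)
        moreover have "\<beta> \<le> 1 - q + Q x"
        proof -
          have "\<forall>i. \<bar>x $ i - x0 $ i\<bar> \<le> r2" using x \<rho>(3) order_trans by blast
          from r2(2)[OF this] show ?thesis unfolding \<beta>_def by (simp add: field_simps)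
        qed
        ultimately show ?thesis using c(1) \<beta> by (intro mult_mono power_mono) auto
      qed
      show "- M \<le> D x * ?T x" if "x \<in> cbox 0 (\<chi> i. L) - cbox (x0 - (\<chi> i. \<rho>)) (x0 + (\<chi> i. \<rho>))" for x
      proof (cases "\<forall>i. \<bar>x $ i - x0 $ i\<bar> \<le> r")
        case True
        then have "c < D x" using r1(2)[of x] r(2) order_trans by blast
        then have "0 \<le> D x * ?T x" using c(1) T0[of x] by simp
        then show ?thesis using M0 by linarith
      next
        case False
        then obtain i where "\<bar>x $ i - x0 $ i\<bar> > r" by (auto simp: not_le)
        then have "Q x \<le> q" using that by (intro far[of x i]) (auto simp: mem_box_cart)
        then have "?T x \<le> 1" using Q(1)[of x] q by (intro power_le_one) auto
        then have "\<bar>D x * ?T x\<bar> \<le> M * 1" unfolding abs_mult using T0[of x] M0 M[of x] by (intro mult_mono) auto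
        then show ?thesis by linarith
      qed
      show "cbox (x0 - (\<chi> i. \<rho>)) (x0 + (\<chi> i. \<rho>)) \<subseteq> cbox 0 (\<chi> i. L)" using VQ by (simp add: V_def)
      show "0 \<le> M" by (rule M0)
      show "0 \<le> c * \<beta> ^ n" using c(1) \<beta> by simp
    qed
    also have "\<dots> = 0" by (rule trig_poly_annihilated[OF D tT])
    finally show ?thesis .
  qed
  obtain n where "L ^ 3 * M / (measure lborel V * c) < \<beta> ^ n"
    using real_arch_pow[OF \<beta>] by blast
  then have "L ^ 3 * M < measure lborel V * c * \<beta> ^ n" using cV c(1) by (simp add: divide_less_eq mult.commute)
  with key[of n] show False by (simp add: mult.assoc)
qed

text \<open>Apply the preceding lemma to \<open>D\<close> and \<open>- D\<close> inside the cell; the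
  boundary follows by continuity.\<close>

lemma zero_of_vanishing_coeffs:
  assumes L: "L > 0" and D: "continuous_on UNIV D" "\<And>k. cos_coeff L D k = 0" "\<And>k. sin_coeff L D k = 0"
    and per: "\<And>x i. D (x + axis i L) = D x"
  shows "D x = 0"
proof -
  obtain M where M: "\<And>x. \<bar>D x\<bar> \<le> M" using periodic_continuous_bounded[OF L D(1) per] by blast
  have neg: "continuous_on UNIV (\<lambda>x. - D x)" "cos_coeff L (\<lambda>x. - D x) k = 0" "sin_coeff L (\<lambda>x. - D x) k = 0" for k
  proof -
    show "cos_coeff L (\<lambda>x. - D x) k = 0"
      using cell_integral_cmult[of L "-1" "\<lambda>x. D x * cos_mode L k x"] D(2)[of k] by (simp add: cos_coeff_def)
    show "sin_coeff L (\<lambda>x. - D x) k = 0"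
      using cell_integral_cmult[of L "-1" "\<lambda>x. D x * sin_mode L k x"] D(3)[of k] by (simp add: sin_coeff_def)
  qed (intro continuous_intros D(1))
  have inner: "D y = 0" if "y \<in> box 0 (\<chi> i. L)" for y
  proof -
    have y: "\<And>i. 0 < y $ i \<and> y $ i < L" using that by (simp add: mem_box_cart)
    have "D y \<le> 0" by (rule nonpos_of_vanishing_coeffs[OF L D M y])
    moreover have "- D y \<le> 0" using M by (intro nonpos_of_vanishing_coeffs[OF L neg _ y, of M]) simp
    ultimately show ?thesis by linarith
  qed
  obtain y where y: "y \<in> cbox (0::real^3) (\<chi> i. L)" "D y = D x"
    by (rule periodic_reduce_to_cell[OF L, where x = x and 'a = real]) (use per in blast)
  have "(\<chi> i. L / 2) \<in> box (0::real^3) (\<chi> i. L)" using L by (simp add: mem_box_cart)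
  then have "closure (box (0::real^3) (\<chi> i. L)) = cbox 0 (\<chi> i. L)" by (intro closure_box) blast
  moreover have "closed {y. D y = 0}" using D(1) by (intro closed_Collect_eq continuous_intros)
  ultimately have "cbox 0 (\<chi> i. L) \<subseteq> {y. D y = 0}"
    using inner closure_minimal[of "box 0 (\<chi> i. L)" "{y. D y = 0}"] by auto
  then show ?thesis using y by auto
qed

subsection \<open>Convergence of the truncated series\<close>

lemma cell_integral_modes:
  assumes L: "L > 0"
  shows "cell_integral L (cos_mode L k) = (if k = 0 then L ^ 3 else 0)" "cell_integral L (sin_mode L k) = 0"
proof -
  have "cell_integral L (cos_mode L k) = 0 \<and> cell_integral L (sin_mode L k) = 0" if k0: "k \<noteq> 0"
  proof -
    obtain i where i: "k $ i \<noteq> 0" using k0 by (metis vec_eq_iff zero_index)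
    define \<kappa> where "\<kappa> = 2 * pi / L * of_int (k $ i)"
    have \<kappa>: "\<kappa> \<noteq> 0" using i L by (simp add: \<kappa>_def)
    note pdm = pd_modes[of i L k, folded \<kappa>_def]
    have "cell_integral L (pd i (sin_mode L k)) = 0" "cell_integral L (pd i (cos_mode L k)) = 0"
      by (rule cell_integral_pd[OF L]; simp add: modes_differentiable modes_periodic[OF L] pdm
          continuous_on_mult continuous_on_const modes_continuous continuous_on_minus)+
    then have "\<kappa> * cell_integral L (cos_mode L k) = 0" "(- \<kappa>) * cell_integral L (sin_mode L k) = 0"
      unfolding pdm cell_integral_cmult .
    then show ?thesis using \<kappa> by simp
  qed
  moreover have "cos_mode L 0 = (\<lambda>x. 1)" "sin_mode L 0 = (\<lambda>x. 0)"
    by (auto simp: cos_mode_def sin_mode_def phase_zero)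
  ultimately show "cell_integral L (cos_mode L k) = (if k = 0 then L ^ 3 else 0)" "cell_integral L (sin_mode L k) = 0"
    using cell_integral_const[OF L] by (cases "k = 0"; simp)+
qed

lemma cell_integral_comb: "cell_integral L (\<lambda>x. a * cos_mode L k x + b * cos_mode L l x)
    = a * cell_integral L (cos_mode L k) + b * cell_integral L (cos_mode L l)"
  "cell_integral L (\<lambda>x. a * sin_mode L k x + b * sin_mode L l x)
    = a * cell_integral L (sin_mode L k) + b * cell_integral L (sin_mode L l)"
  by (subst cell_integral_add; simp add: cell_integral_cmult continuous_on_mult continuous_on_const modes_continuous)+

lemma modes_orthogonal:
  assumes L: "L > 0"
  shows "cos_coeff L (cos_mode L k) l = L ^ 3 / 2 * ((if k = l then 1 else 0) + (if k = - l then 1 else 0))"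
    "sin_coeff L (cos_mode L k) l = 0" "cos_coeff L (sin_mode L k) l = 0"
    "sin_coeff L (sin_mode L k) l = L ^ 3 / 2 * ((if k = l then 1 else 0) - (if k = - l then 1 else 0))"
  unfolding cos_coeff_def sin_coeff_def modes_mult cell_integral_comb cell_integral_modes[OF L]
  by (auto simp: eq_neg_iff_add_eq_0)

lemma coeff_comb:
  assumes "continuous_on UNIV f" "continuous_on UNIV g"
  shows "cos_coeff L (\<lambda>x. (a * f x + b * g x) / c) k = (a * cos_coeff L f k + b * cos_coeff L g k) / c"
    "sin_coeff L (\<lambda>x. (a * f x + b * g x) / c) k = (a * sin_coeff L f k + b * sin_coeff L g k) / c"
proof -
  have "cell_integral L (\<lambda>x. (a * f x + b * g x) / c * m x)
     = (a * cell_integral L (\<lambda>x. f x * m x) + b * cell_integral L (\<lambda>x. g x * m x)) / c"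
    if m: "continuous_on UNIV m" for m
  proof -
    have lin: "cell_integral L (\<lambda>x. \<alpha> * (f x * m x) + \<beta> * (g x * m x))
        = \<alpha> * cell_integral L (\<lambda>x. f x * m x) + \<beta> * cell_integral L (\<lambda>x. g x * m x)" for \<alpha> \<beta>
      by (subst cell_integral_add) (auto simp: cell_integral_cmult intro!: continuous_on_mult continuous_on_const m assms)
    have "(\<lambda>x. (a * f x + b * g x) / c * m x) = (\<lambda>x. (a / c) * (f x * m x) + (b / c) * (g x * m x))"
      by (intro ext) (simp add: add_divide_distrib distrib_right mult.assoc)
    then show ?thesis by (simp only: lin) (simp add: add_divide_distrib)
  qed
  then show "cos_coeff L (\<lambda>x. (a * f x + b * g x) / c) k = (a * cos_coeff L f k + b * cos_coeff L g k) / c"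
    "sin_coeff L (\<lambda>x. (a * f x + b * g x) / c) k = (a * sin_coeff L f k + b * sin_coeff L g k) / c"
    unfolding cos_coeff_def sin_coeff_def using modes_continuous by blast+
qed

lemma fourier_term_continuous: "continuous_on S (fourier_term L f k)"
  unfolding fourier_term_def[abs_def] divide_inverse by (intro continuous_intros modes_continuous)

lemma coeff_sum:
  assumes "finite S" "\<And>k. k \<in> S \<Longrightarrow> continuous_on UNIV (g k)"
  shows "cos_coeff L (\<lambda>x. \<Sum>k\<in>S. g k x) l = (\<Sum>k\<in>S. cos_coeff L (g k) l)"
    "sin_coeff L (\<lambda>x. \<Sum>k\<in>S. g k x) l = (\<Sum>k\<in>S. sin_coeff L (g k) l)"
  unfolding cos_coeff_def sin_coeff_def sum_distrib_right
  using assms by (auto intro!: cell_integral_sum continuous_intros modes_continuous)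

lemma l1_norm_uminus: "l1_norm (- k) = l1_norm k"
  by (simp add: l1_norm_def)

lemma coeff_uminus_freq: "cos_coeff L f (- k) = cos_coeff L f k" "sin_coeff L f (- k) = - sin_coeff L f k"
proof -
  have m: "cos_mode L (- k) = cos_mode L k" "sin_mode L (- k) = (\<lambda>x. - sin_mode L k x)"
    by (auto simp: cos_mode_def sin_mode_def phase_freq_uminus)
  show "cos_coeff L f (- k) = cos_coeff L f k" by (simp add: cos_coeff_def m)
  show "sin_coeff L f (- k) = - sin_coeff L f k"
    using cell_integral_cmult[of L "-1" "\<lambda>x. f x * sin_mode L k x"] by (simp add: sin_coeff_def m)
qed

lemma coeff_fourier_proj:
  assumes L: "L > 0" and f: "continuous_on UNIV f" and l: "l1_norm l \<le> int n"
  shows "cos_coeff L (fourier_proj L n f) l = cos_coeff L f l" "sin_coeff L (fourier_proj L n f) l = sin_coeff L f l"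
proof -
  let ?S = "{k. l1_norm k \<le> int n}"
  have fp: "fourier_proj L n f = (\<lambda>x. \<Sum>k\<in>?S. fourier_term L f k x)"
    by (intro ext fourier_proj_eq_sum_terms L f)
  have l': "l \<in> ?S" "- l \<in> ?S" using l by (auto simp: l1_norm_uminus)
  have L3: "L ^ 3 \<noteq> 0" using L by simp
  have tc: "cos_coeff L (fourier_term L f k) l = (if k = l then cos_coeff L f k / 2 else 0) + (if k = - l then cos_coeff L f k / 2 else 0)" for k
    unfolding fourier_term_def[abs_def] coeff_comb[OF modes_continuous] modes_orthogonal[OF L]
    using L3 by (auto simp: coeff_uminus_freq)
  have ts: "sin_coeff L (fourier_term L f k) l = (if k = l then sin_coeff L f k / 2 else 0) - (if k = - l then sin_coeff L f k / 2 else 0)" for k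
  proof -
    have "sin_coeff L (fourier_term L f k) l = (cos_coeff L f k * 0
        + sin_coeff L f k * (L ^ 3 / 2 * ((if k = l then 1 else 0) - (if k = - l then 1 else 0)))) / L ^ 3"
      unfolding fourier_term_def[abs_def] coeff_comb[OF modes_continuous] modes_orthogonal[OF L] ..
    also have "\<dots> = sin_coeff L f k / 2 * ((if k = l then 1 else 0) - (if k = - l then 1 else 0))"
      using L3 by simp
    finally have e: "sin_coeff L (fourier_term L f k) l = sin_coeff L f k / 2 * ((if k = l then 1 else 0) - (if k = - l then 1 else 0))" .
    have "x * ((if P then 1 else 0) - (if Q then 1 else 0)) = (if P then x else 0) - (if Q then x else 0)" for x :: real and P Q
      by simp
    then show ?thesis unfolding e .
  qed
  show "cos_coeff L (fourier_proj L n f) l = cos_coeff L f l"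
    unfolding fp coeff_sum[OF finite_l1_ball fourier_term_continuous] tc sum.distrib
    using l' finite_l1_ball by (simp add: coeff_uminus_freq)
  show "sin_coeff L (fourier_proj L n f) l = sin_coeff L f l"
    unfolding fp coeff_sum[OF finite_l1_ball fourier_term_continuous] ts sum_subtractf
    using l' finite_l1_ball by (simp add: coeff_uminus_freq)
qed

text \<open>The increments are dominated by those of the decreasing sequence \<open>b\<close>, since
  \<open>b n - b (n + 1) = 1 / (n (n + 1) (n + 2))\<close>. This bounds the tail of the sum
  without comparison with an integral.\<close>

lemma cubic_increments_limit:
  fixes a :: "nat \<Rightarrow> real"
  assumes inc: "\<And>n. \<bar>a (Suc n) - a n\<bar> \<le> C / real (Suc n) ^ 3"
  shows "convergent a" and "\<And>l K. a \<longlonglongrightarrow> l \<Longrightarrow> K \<ge> 1 \<Longrightarrow> \<bar>l - a K\<bar> \<le> C / real K ^ 2"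
proof -
  have C: "C \<ge> 0" using order_trans[OF abs_ge_zero inc[of 0]] by simp
  define b where "b n = 1 / (2 * real n * (real n + 1))" for n
  have tele: "\<bar>a (K + m) - a K\<bar> \<le> C * (b K - b (K + m))" if "K \<ge> 1" for K m
  proof (induction m)
    case (Suc m)
    let ?n = "K + m"
    have n: "real ?n \<ge> 1" using that by linarith
    have "1 / (2 * x * (x + 1)) - 1 / (2 * (x + 1) * (x + 1 + 1)) = 1 / (x * (x + 1) * (x + 2))" if "x \<ge> 1" for x :: real
    proof -
      have "x \<noteq> 0" "x + 1 \<noteq> 0" "x + 2 \<noteq> 0" using that by auto
      then show ?thesis by (simp add: divide_simps) (simp add: algebra_simps)
    qed
    from this[OF n] have "b ?n - b (Suc ?n) = 1 / (real ?n * (real ?n + 1) * (real ?n + 2))"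
      by (simp only: b_def of_nat_Suc add.commute[of 1])
    moreover have "real ?n * (real ?n + 1) * (real ?n + 2) \<le> real (Suc ?n) ^ 3"
      by (simp add: power3_eq_cube algebra_simps)
    ultimately have "1 / real (Suc ?n) ^ 3 \<le> b ?n - b (Suc ?n)"
      using n by (simp only:) (intro divide_left_mono, auto)
    then have "C / real (Suc ?n) ^ 3 \<le> C * (b ?n - b (Suc ?n))"
      using mult_left_mono[OF _ C] by fastforce
    with inc[of ?n] have "\<bar>a (Suc ?n) - a ?n\<bar> \<le> C * b ?n - C * b (Suc ?n)" by (simp add: right_diff_distrib)
    with Suc show ?case by (simp add: right_diff_distrib)
  qed simp
  have bK: "\<bar>a m - a K\<bar> \<le> C / real K ^ 2" if "K \<ge> 1" "m \<ge> K" for K m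
  proof -
    have "\<bar>a m - a K\<bar> \<le> C * (b K - b m)" using tele[of K "m - K"] that by simp
    also have "\<dots> \<le> C * (1 / real K ^ 2)"
    proof (intro mult_left_mono C)
      have "b m \<ge> 0" by (simp add: b_def)
      moreover have "b K \<le> 1 / real K ^ 2"
        using that unfolding b_def power2_eq_square by (intro frac_le) (auto simp: algebra_simps)
      ultimately show "b K - b m \<le> 1 / real K ^ 2" by linarith
    qed
    finally show ?thesis by simp
  qed
  have lim0: "(\<lambda>K. C / real K ^ 2) \<longlonglongrightarrow> 0"
    by (intro tendsto_divide_0[OF tendsto_const] filterlim_at_top_imp_at_infinity filterlim_pow_at_top filterlim_real_sequentially) simp
  show "convergent a"
  proof (rule Cauchy_convergent, rule CauchyI')
    fix e :: real assume "e > 0"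
    then obtain K0 where K0: "\<And>K. K \<ge> K0 \<Longrightarrow> C / real K ^ 2 < e / 2"
      using order_tendstoD(2)[OF lim0, of "e / 2"] unfolding eventually_sequentially by auto
    let ?K = "max 1 K0"
    have "dist (a m) (a n) < e" if "m \<ge> ?K" "n > m" for m n
    proof -
      have "\<bar>a m - a ?K\<bar> \<le> C / real ?K ^ 2" "\<bar>a n - a ?K\<bar> \<le> C / real ?K ^ 2"
        using that by (intro bK; simp)+
      moreover have "C / real ?K ^ 2 < e / 2" by (rule K0) simp
      ultimately show ?thesis unfolding dist_real_def by linarith
    qed
    then show "\<exists>M. \<forall>m\<ge>M. \<forall>n>m. dist (a m) (a n) < e" by blast
  qed
  show "\<bar>l - a K\<bar> \<le> C / real K ^ 2" if "a \<longlonglongrightarrow> l" "K \<ge> 1" for l K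
    by (rule tendsto_upperbound[of "\<lambda>m. \<bar>a m - a K\<bar>" _ sequentially])
      (use that bK in \<open>auto intro!: tendsto_intros simp: eventually_sequentially\<close>)
qed

lemma fourier_proj_Suc:
  assumes L: "L > 0" and f: "continuous_on UNIV f"
  shows "fourier_proj L (Suc n) f x = fourier_proj L n f x + (\<Sum>k\<in>{k. l1_norm k = int (Suc n)}. fourier_term L f k x)"
proof -
  have "{k. l1_norm k \<le> int (Suc n)} = {k. l1_norm k \<le> int n} \<union> {k. l1_norm k = int (Suc n)}" by auto
  moreover have "finite {k. l1_norm k = int (Suc n)}"
    by (rule finite_subset[OF _ finite_l1_ball[of "int (Suc n)"]]) auto
  ultimately show ?thesis
    unfolding fourier_proj_eq_sum_terms[OF L f] by (simp only:) (intro sum.union_disjoint finite_l1_ball, auto)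
qed

text \<open>The shell of frequencies with norm \<open>n\<close> has \<open>O(n\<^sup>2)\<close> elements,
  with coefficients \<open>O(n\<^sup>-\<^sup>6)\<close>. A difference over the distance
  \<open>s\<close> costs a factor \<open>O(n s)\<close>. So both series have increments
  \<open>O(n\<^sup>-\<^sup>3)\<close>.\<close>

lemma fourier_shell_bounds:
  assumes L: "L > 0" and f: "bounded_class_C 6 B f" and per: "\<And>x i. f (x + axis i L) = f x"
  shows "\<bar>fourier_proj L (Suc n) f x - fourier_proj L n f x\<bar> \<le> 36 * B * L ^ 6 / real (Suc n) ^ 3"
    and "s \<ge> 0 \<Longrightarrow> \<bar>(fourier_proj L (Suc n) f (x + s *\<^sub>R axis i 1) - fourier_proj L (Suc n) f x)
      - (fourier_proj L n f (x + s *\<^sub>R axis i 1) - fourier_proj L n f x)\<bar> \<le> 288 * B * L ^ 5 * s / real (Suc n) ^ 3"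
proof -
  let ?n = "real (Suc n)"
  let ?S = "{k. l1_norm k = int (Suc n)}"
  let ?b = "2 * B * L ^ 6 / ?n ^ 6"
  have cf: "continuous_on UNIV f" using f by (rule bounded_class_C_continuous)
  have B0: "B \<ge> 0" using bounded_class_C_bound[OF f, of 0] by linarith
  have b0: "?b \<ge> 0" using B0 L by simp
  have n1: "?n \<ge> 1" by simp
  have coef: "(\<bar>cos_coeff L f k\<bar> + \<bar>sin_coeff L f k\<bar>) / L ^ 3 \<le> ?b" if "k \<in> ?S" for k
  proof -
    have k1: "l1_norm k \<ge> 1" and kn: "(of_int (l1_norm k) :: real) = ?n" using that by auto
    have "\<bar>cos_coeff L f k\<bar> + \<bar>sin_coeff L f k\<bar> \<le> 2 * (L ^ 3 * B * L ^ 6 / ?n ^ 6)"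
      using fourier_term_coeff_bound[OF L f per k1] unfolding kn by linarith
    also have "\<dots> = ?b * L ^ 3" by simp
    finally show ?thesis using L by (simp only: pos_divide_le_eq zero_less_power)
  qed
  have comb: "\<bar>(c * u + s * v) / L ^ 3\<bar> \<le> (\<bar>c\<bar> + \<bar>s\<bar>) / L ^ 3 * m" if "\<bar>u\<bar> \<le> m" "\<bar>v\<bar> \<le> m" for c s u v m :: real
  proof -
    have "\<bar>c * u + s * v\<bar> \<le> \<bar>c\<bar> * m + \<bar>s\<bar> * m"
      using that by (intro order_trans[OF abs_triangle_ineq] add_mono) (auto simp: abs_mult intro!: mult_left_mono)
    then show ?thesis using L by (simp add: divide_right_mono distrib_right)
  qed
  have shell: "\<bar>\<Sum>k\<in>?S. g k\<bar> \<le> 18 * ?n ^ 2 * M" if "\<And>k. k \<in> ?S \<Longrightarrow> \<bar>g k\<bar> \<le> M" "M \<ge> 0" for g M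
  proof -
    have "\<bar>\<Sum>k\<in>?S. g k\<bar> \<le> (\<Sum>k\<in>?S. M)" by (intro order_trans[OF sum_abs] sum_mono that)
    also have "\<dots> = real (card ?S) * M" by simp
    also have "\<dots> \<le> 18 * ?n ^ 2 * M" using card_l1_sphere[of "Suc n"] that(2) by (intro mult_right_mono) auto
    finally show ?thesis .
  qed
  have "\<bar>\<Sum>k\<in>?S. fourier_term L f k x\<bar> \<le> 18 * ?n ^ 2 * ?b"
  proof (rule shell[OF _ b0])
    fix k assume k: "k \<in> ?S"
    show "\<bar>fourier_term L f k x\<bar> \<le> ?b"
      using comb[of "cos_mode L k x" 1 "sin_mode L k x" "cos_coeff L f k" "sin_coeff L f k"] coef[OF k]
      by (simp add: fourier_term_def cos_mode_def sin_mode_def)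
  qed
  also have "18 * ?n ^ 2 * ?b = 36 * B * L ^ 6 / ?n ^ 4"
  proof -
    have "?n ^ 6 = ?n ^ 4 * ?n ^ 2" by (simp add: eval_nat_numeral del: of_nat_Suc)
    moreover have "18 * p * (2 * B * L ^ 6 / (m * p)) = 36 * B * L ^ 6 / m" if "p > 0" for m p :: real
      using that by simp
    moreover have "?n ^ 2 > 0" by simp
    ultimately show ?thesis by (simp only:)
  qed
  also have "\<dots> \<le> 36 * B * L ^ 6 / ?n ^ 3"
    using B0 L n1 by (intro divide_left_mono power_increasing mult_nonneg_nonneg) auto
  finally show "\<bar>fourier_proj L (Suc n) f x - fourier_proj L n f x\<bar> \<le> 36 * B * L ^ 6 / ?n ^ 3"
    unfolding fourier_proj_Suc[OF L cf, of n] by simp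
  assume s: "s \<ge> 0"
  let ?y = "x + s *\<^sub>R axis i 1"
  have "\<bar>\<Sum>k\<in>?S. fourier_term L f k ?y - fourier_term L f k x\<bar> \<le> 18 * ?n ^ 2 * (?b * (8 * ?n * s / L))"
  proof (rule shell)
    fix k assume k: "k \<in> ?S"
    have "\<bar>real_of_int (k $ i)\<bar> \<le> ?n"
    proof -
      have "\<bar>k $ i\<bar> \<le> int (Suc n)" using l1_norm_ge_component[of k i] k by simp
      then have "real_of_int \<bar>k $ i\<bar> \<le> real_of_int (int (Suc n))" by (simp only: of_int_le_iff)
      then show ?thesis by simp
    qed
    then have "\<bar>2 * pi / L * of_int (k $ i) * s\<bar> \<le> 2 * pi / L * ?n * s"
      using L s by (simp add: abs_mult divide_right_mono mult_right_mono mult_left_mono)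
    also have "\<dots> \<le> 8 / L * ?n * s" using L s pi_less_4 by (intro mult_right_mono divide_right_mono) auto
    finally have ph: "\<bar>phase L k ?y - phase L k x\<bar> \<le> 8 * ?n * s / L" by (simp add: phase_add phase_axis)
    have trig: "\<bar>cos u - cos v\<bar> \<le> \<bar>u - v\<bar>" "\<bar>sin u - sin v\<bar> \<le> \<bar>u - v\<bar>" for u v :: real
    proof -
      have sinx: "\<bar>sin x\<bar> \<le> \<bar>x\<bar>" for x :: real by (rule abs_sin_x_le_abs_x)
      have e: "\<bar>2 * (a * sin ((u - v) / 2))\<bar> \<le> \<bar>u - v\<bar>" if "\<bar>a\<bar> \<le> 1" for a
      proof -
        have "\<bar>a\<bar> * \<bar>sin ((u - v) / 2)\<bar> \<le> 1 * \<bar>(u - v) / 2\<bar>" by (intro mult_mono that sinx abs_ge_zero) simp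
        then show ?thesis by (simp add: abs_mult)
      qed
      have "sin ((v - u) / 2) = - sin ((u - v) / 2)" by (metis minus_diff_eq minus_divide_left sin_minus)
      then have "cos u - cos v = 2 * ((- sin ((u + v) / 2)) * sin ((u - v) / 2))"
        unfolding cos_diff_cos by simp
      then show "\<bar>cos u - cos v\<bar> \<le> \<bar>u - v\<bar>" using e[of "- sin ((u + v) / 2)"] by simp
      have "sin u - sin v = 2 * (cos ((u + v) / 2) * sin ((u - v) / 2))"
        using sin_diff_sin[of u v] by (simp add: mult.commute)
      then show "\<bar>sin u - sin v\<bar> \<le> \<bar>u - v\<bar>" using e[of "cos ((u + v) / 2)"] by simp
    qed
    have "\<bar>cos_mode L k ?y - cos_mode L k x\<bar> \<le> 8 * ?n * s / L" "\<bar>sin_mode L k ?y - sin_mode L k x\<bar> \<le> 8 * ?n * s / L"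
      unfolding cos_mode_def sin_mode_def using trig ph order_trans by blast+
    from comb[OF this, of "cos_coeff L f k" "sin_coeff L f k"]
    have "\<bar>fourier_term L f k ?y - fourier_term L f k x\<bar> \<le> (\<bar>cos_coeff L f k\<bar> + \<bar>sin_coeff L f k\<bar>) / L ^ 3 * (8 * ?n * s / L)"
      by (simp add: fourier_term_def right_diff_distrib diff_divide_distrib[symmetric] add_divide_distrib[symmetric])
         (simp add: algebra_simps)
    also have "\<dots> \<le> ?b * (8 * ?n * s / L)" using coef[OF k] s L by (intro mult_right_mono) auto
    finally show "\<bar>fourier_term L f k ?y - fourier_term L f k x\<bar> \<le> ?b * (8 * ?n * s / L)" .
  next
    show "0 \<le> ?b * (8 * ?n * s / L)"
      using s L by (intro mult_nonneg_nonneg[OF b0] divide_nonneg_pos mult_nonneg_nonneg) auto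
  qed
  also have "18 * ?n ^ 2 * (?b * (8 * ?n * s / L)) = 288 * B * L ^ 5 * s / ?n ^ 3"
  proof -
    have "?n ^ 6 = ?n ^ 3 * (?n ^ 2 * ?n)" "L ^ 6 = L ^ 5 * L" by (simp_all add: eval_nat_numeral del: of_nat_Suc)
    moreover have "18 * p * (2 * B * (l * L) / (m * (p * n)) * (8 * n * s / L)) = 288 * B * l * s / m"
      if "p > 0" "n > 0" for p m n l :: real using that L by simp
    moreover have "?n ^ 2 > 0" "?n > 0" by simp_all
    ultimately show ?thesis by (simp only:)
  qed
  finally show "\<bar>(fourier_proj L (Suc n) f ?y - fourier_proj L (Suc n) f x)
      - (fourier_proj L n f ?y - fourier_proj L n f x)\<bar> \<le> 288 * B * L ^ 5 * s / ?n ^ 3"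
    unfolding fourier_proj_Suc[OF L cf, of n] by (simp add: sum_subtractf)
qed

lemma fourier_proj_continuous:
  assumes "L > 0" "continuous_on UNIV f"
  shows "continuous_on S (fourier_proj L n f)"
proof -
  have "fourier_proj L n f = (\<lambda>x. \<Sum>k\<in>{k. l1_norm k \<le> int n}. fourier_term L f k x)"
    by (intro ext fourier_proj_eq_sum_terms assms)
  then show ?thesis by (simp only:) (intro continuous_on_sum fourier_term_continuous)
qed

lemma fourier_proj_periodic:
  assumes "L > 0" "continuous_on UNIV f"
  shows "fourier_proj L n f (x + axis i L) = fourier_proj L n f x"
  by (simp add: fourier_proj_eq_sum_terms[OF assms] fourier_term_def modes_periodic[OF assms(1)])

text \<open>The truncated series converges uniformly to a continuous function \<open>S\<close> by the shell
  bounds. By orthogonality \<open>S\<close> has the Fourier coefficients of \<open>f\<close>, and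
  the uniqueness theorem identifies the two.\<close>

lemma fourier_proj_tendsto:
  assumes L: "L > 0" and f: "bounded_class_C 6 B f" and per: "\<And>x i. f (x + axis i L) = f x"
  shows "(\<lambda>n. fourier_proj L n f x) \<longlonglongrightarrow> f x"
proof -
  have cf: "continuous_on UNIV f" using f by (rule bounded_class_C_continuous)
  define C where "C = 36 * B * L ^ 6"
  have inc: "\<bar>fourier_proj L (Suc n) f x - fourier_proj L n f x\<bar> \<le> C / real (Suc n) ^ 3" for n x
    unfolding C_def by (rule fourier_shell_bounds(1)[OF L f per])
  define S where "S x = lim (\<lambda>n. fourier_proj L n f x)" for x
  have lim: "(\<lambda>n. fourier_proj L n f x) \<longlonglongrightarrow> S x" for x
    using cubic_increments_limit(1)[where a = "\<lambda>n. fourier_proj L n f x", OF inc] unfolding S_def by (simp add: convergent_LIMSEQ_iff)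
  have err: "\<bar>S x - fourier_proj L n f x\<bar> \<le> C / real n ^ 2" if "n \<ge> 1" for x n
    using cubic_increments_limit(2)[where a = "\<lambda>n. fourier_proj L n f x", OF inc lim that] .
  have C0: "C \<ge> 0" using bounded_class_C_bound[OF f, of 0] L by (simp add: C_def)
  have lim0: "(\<lambda>K. M / real K ^ 2) \<longlonglongrightarrow> 0" for M
    by (intro tendsto_divide_0[OF tendsto_const] filterlim_at_top_imp_at_infinity filterlim_pow_at_top filterlim_real_sequentially) simp
  have cS: "continuous_on UNIV S"
  proof (rule uniform_limit_theorem[where F = sequentially])
    show "uniform_limit UNIV (\<lambda>n. fourier_proj L n f) S sequentially"
    proof (rule uniform_limitI)
      fix e :: real assume "e > 0"
      from order_tendstoD(2)[OF lim0 this, of C] eventually_ge_at_top[of 1]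
      show "\<forall>\<^sub>F n in sequentially. \<forall>x\<in>UNIV. dist (fourier_proj L n f x) (S x) < e"
        by eventually_elim (metis dist_commute dist_real_def err order_le_less_trans)
    qed
  qed (auto simp: fourier_proj_continuous[OF L cf])
  have zero: "cell_integral L (\<lambda>x. (f x - S x) * m x) = 0"
    if m: "continuous_on UNIV m" "\<And>x. \<bar>m x\<bar> \<le> 1" and
      eq: "\<And>n. n \<ge> nn \<Longrightarrow> cell_integral L (\<lambda>x. fourier_proj L n f x * m x) = cell_integral L (\<lambda>x. f x * m x)" for m nn
  proof -
    let ?I = "cell_integral L (\<lambda>x. (f x - S x) * m x)"
    have "\<bar>?I\<bar> \<le> L ^ 3 * C / real n ^ 2" if n: "n \<ge> max 1 nn" for n
    proof -
      note ci = continuous_on_mult[OF cf m(1)] continuous_on_mult[OF cS m(1)]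
        continuous_on_mult[OF fourier_proj_continuous[OF L cf, of UNIV n] m(1)]
      have "?I = cell_integral L (\<lambda>x. fourier_proj L n f x * m x) - cell_integral L (\<lambda>x. S x * m x)"
        using n eq[of n] ci by (simp add: left_diff_distrib cell_integral_diff)
      also have "\<dots> = cell_integral L (\<lambda>x. (fourier_proj L n f x - S x) * m x)"
        using ci by (simp add: left_diff_distrib cell_integral_diff)
      also have "\<bar>\<dots>\<bar> \<le> L ^ 3 * (C / real n ^ 2)"
      proof (rule cell_integral_bound[OF L])
        show "continuous_on UNIV (\<lambda>x. (fourier_proj L n f x - S x) * m x)"
          by (intro continuous_intros cS m fourier_proj_continuous[OF L cf])
        show "\<bar>(fourier_proj L n f x - S x) * m x\<bar> \<le> C / real n ^ 2" for x
        proof -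
          have "\<bar>fourier_proj L n f x - S x\<bar> * \<bar>m x\<bar> \<le> C / real n ^ 2 * 1"
            using err[of n x] n m(2)[of x] C0 by (intro mult_mono) (auto simp: abs_minus_commute)
          then show ?thesis by (simp add: abs_mult)
        qed
      qed
      finally show ?thesis by simp
    qed
    then have "\<forall>\<^sub>F n in sequentially. \<bar>?I\<bar> \<le> L ^ 3 * C / real n ^ 2"
      unfolding eventually_sequentially by blast
    then have "\<bar>?I\<bar> \<le> 0" by (intro tendsto_lowerbound[OF lim0]) auto
    then show ?thesis by simp
  qed
  have "f x - S x = 0"
  proof (rule zero_of_vanishing_coeffs[OF L])
    show "continuous_on UNIV (\<lambda>x. f x - S x)" by (intro continuous_intros cf cS)
    have sp: "fourier_proj L n f (x + axis i L) = fourier_proj L n f x" for n x i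
      by (rule fourier_proj_periodic[OF L cf])
    show "f (x + axis i L) - S (x + axis i L) = f x - S x" for x i by (simp add: S_def sp per)
    fix k
    have k: "l1_norm k \<le> int n" if "n \<ge> nat (l1_norm k)" for n using that by linarith
    show "cos_coeff L (\<lambda>x. f x - S x) k = 0"
      unfolding cos_coeff_def
    proof (rule zero[where nn = "nat (l1_norm k)"])
      show "continuous_on UNIV (cos_mode L k)" by (rule modes_continuous)
      show "\<bar>cos_mode L k x\<bar> \<le> 1" for x by (simp add: cos_mode_def)
      show "cell_integral L (\<lambda>x. fourier_proj L n f x * cos_mode L k x) = cell_integral L (\<lambda>x. f x * cos_mode L k x)"
        if "n \<ge> nat (l1_norm k)" for n
        using coeff_fourier_proj(1)[OF L cf k[OF that]] by (simp only: cos_coeff_def)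
    qed
    show "sin_coeff L (\<lambda>x. f x - S x) k = 0"
      unfolding sin_coeff_def
    proof (rule zero[where nn = "nat (l1_norm k)"])
      show "continuous_on UNIV (sin_mode L k)" by (rule modes_continuous)
      show "\<bar>sin_mode L k x\<bar> \<le> 1" for x by (simp add: sin_mode_def)
      show "cell_integral L (\<lambda>x. fourier_proj L n f x * sin_mode L k x) = cell_integral L (\<lambda>x. f x * sin_mode L k x)"
        if "n \<ge> nat (l1_norm k)" for n
        using coeff_fourier_proj(2)[OF L cf k[OF that]] by (simp only: sin_coeff_def)
    qed
  qed
  then show ?thesis using lim[of x] by simp
qed

lemma fourier_proj_error:
  assumes L: "L > 0" and f: "bounded_class_C 6 B f" and per: "\<And>x i. f (x + axis i L) = f x" and K: "K \<ge> 1"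
  shows "\<bar>f x - fourier_proj L K f x\<bar> \<le> 36 * B * L ^ 6 / real K ^ 2"
    and "s \<ge> 0 \<Longrightarrow> \<bar>(f (x + s *\<^sub>R axis i 1) - f x) - (fourier_proj L K f (x + s *\<^sub>R axis i 1) - fourier_proj L K f x)\<bar>
      \<le> 288 * B * L ^ 5 * s / real K ^ 2"
proof -
  show "\<bar>f x - fourier_proj L K f x\<bar> \<le> 36 * B * L ^ 6 / real K ^ 2"
    by (rule cubic_increments_limit(2)[where a = "\<lambda>n. fourier_proj L n f x",
          OF fourier_shell_bounds(1)[OF L f per] fourier_proj_tendsto[OF L f per] K])
  show "\<bar>(f (x + s *\<^sub>R axis i 1) - f x) - (fourier_proj L K f (x + s *\<^sub>R axis i 1) - fourier_proj L K f x)\<bar>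
      \<le> 288 * B * L ^ 5 * s / real K ^ 2" if "s \<ge> 0"
    by (rule cubic_increments_limit(2)[where a = "\<lambda>n. fourier_proj L n f (x + s *\<^sub>R axis i 1) - fourier_proj L n f x",
          OF fourier_shell_bounds(2)[OF L f per that]
            tendsto_diff[OF fourier_proj_tendsto[OF L f per] fourier_proj_tendsto[OF L f per]] K])
qed

subsection \<open>Mean values of trigonometric polynomials on the grid\<close>

text \<open>Multiplied by \<open>2 sin (\<theta> / 2)\<close>, the sum telescopes to a difference of values
  one period apart. The factor does not vanish because the frequency is not a multiple of
  \<open>N\<close>.\<close>

lemma sum_cos_full_period:
  fixes m :: int
  assumes "m \<noteq> 0" "\<bar>m\<bar> < int N"
  shows "(\<Sum>i=1..int N. cos (\<alpha> + 2 * pi * of_int m / real N * of_int i)) = 0"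
proof -
  define \<theta> where "\<theta> = 2 * pi * of_int m / real N"
  have N: "real N > 0" using assms by linarith
  let ?F = "\<lambda>i. sin (\<alpha> + \<theta> * of_int i - \<theta> / 2)"
  have "?F (i + int N) = ?F i" for i
  proof -
    have "\<alpha> + \<theta> * of_int (i + int N) - \<theta> / 2 = (\<alpha> + \<theta> * of_int i - \<theta> / 2) + 2 * pi * of_int m"
      using N by (simp add: \<theta>_def field_simps)
    then show ?thesis by (simp only:) (simp add: sin_add)
  qed
  then have "(\<Sum>i=1..int N. ?F (i + 1)) = (\<Sum>i=1..int N. ?F i)" by (rule sum_periodic_shift)
  then have "(\<Sum>i=1..int N. ?F (i + 1) - ?F i) = 0" by (simp add: sum_subtractf)
  moreover have "?F (i + 1) - ?F i = 2 * sin (\<theta> / 2) * cos (\<alpha> + \<theta> * of_int i)" for i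
  proof -
    have "?F (i + 1) = sin ((\<alpha> + \<theta> * of_int i) + \<theta> / 2)" by (simp add: algebra_simps)
    then show ?thesis by (simp add: sin_add sin_diff)
  qed
  ultimately have "2 * sin (\<theta> / 2) * (\<Sum>i=1..int N. cos (\<alpha> + \<theta> * of_int i)) = 0"
    by (simp add: sum_distrib_left)
  moreover have "sin (\<theta> / 2) \<noteq> 0"
  proof -
    have t: "\<theta> / 2 = pi * (of_int m / real N)" by (simp add: \<theta>_def)
    have b: "0 < \<bar>of_int m / real N\<bar>" "\<bar>of_int m / real N\<bar> < 1"
      using assms N by (simp_all add: divide_less_eq)
    have "sin (pi * \<bar>of_int m / real N\<bar>) > 0"
    proof (rule sin_gt_zero)
      show "0 < pi * \<bar>of_int m / real N\<bar>" by (rule mult_pos_pos[OF pi_gt_zero b(1)])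
      show "pi * \<bar>of_int m / real N\<bar> < pi" using mult_strict_left_mono[OF b(2) pi_gt_zero] by (simp only: mult_1_right)
    qed
    moreover have "sin (pi * \<bar>of_int m / real N\<bar>) = sin (\<theta> / 2) \<or> sin (pi * \<bar>of_int m / real N\<bar>) = - sin (\<theta> / 2)"
      unfolding t by (cases "of_int m / real N \<ge> 0") (simp_all add: abs_if)
    ultimately show ?thesis by auto
  qed
  ultimately show ?thesis by (simp add: \<theta>_def)
qed

lemma phase_vector:
  "phase L k (vector [a, b, c]) = 2 * pi / L * (of_int (k $ 1) * a + of_int (k $ 2) * b + of_int (k $ 3) * c)"
  by (simp add: phase_def sum_3)

lemma gsum_mode:
  assumes L: "L > 0" and N: "N > 0" and k: "k \<noteq> 0" "l1_norm k < int N"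
  shows "gsum N (grid_proj (mesh L N) (\<lambda>x. cos (phase L k x + \<gamma>))) = 0"
proof -
  let ?h = "mesh L N"
  have ph: "2 * pi / L * (of_int m * node ?h i) = 2 * pi * of_int m / real N * of_int i - pi * of_int m / real N" for m i
    using L N by (simp add: node_def mesh_def field_simps)
  let ?P = "\<lambda>m i. 2 * pi * of_int m / real N * of_int i :: real"
  let ?Q = "\<lambda>m. pi * of_int m / real N :: real"
  have expand: "phase L k (vector [node ?h i, node ?h j, node ?h l]) + \<gamma>
     = ?P (k $ 1) i - ?Q (k $ 1) + (?P (k $ 2) j - ?Q (k $ 2)) + (?P (k $ 3) l - ?Q (k $ 3)) + \<gamma>" for i j l
    unfolding phase_vector distrib_left ph ..
  have kb: "\<bar>k $ i\<bar> < int N" for i using l1_norm_ge_component[of k i] k(2) by linarith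
  obtain i where "k $ i \<noteq> 0" using k(1) by (metis vec_eq_iff zero_index)
  then consider "k $ 1 \<noteq> 0" | "k $ 2 \<noteq> 0" | "k $ 3 \<noteq> 0" using exhaust_3[of i] by auto
  then show ?thesis
  proof cases
    case 1
    have "gsum N (grid_proj ?h (\<lambda>x. cos (phase L k x + \<gamma>)))
      = (\<Sum>j=1..int N. \<Sum>i=1..int N. \<Sum>l=1..int N. cos (phase L k (vector [node ?h i, node ?h j, node ?h l]) + \<gamma>))"
      unfolding gsum_def grid_proj_def by (rule sum.swap)
    also have "\<dots> = (\<Sum>j=1..int N. \<Sum>l=1..int N. \<Sum>i=1..int N. cos (phase L k (vector [node ?h i, node ?h j, node ?h l]) + \<gamma>))"
      by (rule sum.cong[OF refl], rule sum.swap)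
    also have "\<dots> = 0"
    proof (rule sum.neutral, rule ballI, rule sum.neutral, rule ballI)
      fix j l
      have "phase L k (vector [node ?h i, node ?h j, node ?h l]) + \<gamma> =
         (- ?Q (k $ 1) + (?P (k $ 2) j - ?Q (k $ 2)) + (?P (k $ 3) l - ?Q (k $ 3)) + \<gamma>) + ?P (k $ 1) i" for i
        unfolding expand by simp
      then show "(\<Sum>i=1..int N. cos (phase L k (vector [node ?h i, node ?h j, node ?h l]) + \<gamma>)) = 0"
        by (simp only: sum_cos_full_period[OF 1 kb])
    qed
    finally show ?thesis .
  next
    case 2
    have "gsum N (grid_proj ?h (\<lambda>x. cos (phase L k x + \<gamma>)))
      = (\<Sum>i=1..int N. \<Sum>l=1..int N. \<Sum>j=1..int N. cos (phase L k (vector [node ?h i, node ?h j, node ?h l]) + \<gamma>))"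
      unfolding gsum_def grid_proj_def by (rule sum.cong[OF refl], rule sum.swap)
    also have "\<dots> = 0"
    proof (rule sum.neutral, rule ballI, rule sum.neutral, rule ballI)
      fix i l
      have "phase L k (vector [node ?h i, node ?h j, node ?h l]) + \<gamma> =
         (?P (k $ 1) i - ?Q (k $ 1) + (- ?Q (k $ 2)) + (?P (k $ 3) l - ?Q (k $ 3)) + \<gamma>) + ?P (k $ 2) j" for j
        unfolding expand by simp
      then show "(\<Sum>j=1..int N. cos (phase L k (vector [node ?h i, node ?h j, node ?h l]) + \<gamma>)) = 0"
        by (simp only: sum_cos_full_period[OF 2 kb])
    qed
    finally show ?thesis .
  next
    case 3
    have "(\<Sum>l=1..int N. cos (phase L k (vector [node ?h i, node ?h j, node ?h l]) + \<gamma>)) = 0" for i j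
    proof -
      have "phase L k (vector [node ?h i, node ?h j, node ?h l]) + \<gamma> =
         (?P (k $ 1) i - ?Q (k $ 1) + (?P (k $ 2) j - ?Q (k $ 2)) + (- ?Q (k $ 3)) + \<gamma>) + ?P (k $ 3) l" for l
        unfolding expand by simp
      then show ?thesis by (simp only: sum_cos_full_period[OF 3 kb])
    qed
    then show ?thesis by (simp add: gsum_def grid_proj_def)
  qed
qed

lemma gsum_sum:
  assumes "finite S"
  shows "gsum N (\<lambda>i j k. \<Sum>l\<in>S. g l i j k) = (\<Sum>l\<in>S. gsum N (g l))"
  using assms by (induction S rule: finite_induct) (simp_all add: gsum_add gsum_const)

text \<open>No frequency up to \<open>K\<close> is aliased to zero on \<open>2 K + 1\<close> nodes, so only
  the constant term contributes to the average over the grid.\<close>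

lemma grid_mean_fourier_proj:
  assumes L: "L > 0" and f: "continuous_on UNIV f"
  shows "grid_mean L (2 * K + 1) (grid_proj (mesh L (2 * K + 1)) (fourier_proj L K f)) = cos_coeff L f 0 / L ^ 3"
proof -
  let ?N = "2 * K + 1" and ?S = "{k. l1_norm k \<le> int K}"
  let ?h = "mesh L ?N"
  have N: "?N > 0" by simp
  have gp: "grid_proj ?h (fourier_proj L K f) = (\<lambda>i j k. \<Sum>l\<in>?S. grid_proj ?h (fourier_term L f l) i j k)"
    by (intro ext) (simp add: grid_proj_def fourier_proj_eq_sum_terms[OF L f])
  have zero: "gsum ?N (grid_proj ?h (fourier_term L f l)) = 0" if "l \<in> ?S - {0}" for l
  proof -
    have l: "l \<noteq> 0" "l1_norm l < int ?N" using that by auto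
    have "grid_proj ?h (fourier_term L f l) = (\<lambda>i j k. (cos_coeff L f l / L ^ 3) * grid_proj ?h (\<lambda>x. cos (phase L l x + 0)) i j k
        + (sin_coeff L f l / L ^ 3) * grid_proj ?h (\<lambda>x. cos (phase L l x + (- (pi / 2)))) i j k)"
      by (intro ext) (simp add: grid_proj_def fourier_term_def cos_mode_def sin_mode_def cos_add cos_diff sin_minus add_divide_distrib)
    then show ?thesis by (simp only: gsum_add gsum_cmult gsum_mode[OF L N l])
  qed
  have fin: "finite ?S" by (rule finite_l1_ball)
  have "gsum ?N (grid_proj ?h (fourier_proj L K f)) = (\<Sum>l\<in>?S. gsum ?N (grid_proj ?h (fourier_term L f l)))"
    unfolding gp by (rule gsum_sum[OF fin])
  also have "\<dots> = gsum ?N (grid_proj ?h (fourier_term L f 0))"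
  proof -
    have "0 \<in> ?S" by (simp add: l1_norm_def)
    from sum.remove[OF fin this, of "\<lambda>l. gsum ?N (grid_proj ?h (fourier_term L f l))"]
    show ?thesis using sum.neutral[of "?S - {0}" "\<lambda>l. gsum ?N (grid_proj ?h (fourier_term L f l))"] zero by simp
  qed
  also have "grid_proj ?h (fourier_term L f 0) = (\<lambda>i j k. cos_coeff L f 0 / L ^ 3)"
    by (intro ext) (simp add: grid_proj_def fourier_term_def cos_mode_def sin_mode_def phase_zero)
  finally have sum: "gsum ?N (grid_proj ?h (fourier_proj L K f)) = real ?N ^ 3 * (cos_coeff L f 0 / L ^ 3)"
    by (simp only: gsum_const)
  have "0 < real ?N" using N by (simp only: of_nat_0_less_iff)
  then have nz: "real ?N ^ 3 \<noteq> 0" by (metis less_irrefl zero_less_power)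
  show ?thesis unfolding grid_mean_eq_average[OF L N] sum by (rule nonzero_mult_div_cancel_left[OF nz])
qed

section \<open>Smooth test functions\<close>

definition bump_base :: "real \<Rightarrow> real \<Rightarrow> real" where
  "bump_base r x = (x + r) * (r - x)"

text \<open>A family that contains the standard bump function \<open>exp (- 1 / (r\<^sup>2 -
  x\<^sup>2))\<close> and is closed under differentiation, so that smoothness needs to be checked
  only once. \<open>flat_deriv\<close> is the polynomial factor of the derivative.\<close>

definition flat_fun :: "real \<Rightarrow> real poly \<Rightarrow> nat \<Rightarrow> real \<Rightarrow> real" where
  "flat_fun r p n x = (if \<bar>x\<bar> < r then poly p x / bump_base r x ^ n * exp (- 1 / bump_base r x) else 0)"

definition flat_deriv :: "real \<Rightarrow> real poly \<Rightarrow> nat \<Rightarrow> real poly" where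
  "flat_deriv r p n = (let u = [:r, 1:] * [:r, -1:] in
     pderiv p * u ^ 2 - smult (real n) (p * pderiv u * u) + p * pderiv u)"

lemma derivative_zero_of_quadratic:
  fixes g :: "real \<Rightarrow> real"
  assumes "\<And>y. \<bar>g y\<bar> \<le> C * (y - a)\<^sup>2"
  shows "(g has_real_derivative 0) (at a)"
proof -
  have ga: "g a = 0" using assms[of a] by simp
  have "((\<lambda>h. (g (a + h) - g a) / h) \<longlongrightarrow> 0) (at 0)"
  proof (rule Lim_null_comparison)
    show "\<forall>\<^sub>F h in at 0. norm ((g (a + h) - g a) / h) \<le> C * \<bar>h\<bar>"
    proof (rule eventually_at_filter[THEN iffD2], rule always_eventually, intro allI impI)
      fix h :: real assume "h \<noteq> 0"
      then show "norm ((g (a + h) - g a) / h) \<le> C * \<bar>h\<bar>"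
        using assms[of "a + h"] by (simp add: ga divide_le_eq power2_eq_square mult.assoc abs_mult_self_eq)
    qed
    have "((\<lambda>h. C * \<bar>h\<bar>) \<longlongrightarrow> C * \<bar>0\<bar>) (at (0::real))" by (intro tendsto_intros)
    then show "((\<lambda>h. C * \<bar>h\<bar>) \<longlongrightarrow> 0) (at (0::real))" by simp
  qed
  then show ?thesis by (simp add: DERIV_def)
qed

lemma bump_base_pos: "\<bar>x\<bar> < r \<Longrightarrow> bump_base r x > 0"
  unfolding bump_base_def by (intro mult_pos_pos) auto

lemma exp_neg_inverse_le:
  assumes "u > (0::real)"
  shows "exp (- 1 / u) \<le> fact m * u ^ m"
proof -
  have "(1 / u) ^ m / fact m \<le> exp (1 / u)"
  proof -
    have "(\<Sum>k\<in>{m}. (1 / u) ^ k /\<^sub>R fact k) \<le> (\<Sum>k. (1 / u) ^ k /\<^sub>R fact k)"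
      using assms by (intro sum_le_suminf summable_exp_generic) auto
    then show ?thesis by (simp add: exp_def divide_inverse mult.commute)
  qed
  then have "1 / exp (1 / u) \<le> 1 / ((1 / u) ^ m / fact m)"
    using assms by (intro divide_left_mono) auto
  then show ?thesis by (simp add: exp_minus inverse_eq_divide power_divide mult.commute)
qed

text \<open>The exponential beats every negative power, so the functions vanish to second order at
  \<open>\<plusminus>r\<close>. This gives the derivative zero at these two points, where the
  formula changes.\<close>

lemma flat_fun_quadratic:
  assumes r: "r > 0"
  shows "\<exists>C. \<forall>y. \<bar>flat_fun r p n y\<bar> \<le> C * (y - r)\<^sup>2 \<and> \<bar>flat_fun r p n y\<bar> \<le> C * (y + r)\<^sup>2"
proof -
  have "bounded (poly p ` {-r..r})"
    by (intro compact_imp_bounded compact_continuous_image) (auto intro: continuous_intros)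
  then obtain M where "\<forall>y\<in>{-r..r}. \<bar>poly p y\<bar> \<le> M" unfolding bounded_iff by auto
  then have M: "\<And>y. y \<in> {-r..r} \<Longrightarrow> \<bar>poly p y\<bar> \<le> M" by blast
  have M0: "M \<ge> 0" using M[of r] r by force
  define C where "C = M * fact (n + 2) * (2 * r)\<^sup>2"
  have C0: "C \<ge> 0" using M0 by (simp add: C_def)
  have "\<bar>flat_fun r p n y\<bar> \<le> C * (y - r)\<^sup>2 \<and> \<bar>flat_fun r p n y\<bar> \<le> C * (y + r)\<^sup>2" for y
  proof (cases "\<bar>y\<bar> < r")
    case True
    let ?u = "bump_base r y"
    have u: "?u > 0" using True by (rule bump_base_pos)
    have M': "\<bar>poly p y\<bar> \<le> M" by (rule M) (use True in auto)
    have "\<bar>flat_fun r p n y\<bar> = \<bar>poly p y\<bar> / ?u ^ n * exp (- 1 / ?u)"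
      using True u by (simp add: flat_fun_def abs_mult)
    also have "\<dots> \<le> M / ?u ^ n * (fact (n + 2) * ?u ^ (n + 2))"
      using M'  u M0 by (intro mult_mono divide_right_mono exp_neg_inverse_le) auto
    also have "\<dots> = M * fact (n + 2) * ?u\<^sup>2"
      using u by (simp add: power_add power2_eq_square)
    finally have b: "\<bar>flat_fun r p n y\<bar> \<le> M * fact (n + 2) * ?u\<^sup>2" .
    have k: "M * fact (n + 2) * ?u\<^sup>2 \<le> C * c\<^sup>2" if "?u = d * c" "0 \<le> d" "d \<le> 2 * r" for c d
    proof -
      have "d\<^sup>2 * c\<^sup>2 \<le> (2 * r)\<^sup>2 * c\<^sup>2" using that by (intro mult_right_mono power_mono) auto
      then have "M * fact (n + 2) * (d\<^sup>2 * c\<^sup>2) \<le> M * fact (n + 2) * ((2 * r)\<^sup>2 * c\<^sup>2)"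
        using M0 by (intro mult_left_mono) auto
      then show ?thesis unfolding that(1) C_def power_mult_distrib by (simp only: mult.assoc)
    qed
    have "?u = (r - y) * (y + r)" "?u = (y + r) * (r - y)" by (simp_all add: bump_base_def mult.commute)
    note ue = this
    have y: "- r \<le> y" "y \<le> r" using True by auto
    have "M * fact (n + 2) * ?u\<^sup>2 \<le> C * (y + r)\<^sup>2" by (rule k[OF ue(1)]) (use y in auto)
    moreover have "M * fact (n + 2) * ?u\<^sup>2 \<le> C * (r - y)\<^sup>2" by (rule k[OF ue(2)]) (use y in auto)
    ultimately show ?thesis unfolding power2_commute[of y r] using order_trans[OF b] by blast
  qed (auto simp: flat_fun_def C0)
  then show ?thesis by blast
qed

lemma flat_fun_derivative:
  assumes r: "r > 0"
  shows "(flat_fun r p n has_real_derivative flat_fun r (flat_deriv r p n) (n + 2) x) (at x)"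
proof -
  obtain C where C: "\<And>y. \<bar>flat_fun r p n y\<bar> \<le> C * (y - r)\<^sup>2" "\<And>y. \<bar>flat_fun r p n y\<bar> \<le> C * (y - (- r))\<^sup>2"
    using flat_fun_quadratic[OF r, of p n] by auto
  consider "\<bar>x\<bar> < r" | "x = r" | "x = - r" | "\<bar>x\<bar> > r" by linarith
  then show ?thesis
  proof cases
    case 1
    let ?u = "bump_base r"
    have u: "?u x > 0" using 1 by (rule bump_base_pos)
    have du: "(?u has_real_derivative (r - x) - (x + r)) (at x)"
      unfolding bump_base_def by (auto intro!: derivative_eq_intros)
    have "((\<lambda>x. poly p x / ?u x ^ n * exp (- 1 / ?u x)) has_real_derivative
        (poly (pderiv p) x * ?u x ^ n - poly p x * (real n * ?u x ^ (n - 1) * ((r - x) - (x + r)))) / (?u x ^ n * ?u x ^ n) * exp (- 1 / ?u x)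
        + exp (- 1 / ?u x) * (((r - x) - (x + r)) / (?u x * ?u x)) * (poly p x / ?u x ^ n)) (at x)"
      using u by (auto intro!: derivative_eq_intros du simp: field_simps)
    also have "(poly (pderiv p) x * ?u x ^ n - poly p x * (real n * ?u x ^ (n - 1) * ((r - x) - (x + r)))) / (?u x ^ n * ?u x ^ n) * exp (- 1 / ?u x)
        + exp (- 1 / ?u x) * (((r - x) - (x + r)) / (?u x * ?u x)) * (poly p x / ?u x ^ n)
      = flat_fun r (flat_deriv r p n) (n + 2) x"
    proof -
      have alg: "(P' * u ^ n - P * (real n * u ^ (n - 1) * d)) / (u ^ n * u ^ n) * E + E * (d / (u * u)) * (P / u ^ n)
        = (P' * u ^ 2 - real n * (P * d * u) + P * d) / u ^ (n + 2) * E" if "u \<noteq> 0" for P' P u d E :: real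
      proof (cases n)
        case 0
        then show ?thesis using that by (simp add: field_simps power2_eq_square)
      next
        case (Suc m)
        then show ?thesis using that by (simp add: field_simps power2_eq_square power_add)
      qed
      define U where "U = [:r, 1:] * [:r, -1:]"
      have pu: "poly U x = ?u x" by (simp add: U_def bump_base_def algebra_simps)
      have pd: "poly (pderiv U) x = (r - x) - (x + r)" by (simp add: U_def pderiv_mult pderiv_pCons algebra_simps)
      have pe: "poly (flat_deriv r p n) x = poly (pderiv p) x * ?u x ^ 2 - real n * (poly p x * ((r - x) - (x + r)) * ?u x) + poly p x * ((r - x) - (x + r))"
        unfolding flat_deriv_def Let_def U_def[symmetric] by (simp only: poly_add poly_diff poly_mult poly_power poly_smult pu pd)
      have "flat_fun r (flat_deriv r p n) (n + 2) x = poly (flat_deriv r p n) x / ?u x ^ (n + 2) * exp (- 1 / ?u x)"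
        using 1 by (simp only: flat_fun_def if_True)
      moreover have "?u x \<noteq> 0" using u by simp
      ultimately show ?thesis using alg pe by (simp only:)
    qed
    finally have "((\<lambda>x. poly p x / ?u x ^ n * exp (- 1 / ?u x)) has_real_derivative flat_fun r (flat_deriv r p n) (n + 2) x) (at x)" .
    then show ?thesis
    proof (rule has_field_derivative_transform_within_open)
      show "open {-r<..<r}" "x \<in> {-r<..<r}" using 1 by auto
    qed (auto simp: flat_fun_def abs_less_iff)
  next
    case 2
    have "(flat_fun r p n has_real_derivative 0) (at x)" using derivative_zero_of_quadratic[OF C(1)] 2 by simp
    moreover have "flat_fun r (flat_deriv r p n) (n + 2) x = 0" using 2 r by (simp add: flat_fun_def)
    ultimately show ?thesis by simp
  next
    case 3
    have "(flat_fun r p n has_real_derivative 0) (at x)" using derivative_zero_of_quadratic[OF C(2)] 3 by simp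
    moreover have "flat_fun r (flat_deriv r p n) (n + 2) x = 0" using 3 r by (simp add: flat_fun_def)
    ultimately show ?thesis by simp
  next
    case 4
    have "((\<lambda>x. 0) has_real_derivative 0) (at x)" by simp
    then have "(flat_fun r p n has_real_derivative 0) (at x)"
    proof (rule has_field_derivative_transform_within_open)
      show "open {y. r < \<bar>y\<bar>}" by (intro open_Collect_less continuous_intros)
    qed (use 4 in \<open>auto simp: flat_fun_def\<close>)
    then show ?thesis using 4 by (simp add: flat_fun_def)
  qed
qed

lemma deriv_flat_fun: "r > 0 \<Longrightarrow> deriv (flat_fun r p n) = flat_fun r (flat_deriv r p n) (n + 2)"
  by (intro ext DERIV_imp_deriv flat_fun_derivative)

definition bump :: "real \<Rightarrow> real \<Rightarrow> real" where
  "bump r = flat_fun r 1 0"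

lemma iterated_deriv_bump: "r > 0 \<Longrightarrow> \<exists>p n. (deriv ^^ k) (bump r) = flat_fun r p n"
proof (induction k)
  case 0 then show ?case by (auto simp: bump_def)
next
  case (Suc k)
  then obtain p n where "(deriv ^^ k) (bump r) = flat_fun r p n" by blast
  then show ?case using Suc.prems by (auto simp: deriv_flat_fun)
qed

lemma iterated_deriv_bump_derivative:
  assumes "r > 0"
  shows "((deriv ^^ k) (bump r) has_real_derivative (deriv ^^ Suc k) (bump r) x) (at x)"
proof -
  obtain p n where "(deriv ^^ k) (bump r) = flat_fun r p n" using iterated_deriv_bump[OF assms] by blast
  then show ?thesis using flat_fun_derivative[OF assms] by (simp add: deriv_flat_fun assms)
qed

lemma iterated_deriv_bump_continuous: "r > 0 \<Longrightarrow> continuous_on S ((deriv ^^ k) (bump r))"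
  by (rule DERIV_continuous_on[OF has_field_derivative_at_within]) (rule iterated_deriv_bump_derivative)

lemma iterated_deriv_shift:
  assumes r: "r > 0"
  shows "(deriv ^^ k) (\<lambda>s. bump r (s - t)) = (\<lambda>s. (deriv ^^ k) (bump r) (s - t))"
proof (induction k)
  case (Suc k)
  have "((\<lambda>s. (deriv ^^ k) (bump r) (s - t)) has_real_derivative (deriv ^^ Suc k) (bump r) (s - t) * 1) (at s)" for s
    by (rule DERIV_chain2[OF iterated_deriv_bump_derivative[OF r]]) (auto intro!: derivative_eq_intros)
  then have "deriv (\<lambda>s. (deriv ^^ k) (bump r) (s - t)) s = (deriv ^^ Suc k) (bump r) (s - t)" for s
    by (metis DERIV_imp_deriv mult.right_neutral)
  then show ?case using Suc by auto
qed simp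

lemma bump_nonneg: "bump r x \<ge> 0"
  by (simp add: bump_def flat_fun_def)

lemma bump_pos: "\<bar>x\<bar> < r \<Longrightarrow> bump r x > 0"
  by (simp add: bump_def flat_fun_def)

lemma bump_zero: "\<bar>x\<bar> \<ge> r \<Longrightarrow> bump r x = 0"
  by (simp add: bump_def flat_fun_def)

lemma test_fun_bump:
  assumes r: "r > 0" and t: "r < t" "t < T - r"
  shows "test_fun T (\<lambda>s. bump r (s - t))"
proof -
  have sub: "closure {s. bump r (s - t) \<noteq> 0} \<subseteq> {t - r..t + r}"
    by (rule closure_minimal) (use bump_zero[of r] in \<open>force simp: not_le[symmetric]\<close>, simp)
  have "(deriv ^^ k) (\<lambda>s. bump r (s - t)) field_differentiable at s" for k s
  proof -
    have "((\<lambda>s. (deriv ^^ k) (bump r) (s - t)) has_real_derivative (deriv ^^ Suc k) (bump r) (s - t) * 1) (at s)"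
      by (rule DERIV_chain2[OF iterated_deriv_bump_derivative[OF r]]) (auto intro!: derivative_eq_intros)
    then show ?thesis unfolding iterated_deriv_shift[OF r] field_differentiable_def by blast
  qed
  moreover have "compact (closure {s. bump r (s - t) \<noteq> 0})"
    using sub by (meson bounded_closed_interval bounded_subset closed_closure compact_eq_bounded_closed)
  moreover have "{t - r..t + r} \<subseteq> {0<..<T}" using t by auto
  ultimately show ?thesis using sub unfolding test_fun_def by blast
qed

lemma test_fun_deriv: "test_fun T \<eta> \<Longrightarrow> test_fun T (deriv \<eta>)"
proof -
  assume t: "test_fun T \<eta>"
  let ?S = "closure {t. \<eta> t \<noteq> 0}"
  have "deriv \<eta> t = 0" if "t \<notin> ?S" for t
  proof -
    have "((\<lambda>t. 0) has_real_derivative 0) (at t)" by simp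
    then have "(\<eta> has_real_derivative 0) (at t)"
    proof (rule has_field_derivative_transform_within_open)
      show "open (- ?S)" by (simp add: open_Compl)
      show "0 = \<eta> s" if "s \<in> - ?S" for s using that closure_subset[of "{t. \<eta> t \<noteq> 0}"] by auto
    qed (use that in auto)
    then show ?thesis by (rule DERIV_imp_deriv)
  qed
  then have sub: "closure {t. deriv \<eta> t \<noteq> 0} \<subseteq> ?S" by (intro closure_minimal) auto
  have "compact (closure {t. deriv \<eta> t \<noteq> 0})"
    using sub t unfolding test_fun_def by (meson closed_closure compact_eq_bounded_closed bounded_subset)
  moreover have "(deriv ^^ k) (deriv \<eta>) field_differentiable at t" for k t
    using t unfolding test_fun_def by (metis comp_apply funpow_Suc_right)
  ultimately show ?thesis using sub t unfolding test_fun_def by blast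
qed

lemma test_fun_derivative: "test_fun T \<eta> \<Longrightarrow> (\<eta> has_real_derivative deriv \<eta> t) (at t)"
  unfolding test_fun_def using DERIV_deriv_iff_field_differentiable
  by (metis funpow_0)

lemma test_fun_continuous: "test_fun T \<eta> \<Longrightarrow> continuous_on S \<eta>"
  by (rule DERIV_continuous_on[OF has_field_derivative_at_within]) (rule test_fun_derivative)

lemma test_fun_zero: "test_fun T \<eta> \<Longrightarrow> t \<le> 0 \<or> T \<le> t \<Longrightarrow> \<eta> t = 0"
  unfolding test_fun_def using closure_subset[of "{t. \<eta> t \<noteq> 0}"] by fastforce

section \<open>A distributional second derivative determines a function\<close>

lemma abs_integrable_subinterval:
  fixes z :: "real \<Rightarrow> real"
  assumes "z absolutely_integrable_on {0..T}" "0 \<le> a" "b \<le> T"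
  shows "z absolutely_integrable_on {a..b}"
  using absolutely_integrable_on_subinterval[OF assms(1), of a b] assms by simp

lemma integral_abs_le_integral:
  fixes f g :: "real \<Rightarrow> real"
  assumes "f integrable_on S" "g integrable_on S" "\<And>x. x \<in> S \<Longrightarrow> \<bar>f x\<bar> \<le> g x"
  shows "\<bar>integral S f\<bar> \<le> integral S g"
  using integral_norm_bound_integral[of f S g] assms by simp

lemma test_fun_bounds:
  assumes "test_fun T \<eta>"
  shows "\<exists>C\<ge>0. \<forall>s\<in>{0..T}. \<bar>deriv \<eta> s\<bar> \<le> C \<and> (\<forall>t\<in>{0..T}. \<bar>\<eta> s - \<eta> t\<bar> \<le> C * \<bar>s - t\<bar>)"
proof -
  have "bounded (deriv \<eta> ` {0..T})"
    by (intro compact_imp_bounded compact_continuous_image test_fun_continuous[OF test_fun_deriv[OF assms]]) simp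
  then obtain C where "\<forall>s\<in>{0..T}. \<bar>deriv \<eta> s\<bar> \<le> C" unfolding bounded_iff by auto
  then have C: "\<And>s. s \<in> {0..T} \<Longrightarrow> \<bar>deriv \<eta> s\<bar> \<le> max C 0" by force
  have "\<bar>\<eta> s - \<eta> t\<bar> \<le> max C 0 * \<bar>s - t\<bar>" if "s \<in> {0..T}" "t \<in> {0..T}" for s t
    using field_differentiable_bound[of "{0..T}" \<eta> "deriv \<eta>" "max C 0" t s] that C
      test_fun_derivative[OF assms, THEN has_field_derivative_at_within]
    by (simp add: abs_minus_commute)
  then show ?thesis using C by (intro exI[of _ "max C 0"]) auto
qed

text \<open>The primitive \<open>Z\<close> of an integrable function may fail to be differentiable, so the
  product rule is replaced by an estimate: \<open>H\<close>, the defect in the formula integrated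
  up to \<open>t\<close>, changes over \<open>[a, b]\<close> by at most \<open>2 C (b - a)\<close>
  times the integral of \<open>\<bar>z\<bar>\<close> over \<open>[a, b]\<close>. Summing over a
  partition into \<open>n\<close> equal parts gives \<open>O(1 / n)\<close>, so that
  \<open>H\<close> does not change at all.\<close>

lemma test_fun_by_parts_integrable:
  fixes z :: "real \<Rightarrow> real"
  assumes T: "T > 0" and \<eta>: "test_fun T \<eta>" and z: "z absolutely_integrable_on {0..T}"
  defines "Z \<equiv> \<lambda>t. integral {0..t} z"
  shows "integral {0..T} (\<lambda>t. \<eta> t * z t) = - integral {0..T} (\<lambda>t. deriv \<eta> t * Z t)"
proof -
  define V where "V t = integral {0..t} (\<lambda>s. \<bar>z s\<bar>)" for t
  obtain C where C: "C \<ge> 0" "\<And>s. s \<in> {0..T} \<Longrightarrow> \<bar>deriv \<eta> s\<bar> \<le> C"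
    "\<And>s t. s \<in> {0..T} \<Longrightarrow> t \<in> {0..T} \<Longrightarrow> \<bar>\<eta> s - \<eta> t\<bar> \<le> C * \<bar>s - t\<bar>"
    using test_fun_bounds[OF \<eta>] by blast
  have zi: "z integrable_on {a..b}" and zai: "(\<lambda>s. \<bar>z s\<bar>) integrable_on {a..b}" if "0 \<le> a" "b \<le> T" for a b
    using abs_integrable_subinterval[OF z that] by (auto simp: absolutely_integrable_on_def)
  have contZ: "continuous_on {0..T} Z"
    unfolding Z_def using zi[of 0 T] T by (intro indefinite_integral_continuous_1) auto
  have Zd: "Z b - Z a = integral {a..b} z" if "0 \<le> a" "a \<le> b" "b \<le> T" for a b
    unfolding Z_def using Henstock_Kurzweil_Integration.integral_combine[of 0 a b z] zi[of 0 b] that by simp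
  have Vd: "V b - V a = integral {a..b} (\<lambda>s. \<bar>z s\<bar>)" if "0 \<le> a" "a \<le> b" "b \<le> T" for a b
    unfolding V_def using Henstock_Kurzweil_Integration.integral_combine[of 0 a b "\<lambda>s. \<bar>z s\<bar>"] zai[of 0 b] that by simp
  have Vmono: "V a \<le> V b" if "0 \<le> a" "a \<le> b" "b \<le> T" for a b
  proof -
    have "0 \<le> integral {a..b} (\<lambda>s. \<bar>z s\<bar>)" by (rule integral_nonneg[OF zai]) (use that in auto)
    then show ?thesis using Vd[OF that] by simp
  qed
  have ZV: "\<bar>Z b - Z a\<bar> \<le> V b - V a" if "0 \<le> a" "a \<le> b" "b \<le> T" for a b
    unfolding Zd[OF that] Vd[OF that]
    by (rule integral_abs_le_integral[OF zi zai order_refl]) (use that in simp_all)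
  have \<eta>zi: "(\<lambda>t. \<eta> t * z t) absolutely_integrable_on {0..T}"
  proof (rule absolutely_integrable_bounded_measurable_product_real)
    show "\<eta> \<in> borel_measurable (lebesgue_on {0..T})"
      by (intro continuous_imp_measurable_on_sets_lebesgue test_fun_continuous[OF \<eta>]) auto
    show "bounded (\<eta> ` {0..T})"
      by (intro compact_imp_bounded compact_continuous_image test_fun_continuous[OF \<eta>]) simp
  qed (use z in auto)
  have i1: "(\<lambda>t. \<eta> t * z t) integrable_on {a..b}" if "0 \<le> a" "b \<le> T" for a b
    using abs_integrable_subinterval[OF \<eta>zi that] by (auto simp: absolutely_integrable_on_def)
  have c2: "continuous_on {0..T} (\<lambda>t. deriv \<eta> t * Z t)"
    by (intro continuous_intros contZ test_fun_continuous[OF test_fun_deriv[OF \<eta>]])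
  have i2: "(\<lambda>t. deriv \<eta> t * Z t) integrable_on {a..b}" if "0 \<le> a" "b \<le> T" for a b
    by (rule integrable_continuous_real, rule continuous_on_subset[OF c2]) (use that in auto)
  define H where "H t = integral {0..t} (\<lambda>t. \<eta> t * z t) + integral {0..t} (\<lambda>t. deriv \<eta> t * Z t) - \<eta> t * Z t" for t
  have step: "\<bar>H b - H a\<bar> \<le> 2 * C * (b - a) * (V b - V a)" if ab: "0 \<le> a" "a \<le> b" "b \<le> T" for a b
  proof -
    have e1: "integral {0..b} (\<lambda>t. \<eta> t * z t) - integral {0..a} (\<lambda>t. \<eta> t * z t) = integral {a..b} (\<lambda>t. \<eta> t * z t)"
      using Henstock_Kurzweil_Integration.integral_combine[of 0 a b "\<lambda>t. \<eta> t * z t"] i1[of 0 b] ab by simp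
    have e2: "integral {0..b} (\<lambda>t. deriv \<eta> t * Z t) - integral {0..a} (\<lambda>t. deriv \<eta> t * Z t) = integral {a..b} (\<lambda>t. deriv \<eta> t * Z t)"
      using Henstock_Kurzweil_Integration.integral_combine[of 0 a b "\<lambda>t. deriv \<eta> t * Z t"] i2[of 0 b] ab by simp
    have d1: "((\<lambda>t. deriv \<eta> t * Z b) has_integral (\<eta> b - \<eta> a) * Z b) {a..b}"
      using fundamental_theorem_of_calculus[of a b \<eta> "deriv \<eta>"] ab
        has_field_derivative_at_within[OF test_fun_derivative[OF \<eta>]]
      by (intro has_integral_mult_left) (simp add: has_real_derivative_iff_has_vector_derivative)
    have A: "((\<lambda>t. (\<eta> t - \<eta> a) * z t) has_integral (integral {a..b} (\<lambda>t. \<eta> t * z t) - \<eta> a * integral {a..b} z)) {a..b}"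
      unfolding left_diff_distrib using ab
      by (intro has_integral_diff has_integral_mult_right integrable_integral i1 zi) auto
    have B: "((\<lambda>t. deriv \<eta> t * (Z t - Z b)) has_integral (integral {a..b} (\<lambda>t. deriv \<eta> t * Z t) - (\<eta> b - \<eta> a) * Z b)) {a..b}"
      unfolding right_diff_distrib using ab
      by (intro has_integral_diff integrable_integral i2 d1) auto
    have dec: "H b - H a = integral {a..b} (\<lambda>t. (\<eta> t - \<eta> a) * z t) + integral {a..b} (\<lambda>t. deriv \<eta> t * (Z t - Z b))"
      unfolding integral_unique[OF A] integral_unique[OF B] e1[symmetric] e2[symmetric] H_def Zd[OF ab, symmetric]
      by (simp add: algebra_simps)
    have "\<bar>integral {a..b} (\<lambda>t. (\<eta> t - \<eta> a) * z t)\<bar> \<le> integral {a..b} (\<lambda>t. C * (b - a) * \<bar>z t\<bar>)"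
    proof (rule integral_abs_le_integral)
      show "\<bar>(\<eta> t - \<eta> a) * z t\<bar> \<le> C * (b - a) * \<bar>z t\<bar>" if "t \<in> {a..b}" for t
      proof -
        have "\<bar>\<eta> t - \<eta> a\<bar> \<le> C * \<bar>t - a\<bar>" using that ab by (intro C(3)) auto
        also have "\<dots> \<le> C * (b - a)" using that C(1) by (intro mult_left_mono) auto
        finally show ?thesis by (simp add: abs_mult mult_right_mono)
      qed
      show "(\<lambda>t. (\<eta> t - \<eta> a) * z t) integrable_on {a..b}" using A by (rule has_integral_integrable)
      show "(\<lambda>t. C * (b - a) * \<bar>z t\<bar>) integrable_on {a..b}"
        by (rule integrable_on_mult_right[OF zai]) (use ab in simp_all)
    qed
    then have I1: "\<bar>integral {a..b} (\<lambda>t. (\<eta> t - \<eta> a) * z t)\<bar> \<le> C * (b - a) * (V b - V a)"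
      by (simp add: Vd[OF ab])
    have "\<bar>integral {a..b} (\<lambda>t. deriv \<eta> t * (Z t - Z b))\<bar> \<le> integral {a..b} (\<lambda>t. C * (V b - V a))"
    proof (rule integral_abs_le_integral)
      show "\<bar>deriv \<eta> t * (Z t - Z b)\<bar> \<le> C * (V b - V a)" if "t \<in> {a..b}" for t
      proof -
        have "\<bar>Z t - Z b\<bar> \<le> V b - V t" using ZV[of t b] that ab by (simp add: abs_minus_commute)
        also have "\<dots> \<le> V b - V a" using Vmono[of a t] that ab by simp
        finally show ?thesis unfolding abs_mult using C(1) C(2)[of t] that ab by (intro mult_mono) auto
      qed
      show "(\<lambda>t. deriv \<eta> t * (Z t - Z b)) integrable_on {a..b}" using B by (rule has_integral_integrable)
      show "(\<lambda>t. C * (V b - V a)) integrable_on {a..b}" by (rule integrable_const_ivl)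
    qed
    then have I2: "\<bar>integral {a..b} (\<lambda>t. deriv \<eta> t * (Z t - Z b))\<bar> \<le> C * (b - a) * (V b - V a)"
      using ab by (simp add: mult.commute mult.left_commute)
    have sum: "\<bar>u + v\<bar> \<le> 2 * C * (b - a) * (V b - V a)"
      if "\<bar>u\<bar> \<le> C * (b - a) * (V b - V a)" "\<bar>v\<bar> \<le> C * (b - a) * (V b - V a)" for u v
      using that by (simp add: abs_le_iff)
    show ?thesis unfolding dec by (rule sum[OF I1 I2])
  qed
  have "\<bar>H T - H 0\<bar> \<le> 2 * C * T * V T / real n" if n: "n > 0" for n
  proof -
    define p where "p i = T * real i / real n" for i
    have p1: "0 \<le> p i" for i using T by (simp add: p_def)
    have p2: "p (Suc i) - p i = T / real n" for i
      by (simp add: p_def add_divide_distrib distrib_left)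
    have "0 \<le> T / real n" using T by simp
    then have p3: "p i \<le> p (Suc i)" for i using p2[of i] by linarith
    have p4: "p (Suc i) \<le> T" if "i < n" for i
    proof -
      have "real (Suc i) \<le> real n" using that by simp
      then have "T * real (Suc i) \<le> T * real n" using T by (intro mult_left_mono) auto
      then show ?thesis using n by (simp add: p_def pos_divide_le_eq)
    qed
    have "H T - H 0 = (\<Sum>i<n. H (p (Suc i)) - H (p i))"
      using n by (subst sum_lessThan_telescope) (simp add: p_def)
    also have "\<bar>\<dots>\<bar> \<le> (\<Sum>i<n. 2 * C * (T / real n) * (V (p (Suc i)) - V (p i)))"
    proof (rule order_trans[OF sum_abs], rule sum_mono)
      fix i assume "i \<in> {..<n}"
      then show "\<bar>H (p (Suc i)) - H (p i)\<bar> \<le> 2 * C * (T / real n) * (V (p (Suc i)) - V (p i))"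
        using step[OF p1 p3 p4, of i] by (simp only: p2 lessThan_iff)
    qed
    also have "\<dots> = 2 * C * (T / real n) * (V (p n) - V (p 0))"
      by (simp only: sum_distrib_left[symmetric] sum_lessThan_telescope[of "\<lambda>i. V (p i)" n])
    also have "\<dots> = 2 * C * T * V T / real n" using n by (simp add: p_def V_def)
    finally show ?thesis .
  qed
  then have "\<forall>\<^sub>F n in sequentially. \<bar>H T - H 0\<bar> \<le> 2 * C * T * V T / real n"
    unfolding eventually_sequentially by (intro exI[of _ 1]) auto
  moreover have "(\<lambda>n. 2 * C * T * V T / real n) \<longlonglongrightarrow> 0" by (rule lim_const_over_n)
  ultimately have "\<bar>H T - H 0\<bar> \<le> 0" by (intro tendsto_lowerbound) auto
  then show ?thesis using test_fun_zero[OF \<eta>] T by (simp add: H_def)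
qed

lemma test_fun_by_parts:
  fixes W W' :: "real \<Rightarrow> real"
  assumes T: "T > 0" and \<eta>: "test_fun T \<eta>"
    and W: "\<And>t. t \<in> {0..T} \<Longrightarrow> (W has_real_derivative W' t) (at t within {0..T})" "continuous_on {0..T} W'"
  shows "integral {0..T} (\<lambda>t. \<eta> t * W' t) = - integral {0..T} (\<lambda>t. deriv \<eta> t * W t)"
proof -
  have cW: "continuous_on {0..T} W" using W(1) by (rule DERIV_continuous_on)
  have "((\<lambda>t. \<eta> t * W t) has_vector_derivative \<eta> t * W' t + deriv \<eta> t * W t) (at t within {0..T})" if "t \<in> {0..T}" for t
    using DERIV_mult[OF has_field_derivative_at_within[OF test_fun_derivative[OF \<eta>]] W(1)[OF that]]
    by (simp add: has_real_derivative_iff_has_vector_derivative algebra_simps)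
  then have "((\<lambda>t. \<eta> t * W' t + deriv \<eta> t * W t) has_integral \<eta> T * W T - \<eta> 0 * W 0) {0..T}"
    using T by (intro fundamental_theorem_of_calculus) auto
  then have "integral {0..T} (\<lambda>t. \<eta> t * W' t + deriv \<eta> t * W t) = 0"
    using test_fun_zero[OF \<eta>] by (simp add: integral_unique)
  moreover have "(\<lambda>t. \<eta> t * W' t) integrable_on {0..T}"
    by (intro integrable_continuous_real continuous_on_mult test_fun_continuous[OF \<eta>] W(2))
  moreover have "(\<lambda>t. deriv \<eta> t * W t) integrable_on {0..T}"
    by (intro integrable_continuous_real continuous_on_mult test_fun_continuous[OF test_fun_deriv[OF \<eta>]] cW)
  ultimately show ?thesis by (simp add: integral_add)
qed

text \<open>The mollification \<open>A r\<close> of \<open>G\<close> at a small scale \<open>r\<close> is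
  smooth with vanishing second derivative on \<open>[p, q]\<close>, hence affine there. Divided by
  the mass \<open>c r\<close> of the mollifier it converges to \<open>G\<close>. The conclusion is
  the affine interpolation formula without division.\<close>

lemma affine_of_vanishing_second_derivative:
  fixes G :: "real \<Rightarrow> real"
  assumes T: "T > 0" and G: "continuous_on {0..T} G"
    and null: "\<And>\<eta>. test_fun T \<eta> \<Longrightarrow> integral {0..T} (\<lambda>t. deriv (deriv \<eta>) t * G t) = 0"
    and pq: "0 < p" "p < q" "q < T" and t: "t \<in> {p..q}"
  shows "(q - p) * G t = (q - t) * G p + (t - p) * G q"
proof -
  define A where "A r t = integral (cbox 0 T) (\<lambda>s. bump r (s - t) * G s)" for r t
  define r0 where "r0 = min p (T - q) / 2"
  have r0: "r0 > 0" using pq by (simp add: r0_def)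
  have "r0 \<le> p / 2" "r0 \<le> (T - q) / 2" by (simp_all add: r0_def)
  then have r0': "r0 < p" "q < T - r0" using pq by (simp_all add: field_simps)
  have G': "continuous_on (cbox 0 T) G" using G by simp
  have Gx: "continuous_on (U \<times> cbox 0 T) (\<lambda>x. G (snd x))" for U :: "real set"
    by (rule continuous_on_compose2[OF G']) (auto intro!: continuous_intros)
  have aff: "(q - p) * A r t = (q - t) * A r p + (t - p) * A r q" if r: "0 < r" "r \<le> r0" for r
  proof -
    have rr: "r < p" "q < T - r" using r r0' by simp_all
    define A1 where "A1 t = integral (cbox 0 T) (\<lambda>s. - deriv (bump r) (s - t) * G s)" for t
    note bd = iterated_deriv_bump_derivative[OF r(1)] and bc = iterated_deriv_bump_continuous[OF r(1)]
    have der: "((\<lambda>x. (deriv ^^ k) (bump r) (s - x)) has_real_derivative - (deriv ^^ Suc k) (bump r) (s - x)) (at x within UNIV)" for k s x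
    proof -
      have "((\<lambda>x. s - x) has_real_derivative - 1) (at x within UNIV)" by (auto intro!: derivative_eq_intros)
      from DERIV_chain2[where f = "(deriv ^^ k) (bump r)" and g = "\<lambda>x. s - x" and x = x, OF bd this] show ?thesis by simp
    qed
    have comp: "continuous_on (UNIV \<times> cbox 0 T) (\<lambda>x. (deriv ^^ k) (bump r) (snd x - fst x))" for k
      by (rule continuous_on_compose2[OF bc[of UNIV k]]) (auto intro!: continuous_intros)
    have bs: "continuous_on (cbox 0 T) (\<lambda>s. (deriv ^^ k) (bump r) (s - x))" for k x
      by (rule continuous_on_compose2[OF bc[of UNIV k]]) (auto intro!: continuous_intros)
    have DA: "(A r has_real_derivative A1 x) (at x)" for x
      unfolding A_def A1_def
    proof (rule leibniz_rule_field_derivative[where U = UNIV])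
      show "((\<lambda>x. bump r (s - x) * G s) has_real_derivative - deriv (bump r) (s - x) * G s) (at x within UNIV)" for x s
        using DERIV_cmult_right[OF der[where k = 0 and s = s and x = x], where c = "G s"] by simp
      show "(\<lambda>s. bump r (s - x) * G s) integrable_on cbox 0 T" for x
        using bs[where k = 0, of x] by (intro integrable_continuous continuous_intros G') simp
      show "continuous_on (UNIV \<times> cbox 0 T) (\<lambda>(x, s). - deriv (bump r) (s - x) * G s)"
        unfolding case_prod_beta using comp[where k = 1] by (intro continuous_intros Gx) simp
    qed auto
    have DA1: "(A1 has_real_derivative integral (cbox 0 T) (\<lambda>s. deriv (deriv (bump r)) (s - x) * G s)) (at x)" for x
      unfolding A1_def
    proof (rule leibniz_rule_field_derivative[where U = UNIV])
      show "((\<lambda>x. - deriv (bump r) (s - x) * G s) has_real_derivative deriv (deriv (bump r)) (s - x) * G s) (at x within UNIV)" for x s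
        using DERIV_cmult_right[OF DERIV_minus[OF der[where k = 1 and s = s and x = x]], where c = "G s"] by simp
      show "(\<lambda>s. - deriv (bump r) (s - x) * G s) integrable_on cbox 0 T" for x
        using bs[where k = 1, of x] by (intro integrable_continuous continuous_intros G') simp
      show "continuous_on (UNIV \<times> cbox 0 T) (\<lambda>(x, s). deriv (deriv (bump r)) (s - x) * G s)"
        unfolding case_prod_beta using comp[where k = 2] by (intro continuous_intros Gx) (simp add: numeral_2_eq_2)
    qed auto
    have A2: "integral (cbox 0 T) (\<lambda>s. deriv (deriv (bump r)) (s - x) * G s) = 0" if "x \<in> {p..q}" for x
    proof -
      have "test_fun T (\<lambda>s. bump r (s - x))" using that rr r by (intro test_fun_bump) auto
      from null[OF this] show ?thesis
        using iterated_deriv_shift[OF r(1), of 2 x] by (simp add: numeral_2_eq_2)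
    qed
    have "\<exists>c. \<forall>x\<in>{p..q}. A1 x = c"
    proof (rule has_field_derivative_zero_constant)
      show "(A1 has_real_derivative 0) (at x within {p..q})" if "x \<in> {p..q}" for x
        using has_field_derivative_at_within[OF DA1[of x]] A2[OF that] by simp
    qed simp
    then obtain c where c: "\<And>x. x \<in> {p..q} \<Longrightarrow> A1 x = c" by blast
    have "\<exists>d. \<forall>x\<in>{p..q}. A r x - c * x = d"
    proof (rule has_field_derivative_zero_constant)
      show "((\<lambda>x. A r x - c * x) has_real_derivative 0) (at x within {p..q})" if "x \<in> {p..q}" for x
        using has_field_derivative_at_within[OF DA[of x]] c[OF that] by (auto intro!: derivative_eq_intros)
    qed simp
    then obtain d where d: "\<And>x. x \<in> {p..q} \<Longrightarrow> A r x - c * x = d" by blast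
    have e: "A r x = d + c * x" if "x \<in> {p..q}" for x using d[OF that] by simp
    show ?thesis unfolding e[OF t] using e[of p] e[of q] pq by (simp add: algebra_simps)
  qed
  define c where "c r = integral (cbox (-r) r) (bump r)" for r
  \<comment> \<open>The error of the mollification, relative to its mass, is at most the oscillation of
     \<open>G\<close> within the distance \<open>r\<close>.\<close>
  have conc: "\<exists>r1>0. \<forall>r. 0 < r \<and> r \<le> r1 \<longrightarrow> \<bar>A r x - c r * G x\<bar> \<le> e * c r"
    if x: "x \<in> {p..q}" and e: "e > 0" for x e
  proof -
    have "x \<in> {0..T}" using x pq by auto
    then obtain d where d: "d > 0" "\<And>s. s \<in> {0..T} \<Longrightarrow> dist s x < d \<Longrightarrow> dist (G s) (G x) < e"
      using G e unfolding continuous_on_iff by metis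
    define r1 where "r1 = min r0 (d / 2)"
    have "\<bar>A r x - c r * G x\<bar> \<le> e * c r" if r: "0 < r" "r \<le> r1" for r
    proof -
      have "r \<le> r0" "r \<le> d / 2" using r by (simp_all add: r1_def)
      then have rr: "r < p" "q < T - r" "r < d" using r r0' d(1) by simp_all
      have b0: "continuous_on UNIV (bump r)"
        using iterated_deriv_bump_continuous[OF r(1), where k = 0 and S = UNIV] by simp
      have sh: "continuous_on S (\<lambda>s. s - x)" for S by (intro continuous_intros)
      have bc: "continuous_on S (\<lambda>s. bump r (s - x))" for S
        by (rule continuous_on_compose2[OF b0 sh]) simp
      have "((\<lambda>s. bump r (s - x)) has_integral c r) {x - r..x + r}"
      proof -
        have "(bump r has_integral c r) {- r..r}"
          unfolding c_def box_real(2) by (intro integrable_integral integrable_continuous_real continuous_on_subset[OF b0]) simp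
        moreover have "(\<lambda>s. bump r (s - x)) \<circ> (+) x = bump r" by (intro ext) simp
        ultimately have hi: "((\<lambda>s. bump r (s - x)) has_integral c r) {- r + x..r + x}"
          using has_integral_shift_Icc_real[of "\<lambda>s. bump r (s - x)" x "c r" "- r" r] by simp
        have "{- r + x..r + x} = {x - r..x + r}" by (simp add: add.commute)
        with hi show ?thesis by (simp only:)
      qed
      then have hc: "((\<lambda>s. bump r (s - x)) has_integral c r) {0..T}"
        by (rule has_integral_on_superset) (use rr x bump_zero[of r] in \<open>auto simp: not_le\<close>)
      have hA: "((\<lambda>s. bump r (s - x) * G s) has_integral A r x) {0..T}"
        unfolding A_def cbox_interval by (intro integrable_integral integrable_continuous_real continuous_intros bc G)
      have hd: "((\<lambda>s. bump r (s - x) * (G s - G x)) has_integral A r x - c r * G x) {0..T}"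
        unfolding right_diff_distrib by (intro has_integral_diff hA has_integral_mult_left hc)
      have "\<bar>integral {0..T} (\<lambda>s. bump r (s - x) * (G s - G x))\<bar> \<le> integral {0..T} (\<lambda>s. e * bump r (s - x))"
      proof (rule integral_abs_le_integral)
        show "\<bar>bump r (s - x) * (G s - G x)\<bar> \<le> e * bump r (s - x)" if s: "s \<in> {0..T}" for s
        proof (cases "\<bar>s - x\<bar> < r")
          case True
          then have "\<bar>G s - G x\<bar> \<le> e" using d(2)[OF s] rr(3) by (simp add: dist_real_def less_imp_le)
          then have "bump r (s - x) * \<bar>G s - G x\<bar> \<le> bump r (s - x) * e" by (intro mult_left_mono bump_nonneg)
          then show ?thesis by (simp add: abs_mult bump_nonneg mult.commute)
        qed (simp add: bump_zero)
        show "(\<lambda>s. bump r (s - x) * (G s - G x)) integrable_on {0..T}" using hd by (rule has_integral_integrable)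
        show "(\<lambda>s. e * bump r (s - x)) integrable_on {0..T}" using has_integral_mult_right[OF hc] by (rule has_integral_integrable)
      qed
      then show ?thesis using hc hd by (simp add: integral_unique)
    qed
    then show ?thesis using r0 d(1) by (intro exI[of _ r1]) (auto simp: r1_def)
  qed
  have cpos: "c r > 0" if "r > 0" for r
  proof -
    have "integral {- r..r} (\<lambda>x. 0) < integral {- r..r} (bump r)"
    proof (rule integral_less_real)
      show "continuous_on {- r..r} (bump r)" using iterated_deriv_bump_continuous[OF that, where k = 0] by simp
      show "{- r<..<r} \<noteq> {}" using that by simp
      show "0 < bump r x" if "x \<in> {- r<..<r}" for x using that by (intro bump_pos) auto
    qed simp
    then show ?thesis by (simp add: c_def)
  qed
  have bnd: "\<bar>(q - p) * G t - ((q - t) * G p + (t - p) * G q)\<bar> \<le> e * (2 * (q - p))" if e: "e > 0" for e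
  proof -
    have pI: "p \<in> {p..q}" "q \<in> {p..q}" using pq by auto
    from conc[OF t e] obtain r1 where r1: "r1 > 0"
      "\<forall>r. 0 < r \<and> r \<le> r1 \<longrightarrow> \<bar>A r t - c r * G t\<bar> \<le> e * c r" by (elim exE conjE)
    from conc[OF pI(1) e] obtain r2 where r2: "r2 > 0"
      "\<forall>r. 0 < r \<and> r \<le> r2 \<longrightarrow> \<bar>A r p - c r * G p\<bar> \<le> e * c r" by (elim exE conjE)
    from conc[OF pI(2) e] obtain r3 where r3: "r3 > 0"
      "\<forall>r. 0 < r \<and> r \<le> r3 \<longrightarrow> \<bar>A r q - c r * G q\<bar> \<le> e * c r" by (elim exE conjE)
    define r where "r = min (min r1 r2) (min r3 r0)"
    have rp: "0 < r" "r \<le> r1" "r \<le> r2" "r \<le> r3" "r \<le> r0" using r1(1) r2(1) r3(1) r0 by (auto simp: r_def)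
    have b: "\<bar>A r t - c r * G t\<bar> \<le> e * c r" "\<bar>A r p - c r * G p\<bar> \<le> e * c r" "\<bar>A r q - c r * G q\<bar> \<le> e * c r"
      using r1(2) r2(2) r3(2) rp by blast+
    have "c r * ((q - p) * G t - ((q - t) * G p + (t - p) * G q))
       = - ((q - p) * (A r t - c r * G t)) + ((q - t) * (A r p - c r * G p) + (t - p) * (A r q - c r * G q))"
      using aff[OF rp(1,5)] by (simp add: algebra_simps)
    also have "\<bar>\<dots>\<bar> \<le> (q - p) * (e * c r) + ((q - t) * (e * c r) + (t - p) * (e * c r))"
    proof -
      have "\<bar>(q - p) * (A r t - c r * G t)\<bar> \<le> (q - p) * (e * c r)" "\<bar>(q - t) * (A r p - c r * G p)\<bar> \<le> (q - t) * (e * c r)"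
        "\<bar>(t - p) * (A r q - c r * G q)\<bar> \<le> (t - p) * (e * c r)"
        unfolding abs_mult using b rp pq t by (auto intro!: mult_mono)
      then show ?thesis by linarith
    qed
    also have "\<dots> = c r * (e * (2 * (q - p)))" by (simp add: algebra_simps)
    finally have "c r * \<bar>(q - p) * G t - ((q - t) * G p + (t - p) * G q)\<bar> \<le> c r * (e * (2 * (q - p)))"
      using cpos[OF rp(1)] by (simp add: abs_mult)
    then show ?thesis using cpos[OF rp(1)] by simp
  qed
  have "\<bar>(q - p) * G t - ((q - t) * G p + (t - p) * G q)\<bar> \<le> 0"
  proof (rule field_le_epsilon)
    fix e :: real assume "e > 0"
    then show "\<bar>(q - p) * G t - ((q - t) * G p + (t - p) * G q)\<bar> \<le> 0 + e"
      using bnd[of "e / (2 * (q - p))"] pq by simp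
  qed
  then show ?thesis by simp
qed

text \<open>Subtract from \<open>F\<close> the second primitive \<open>W\<close> of \<open>z\<close>, which
  is \<open>C\<^sup>1\<close>. The remainder has vanishing distributional second derivative, so it
  is affine.\<close>

lemma C1_of_distributional_second_derivative:
  fixes F z :: "real \<Rightarrow> real"
  assumes T: "T > 0" and F: "continuous_on {0..T} F" and z: "z absolutely_integrable_on {0..T}"
    and weak: "\<And>\<eta>. test_fun T \<eta> \<Longrightarrow> integral {0..T} (\<lambda>t. deriv (deriv \<eta>) t * F t) = integral {0..T} (\<lambda>t. \<eta> t * z t)"
  shows "\<exists>F'. continuous_on {0<..<T} F' \<and> (\<forall>t\<in>{0<..<T}. (F has_real_derivative F' t) (at t))"
proof -
  define Z where "Z t = integral {0..t} z" for t
  define W where "W t = integral {0..t} Z" for t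
  have contZ: "continuous_on {0..T} Z"
    unfolding Z_def using z by (intro indefinite_integral_continuous_1) (auto simp: absolutely_integrable_on_def)
  have dW: "(W has_real_derivative Z t) (at t within {0..T})" if "t \<in> {0..T}" for t
    unfolding W_def has_real_derivative_iff_has_vector_derivative
    by (rule integral_has_vector_derivative[OF contZ that])
  have contW: "continuous_on {0..T} W" using dW by (rule DERIV_continuous_on)
  define G where "G t = F t - W t" for t
  have contG: "continuous_on {0..T} G" unfolding G_def by (intro continuous_intros F contW)
  have null: "integral {0..T} (\<lambda>t. deriv (deriv \<eta>) t * G t) = 0" if \<eta>: "test_fun T \<eta>" for \<eta>
  proof -
    note \<eta>1 = test_fun_deriv[OF \<eta>]
    note \<eta>2 = test_fun_deriv[OF \<eta>1]
    have "integral {0..T} (\<lambda>t. \<eta> t * z t) = - integral {0..T} (\<lambda>t. deriv \<eta> t * Z t)"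
      unfolding Z_def by (rule test_fun_by_parts_integrable[OF T \<eta> z])
    also have "integral {0..T} (\<lambda>t. deriv \<eta> t * Z t) = - integral {0..T} (\<lambda>t. deriv (deriv \<eta>) t * W t)"
      by (rule test_fun_by_parts[OF T \<eta>1 dW contZ])
    finally have "integral {0..T} (\<lambda>t. deriv (deriv \<eta>) t * F t) = integral {0..T} (\<lambda>t. deriv (deriv \<eta>) t * W t)"
      using weak[OF \<eta>] by simp
    then show ?thesis
      unfolding G_def right_diff_distrib
      by (subst integral_diff) (auto intro!: integrable_continuous_real continuous_on_mult test_fun_continuous[OF \<eta>2] F contW)
  qed
  \<comment> \<open>Fixed reference points make the slope the same for all intervals \<open>[p, q]\<close> that
     contain them.\<close>
  define \<beta> where "\<beta> = (G (2 * T / 3) - G (T / 3)) / (T / 3)"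
  have Ga: "G t = G (T / 3) + \<beta> * (t - T / 3)" if t: "t \<in> {0<..<T}" for t
  proof -
    define p q where "p = min t (T / 3)" and "q = max t (2 * T / 3)"
    have pq: "0 < p" "p < q" "q < T" using t T by (auto simp: p_def q_def)
    have in_pq: "t \<in> {p..q}" "T / 3 \<in> {p..q}" "2 * T / 3 \<in> {p..q}" using t T by (auto simp: p_def q_def)
    define \<sigma> where "\<sigma> = (G q - G p) / (q - p)"
    have lin: "G s = G p + \<sigma> * (s - p)" if "s \<in> {p..q}" for s
      using affine_of_vanishing_second_derivative[OF T contG null pq that] pq by (simp add: \<sigma>_def field_simps)
    have "\<beta> = \<sigma>" unfolding \<beta>_def lin[OF in_pq(2)] lin[OF in_pq(3)] using T by (simp add: field_simps)
    then show ?thesis unfolding lin[OF in_pq(1)] lin[OF in_pq(2)] by (simp add: algebra_simps)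
  qed
  have "(F has_real_derivative Z t + \<beta>) (at t)" if t: "t \<in> {0<..<T}" for t
  proof -
    have "(W has_real_derivative Z t) (at t)"
      using dW[of t] t at_within_interior[of t "{0..T}"] by simp
    then have "((\<lambda>t. W t + (G (T / 3) + \<beta> * (t - T / 3))) has_real_derivative Z t + \<beta>) (at t)"
      by (auto intro!: derivative_eq_intros)
    then show ?thesis
    proof (rule has_field_derivative_transform_within_open)
      show "open {0<..<T}" "t \<in> {0<..<T}" using t by auto
      show "W s + (G (T / 3) + \<beta> * (s - T / 3)) = F s" if "s \<in> {0<..<T}" for s
        using Ga[OF that] by (simp add: G_def)
    qed
  qed
  moreover have "continuous_on {0<..<T} (\<lambda>t. Z t + \<beta>)"
    by (intro continuous_intros continuous_on_subset[OF contZ]) auto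
  ultimately show ?thesis by blast
qed

section \<open>From Bochner integrals to scalar integrals\<close>

lemma sup_norm_bound:
  assumes "L > 0" "f \<in> C_per L 0"
  shows "\<bar>f x\<bar> \<le> C_norm 0 f"
  using C_norm_bound[OF assms, of "[]" x] by simp

lemma C_per_zero_closed:
  assumes "f \<in> C_per L 0" "g \<in> C_per L 0"
  shows "(\<lambda>x. f x - g x) \<in> C_per L 0" "(\<lambda>x. c * f x) \<in> C_per L 0" "(\<lambda>x. f x + g x) \<in> C_per L 0"
  using assms by (auto simp: C_per_def intro!: continuous_intros)

lemma open_interval_lebesgue: "{0<..<T :: real} \<in> sets lebesgue"
  by simp

lemma AE_lebesgue_on_negligible:
  assumes "AE t in lebesgue_on S. P t" "S \<in> sets lebesgue"
  shows "\<exists>N. negligible N \<and> (\<forall>t. t \<in> S - N \<longrightarrow> P t)"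
proof -
  obtain N where N: "\<And>t. t \<in> space (lebesgue_on S) - N \<Longrightarrow> P t" "N \<in> null_sets (lebesgue_on S)"
    using AE_E3[OF assms(1)] by blast
  have "negligible N"
    using N(2) assms(2) by (simp add: null_sets_restrict_space negligible_iff_null_sets)
  moreover have "\<forall>t. t \<in> S - N \<longrightarrow> P t" using N(1) by (simp add: space_restrict_space)
  ultimately show ?thesis by blast
qed

lemma simple_fun_value_integral:
  assumes "simple_fun L 0 T s"
  shows "integrable (lebesgue_on {0<..<T}) (\<lambda>t. s t x)"
    and "integral\<^sup>L (lebesgue_on {0<..<T}) (\<lambda>t. s t x) = simple_integral T s x"
proof -
  let ?\<Omega> = "{0<..<T}"
  let ?M = "lebesgue_on ?\<Omega>"
  have sf: "simple_function ?M s" using assms by (simp add: simple_fun_def)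
  have fin: "finite (s ` ?\<Omega>)" using sf by (simp add: simple_function_def space_restrict_space)
  have ms: "{t \<in> ?\<Omega>. s t = y} \<in> sets ?M" for y
  proof (cases "y \<in> s ` ?\<Omega>")
    case True
    then have "s -` {y} \<inter> space ?M \<in> sets ?M" using sf by (auto simp: simple_function_def space_restrict_space)
    moreover have "s -` {y} \<inter> space ?M = {t \<in> ?\<Omega>. s t = y}" by (auto simp: space_restrict_space)
    ultimately show ?thesis by simp
  next
    case False
    then have "{t \<in> ?\<Omega>. s t = y} = {}" by auto
    then show ?thesis by (simp only: sets.empty_sets)
  qed
  have meas: "measure ?M {t \<in> ?\<Omega>. s t = y} = measure lebesgue {t \<in> ?\<Omega>. s t = y}" for y
    by (rule measure_restrict_space) auto
  have em: "emeasure ?M {t \<in> ?\<Omega>. s t = y} < \<infinity>" for y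
  proof -
    have "emeasure ?M {t \<in> ?\<Omega>. s t = y} \<le> emeasure ?M ?\<Omega>" by (rule emeasure_mono) (auto simp: sets_restrict_space)
    also have "\<dots> < \<infinity>" using emeasure_bounded_finite[of ?\<Omega>] by (simp add: emeasure_restrict_space)
    finally show ?thesis .
  qed
  have rep: "s t x = (\<Sum>y\<in>s ` ?\<Omega>. y x * indicator {t \<in> ?\<Omega>. s t = y} t)" if "t \<in> space ?M" for t
  proof -
    have t: "t \<in> ?\<Omega>" using that by (simp add: space_restrict_space)
    have "(\<Sum>y\<in>s ` ?\<Omega>. y x * indicator {t \<in> ?\<Omega>. s t = y} t) = (\<Sum>y\<in>s ` ?\<Omega>. if y = s t then y x else 0)"
      using t by (intro sum.cong refl) (auto simp: indicator_def)
    also have "\<dots> = s t x" using fin t by (subst sum.delta) auto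
    finally show ?thesis by simp
  qed
  have ii: "integrable ?M (\<lambda>t. \<Sum>y\<in>s ` ?\<Omega>. y x * indicator {t \<in> ?\<Omega>. s t = y} t)"
    using ms em by (intro Bochner_Integration.integrable_sum integrable_mult_right integrable_real_indicator) auto
  show "integrable ?M (\<lambda>t. s t x)"
    using ii by (subst Bochner_Integration.integrable_cong[OF refl rep]) auto
  have "integral\<^sup>L ?M (\<lambda>t. s t x) = integral\<^sup>L ?M (\<lambda>t. \<Sum>y\<in>s ` ?\<Omega>. y x * indicator {t \<in> ?\<Omega>. s t = y} t)"
    by (rule Bochner_Integration.integral_cong[OF refl rep])
  also have "\<dots> = (\<Sum>y\<in>s ` ?\<Omega>. y x * measure ?M {t \<in> ?\<Omega>. s t = y})"
  proof (subst Bochner_Integration.integral_sum)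
    show "integrable ?M (\<lambda>t. y x * indicator {t \<in> ?\<Omega>. s t = y} t)" for y
      using ms em by (intro integrable_mult_right integrable_real_indicator) auto
    show "(\<Sum>y\<in>s ` ?\<Omega>. integral\<^sup>L ?M (\<lambda>t. y x * indicator {t \<in> ?\<Omega>. s t = y} t)) = (\<Sum>y\<in>s ` ?\<Omega>. y x * measure ?M {t \<in> ?\<Omega>. s t = y})"
    proof (intro sum.cong refl)
      fix y
      have "{t \<in> ?\<Omega>. s t = y} \<inter> space ?M = {t \<in> ?\<Omega>. s t = y}" by (auto simp: space_restrict_space)
      then show "integral\<^sup>L ?M (\<lambda>t. y x * indicator {t \<in> ?\<Omega>. s t = y} t) = y x * measure ?M {t \<in> ?\<Omega>. s t = y}"
        by (simp only: integral_mult_right_zero Bochner_Integration.integral_indicator)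
    qed
  qed
  also have "\<dots> = simple_integral T s x" by (simp only: simple_integral_def meas mult.commute)
  finally show "integral\<^sup>L ?M (\<lambda>t. s t x) = simple_integral T s x" .
qed

lemma strongly_measurable_value:
  assumes L: "L > 0" and u: "strongly_measurable L 0 T u"
  shows "\<exists>g. g \<in> borel_measurable (lebesgue_on {0<..<T}) \<and> (AE t in lebesgue_on {0<..<T}. g t = u t x)"
proof -
  let ?M = "lebesgue_on {0<..<T}"
  obtain s where s: "\<And>n. simple_fun L 0 T (s n)" "AE t in ?M. (\<lambda>n. C_norm 0 (\<lambda>x. u t x - s n t x)) \<longlonglongrightarrow> 0"
    and uC: "AE t in ?M. u t \<in> C_per L 0"
    using u by (auto simp: strongly_measurable_def)
  have "(\<lambda>t. lim (\<lambda>n. s n t x)) \<in> borel_measurable ?M"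
    using simple_fun_value_integral(1)[OF s(1)] by (intro borel_measurable_lim_metric) (rule borel_measurable_integrable)
  moreover have "AE t in ?M. lim (\<lambda>n. s n t x) = u t x"
    using s(2) uC AE_space
  proof eventually_elim
    case (elim t)
    have "s n t \<in> C_per L 0" for n using s(1)[of n] elim(3) by (simp add: simple_fun_def space_restrict_space)
    then have b: "\<bar>u t x - s n t x\<bar> \<le> C_norm 0 (\<lambda>x. u t x - s n t x)" for n
      using sup_norm_bound[OF L C_per_zero_closed(1)[OF elim(2)], of "s n t" x] by simp
    have "(\<lambda>n. u t x - s n t x) \<longlonglongrightarrow> 0"
      by (rule Lim_null_comparison[OF _ elim(1)]) (use b in auto)
    from tendsto_diff[OF tendsto_const[of "u t x"] this] have "(\<lambda>n. s n t x) \<longlonglongrightarrow> u t x" by simp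
    then show ?case by (rule limI)
  qed
  ultimately show ?thesis by blast
qed

text \<open>Point evaluation is continuous for the sup norm, so it commutes with the limit of simple
  functions. The auxiliary function \<open>g\<close> is a pointwise limit of simple functions that
  agrees with \<open>t \<mapsto> f t x\<close> almost everywhere.\<close>

lemma has_bochner_value:
  assumes L: "L > 0" and f: "has_bochner L 0 T f w"
  shows "((\<lambda>t. f t x) has_integral w x) {0..T}"
proof -
  let ?M = "lebesgue_on {0<..<T}"
  have sm: "strongly_measurable L 0 T f" and w: "w \<in> C_per L 0" using f by (auto simp: has_bochner_def)
  obtain s where s: "\<And>n. simple_fun L 0 T (s n)"
    and s1: "(\<lambda>n. \<integral>\<^sup>+t. ennreal (C_norm 0 (\<lambda>x. f t x - s n t x)) \<partial>?M) \<longlonglongrightarrow> 0"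
    and s2: "(\<lambda>n. C_norm 0 (\<lambda>x. w x - simple_integral T (s n) x)) \<longlonglongrightarrow> 0"
    using f by (auto simp: has_bochner_def)
  obtain g where g: "g \<in> borel_measurable ?M" "AE t in ?M. g t = f t x" using strongly_measurable_value[OF L sm] by blast
  have fC: "AE t in ?M. f t \<in> C_per L 0" using sm by (simp add: strongly_measurable_def)
  note si = simple_fun_value_integral[OF s]
  have le: "(\<integral>\<^sup>+t. ennreal \<bar>g t - s n t x\<bar> \<partial>?M) \<le> (\<integral>\<^sup>+t. ennreal (C_norm 0 (\<lambda>x. f t x - s n t x)) \<partial>?M)" for n
  proof (rule nn_integral_mono_AE)
    show "AE t in ?M. ennreal \<bar>g t - s n t x\<bar> \<le> ennreal (C_norm 0 (\<lambda>x. f t x - s n t x))"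
      using g(2) fC AE_space
    proof eventually_elim
      case (elim t)
      have "s n t \<in> C_per L 0" using s[of n] elim(3) by (simp add: simple_fun_def space_restrict_space)
      then show ?case using sup_norm_bound[OF L C_per_zero_closed(1)[OF elim(2)], of "s n t" x] elim(1)
        by (intro ennreal_leI) simp
    qed
  qed
  have lim0: "(\<lambda>n. \<integral>\<^sup>+t. ennreal \<bar>g t - s n t x\<bar> \<partial>?M) \<longlonglongrightarrow> 0"
    by (rule tendsto_sandwich[OF _ _ tendsto_const s1]) (use le in auto)
  have "\<forall>\<^sub>F n in sequentially. (\<integral>\<^sup>+t. ennreal \<bar>g t - s n t x\<bar> \<partial>?M) < 1"
    using order_tendstoD(2)[OF lim0, of 1] by simp
  then obtain n where n: "(\<integral>\<^sup>+t. ennreal \<bar>g t - s n t x\<bar> \<partial>?M) < 1" by (auto simp: eventually_sequentially)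
  have sn: "(\<lambda>t. s n t x) \<in> borel_measurable ?M" for n using si(1) by (rule borel_measurable_integrable)
  have "integrable ?M (\<lambda>t. g t - s n t x)"
    using n g(1) sn by (intro integrableI_bounded) (auto intro: less_trans)
  from Bochner_Integration.integrable_add[OF this si(1)[of n x]] have gi: "integrable ?M g" by simp
  have "(\<lambda>n. integral\<^sup>L ?M (\<lambda>t. s n t x)) \<longlonglongrightarrow> integral\<^sup>L ?M g"
    using lim0 by (intro tendsto_L1_int si(1) gi) (simp add: abs_minus_commute)
  then have l1: "(\<lambda>n. simple_integral T (s n) x) \<longlonglongrightarrow> integral\<^sup>L ?M g" by (simp only: si(2))
  have "(\<lambda>n. w x - simple_integral T (s n) x) \<longlonglongrightarrow> 0"
  proof (rule Lim_null_comparison[OF _ s2])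
    have "simple_integral T (s n) \<in> C_per L 0" for n
    proof -
      have sp: "y \<in> C_per L 0" if "y \<in> s n ` {0<..<T}" for y using s[of n] that by (auto simp: simple_fun_def)
      then show ?thesis
        unfolding simple_integral_def[abs_def] C_per_def by (auto intro!: continuous_intros sum.cong)
    qed
    then show "\<forall>\<^sub>F n in sequentially. norm (w x - simple_integral T (s n) x) \<le> C_norm 0 (\<lambda>x. w x - simple_integral T (s n) x)"
      using sup_norm_bound[OF L C_per_zero_closed(1)[OF w]] by (intro always_eventually) simp
  qed
  from tendsto_diff[OF tendsto_const[of "w x"] this] have "(\<lambda>n. simple_integral T (s n) x) \<longlonglongrightarrow> w x" by simp
  with l1 have eq: "integral\<^sup>L ?M g = w x" by (rule LIMSEQ_unique)
  have "(g has_integral w x) {0<..<T}"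
    using has_integral_integral_lebesgue_on[OF gi] eq by simp
  moreover obtain N where N: "negligible N" "\<And>t. t \<in> {0<..<T} - N \<Longrightarrow> g t = f t x"
    using AE_lebesgue_on_negligible[OF g(2) open_interval_lebesgue] by blast
  ultimately have "((\<lambda>t. f t x) has_integral w x) {0<..<T}"
    using has_integral_spike[OF N(1), of "{0<..<T}" "\<lambda>t. f t x" g] N(2) by auto
  then show ?thesis by (simp add: has_integral_Icc_iff_Ioo)
qed

lemma L2_time_value:
  assumes L: "L > 0" and z: "z \<in> L2_time L 0 T"
  shows "(\<lambda>t. z t x) absolutely_integrable_on {0..T}"
proof -
  let ?M = "lebesgue_on {0<..<T}"
  have sm: "strongly_measurable L 0 T z" and fin: "(\<integral>\<^sup>+t. ennreal ((C_norm 0 (z t))\<^sup>2) \<partial>?M) < \<infinity>"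
    using z by (auto simp: L2_time_def)
  obtain g where g: "g \<in> borel_measurable ?M" "AE t in ?M. g t = z t x" using strongly_measurable_value[OF L sm] by blast
  have zC: "AE t in ?M. z t \<in> C_per L 0" using sm by (simp add: strongly_measurable_def)
  have "(\<integral>\<^sup>+t. ennreal ((g t)\<^sup>2) \<partial>?M) \<le> (\<integral>\<^sup>+t. ennreal ((C_norm 0 (z t))\<^sup>2) \<partial>?M)"
  proof (rule nn_integral_mono_AE)
    show "AE t in ?M. ennreal ((g t)\<^sup>2) \<le> ennreal ((C_norm 0 (z t))\<^sup>2)"
      using g(2) zC
    proof eventually_elim
      case (elim t)
      then have "\<bar>g t\<bar> \<le> C_norm 0 (z t)" using sup_norm_bound[OF L elim(2), of x] by simp
      then show ?case using power_mono[of "\<bar>g t\<bar>" _ 2] by (intro ennreal_leI) simp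
    qed
  qed
  then have fin2: "(\<integral>\<^sup>+t. ennreal ((g t)\<^sup>2) \<partial>?M) < \<infinity>" using fin by (rule le_less_trans)
  have g2: "integrable ?M (\<lambda>t. (g t)\<^sup>2)"
  proof (rule integrableI_bounded)
    show "(\<lambda>t. (g t)\<^sup>2) \<in> borel_measurable ?M" using g(1) by (rule borel_measurable_power)
    show "(\<integral>\<^sup>+t. ennreal (norm ((g t)\<^sup>2)) \<partial>?M) < \<infinity>" using fin2 by simp
  qed
  have one: "integrable ?M (\<lambda>t. 1 :: real)"
    using emeasure_bounded_finite[of "{0<..<T}"]
    by (intro integrableI_bounded) (auto simp: emeasure_restrict_space space_restrict_space)
  have gi: "integrable ?M g"
  proof (rule Bochner_Integration.integrable_bound[OF Bochner_Integration.integrable_add[OF one g2] g(1)])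
    have "\<bar>y\<bar> \<le> 1 + y\<^sup>2" for y :: real
    proof -
      have "0 \<le> (\<bar>y\<bar> - 1)\<^sup>2" by simp
      then have "2 * \<bar>y\<bar> \<le> 1 + y\<^sup>2" by (simp add: power2_diff)
      then show ?thesis by linarith
    qed
    moreover have "norm (1 + y\<^sup>2) = 1 + y\<^sup>2" for y :: real
      unfolding real_norm_def by (intro abs_of_nonneg add_nonneg_nonneg) simp_all
    ultimately show "AE t in ?M. norm (g t) \<le> norm (1 + (g t)\<^sup>2)" by (intro AE_I2) (simp only: real_norm_def)
  qed
  then have ga: "g absolutely_integrable_on {0<..<T}"
    by (simp add: set_integrable_def integrable_restrict_space)
  obtain N where N: "negligible N" "\<And>t. t \<in> {0<..<T} - N \<Longrightarrow> g t = z t x"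
    using AE_lebesgue_on_negligible[OF g(2) open_interval_lebesgue] by blast
  have "(\<lambda>t. z t x) absolutely_integrable_on {0<..<T}"
    by (rule absolutely_integrable_spike[OF ga N(1)]) (simp only: N(2))
  then show ?thesis
    by (simp only: absolutely_integrable_on_def integrable_on_def has_integral_Icc_iff_Ioo)
qed

lemma H2_time_value:
  assumes L: "L > 0" and u: "u \<in> H_time 2 L 0 T"
  shows "\<exists>z. z absolutely_integrable_on {0..T} \<and> (\<forall>\<eta>. test_fun T \<eta> \<longrightarrow>
    integral {0..T} (\<lambda>t. deriv (deriv \<eta>) t * u t x) = integral {0..T} (\<lambda>t. \<eta> t * z t))"
proof -
  obtain v z where v: "weak_time_deriv L 0 T u v" and z: "z \<in> L2_time L 0 T" "weak_time_deriv L 0 T v z"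
    using u by (auto simp: numeral_2_eq_2)
  have "integral {0..T} (\<lambda>t. deriv (deriv \<eta>) t * u t x) = integral {0..T} (\<lambda>t. \<eta> t * z t x)" if \<eta>: "test_fun T \<eta>" for \<eta>
  proof -
    obtain w1 where w1: "has_bochner L 0 T (\<lambda>t x. deriv (deriv \<eta>) t * u t x) w1"
      "has_bochner L 0 T (\<lambda>t x. deriv \<eta> t * v t x) (\<lambda>x. - w1 x)"
      using v test_fun_deriv[OF \<eta>] unfolding weak_time_deriv_def by blast
    obtain w2 where w2: "has_bochner L 0 T (\<lambda>t x. deriv \<eta> t * v t x) w2"
      "has_bochner L 0 T (\<lambda>t x. \<eta> t * z t x) (\<lambda>x. - w2 x)"
      using z(2) \<eta> unfolding weak_time_deriv_def by blast
    note h = has_bochner_value[OF L w1(1), of x] has_bochner_value[OF L w1(2), of x]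
      has_bochner_value[OF L w2(1), of x] has_bochner_value[OF L w2(2), of x]
    have "w2 x = - w1 x" using has_integral_unique[OF h(3) h(2)] .
    then show ?thesis using integral_unique[OF h(1)] integral_unique[OF h(4)] by simp
  qed
  then show ?thesis using L2_time_value[OF L z(1)] by blast
qed

lemma C_time_value_continuous:
  assumes L: "L > 0" and u: "u \<in> C_time L 0 T"
  shows "continuous_on {0..T} (\<lambda>t. u t x)"
  unfolding continuous_on_def
proof
  fix t assume t: "t \<in> {0..T}"
  have uC: "\<And>s. s \<in> {0..T} \<Longrightarrow> u s \<in> C_per L 0"
    and lim: "((\<lambda>s. C_norm 0 (\<lambda>x. u s x - u t x)) \<longlongrightarrow> 0) (at t within {0..T})"
    using u t by (auto simp: C_time_def)
  have "((\<lambda>s. u s x - u t x) \<longlongrightarrow> 0) (at t within {0..T})"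
  proof (rule Lim_null_comparison[OF _ lim])
    show "\<forall>\<^sub>F s in at t within {0..T}. norm (u s x - u t x) \<le> C_norm 0 (\<lambda>x. u s x - u t x)"
      unfolding eventually_at_filter
      using sup_norm_bound[OF L C_per_zero_closed(1)[OF uC uC[OF t]]] by (intro always_eventually) auto
  qed
  then show "((\<lambda>t. u t x) \<longlongrightarrow> u t x) (at t within {0..T})" by (simp add: LIM_zero_iff)
qed

lemma AE_open_interval_dense:
  fixes T :: real
  assumes "AE t in lebesgue_on {0<..<T}. P t" "open S" "S \<subseteq> {0<..<T}" "S \<noteq> {}"
  shows "\<exists>t\<in>S. P t"
proof (rule ccontr)
  assume no: "\<not> (\<exists>t\<in>S. P t)"
  obtain N where N: "negligible N" "\<And>t. t \<in> {0<..<T} - N \<Longrightarrow> P t"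
    using AE_lebesgue_on_negligible[OF assms(1) open_interval_lebesgue] by blast
  have "S \<subseteq> N" using no N(2) assms(3) by blast
  then have "negligible S" using N(1) negligible_subset by blast
  then show False using open_not_negligible assms(2,4) by blast
qed

text \<open>Since \<open>F'\<close> is continuous, a bound for it that fails somewhere fails on a nonempty
  open set, and such a set is not negligible. So the bound holds at all times and the mean value
  theorem applies.\<close>

lemma mean_value_inequality_ae:
  fixes F :: "real \<Rightarrow> real"
  assumes F: "continuous_on {0..T} F"
    and F': "continuous_on {0<..<T} F'" "\<And>t. t \<in> {0<..<T} \<Longrightarrow> (F has_real_derivative F' t) (at t)"
    and ae: "AE t in lebesgue_on {0<..<T}. t \<in> {a<..<b} \<longrightarrow> (\<exists>d. (F has_real_derivative d) (at t) \<and> \<bar>d - A\<bar> \<le> B)"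
    and ab: "0 \<le> a" "a < b" "b \<le> T"
  shows "\<bar>F b - F a - (b - a) * A\<bar> \<le> (b - a) * B"
proof -
  have bound: "\<bar>F' t - A\<bar> \<le> B" if t: "t \<in> {a<..<b}" for t
  proof (rule ccontr)
    assume "\<not> \<bar>F' t - A\<bar> \<le> B"
    let ?S = "{a<..<b} \<inter> (\<lambda>t. \<bar>F' t - A\<bar>) -` {B<..}"
    have sub: "{a<..<b} \<subseteq> {0<..<T}" using ab by (intro greaterThanLessThan_subseteq_greaterThanLessThan[THEN iffD2]) simp
    have "open ?S"
      by (intro continuous_open_preimage continuous_intros continuous_on_subset[OF F'(1) sub] open_greaterThan open_greaterThanLessThan)
    moreover have "t \<in> ?S" using t \<open>\<not> \<bar>F' t - A\<bar> \<le> B\<close> by auto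
    moreover have "?S \<subseteq> {0<..<T}" using sub by (rule order_trans[OF Int_lower1])
    ultimately obtain s where s: "s \<in> ?S" "s \<in> {a<..<b} \<longrightarrow> (\<exists>d. (F has_real_derivative d) (at s) \<and> \<bar>d - A\<bar> \<le> B)"
      using AE_open_interval_dense[OF ae, of ?S] by (metis empty_iff)
    from s(1) have s': "s \<in> {a<..<b}" "B < \<bar>F' s - A\<bar>" by simp_all
    from mp[OF s(2) s'(1)] obtain d where d: "(F has_real_derivative d) (at s)" "\<bar>d - A\<bar> \<le> B" by (elim exE conjE)
    have "(F has_real_derivative F' s) (at s)" by (rule F'(2)) (rule subsetD[OF sub s'(1)])
    then have "d = F' s" by (rule DERIV_unique[OF d(1)])
    then show False using s'(2) d(2) by simp
  qed
  have "\<exists>l z. a < z \<and> z < b \<and> (F has_real_derivative l) (at z) \<and> F b - F a = (b - a) * l"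
  proof (rule MVT[OF ab(2)])
    show "continuous_on {a..b} F" by (rule continuous_on_subset[OF F]) (use ab in auto)
    show "F differentiable (at x)" if "a < x" "x < b" for x
      using F'(2)[of x] that ab by (auto simp: real_differentiable_def)
  qed
  then obtain l z where z: "a < z" "z < b" "(F has_real_derivative l) (at z)" "F b - F a = (b - a) * l" by blast
  have "l = F' z" using DERIV_unique[OF z(3) F'(2)] z ab by simp
  then have "\<bar>l - A\<bar> \<le> B" using bound z by simp
  moreover have "F b - F a - (b - a) * A = (b - a) * (l - A)" using z(4) by (simp add: algebra_simps)
  ultimately show ?thesis using ab by (simp add: abs_mult mult_left_mono)
qed

section \<open>Properties of the exact solution\<close>

locale film_solution =
  fixes L T \<epsilon> :: real and \<Phi> :: "real \<Rightarrow> real^3 \<Rightarrow> real"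
  assumes L: "L > 0" and eps: "\<epsilon> > 0" and T: "T > 0"
    and pos: "\<And>t x. t \<in> {0..T} \<Longrightarrow> \<Phi> t x > 0"
    and reg: "\<Phi> \<in> reg_class L T"
    and pde: "pde_solution \<epsilon> T \<Phi>"
begin

abbreviation rate :: "real \<Rightarrow> real^3 \<Rightarrow> real" where
  "rate t \<equiv> laplacian (chem_pot \<epsilon> (\<Phi> t))"

text \<open>The times at which the equation holds and the solution has six derivatives bounded by
  \<open>B\<close>. For suitable \<open>B\<close> these are almost all times. At other times the
  solution is only known to be continuous in space.\<close>

definition good_time :: "real \<Rightarrow> real \<Rightarrow> bool" where
  "good_time B t \<longleftrightarrow> bounded_class_C 6 B (\<Phi> t) \<and> (\<forall>x. ((\<lambda>s. \<Phi> s x) has_real_derivative rate t x) (at t))"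

lemma sol_C_per: "t \<in> {0..T} \<Longrightarrow> \<Phi> t \<in> C_per L 0"
  using reg by (auto simp: reg_class_def C_time_def)

lemma sol_continuous: "t \<in> {0..T} \<Longrightarrow> continuous_on S (\<Phi> t)"
  using C_per_continuous[OF sol_C_per] continuous_on_subset by blast

lemma sol_periodic: "t \<in> {0..T} \<Longrightarrow> \<Phi> t (x + axis i L) = \<Phi> t x"
  using sol_C_per by (simp add: C_per_def)

lemma sol_sup_continuous:
  assumes "t \<in> {0..T}"
  shows "((\<lambda>s. C_norm 0 (\<lambda>x. \<Phi> s x - \<Phi> t x)) \<longlongrightarrow> 0) (at t within {0..T})"
  using reg assms by (auto simp: reg_class_def C_time_def)

lemma sol_sup_bound:
  assumes "s \<in> {0..T}" "t \<in> {0..T}"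
  shows "\<bar>\<Phi> s x - \<Phi> t x\<bar> \<le> C_norm 0 (\<lambda>x. \<Phi> s x - \<Phi> t x)"
  using sup_norm_bound[OF L C_per_zero_closed(1)[OF sol_C_per[OF assms(1)] sol_C_per[OF assms(2)]]] .

lemma sol_time_continuous: "continuous_on {0..T} (\<lambda>t. \<Phi> t x)"
  by (rule C_time_value_continuous[OF L]) (use reg in \<open>auto simp: reg_class_def\<close>)

text \<open>Compactness of the closed time interval and of the cell. The argument takes limits in time in
  the sup norm, so that no joint continuity in space and time has to be discussed.\<close>

lemma sol_lower_bound: "\<exists>\<delta>>0. \<forall>t\<in>{0..T}. \<forall>x. \<delta> \<le> \<Phi> t x"
proof (rule ccontr)
  assume neg: "\<not> (\<exists>\<delta>>0. \<forall>t\<in>{0..T}. \<forall>x. \<delta> \<le> \<Phi> t x)"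
  have "\<exists>p. fst p \<in> {0..T} \<and> \<Phi> (fst p) (snd p) < inverse (real (Suc n))" for n
  proof -
    have "inverse (real (Suc n)) > 0" by simp
    with neg have "\<not> (\<forall>t\<in>{0..T}. \<forall>x. inverse (real (Suc n)) \<le> \<Phi> t x)" by blast
    then show ?thesis by (auto simp: not_le)
  qed
  then obtain p where p: "\<And>n. fst (p n) \<in> {0..T}" "\<And>n. \<Phi> (fst (p n)) (snd (p n)) < inverse (real (Suc n))"
    by metis
  obtain l r where l: "l \<in> {0..T}" and r: "strict_mono r" and lim: "((\<lambda>n. fst (p n)) \<circ> r) \<longlonglongrightarrow> l"
    using compact_Icc[of 0 T] p(1) unfolding compact_def by meson
  let ?g = "\<lambda>s. C_norm 0 (\<lambda>x. \<Phi> s x - \<Phi> l x)"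
  have "(\<lambda>p. \<bar>foldr pd (fst p) (\<lambda>x. 0) (snd p)\<bar>) ` ({ds. length ds \<le> 0} \<times> UNIV) = {0}"
    by (auto simp: image_iff)
  then have g0: "?g l = 0" by (simp only: C_norm_def diff_self) simp
  have "continuous (at l within {0..T}) ?g"
    unfolding continuous_within g0 by (rule sol_sup_continuous[OF l])
  then have "(?g \<circ> ((\<lambda>n. fst (p n)) \<circ> r)) \<longlonglongrightarrow> ?g l"
    unfolding continuous_within_sequentially using p(1) lim by (auto simp: o_def)
  then have glim: "(\<lambda>n. ?g (fst (p (r n)))) \<longlonglongrightarrow> 0" by (simp only: g0 o_def)
  let ?Q = "cbox (0::real^3) (\<chi> i. L)"
  have "0 \<in> ?Q" using L by (simp add: mem_box_cart)
  then have "?Q \<noteq> {}" by blast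
  then obtain x0 where x0: "\<And>x. x \<in> ?Q \<Longrightarrow> \<Phi> l x0 \<le> \<Phi> l x"
    using continuous_attains_inf[OF compact_cbox _ sol_continuous[OF l]] by blast
  have low: "\<Phi> l x0 \<le> \<Phi> l x" for x
  proof -
    obtain y where y: "y \<in> ?Q" "\<Phi> l y = \<Phi> l x"
      by (rule periodic_reduce_to_cell[OF L, where x = x and 'a = real]) (use sol_periodic[OF l] in blast)
    then show ?thesis using x0 by metis
  qed
  have "\<Phi> l x0 - ?g (fst (p (r n))) \<le> inverse (real (Suc (r n)))" for n
    using sol_sup_bound[OF p(1)[of "r n"] l, of "snd (p (r n))"] p(2)[of "r n"] low[of "snd (p (r n))"] by linarith
  moreover have "(\<lambda>n. inverse (real (Suc (r n)))) \<longlonglongrightarrow> 0"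
    using LIMSEQ_subseq_LIMSEQ[OF LIMSEQ_inverse_real_of_nat r] by (simp add: o_def)
  moreover have "(\<lambda>n. \<Phi> l x0 - ?g (fst (p (r n)))) \<longlonglongrightarrow> \<Phi> l x0 - 0"
    by (intro tendsto_diff tendsto_const glim)
  ultimately have "\<Phi> l x0 - 0 \<le> 0" by (intro LIMSEQ_le) auto
  then show False using pos[OF l, of x0] by simp
qed

lemma sol_good_ae: "\<exists>B\<ge>0. AE t in lebesgue_on {0<..<T}. good_time B t"
proof -
  obtain B where B: "AE t in lebesgue_on {0<..<T}. C_norm 6 (\<Phi> t) \<le> B"
    and C6: "AE t in lebesgue_on {0<..<T}. \<Phi> t \<in> C_per L 6"
    using reg by (auto simp: reg_class_def Linf_time_def strongly_measurable_def)
  have "AE t in lebesgue_on {0<..<T}. good_time (max 0 B) t"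
    using B C6 pde[unfolded pde_solution_def]
  proof eventually_elim
    case (elim t)
    have "bounded_class_C 6 (max 0 B) (\<Phi> t)" by (rule C_per_imp_bounded_class_C[OF L elim(2)]) (use elim(1) in simp)
    then show ?case using elim(3) by (simp add: good_time_def)
  qed
  then show ?thesis by (intro exI[of _ "max 0 B"]) auto
qed

lemma all_times_of_good_times:
  assumes F: "continuous_on {0..T} F" and ae: "AE t in lebesgue_on {0<..<T}. F t \<le> (R::real)"
    and t: "t \<in> {0..T}"
  shows "F t \<le> R"
proof -
  have cl: "closure {0<..<T} = {0..T}" using T by simp
  have "F s \<le> R" if s: "s \<in> {0<..<T}" for s
  proof (rule ccontr)
    assume "\<not> F s \<le> R"
    let ?S = "{0<..<T} \<inter> F -` {R<..}"
    have "open ?S"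
      by (intro continuous_open_preimage continuous_on_subset[OF F] open_greaterThan open_greaterThanLessThan) auto
    moreover have "s \<in> ?S" using s \<open>\<not> F s \<le> R\<close> by auto
    ultimately show False using AE_open_interval_dense[OF ae, of ?S] by force
  qed
  then show ?thesis using continuous_le_on_closure[of "{0<..<T}" F t R] F t cl by auto
qed

text \<open>Linear combinations of point values; they stand in for every functional of the solution
  whose evolution in time is followed below.\<close>

inductive point_functional :: "((real^3 \<Rightarrow> real) \<Rightarrow> real) \<Rightarrow> bool" where
  eval: "point_functional (\<lambda>f. f x)"
| add: "point_functional F \<Longrightarrow> point_functional G \<Longrightarrow> point_functional (\<lambda>f. F f + G f)"
| cmult: "point_functional F \<Longrightarrow> point_functional (\<lambda>f. c * F f)"

lemma point_functional_sum:
  assumes "finite S" "\<And>i. i \<in> S \<Longrightarrow> point_functional (F i)"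
  shows "point_functional (\<lambda>f. \<Sum>i\<in>S. F i f)"
  using assms
proof (induction S rule: finite_induct)
  case empty
  show ?case using point_functional.cmult[OF point_functional.eval[of 0], of 0] by simp
next
  case (insert i S)
  then show ?case using point_functional.add[of "F i" "\<lambda>f. \<Sum>i\<in>S. F i f"] by simp
qed

text \<open>The continuity of the derivative in time comes from the class \<open>H\<^sup>2\<close> and its
  value at good times from the equation.\<close>

lemma point_functional_evolution:
  assumes "point_functional F"
  shows "continuous_on {0..T} (\<lambda>t. F (\<Phi> t))"
    and "\<exists>F'. continuous_on {0<..<T} F' \<and> (\<forall>t\<in>{0<..<T}. ((\<lambda>s. F (\<Phi> s)) has_real_derivative F' t) (at t))"
    and "good_time B t \<Longrightarrow> ((\<lambda>s. F (\<Phi> s)) has_real_derivative F (rate t)) (at t)"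
  using assms
proof induction
  case (eval x)
  { case 1 show ?case by (rule sol_time_continuous) }
  { case 2
    have "\<Phi> \<in> H_time 2 L 0 T" using reg by (simp add: reg_class_def)
    then obtain z where z: "z absolutely_integrable_on {0..T}"
      "\<And>\<eta>. test_fun T \<eta> \<Longrightarrow> integral {0..T} (\<lambda>t. deriv (deriv \<eta>) t * \<Phi> t x) = integral {0..T} (\<lambda>t. \<eta> t * z t)"
      using H2_time_value[OF L, of \<Phi> T x] by blast
    show ?case by (rule C1_of_distributional_second_derivative[OF T sol_time_continuous z]) }
  { case 3 then show ?case by (simp add: good_time_def) }
next
  case (add F G)
  { case 1 show ?case by (intro continuous_intros add) }
  { case 2
    obtain F' G' where "continuous_on {0<..<T} F'" "\<forall>t\<in>{0<..<T}. ((\<lambda>s. F (\<Phi> s)) has_real_derivative F' t) (at t)"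
      "continuous_on {0<..<T} G'" "\<forall>t\<in>{0<..<T}. ((\<lambda>s. G (\<Phi> s)) has_real_derivative G' t) (at t)"
      using add.IH(2) add.IH(5) by blast
    then show ?case
      by (intro exI[of _ "\<lambda>t. F' t + G' t"]) (auto intro!: continuous_on_add DERIV_add) }
  { case 3 then show ?case using add.IH(3,6) by (intro DERIV_add) }
next
  case (cmult F c)
  { case 1 show ?case by (intro continuous_intros cmult) }
  { case 2
    obtain F' where "continuous_on {0<..<T} F'" "\<forall>t\<in>{0<..<T}. ((\<lambda>s. F (\<Phi> s)) has_real_derivative F' t) (at t)"
      using cmult.IH(2) by blast
    then show ?case
      by (intro exI[of _ "\<lambda>t. c * F' t"]) (auto intro!: continuous_on_mult_const DERIV_cmult continuous_on_mult continuous_on_const) }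
  { case 3 then show ?case using cmult.IH(3) by (intro DERIV_cmult) }
qed

lemma point_functional_increment:
  assumes F: "point_functional F" and good: "AE t in lebesgue_on {0<..<T}. good_time B t"
    and ab: "0 \<le> a" "a \<le> b" "b \<le> T"
    and bound: "\<And>t. good_time B t \<Longrightarrow> t \<in> {a<..<b} \<Longrightarrow> \<bar>F (rate t) - A\<bar> \<le> R"
  shows "\<bar>F (\<Phi> b) - F (\<Phi> a) - (b - a) * A\<bar> \<le> (b - a) * R"
proof (cases "a = b")
  case False
  obtain F' where F': "continuous_on {0<..<T} F'" "\<And>t. t \<in> {0<..<T} \<Longrightarrow> ((\<lambda>s. F (\<Phi> s)) has_real_derivative F' t) (at t)"
    using point_functional_evolution(2)[OF F] by blast
  show ?thesis
  proof (rule mean_value_inequality_ae[where F = "\<lambda>t. F (\<Phi> t)", OF point_functional_evolution(1)[OF F] F'])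
    show "AE t in lebesgue_on {0<..<T}. t \<in> {a<..<b} \<longrightarrow> (\<exists>d. ((\<lambda>t. F (\<Phi> t)) has_real_derivative d) (at t) \<and> \<bar>d - A\<bar> \<le> R)"
      using good by eventually_elim (use point_functional_evolution(3)[OF F] bound in blast)
  qed (use ab False in auto)
qed simp

end

section \<open>Consistency\<close>

lemma powi_lipschitz:
  fixes d :: real
  assumes d: "d > 0" and n: "n \<le> 0"
  shows "\<exists>K\<ge>0. \<forall>a b. d \<le> a \<longrightarrow> d \<le> b \<longrightarrow> \<bar>a powi n - b powi n\<bar> \<le> K * \<bar>a - b\<bar>"
proof -
  let ?K = "\<bar>of_int n\<bar> * d powi (n - 1)"
  have "\<bar>a powi n - b powi n\<bar> \<le> ?K * \<bar>a - b\<bar>" if "d \<le> a" "d \<le> b" for a b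
  proof -
    have "norm (a powi n - b powi n) \<le> ?K * norm (a - b)"
    proof (rule field_differentiable_bound[where S = "{d..}" and f' = "\<lambda>x. of_int n * x powi (n - 1)"])
      show "((\<lambda>x. x powi n) has_field_derivative of_int n * x powi (n - 1)) (at x within {d..})" if "x \<in> {d..}" for x
        by (rule derivative_eq_intros refl)+ (use that d in auto)
      show "norm (of_int n * x powi (n - 1)) \<le> ?K" if "x \<in> {d..}" for x
        using powi_nonpos_bound[OF d, of x "n - 1"] that n unfolding real_norm_def abs_mult
        by (intro mult_left_mono) auto
    qed (use that in auto)
    then show ?thesis by simp
  qed
  moreover have "?K \<ge> 0" using d by simp
  ultimately show ?thesis by blast
qed

lemma bounded_class_C_imp_class_C: "bounded_class_C m B f \<Longrightarrow> class_C m f"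
  by (induction m arbitrary: f) auto

lemma mesh_square_bound:
  assumes L: "L > 0" and K: "K \<ge> 1"
  shows "1 / real K ^ 2 \<le> 9 / L\<^sup>2 * (mesh L (2 * K + 1))\<^sup>2"
proof -
  have "real (2 * K + 1) \<le> 3 * real K" using K by simp
  then have "(real (2 * K + 1))\<^sup>2 \<le> (3 * real K)\<^sup>2" by (rule power_mono) simp
  then have "1 / (3 * real K)\<^sup>2 \<le> 1 / (real (2 * K + 1))\<^sup>2"
    using K by (intro divide_left_mono mult_pos_pos zero_less_power) auto
  moreover have "9 / L\<^sup>2 * (mesh L (2 * K + 1))\<^sup>2 = 9 * (1 / (real (2 * K + 1))\<^sup>2)"
    using L by (simp add: mesh_def power_divide del: of_nat_add of_nat_mult of_nat_Suc)
  moreover have "1 / real K ^ 2 = 9 * (1 / (3 * real K)\<^sup>2)" by (simp add: power_mult_distrib)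
  ultimately show ?thesis by (simp only:) 
qed

lemma grid_proj_periodic:
  assumes N: "N > 0" and f: "\<And>x i. f (x + axis i L) = f x"
  shows "grid_proj (mesh L N) f \<in> grid_per N"
proof -
  have n: "node (mesh L N) (i + int N) = node (mesh L N) i + L" for i
    using N by (simp add: node_def mesh_def field_simps)
  have "vector [a + L, b, c] = vector [a, b, c] + (axis 1 L :: real^3)"
    "vector [a, b + L, c] = vector [a, b, c] + (axis 2 L :: real^3)"
    "vector [a, b, c + L] = vector [a, b, c] + (axis 3 L :: real^3)" for a b c
    by (simp_all add: vec_eq_iff forall_3 axis_def)
  then show ?thesis by (simp add: grid_per_def grid_proj_def n f)
qed

lemma grid_inner_young_sup:
  assumes LN: "L > 0" "N > 0" and u: "\<And>i j k. \<bar>u i j k\<bar> \<le> S" and th: "\<theta> > 0"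
  shows "\<bar>grid_inner L N u w\<bar> \<le> \<theta> / 2 * (L ^ 3 * S\<^sup>2) + 1 / (2 * \<theta>) * grid_inner L N w w"
proof -
  have *: "grid_inner L N u w \<le> \<theta> / 2 * (L ^ 3 * S\<^sup>2) + 1 / (2 * \<theta>) * grid_inner L N w w"
    if u: "\<And>i j k. \<bar>u i j k\<bar> \<le> S" for u
  proof -
    have "\<theta> / 2 * grid_inner L N u u \<le> \<theta> / 2 * (L ^ 3 * S\<^sup>2)"
      using th by (intro mult_left_mono grid_inner_sq_le_sup[OF LN u]) auto
    then show ?thesis using grid_inner_young[OF LN th, of u w] by linarith
  qed
  have "grid_inner L N (\<lambda>i j k. - u i j k) w = - grid_inner L N u w"
    by (simp add: grid_inner_gsum gsum_uminus)
  then show ?thesis using *[of u, OF u] *[of "\<lambda>i j k. - u i j k"] u by (simp add: abs_le_iff)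
qed

text \<open>The bounds for the exact solution on which the error constant depends: from below, on six
  derivatives in space, and on four derivatives of the chemical potential.\<close>

locale film_bounds = film_solution +
  fixes \<delta> B M :: real
  assumes \<delta>: "\<delta> > 0" and lower: "\<And>t x. t \<in> {0..T} \<Longrightarrow> \<delta> \<le> \<Phi> t x"
    and B: "B \<ge> 0" and good: "AE t in lebesgue_on {0<..<T}. good_time B t"
    and M: "M \<ge> 0" and mu: "\<And>t. t \<in> {0..T} \<Longrightarrow> good_time B t \<Longrightarrow> bounded_class_C 4 M (chem_pot \<epsilon> (\<Phi> t))"

lemma (in film_solution) ex_film_bounds: "\<exists>\<delta> B M. film_bounds L T \<epsilon> \<Phi> \<delta> B M"
proof -
  obtain \<delta> where \<delta>: "\<delta> > 0" "\<forall>t\<in>{0..T}. \<forall>x. \<delta> \<le> \<Phi> t x" using sol_lower_bound by blast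
  obtain B where B: "B \<ge> 0" "AE t in lebesgue_on {0<..<T}. good_time B t" using sol_good_ae by blast
  obtain M where M: "M \<ge> 0" "\<forall>f. bounded_class_C 6 B f \<longrightarrow> (\<forall>x. \<delta> \<le> f x) \<longrightarrow> bounded_class_C 4 M (chem_pot \<epsilon> f)"
    using bounded_class_C_chem_pot[OF \<delta>(1), of B \<epsilon>] by blast
  have "film_bounds L T \<epsilon> \<Phi> \<delta> B M"
    by unfold_locales (use \<delta> B M in \<open>auto simp: good_time_def simp del: bounded_class_C.simps\<close>)
  then show ?thesis by blast
qed

context film_bounds
begin

lemma rate_class:
  assumes "t \<in> {0..T}" "good_time B t"
  shows "bounded_class_C 2 (3 * M) (rate t)"
proof -
  have "bounded_class_C (Suc (Suc 2)) M (chem_pot \<epsilon> (\<Phi> t))" using mu[OF assms] by (simp add: eval_nat_numeral)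
  then show ?thesis by (rule bounded_class_C_laplacian)
qed

lemma sol_lipschitz:
  assumes "a \<in> {0..T}" "b \<in> {0..T}"
  shows "\<bar>\<Phi> b x - \<Phi> a x\<bar> \<le> 3 * M * \<bar>b - a\<bar>"
proof -
  have *: "\<bar>\<Phi> b x - \<Phi> a x\<bar> \<le> 3 * M * \<bar>b - a\<bar>" if ab: "0 \<le> a" "a \<le> b" "b \<le> T" for a b
  proof -
    have "\<bar>\<Phi> b x - \<Phi> a x - (b - a) * 0\<bar> \<le> (b - a) * (3 * M)"
    proof (rule point_functional_increment[OF point_functional.eval good ab])
      fix t assume "good_time B t" "t \<in> {a<..<b}"
      then show "\<bar>rate t x - 0\<bar> \<le> 3 * M" using bounded_class_C_bound[OF rate_class, of t x] ab by simp
    qed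
    then show ?thesis using ab by (simp add: mult.commute)
  qed
  show ?thesis using *[of a b] *[of b a] assms by (cases "a \<le> b") (auto simp: abs_minus_commute)
qed

text \<open>The difference quotients, not the derivatives, of \<open>\<Phi>\<close> are followed in time:
  they are combinations of point values. The bound does not degenerate as \<open>h\<close> tends
  to zero because \<open>\<Delta>\<mu>\<close> has two bounded derivatives.\<close>

lemma sol_lap_lipschitz:
  assumes "a \<in> {0..T}" "b \<in> {0..T}" and h: "h > 0"
  shows "\<bar>lap_diff h (\<Phi> b) x - lap_diff h (\<Phi> a) x\<bar> \<le> 9 * M * \<bar>b - a\<bar>"
proof -
  have pf: "point_functional (\<lambda>f. lap_diff h f x)"
  proof -
    have eq: "(\<lambda>f. lap_diff h f x) = (\<lambda>f. (1 / h\<^sup>2) * (\<Sum>i\<in>UNIV. (f (x + h *\<^sub>R axis i 1) + f (x - h *\<^sub>R axis i 1)) + (- 2) * f x))"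
      by (intro ext) (simp add: lap_diff_def)
    show ?thesis unfolding eq by (intro point_functional.cmult point_functional_sum point_functional.add point_functional.eval) simp
  qed
  have *: "\<bar>lap_diff h (\<Phi> b) x - lap_diff h (\<Phi> a) x\<bar> \<le> 9 * M * \<bar>b - a\<bar>" if ab: "0 \<le> a" "a \<le> b" "b \<le> T" for a b
  proof -
    have "\<bar>lap_diff h (\<Phi> b) x - lap_diff h (\<Phi> a) x - (b - a) * 0\<bar> \<le> (b - a) * (9 * M)"
    proof (rule point_functional_increment[OF pf good ab])
      fix t assume t: "good_time B t" "t \<in> {a<..<b}"
      then show "\<bar>lap_diff h (rate t) x - 0\<bar> \<le> 9 * M" using lap_diff_bound[OF rate_class h, of t x] ab by simp
    qed
    then show ?thesis using ab by (simp add: mult.commute)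
  qed
  show ?thesis using *[of a b] *[of b a] assms by (cases "a \<le> b") (auto simp: abs_minus_commute)
qed

lemma coeff_time_continuous:
  "continuous_on {0..T} (\<lambda>t. cos_coeff L (\<Phi> t) k)" "continuous_on {0..T} (\<lambda>t. sin_coeff L (\<Phi> t) k)"
proof -
  have *: "continuous_on {0..T} (\<lambda>t. cell_integral L (\<lambda>x. \<Phi> t x * m x))"
    if m: "continuous_on UNIV m" "\<And>x. \<bar>m x\<bar> \<le> 1" for m
    unfolding continuous_on_def
  proof
    fix t assume t: "t \<in> {0..T}"
    have "((\<lambda>s. cell_integral L (\<lambda>x. \<Phi> s x * m x) - cell_integral L (\<lambda>x. \<Phi> t x * m x)) \<longlongrightarrow> 0) (at t within {0..T})"
    proof (rule Lim_null_comparison)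
      have "((\<lambda>s. L ^ 3 * C_norm 0 (\<lambda>x. \<Phi> s x - \<Phi> t x)) \<longlongrightarrow> L ^ 3 * 0) (at t within {0..T})"
        by (intro tendsto_mult tendsto_const sol_sup_continuous[OF t])
      then show "((\<lambda>s. L ^ 3 * C_norm 0 (\<lambda>x. \<Phi> s x - \<Phi> t x)) \<longlongrightarrow> 0) (at t within {0..T})" by simp
      have "norm (cell_integral L (\<lambda>x. \<Phi> s x * m x) - cell_integral L (\<lambda>x. \<Phi> t x * m x)) \<le> L ^ 3 * C_norm 0 (\<lambda>x. \<Phi> s x - \<Phi> t x)"
        if s: "s \<in> {0..T}" for s
      proof -
        have "cell_integral L (\<lambda>x. \<Phi> s x * m x) - cell_integral L (\<lambda>x. \<Phi> t x * m x) = cell_integral L (\<lambda>x. \<Phi> s x * m x - \<Phi> t x * m x)"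
          by (rule cell_integral_diff[symmetric]) (intro continuous_on_mult sol_continuous s t m)+
        also have "\<bar>\<dots>\<bar> \<le> L ^ 3 * C_norm 0 (\<lambda>x. \<Phi> s x - \<Phi> t x)"
        proof (rule cell_integral_bound[OF L])
          show "continuous_on UNIV (\<lambda>x. \<Phi> s x * m x - \<Phi> t x * m x)"
            by (intro continuous_on_diff continuous_on_mult sol_continuous s t m)
          fix x
          have "\<bar>\<Phi> s x - \<Phi> t x\<bar> * \<bar>m x\<bar> \<le> C_norm 0 (\<lambda>x. \<Phi> s x - \<Phi> t x) * 1"
            using sol_sup_bound[OF s t, of x] by (intro mult_mono m(2)) auto
          then show "\<bar>\<Phi> s x * m x - \<Phi> t x * m x\<bar> \<le> C_norm 0 (\<lambda>x. \<Phi> s x - \<Phi> t x)"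
            by (simp add: left_diff_distrib[symmetric] abs_mult)
        qed
        finally show ?thesis by simp
      qed
      then show "\<forall>\<^sub>F s in at t within {0..T}. norm (cell_integral L (\<lambda>x. \<Phi> s x * m x) - cell_integral L (\<lambda>x. \<Phi> t x * m x))
          \<le> L ^ 3 * C_norm 0 (\<lambda>x. \<Phi> s x - \<Phi> t x)"
        unfolding eventually_at_filter by (intro always_eventually) blast
    qed
    then show "((\<lambda>s. cell_integral L (\<lambda>x. \<Phi> s x * m x)) \<longlongrightarrow> cell_integral L (\<lambda>x. \<Phi> t x * m x)) (at t within {0..T})"
      by (simp add: LIM_zero_iff)
  qed
  show "continuous_on {0..T} (\<lambda>t. cos_coeff L (\<Phi> t) k)" unfolding cos_coeff_def
    by (rule *[OF modes_continuous(1)]) (simp add: cos_mode_def)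
  show "continuous_on {0..T} (\<lambda>t. sin_coeff L (\<Phi> t) k)" unfolding sin_coeff_def
    by (rule *[OF modes_continuous(2)]) (simp add: sin_mode_def)
qed

lemma fourier_proj_time_continuous: "continuous_on {0..T} (\<lambda>t. fourier_proj L K (\<Phi> t) x)"
proof -
  have "continuous_on {0..T} (\<lambda>t. \<Sum>k\<in>{k. l1_norm k \<le> int K}. fourier_term L (\<Phi> t) k x)"
    unfolding fourier_term_def divide_inverse
    by (intro continuous_on_sum continuous_on_mult continuous_on_add continuous_on_const coeff_time_continuous)
  then show ?thesis
    by (rule continuous_on_eq) (simp add: fourier_proj_eq_sum_terms[OF L sol_continuous])
qed

text \<open>At good times this is the bound for \<open>C\<^sup>6\<close> functions, with \<open>1 / K \<le>
  3 h / L\<close>; it extends to all times by continuity in time.\<close>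

lemma projection_error:
  assumes K: "K \<ge> 1" and t: "t \<in> {0..T}"
  defines "h \<equiv> mesh L (2 * K + 1)"
  shows "\<bar>\<Phi> t x - fourier_proj L K (\<Phi> t) x\<bar> \<le> 324 * B * L ^ 4 * h\<^sup>2"
    and "\<bar>(\<Phi> t (x + h *\<^sub>R axis i 1) - \<Phi> t x) - (fourier_proj L K (\<Phi> t) (x + h *\<^sub>R axis i 1) - fourier_proj L K (\<Phi> t) x)\<bar>
      \<le> 2592 * B * L ^ 3 * h\<^sup>2 * h"
proof -
  have h: "h > 0" unfolding h_def by (rule mesh_pos[OF L]) simp
  have K2: "1 / real K ^ 2 \<le> 9 / L\<^sup>2 * h\<^sup>2" unfolding h_def by (rule mesh_square_bound[OF L K])
  have L6: "36 * B * L ^ 6 * (9 / L\<^sup>2 * h\<^sup>2) = 324 * B * L ^ 4 * h\<^sup>2" "288 * B * L ^ 5 * h * (9 / L\<^sup>2 * h\<^sup>2) = 2592 * B * L ^ 3 * h\<^sup>2 * h"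
    using L by (simp_all add: eval_nat_numeral)
  have ae: "AE t in lebesgue_on {0<..<T}. t \<in> {0..T} \<and> good_time B t"
    using good AE_space by eventually_elim (simp add: space_restrict_space)
  show "\<bar>\<Phi> t x - fourier_proj L K (\<Phi> t) x\<bar> \<le> 324 * B * L ^ 4 * h\<^sup>2"
  proof (rule all_times_of_good_times[OF _ _ t])
    show "continuous_on {0..T} (\<lambda>t. \<bar>\<Phi> t x - fourier_proj L K (\<Phi> t) x\<bar>)"
      by (intro continuous_on_rabs continuous_on_diff sol_time_continuous fourier_proj_time_continuous)
    show "AE t in lebesgue_on {0<..<T}. \<bar>\<Phi> t x - fourier_proj L K (\<Phi> t) x\<bar> \<le> 324 * B * L ^ 4 * h\<^sup>2"
      using ae
    proof eventually_elim
      case (elim t)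
      have "\<bar>\<Phi> t x - fourier_proj L K (\<Phi> t) x\<bar> \<le> 36 * B * L ^ 6 / real K ^ 2"
        by (rule fourier_proj_error(1)[OF L _ _ K]) (use elim sol_periodic in \<open>auto simp: good_time_def simp del: bounded_class_C.simps\<close>)
      also have "\<dots> = 36 * B * L ^ 6 * (1 / real K ^ 2)" by simp
      also have "\<dots> \<le> 36 * B * L ^ 6 * (9 / L\<^sup>2 * h\<^sup>2)" using B L by (intro mult_left_mono K2) simp
      finally show ?case unfolding L6 .
    qed
  qed
  show "\<bar>(\<Phi> t (x + h *\<^sub>R axis i 1) - \<Phi> t x) - (fourier_proj L K (\<Phi> t) (x + h *\<^sub>R axis i 1) - fourier_proj L K (\<Phi> t) x)\<bar>
      \<le> 2592 * B * L ^ 3 * h\<^sup>2 * h"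
  proof (rule all_times_of_good_times[OF _ _ t])
    show "continuous_on {0..T} (\<lambda>t. \<bar>(\<Phi> t (x + h *\<^sub>R axis i 1) - \<Phi> t x) - (fourier_proj L K (\<Phi> t) (x + h *\<^sub>R axis i 1) - fourier_proj L K (\<Phi> t) x)\<bar>)"
      by (intro continuous_on_rabs continuous_on_diff sol_time_continuous fourier_proj_time_continuous)
    show "AE t in lebesgue_on {0<..<T}. \<bar>(\<Phi> t (x + h *\<^sub>R axis i 1) - \<Phi> t x) - (fourier_proj L K (\<Phi> t) (x + h *\<^sub>R axis i 1) - fourier_proj L K (\<Phi> t) x)\<bar> \<le> 2592 * B * L ^ 3 * h\<^sup>2 * h"
      using ae
    proof eventually_elim
      case (elim t)
      have "\<bar>(\<Phi> t (x + h *\<^sub>R axis i 1) - \<Phi> t x) - (fourier_proj L K (\<Phi> t) (x + h *\<^sub>R axis i 1) - fourier_proj L K (\<Phi> t) x)\<bar> \<le> 288 * B * L ^ 5 * h / real K ^ 2"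
        by (rule fourier_proj_error(2)[OF L _ _ K]) (use elim sol_periodic h in \<open>auto simp: good_time_def simp del: bounded_class_C.simps\<close>)
      also have "\<dots> = 288 * B * L ^ 5 * h * (1 / real K ^ 2)" by simp
      also have "\<dots> \<le> 288 * B * L ^ 5 * h * (9 / L\<^sup>2 * h\<^sup>2)" using B L h by (intro mult_left_mono K2) simp
      finally show ?case unfolding L6 .
    qed
  qed
qed

lemma grid_inner_functional: "point_functional (\<lambda>f. grid_inner L N (grid_proj h f) w)"
proof -
  have eq: "(\<lambda>f. grid_inner L N (grid_proj h f) w) = (\<lambda>f. (mesh L N)^3 *
      (\<Sum>i=1..int N. \<Sum>j=1..int N. \<Sum>k=1..int N. w i j k * f (vector [node h i, node h j, node h k])))"
    by (intro ext) (simp add: grid_inner_def grid_proj_def mult.commute)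
  show ?thesis unfolding eq
    by (intro point_functional.cmult point_functional_sum point_functional.eval finite_atLeastAtMost_int)
qed

lemma chem_pot_periodic:
  assumes t: "t \<in> {0..T}" "good_time B t"
  shows "chem_pot \<epsilon> (\<Phi> t) (x + axis i L) = chem_pot \<epsilon> (\<Phi> t) x"
proof -
  have "class_C 2 (\<Phi> t)"
    using bounded_class_C_imp_class_C[OF bounded_class_C_le[of 6 B "\<Phi> t" 2]] t(2) by (simp add: good_time_def)
  then have "\<Phi> t \<in> C_per L (Suc (Suc 0))" using sol_periodic[OF t(1)] by (simp add: C_per_def numeral_2_eq_2)
  then have "pd j (pd j (\<Phi> t)) \<in> C_per L 0" for j by (intro C_per_pd)
  then have "pd j (pd j (\<Phi> t)) (x + axis i L) = pd j (pd j (\<Phi> t)) x" for j by (simp add: C_per_def)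
  then have "laplacian (\<Phi> t) (x + axis i L) = laplacian (\<Phi> t) x" by (simp only: laplacian_def)
  then show ?thesis by (simp only: chem_pot_def sol_periodic[OF t(1)])
qed

lemma space_truncation:
  assumes t: "t \<in> {0..T}" "good_time B t" and h: "h > 0"
  shows "\<bar>grid_proj h (rate t) i j k - grid_lap h (grid_proj h (chem_pot \<epsilon> (\<Phi> t))) i j k\<bar> \<le> 3 * M * h\<^sup>2"
  using lap_diff_error[OF mu[OF t] h] unfolding grid_lap_grid_proj grid_proj_def by (simp only: abs_minus_commute)

text \<open>The residual consists of \<open>\<Delta>\<mu> - \<Delta>\<^sub>h\<mu>\<close>, which is paired
  with \<open>w\<close>, and of \<open>\<Delta>\<^sub>h(\<mu> - W)\<close>, whose Laplacian is
  moved to \<open>w\<close>. The parameters \<open>\<theta>1\<close> and \<open>\<theta>2\<close>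
  are the weights in the two applications of Young's inequality.\<close>

lemma consistency:
  assumes N: "N > 0" and h: "h = mesh L N" and ab: "0 \<le> a" "a \<le> b" "b \<le> T"
    and W: "W \<in> grid_per N" and w: "w \<in> grid_per N"
    and R: "\<And>t i j k. good_time B t \<Longrightarrow> t \<in> {a<..<b} \<Longrightarrow> \<bar>grid_proj h (chem_pot \<epsilon> (\<Phi> t)) i j k - W i j k\<bar> \<le> R"
    and th: "\<theta>1 > 0" "\<theta>2 > 0"
  shows "\<bar>grid_inner L N (grid_proj h (\<Phi> b)) w - grid_inner L N (grid_proj h (\<Phi> a)) w - (b - a) * grid_inner L N (grid_lap h W) w\<bar>
    \<le> (b - a) * ((\<theta>1 / 2 * (L ^ 3 * (3 * M * h\<^sup>2)\<^sup>2) + 1 / (2 * \<theta>1) * grid_inner L N w w)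
       + (\<theta>2 / 2 * (L ^ 3 * R\<^sup>2) + 1 / (2 * \<theta>2) * grid_inner L N (grid_lap h w) (grid_lap h w)))"
proof (rule point_functional_increment[OF grid_inner_functional good ab])
  fix t assume t: "good_time B t" "t \<in> {a<..<b}"
  have t0: "t \<in> {0..T}" using t(2) ab by auto
  have hp: "h > 0" unfolding h by (rule mesh_pos[OF L N])
  let ?mu = "grid_proj h (chem_pot \<epsilon> (\<Phi> t))"
  let ?u = "\<lambda>i j k. grid_proj h (rate t) i j k - grid_lap h ?mu i j k"
  let ?v = "\<lambda>i j k. ?mu i j k - W i j k"
  have v: "?v \<in> grid_per N"
    using grid_proj_periodic[OF N, of "chem_pot \<epsilon> (\<Phi> t)" L] chem_pot_periodic[OF t0 t(1)] W
    unfolding h by (simp add: grid_per_def)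
  have "grid_inner L N (grid_proj h (rate t)) w - grid_inner L N (grid_lap h W) w
     = grid_inner L N ?u w + grid_inner L N (grid_lap h ?v) w"
  proof -
    have "grid_lap h ?v = (\<lambda>i j k. grid_lap h ?mu i j k - grid_lap h W i j k)"
      by (intro ext) (rule grid_lap_lin(2))
    then show ?thesis by (simp only: grid_inner_diff_left[OF L N])
  qed
  also have "grid_inner L N (grid_lap h ?v) w = grid_inner L N ?v (grid_lap h w)"
    unfolding h using v w unfolding h by (rule grid_inner_lap_symmetric[OF L N])
  finally have e: "grid_inner L N (grid_proj h (rate t)) w - grid_inner L N (grid_lap h W) w
     = grid_inner L N ?u w + grid_inner L N ?v (grid_lap h w)" .
  have "\<bar>grid_inner L N ?u w\<bar> \<le> \<theta>1 / 2 * (L ^ 3 * (3 * M * h\<^sup>2)\<^sup>2) + 1 / (2 * \<theta>1) * grid_inner L N w w"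
    by (rule grid_inner_young_sup[OF L N space_truncation[OF t0 t(1) hp] th(1)])
  moreover have "\<bar>grid_inner L N ?v (grid_lap h w)\<bar> \<le> \<theta>2 / 2 * (L ^ 3 * R\<^sup>2) + 1 / (2 * \<theta>2) * grid_inner L N (grid_lap h w) (grid_lap h w)"
    by (rule grid_inner_young_sup[OF L N R[OF t] th(2)])
  ultimately show "\<bar>grid_inner L N (grid_proj h (rate t)) w - grid_inner L N (grid_lap h W) w\<bar>
    \<le> (\<theta>1 / 2 * (L ^ 3 * (3 * M * h\<^sup>2)\<^sup>2) + 1 / (2 * \<theta>1) * grid_inner L N w w)
       + (\<theta>2 / 2 * (L ^ 3 * R\<^sup>2) + 1 / (2 * \<theta>2) * grid_inner L N (grid_lap h w) (grid_lap h w))"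
    unfolding e by (rule order_trans[OF abs_triangle_ineq add_mono])
qed

lemma grid_average_bound:
  assumes N: "N > 0" and v: "\<And>i j k. \<bar>v i j k\<bar> \<le> S"
  shows "\<bar>grid_mean L N v\<bar> \<le> S"
proof -
  have "\<bar>gsum N v\<bar> \<le> gsum N (\<lambda>i j k. S)"
    by (rule order_trans[OF gsum_abs gsum_mono[OF v]])
  then show ?thesis using N by (simp add: grid_mean_eq_average[OF L N] gsum_const divide_le_eq mult.commute)
qed

text \<open>Conservation of the integral is derived on finer and finer grids: the average of
  \<open>\<Delta>\<mu>\<close> over the grid is \<open>O(h\<^sup>2)\<close> because
  \<open>\<Delta>\<^sub>h\<close> sums to zero, and averages over the grid are integrals up to
  \<open>O(h\<^sup>2)\<close>. Only finitely many point values are differentiated in time, so that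
  no derivative is taken under the integral.\<close>

lemma mass_conservation:
  assumes ab: "0 \<le> a" "a \<le> b" "b \<le> T"
  shows "cos_coeff L (\<Phi> b) 0 = cos_coeff L (\<Phi> a) 0"
proof -
  define C where "C = T * (3 * M) + 2 * (324 * B * L ^ 4)"
  have a0: "a \<in> {0..T}" and b0: "b \<in> {0..T}" using ab by auto
  have bound: "\<bar>cos_coeff L (\<Phi> b) 0 / L ^ 3 - cos_coeff L (\<Phi> a) 0 / L ^ 3\<bar> \<le> C * L\<^sup>2 / real K ^ 2" if K: "K \<ge> 1" for K
  proof -
    let ?N = "2 * K + 1"
    let ?h = "mesh L ?N"
    have N: "?N > 0" by simp
    have hp: "?h > 0" by (rule mesh_pos[OF L N])
    let ?m = "\<lambda>f. grid_mean L ?N (grid_proj ?h f)"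
    have inner1: "?m f = 1 / L ^ 3 * grid_inner L ?N (grid_proj ?h f) (\<lambda>i j k. 1)" for f
      by (simp add: grid_mean_def grid_inner_def)
    have pf: "point_functional ?m" unfolding inner1 by (intro point_functional.cmult grid_inner_functional)
    have "\<bar>?m (\<Phi> b) - ?m (\<Phi> a) - (b - a) * 0\<bar> \<le> (b - a) * (3 * M * ?h\<^sup>2)"
    proof (rule point_functional_increment[OF pf good ab])
      fix t assume t: "good_time B t" "t \<in> {a<..<b}"
      have t0: "t \<in> {0..T}" using t(2) ab by auto
      let ?mu = "grid_proj ?h (chem_pot \<epsilon> (\<Phi> t))"
      have "?mu \<in> grid_per ?N" by (rule grid_proj_periodic[OF N chem_pot_periodic[OF t0 t(1)]])
      then have "gsum ?N (grid_lap ?h ?mu) = 0" by (rule gsum_grid_lap)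
      then have "?m (rate t) = grid_mean L ?N (\<lambda>i j k. grid_proj ?h (rate t) i j k - grid_lap ?h ?mu i j k)"
        by (simp add: grid_mean_gsum gsum_diff)
      then show "\<bar>?m (rate t) - 0\<bar> \<le> 3 * M * ?h\<^sup>2"
        using grid_average_bound[OF N space_truncation[OF t0 t(1) hp]] by simp
    qed
    also have "\<dots> \<le> T * (3 * M * ?h\<^sup>2)" using ab M by (intro mult_right_mono) auto
    finally have s1: "\<bar>?m (\<Phi> b) - ?m (\<Phi> a)\<bar> \<le> T * (3 * M) * ?h\<^sup>2" by simp
    have s2: "\<bar>?m (\<Phi> t) - cos_coeff L (\<Phi> t) 0 / L ^ 3\<bar> \<le> 324 * B * L ^ 4 * ?h\<^sup>2" if t: "t \<in> {0..T}" for t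
    proof -
      have "?m (\<Phi> t) - cos_coeff L (\<Phi> t) 0 / L ^ 3 = ?m (\<Phi> t) - ?m (fourier_proj L K (\<Phi> t))"
        by (simp only: grid_mean_fourier_proj[OF L sol_continuous[OF t]])
      also have "\<dots> = grid_mean L ?N (\<lambda>i j k. grid_proj ?h (\<Phi> t) i j k - grid_proj ?h (fourier_proj L K (\<Phi> t)) i j k)"
        by (simp only: grid_mean_gsum gsum_diff right_diff_distrib)
      also have "\<bar>\<dots>\<bar> \<le> 324 * B * L ^ 4 * ?h\<^sup>2"
        by (rule grid_average_bound[OF N]) (unfold grid_proj_def, rule projection_error(1)[OF K t])
      finally show ?thesis .
    qed
    have h2: "?h\<^sup>2 \<le> L\<^sup>2 / real K ^ 2"
    proof -
      have "?h \<le> L / real K" unfolding mesh_def using L K by (intro divide_left_mono) auto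
      then have "?h\<^sup>2 \<le> (L / real K)\<^sup>2" using hp by (intro power_mono) auto
      then show ?thesis by (simp add: power_divide)
    qed
    have "\<bar>cos_coeff L (\<Phi> b) 0 / L ^ 3 - cos_coeff L (\<Phi> a) 0 / L ^ 3\<bar>
        \<le> T * (3 * M) * ?h\<^sup>2 + 2 * (324 * B * L ^ 4 * ?h\<^sup>2)"
      using s1 s2[OF a0] s2[OF b0] by (simp add: abs_le_iff)
    also have "\<dots> = C * ?h\<^sup>2" by (simp add: C_def distrib_right)
    also have "\<dots> \<le> C * (L\<^sup>2 / real K ^ 2)" using h2 T M B L by (intro mult_left_mono) (auto simp: C_def)
    finally show ?thesis by simp
  qed
  have "(\<lambda>K. C * L\<^sup>2 / real K ^ 2) \<longlonglongrightarrow> 0"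
    by (intro tendsto_divide_0[OF tendsto_const] filterlim_at_top_imp_at_infinity filterlim_pow_at_top filterlim_real_sequentially) simp
  moreover have "\<forall>\<^sub>F K in sequentially. \<bar>cos_coeff L (\<Phi> b) 0 / L ^ 3 - cos_coeff L (\<Phi> a) 0 / L ^ 3\<bar> \<le> C * L\<^sup>2 / real K ^ 2"
    using bound unfolding eventually_sequentially by blast
  ultimately have "\<bar>cos_coeff L (\<Phi> b) 0 / L ^ 3 - cos_coeff L (\<Phi> a) 0 / L ^ 3\<bar> \<le> 0" by (intro tendsto_lowerbound) auto
  then show ?thesis using L by simp
qed

end

section \<open>Nonlinear terms and the Gronwall inequality\<close>

lemma powi_neg_cubes:
  fixes a :: real
  shows "a powi (-3) = inverse a ^ 3" "a powi (-9) = (inverse a ^ 3) ^ 3"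
  by (simp_all add: power_int_minus power_inverse flip: power_mult)

lemma singular_term_monotone:
  fixes a b :: real
  assumes "a > 0" "b > 0"
  shows "(a powi (-9) - b powi (-9)) * (b - a) \<ge> 0"
proof (cases "a \<le> b")
  case True
  then have "b powi (-9) \<le> a powi (-9)" unfolding powi_neg_cubes
    using assms by (intro power_mono le_imp_inverse_le) auto
  then show ?thesis using True by simp
next
  case False
  then have "a powi (-9) \<le> b powi (-9)" unfolding powi_neg_cubes
    using assms by (intro power_mono le_imp_inverse_le) auto
  then show ?thesis using False by (simp add: mult_nonpos_nonpos)
qed

text \<open>If \<open>a\<close> is bounded below, then the power \<open>-3\<close> is Lipschitz and the
  second summand suffices. If \<open>a < d / 2\<close>, put \<open>y = a\<^sup>-\<^sup>3\<close>;
  then the left-hand side is at most \<open>y\<^sup>2\<close>, while the first summand is at least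
  of the order of \<open>d y\<^sup>3\<close>, which dominates because \<open>y \<ge> 8 /
  d\<^sup>3\<close>. This compensates for the lack of a uniform lower bound on the numerical
  solution, which is inserted for \<open>a\<close>.\<close>

lemma explicit_term_controlled:
  fixes d :: real
  assumes d: "d > 0"
  shows "\<exists>C>0. \<forall>a b. a > 0 \<longrightarrow> d \<le> b \<longrightarrow>
    (a powi (-3) - b powi (-3))\<^sup>2 \<le> C * ((a powi (-9) - b powi (-9)) * (b - a) + (b - a)\<^sup>2)"
proof -
  obtain K where K: "K \<ge> 0" "\<And>a b. d / 2 \<le> a \<Longrightarrow> d / 2 \<le> b \<Longrightarrow> \<bar>a powi (-3) - b powi (-3)\<bar> \<le> K * \<bar>a - b\<bar>"
    using powi_lipschitz[of "d / 2" "-3"] d by auto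
  define C where "C = K\<^sup>2 + d\<^sup>2 / 2"
  have C: "C > 0" using d by (simp add: C_def add_nonneg_pos)
  have "(a powi (-3) - b powi (-3))\<^sup>2 \<le> C * ((a powi (-9) - b powi (-9)) * (b - a) + (b - a)\<^sup>2)"
    if a: "a > 0" and b: "d \<le> b" for a b
  proof -
    let ?D = "(a powi (-9) - b powi (-9)) * (b - a)"
    have D: "?D \<ge> 0" using a b d by (intro singular_term_monotone) auto
    show ?thesis
    proof (cases "d / 2 \<le> a")
      case True
      have "\<bar>a powi (-3) - b powi (-3)\<bar> \<le> K * \<bar>a - b\<bar>" using True b d by (intro K(2)) auto
      then have "(a powi (-3) - b powi (-3))\<^sup>2 \<le> (K * \<bar>a - b\<bar>)\<^sup>2"
        using power_mono[of "\<bar>a powi (-3) - b powi (-3)\<bar>" "K * \<bar>a - b\<bar>" 2] by simp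
      also have "\<dots> = K\<^sup>2 * (b - a)\<^sup>2" by (simp add: power_mult_distrib power2_commute)
      also have "\<dots> \<le> C * (?D + (b - a)\<^sup>2)" using D by (intro mult_mono) (auto simp: C_def)
      finally show ?thesis .
    next
      case False
      define y z where "y = inverse a ^ 3" and "z = inverse b ^ 3"
      have ba: "b - a \<ge> d / 2" using False b by simp
      have ia: "inverse a \<ge> 2 / d" using False a d by (simp add: field_simps)
      have ib: "inverse b \<le> 1 / d" using b d by (simp add: field_simps)
      have "(2 / d) ^ 3 \<le> y" unfolding y_def using ia d by (intro power_mono) auto
      then have y: "8 / d ^ 3 \<le> y" by (simp add: power_divide)
      have "z \<le> (1 / d) ^ 3" unfolding z_def using ib b d by (intro power_mono) auto
      then have z: "z \<le> 1 / d ^ 3" by (simp add: power_divide)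
      have z0: "z \<ge> 0" using b d by (simp add: z_def)
      have y0: "y > 0" using a by (simp add: y_def)
      have "8 / d ^ 3 = 8 * (1 / d ^ 3)" by simp
      then have yz: "8 * z \<le> y" using y z by linarith
      have "(8 * z) ^ 3 \<le> y ^ 3" using yz z0 by (intro power_mono) auto
      then have "512 * z ^ 3 \<le> y ^ 3" by (simp add: power_mult_distrib)
      moreover have "z ^ 3 \<ge> 0" using z0 by simp
      ultimately have yz3: "y ^ 3 / 2 \<le> y ^ 3 - z ^ 3" by linarith
      then have yz3': "0 \<le> y ^ 3 - z ^ 3" using zero_less_power[OF y0, of 3] by linarith
      have "y ^ 3 / 2 * (d / 2) \<le> (y ^ 3 - z ^ 3) * (b - a)" using yz3 ba yz3' d by (intro mult_mono) auto
      then have Dy: "y ^ 3 * d / 4 \<le> ?D" by (simp add: powi_neg_cubes y_def z_def)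
      have "(y - z)\<^sup>2 \<le> y\<^sup>2" using yz z0 y0 by (intro power_mono) auto
      also have "\<dots> \<le> d\<^sup>2 / 2 * (y ^ 3 * d / 4)"
      proof -
        have "1 \<le> y * d ^ 3 / 8" using y d by (simp add: field_simps)
        then have "y\<^sup>2 * 1 \<le> y\<^sup>2 * (y * d ^ 3 / 8)" by (intro mult_left_mono) auto
        also have "\<dots> = d\<^sup>2 / 2 * (y ^ 3 * d / 4)" by (simp add: power2_eq_square power3_eq_cube)
        finally show ?thesis by simp
      qed
      also have "\<dots> \<le> d\<^sup>2 / 2 * ?D" using Dy by (intro mult_left_mono) auto
      also have "\<dots> \<le> C * (?D + (b - a)\<^sup>2)" using D by (intro mult_mono) (auto simp: C_def)
      finally show ?thesis by (simp add: powi_neg_cubes y_def z_def)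
    qed
  qed
  then show ?thesis using C by blast
qed

text \<open>The growth factor per step is \<open>(1 + x) / (1 - x) \<le> 1 + 4 x\<close> for \<open>x =
  \<tau> A \<le> 1 / 2\<close>.\<close>

lemma discrete_gronwall:
  fixes Y :: "nat \<Rightarrow> real"
  assumes Y0: "\<And>n. n \<le> m \<Longrightarrow> Y n \<ge> 0" and A: "A \<ge> 0" and \<tau>: "\<tau> > 0" "\<tau> * A \<le> 1 / 2" and F: "F \<ge> 0"
    and step: "\<And>n. n < m \<Longrightarrow> Y (Suc n) \<le> Y n + \<tau> * A * (Y n + Y (Suc n)) + \<tau> * F"
    and mT: "real m * \<tau> \<le> T"
  shows "Y m \<le> exp (4 * A * T) * (Y 0 + 2 * T * F)"
proof -
  define q where "q = 4 * A * \<tau>"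
  have q: "q \<ge> 0" using A \<tau> by (simp add: q_def)
  have one: "Y (Suc n) \<le> (1 + q) * Y n + 2 * \<tau> * F" if n: "n < m" for n
  proof -
    define x where "x = \<tau> * A"
    have x: "0 \<le> x" "x \<le> 1 / 2" using A \<tau> by (simp_all add: x_def)
    have s: "(1 - x) * Y (Suc n) \<le> (1 + x) * Y n + \<tau> * F"
      using step[OF n] by (simp add: x_def algebra_simps)
    have "1 + x \<le> (1 - x) * (1 + 4 * x)"
    proof -
      have "x * x \<le> x * (1 / 2)" using x by (intro mult_left_mono) auto
      then show ?thesis by (simp add: algebra_simps)
    qed
    then have "(1 + x) * Y n \<le> (1 - x) * (1 + 4 * x) * Y n" using Y0[OF less_imp_le[OF n]] by (rule mult_right_mono)
    also have "\<dots> = (1 - x) * ((1 + 4 * x) * Y n)" by (rule mult.assoc)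
    finally have 1: "(1 + x) * Y n \<le> (1 - x) * ((1 + 4 * x) * Y n)" .
    have 2: "\<tau> * F \<le> (1 - x) * (2 * \<tau> * F)"
    proof -
      have "1 * (\<tau> * F) \<le> (2 * (1 - x)) * (\<tau> * F)" using x \<tau> F by (intro mult_right_mono) auto
      then show ?thesis by (simp add: algebra_simps)
    qed
    have "(1 - x) * Y (Suc n) \<le> (1 - x) * ((1 + 4 * x) * Y n) + (1 - x) * (2 * \<tau> * F)"
      by (rule order_trans[OF s add_mono[OF 1 2]])
    then have "(1 - x) * Y (Suc n) \<le> (1 - x) * ((1 + 4 * x) * Y n + 2 * \<tau> * F)"
      by (simp only: distrib_left[of "1 - x"])
    then have "Y (Suc n) \<le> (1 + 4 * x) * Y n + 2 * \<tau> * F" using x by simp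
    then show ?thesis by (simp add: q_def x_def mult_ac)
  qed
  have ind: "n \<le> m \<Longrightarrow> Y n \<le> (1 + q) ^ n * (Y 0 + 2 * real n * \<tau> * F)" for n
  proof (induction n)
    case (Suc n)
    have "Y (Suc n) \<le> (1 + q) * ((1 + q) ^ n * (Y 0 + 2 * real n * \<tau> * F)) + 2 * \<tau> * F"
      using one[of n] Suc q by (smt (verit) Suc_le_lessD less_imp_le mult_left_mono)
    also have "2 * \<tau> * F \<le> (1 + q) ^ Suc n * (2 * \<tau> * F)"
    proof -
      have "1 * (2 * \<tau> * F) \<le> (1 + q) ^ Suc n * (2 * \<tau> * F)"
        using q \<tau> F by (intro mult_right_mono one_le_power) auto
      then show ?thesis by simp
    qed
    finally show ?case by (simp add: algebra_simps)
  qed simp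
  have "Y m \<le> (1 + q) ^ m * (Y 0 + 2 * real m * \<tau> * F)" using ind by simp
  also have "\<dots> \<le> exp (4 * A * T) * (Y 0 + 2 * T * F)"
  proof (rule mult_mono)
    have "(1 + q) ^ m \<le> exp q ^ m" using q by (intro power_mono) (auto simp: add.commute intro: order_trans[OF _ exp_ge_add_one_self])
    also have "\<dots> = exp (4 * A * (real m * \<tau>))" by (simp add: q_def exp_of_nat_mult[symmetric] mult_ac)
    also have "\<dots> \<le> exp (4 * A * T)" using A mT by (simp add: mult_left_mono)
    finally show "(1 + q) ^ m \<le> exp (4 * A * T)" .
    have "real m * \<tau> * F \<le> T * F" using mT F by (rule mult_right_mono)
    then show "Y 0 + 2 * real m * \<tau> * F \<le> Y 0 + 2 * T * F" by simp
    show "0 \<le> Y 0 + 2 * real m * \<tau> * F" using Y0[of 0] \<tau> F by simp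
  qed simp
  finally show ?thesis .
qed

section \<open>The error of the scheme\<close>

text \<open>\<open>K3\<close> and \<open>K9\<close> serve for the exact solution, its shifted grid functions
  and the initial data, which stay above \<open>\<delta> / 2\<close> for small \<open>h\<close>;
  \<open>C1\<close> admits the numerical solution as one argument. All constants below are built
  from the parameters of this locale, so they depend neither on the mesh nor on the time step or
  the numerical solution.\<close>

locale film_constants = film_bounds +
  fixes K3 K9 C1 :: real
  assumes K3: "K3 \<ge> 0" "\<And>a b. \<delta> / 2 \<le> a \<Longrightarrow> \<delta> / 2 \<le> b \<Longrightarrow> \<bar>a powi (-3) - b powi (-3)\<bar> \<le> K3 * \<bar>a - b\<bar>"
    and K9: "K9 \<ge> 0" "\<And>a b. \<delta> / 2 \<le> a \<Longrightarrow> \<delta> / 2 \<le> b \<Longrightarrow> \<bar>a powi (-9) - b powi (-9)\<bar> \<le> K9 * \<bar>a - b\<bar>"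
    and C1: "C1 > 0" "\<And>a b. a > 0 \<Longrightarrow> \<delta> / 2 \<le> b \<Longrightarrow>
      (a powi (-3) - b powi (-3))\<^sup>2 \<le> C1 * ((a powi (-9) - b powi (-9)) * (b - a) + (b - a)\<^sup>2)"
begin

definition proj_const :: real where "proj_const = 324 * B * L ^ 4"
definition proj_grad_const :: real where "proj_grad_const = 2592 * B * L ^ 3"

definition residual_const :: real where
  "residual_const = 8/3 * (K9 + K3) * (3 * M + proj_const) + \<epsilon>\<^sup>2 * (3 * B + 9 * M)"

lemma proj_const_nonneg: "proj_const \<ge> 0" and proj_grad_const_nonneg: "proj_grad_const \<ge> 0"
  using B L by (simp_all add: proj_const_def proj_grad_const_def)

text \<open>The coefficient of \<open>\<parallel>gap\<parallel>\<^sup>2\<close> at the new time level: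
  \<open>4/3 C1\<close> from the explicit term and \<open>1/2\<close> from the residual.\<close>

definition \<kappa> :: real where "\<kappa> = 4/3 * C1 + 1/2"

text \<open>The first two summands are what interpolation leaves of \<open>4/3
  \<parallel>gap\<parallel>\<^sup>2\<close> and \<open>\<kappa>
  \<parallel>gap\<parallel>\<^sup>2\<close> when each may use \<open>\<epsilon>\<^sup>2 /
  4\<close> of the gradient term. The third bounds \<open>(-\<Delta>\<^sub>h)\<^sup>-\<^sup>1
  gap\<close>.\<close>

definition growth :: real where
  "growth = 32 / (9 * \<epsilon>\<^sup>2) + 2 * \<kappa>\<^sup>2 / \<epsilon>\<^sup>2 + 3 * L\<^sup>2"

definition source :: real where "source = L ^ 3 / 2 * (9 * M\<^sup>2 + residual_const\<^sup>2)"

definition initial_const :: real where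
  "initial_const = (3 * L\<^sup>2 / 2 + 4/3 * K9) * (4 * L ^ 3 * proj_const\<^sup>2) + \<epsilon>\<^sup>2 / 4 * (3 * L ^ 3 * proj_grad_const\<^sup>2)"

definition energy_const :: real where
  "energy_const = exp (4 * growth * T) * (initial_const + 2 * T * source)"

definition error_const :: real where
  "error_const = sqrt (4 * energy_const + 6 * L\<^sup>2 * (4 * L ^ 3 * proj_const\<^sup>2))
     + sqrt (4 * energy_const + 2 * \<epsilon>\<^sup>2 * T * (3 * L ^ 3 * proj_grad_const\<^sup>2))"

lemma \<kappa>_pos: "\<kappa> > 0"
  using C1 by (simp add: \<kappa>_def)

lemma growth_pos: "growth > 0"
  using L eps by (simp add: growth_def add_nonneg_pos)

lemma source_nonneg: "source \<ge> 0"
  using L by (simp add: source_def)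

end

text \<open>The bound \<open>h_small\<close> says that the projection error, which also bounds the shift of
  the mean, is at most half the lower bound of the exact solution.\<close>

locale film_scheme = film_constants +
  fixes K N :: nat and h \<Delta>t :: real and \<phi> :: "nat \<Rightarrow> grid_fun"
  assumes K: "K \<ge> 1" and N_def: "N = 2 * K + 1" and h_def: "h = mesh L N"
    and h_small: "324 * B * L ^ 4 * h\<^sup>2 \<le> \<delta> / 2"
    and dt: "\<Delta>t > 0"
    and init: "\<phi> 0 = grid_proj h (fourier_proj L K (\<Phi> 0))"
    and scheme: "scheme_solution \<epsilon> L N \<Delta>t \<phi>"
begin

abbreviation tm :: "nat \<Rightarrow> real" where "tm m \<equiv> real m * \<Delta>t"

text \<open>The scheme keeps the mean of \<open>\<phi> 0\<close>, so this is the constant that gives the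
  exact solution on the grid the mean of the numerical one.\<close>

definition shift :: "nat \<Rightarrow> real" where
  "shift m = grid_mean L N (grid_proj h (\<Phi> (tm m))) - grid_mean L N (\<phi> 0)"

definition comparison :: "nat \<Rightarrow> grid_fun" where
  "comparison m = (\<lambda>i j k. grid_proj h (\<Phi> (tm m)) i j k - shift m)"

definition gap :: "nat \<Rightarrow> grid_fun" where
  "gap m = (\<lambda>i j k. comparison m i j k - \<phi> m i j k)"

definition proj_gap :: "nat \<Rightarrow> grid_fun" where
  "proj_gap m = (\<lambda>i j k. grid_proj h (fourier_proj L K (\<Phi> (tm m))) i j k - comparison m i j k)"

text \<open>The pairing of the difference of the implicit powers with the gap. It is nonnegative because the
  power \<open>-9\<close> decreases.\<close>

definition dissipation :: "nat \<Rightarrow> real" where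
  "dissipation m = h ^ 3 * gsum N (\<lambda>i j k. (\<phi> m i j k powi (-9) - comparison m i j k powi (-9)) * gap m i j k)"

lemma N: "N > 0"
  by (simp add: N_def)

lemma h: "h > 0"
  unfolding h_def by (rule mesh_pos[OF L N])

lemma tm_in: "tm m \<le> T \<Longrightarrow> tm m \<in> {0..T}"
  using dt by simp

lemma phi_step: "\<phi> (Suc n) \<in> grid_per N" "\<phi> (Suc n) i j k > 0" "grid_mean L N (\<phi> (Suc n)) = grid_mean L N (\<phi> n)"
  "\<phi> (Suc n) i j k - \<phi> n i j k = \<Delta>t * grid_lap h (grid_chem_pot \<epsilon> h (\<phi> (Suc n)) (\<phi> n)) i j k"
proof -
  note s = scheme[unfolded scheme_solution_def h_def[symmetric], rule_format, of n]
  show "\<phi> (Suc n) \<in> grid_per N" "\<phi> (Suc n) i j k > 0" "grid_mean L N (\<phi> (Suc n)) = grid_mean L N (\<phi> n)"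
    using s by auto
  have "(\<phi> (Suc n) i j k - \<phi> n i j k) / \<Delta>t = grid_lap h (grid_chem_pot \<epsilon> h (\<phi> (Suc n)) (\<phi> n)) i j k" using s by blast
  then show "\<phi> (Suc n) i j k - \<phi> n i j k = \<Delta>t * grid_lap h (grid_chem_pot \<epsilon> h (\<phi> (Suc n)) (\<phi> n)) i j k"
    using dt by (simp add: field_simps)
qed

lemma phi_mean: "grid_mean L N (\<phi> n) = grid_mean L N (\<phi> 0)"
  by (induction n) (simp_all add: phi_step(3))

lemma phi_per: "\<phi> n \<in> grid_per N"
proof (cases n)
  case 0
  have "0 \<in> {0..T}" using T by simp
  then show ?thesis unfolding 0 init h_def
    by (intro grid_proj_periodic[OF N] fourier_proj_periodic[OF L sol_continuous])
qed (use phi_step(1) in simp)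

lemma proj_mean:
  assumes "tm m \<le> T"
  shows "grid_mean L N (grid_proj h (fourier_proj L K (\<Phi> (tm m)))) = grid_mean L N (\<phi> 0)"
proof -
  have c: "cos_coeff L (\<Phi> (tm m)) 0 = cos_coeff L (\<Phi> 0) 0"
    by (rule mass_conservation) (use assms dt in auto)
  have z: "0 \<in> {0..T}" using T by simp
  show ?thesis
    unfolding init h_def N_def grid_mean_fourier_proj[OF L sol_continuous[OF tm_in[OF assms]]]
      grid_mean_fourier_proj[OF L sol_continuous[OF z]] c ..
qed

lemma proj_error: "tm m \<le> T \<Longrightarrow> \<bar>\<Phi> (tm m) x - fourier_proj L K (\<Phi> (tm m)) x\<bar> \<le> proj_const * h\<^sup>2"
  unfolding proj_const_def h_def N_def by (rule projection_error(1)[OF K tm_in])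

text \<open>Since mass is conserved, the mean of \<open>\<phi> 0\<close> is also the mean of the Fourier
  projection at time \<open>t\<^sub>m\<close>; the shift is therefore the mean of a projection
  error.\<close>

lemma shift_bound:
  assumes "tm m \<le> T" shows "\<bar>shift m\<bar> \<le> proj_const * h\<^sup>2"
proof -
  have "shift m = grid_mean L N (\<lambda>i j k. grid_proj h (\<Phi> (tm m)) i j k - grid_proj h (fourier_proj L K (\<Phi> (tm m))) i j k)"
    unfolding shift_def proj_mean[OF assms, symmetric] by (simp only: grid_mean_gsum gsum_diff right_diff_distrib)
  also have "\<bar>\<dots>\<bar> \<le> proj_const * h\<^sup>2"
    by (rule grid_average_bound[OF N]) (unfold grid_proj_def, rule proj_error[OF assms])
  finally show ?thesis .
qed

lemma comparison_lower: "tm m \<le> T \<Longrightarrow> \<delta> / 2 \<le> comparison m i j k"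
  using lower[OF tm_in, of m "vector [node h i, node h j, node h k]"] shift_bound[of m] h_small
  unfolding comparison_def grid_proj_def proj_const_def by linarith

lemma comparison_per:
  assumes m: "tm m \<le> T"
  shows "comparison m \<in> grid_per N"
  using grid_proj_periodic[OF N, of "\<Phi> (tm m)" L, OF sol_periodic[OF tm_in[OF m]], folded h_def]
  unfolding comparison_def by (simp add: grid_per_def)

lemma phi_pos: "\<phi> n i j k > 0"
proof (cases n)
  case 0
  have t: "tm 0 \<le> T" using T by simp
  have "\<delta> \<le> \<Phi> 0 x" for x using lower[of 0 x] T by simp
  then show ?thesis
    using proj_error[OF t, of "vector [node h i, node h j, node h k]"] h_small \<delta>
    unfolding 0 init grid_proj_def proj_const_def[symmetric] of_nat_0 mult_zero_left
    by (smt (verit) field_sum_of_halves)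
qed (use phi_step(2) in simp)

lemma gap_per: "tm m \<le> T \<Longrightarrow> gap m \<in> grid_per N"
  using comparison_per[of m] phi_per[of m] by (simp add: gap_def grid_per_def)

lemma gsum_comparison: "gsum N (comparison m) = gsum N (\<phi> m)"
proof -
  have "shift m = gsum N (grid_proj h (\<Phi> (tm m))) / real N ^ 3 - gsum N (\<phi> m) / real N ^ 3"
    unfolding shift_def phi_mean[of m, symmetric] by (simp add: grid_mean_eq_average[OF L N])
  then have "real N ^ 3 * shift m = gsum N (grid_proj h (\<Phi> (tm m))) - gsum N (\<phi> m)"
    using N by (simp add: field_simps)
  then show ?thesis by (simp add: comparison_def gsum_diff gsum_const)
qed

lemma gsum_gap: "gsum N (gap m) = 0"
  by (simp add: gap_def gsum_diff gsum_comparison)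

lemma proj_gap_bounds:
  assumes m: "tm m \<le> T"
  shows "\<bar>proj_gap m i j k\<bar> \<le> 2 * proj_const * h\<^sup>2"
    "\<bar>proj_gap m (i+1) j k - proj_gap m i j k\<bar> \<le> proj_grad_const * h\<^sup>2 * mesh L N"
    "\<bar>proj_gap m i (j+1) k - proj_gap m i j k\<bar> \<le> proj_grad_const * h\<^sup>2 * mesh L N"
    "\<bar>proj_gap m i j (k+1) - proj_gap m i j k\<bar> \<le> proj_grad_const * h\<^sup>2 * mesh L N"
proof -
  show "\<bar>proj_gap m i j k\<bar> \<le> 2 * proj_const * h\<^sup>2"
    using proj_error[OF m, of "vector [node h i, node h j, node h k]"] shift_bound[OF m]
    unfolding proj_gap_def comparison_def grid_proj_def by linarith
  have g: "\<bar>(fourier_proj L K (\<Phi> (tm m)) (x + h *\<^sub>R axis l 1) - \<Phi> (tm m) (x + h *\<^sub>R axis l 1)) - (fourier_proj L K (\<Phi> (tm m)) x - \<Phi> (tm m) x)\<bar>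
      \<le> proj_grad_const * h\<^sup>2 * mesh L N" for x l
  proof -
    have "(fourier_proj L K (\<Phi> (tm m)) (x + h *\<^sub>R axis l 1) - \<Phi> (tm m) (x + h *\<^sub>R axis l 1)) - (fourier_proj L K (\<Phi> (tm m)) x - \<Phi> (tm m) x)
      = - ((\<Phi> (tm m) (x + h *\<^sub>R axis l 1) - \<Phi> (tm m) x) - (fourier_proj L K (\<Phi> (tm m)) (x + h *\<^sub>R axis l 1) - fourier_proj L K (\<Phi> (tm m)) x))"
      by simp
    then show ?thesis
      using projection_error(2)[OF K tm_in[OF m], of x l] unfolding proj_grad_const_def h_def N_def by (simp only: abs_minus_cancel)
  qed
  have e: "proj_gap m i' j' k' - proj_gap m i j k = (fourier_proj L K (\<Phi> (tm m)) y - \<Phi> (tm m) y) - (fourier_proj L K (\<Phi> (tm m)) x - \<Phi> (tm m) x)"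
    if "y = vector [node h i', node h j', node h k']" "x = vector [node h i, node h j, node h k]" for i' j' k' x y
    using that by (simp add: proj_gap_def comparison_def grid_proj_def)
  show "\<bar>proj_gap m (i+1) j k - proj_gap m i j k\<bar> \<le> proj_grad_const * h\<^sup>2 * mesh L N"
    unfolding e[OF grid_node_shift(1)[symmetric] refl] by (rule g)
  show "\<bar>proj_gap m i (j+1) k - proj_gap m i j k\<bar> \<le> proj_grad_const * h\<^sup>2 * mesh L N"
    unfolding e[OF grid_node_shift(3)[symmetric] refl] by (rule g)
  show "\<bar>proj_gap m i j (k+1) - proj_gap m i j k\<bar> \<le> proj_grad_const * h\<^sup>2 * mesh L N"
    unfolding e[OF grid_node_shift(5)[symmetric] refl] by (rule g)
qed

lemma proj_gap_per:
  assumes m: "tm m \<le> T"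
  shows "proj_gap m \<in> grid_per N"
  using comparison_per[OF m] grid_proj_periodic[OF N, of "fourier_proj L K (\<Phi> (tm m))" L,
      OF fourier_proj_periodic[OF L sol_continuous[OF tm_in[OF m]]], folded h_def]
  unfolding proj_gap_def by (simp add: grid_per_def)

lemma gsum_proj_gap:
  assumes m: "tm m \<le> T"
  shows "gsum N (proj_gap m) = 0"
proof -
  have "grid_mean L N (grid_proj h (fourier_proj L K (\<Phi> (tm m)))) = grid_mean L N (\<phi> m)"
    using proj_mean[OF m] phi_mean[of m] by simp
  then have "gsum N (grid_proj h (fourier_proj L K (\<Phi> (tm m)))) = gsum N (\<phi> m)"
    using N by (simp add: grid_mean_eq_average[OF L N])
  then show ?thesis by (simp add: proj_gap_def gsum_diff gsum_comparison)
qed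

lemma gap_0: "gap 0 = (\<lambda>i j k. - proj_gap 0 i j k)"
  by (simp add: gap_def proj_gap_def init)

lemma dissipation_nonneg: "tm m \<le> T \<Longrightarrow> dissipation m \<ge> 0"
  unfolding dissipation_def gap_def using h comparison_lower[of m] \<delta>
  by (intro mult_nonneg_nonneg gsum_nonneg singular_term_monotone phi_pos) (auto intro: less_le_trans[of 0 "\<delta> / 2"])

text \<open>Within the step all three arguments, \<open>\<Phi> t\<close> and the two comparison functions,
  differ by the Lipschitz bound in time plus the shift. The Laplacian of \<open>\<Phi> t\<close>
  is replaced by its difference quotient before it is moved in time, because only the latter is
  known to be Lipschitz.\<close>

lemma chem_pot_residual:
  assumes n: "tm (Suc n) \<le> T" and t: "good_time B t" "t \<in> {tm n<..<tm (Suc n)}"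
  shows "\<bar>grid_proj h (chem_pot \<epsilon> (\<Phi> t)) i j k - grid_chem_pot \<epsilon> h (comparison (Suc n)) (comparison n) i j k\<bar>
    \<le> residual_const * (\<Delta>t + h\<^sup>2)"
proof -
  have t': "tm n < t" "t < tm (Suc n)" using t(2) by auto
  have nS: "tm (Suc n) = tm n + \<Delta>t" by (simp add: algebra_simps)
  have n0: "tm n \<le> T" using n nS dt by simp
  have t0: "t \<in> {0..T}" using t' n tm_in[OF n0] by auto
  let ?x = "vector [node h i, node h j, node h k] :: real^3"
  let ?r = "\<Delta>t + h\<^sup>2"
  let ?a = "\<Phi> t ?x" and ?b = "comparison (Suc n) i j k" and ?c = "comparison n i j k"
  have close: "\<bar>?a - comparison m i j k\<bar> \<le> (3 * M + proj_const) * ?r" if m: "tm m \<le> T" "\<bar>t - tm m\<bar> \<le> \<Delta>t" for m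
  proof -
    have "\<bar>?a - \<Phi> (tm m) ?x\<bar> \<le> 3 * M * \<bar>t - tm m\<bar>" by (rule sol_lipschitz[OF tm_in[OF m(1)] t0])
    also have "\<dots> \<le> 3 * M * \<Delta>t" using M m(2) by (intro mult_left_mono) auto
    finally have "\<bar>?a - comparison m i j k\<bar> \<le> 3 * M * \<Delta>t + proj_const * h\<^sup>2"
      using shift_bound[OF m(1)] unfolding comparison_def grid_proj_def by linarith
    also have "\<dots> \<le> (3 * M + proj_const) * \<Delta>t + (3 * M + proj_const) * h\<^sup>2"
      using M proj_const_nonneg dt by (intro add_mono mult_right_mono) auto
    finally show ?thesis by (simp add: distrib_left)
  qed
  have ab: "\<bar>?a - ?b\<bar> \<le> (3 * M + proj_const) * ?r" by (rule close) (use n t' nS in auto)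
  have ac: "\<bar>?a - ?c\<bar> \<le> (3 * M + proj_const) * ?r" by (rule close) (use n0 t' nS in auto)
  have la: "\<delta> / 2 \<le> ?a" using lower[OF t0, of ?x] \<delta> by linarith
  have s9: "\<bar>?a powi (-9) - ?b powi (-9)\<bar> \<le> K9 * ((3 * M + proj_const) * ?r)"
    by (rule order_trans[OF K9(2)[OF la comparison_lower[OF n]] mult_left_mono[OF ab K9(1)]])
  have s3: "\<bar>?a powi (-3) - ?c powi (-3)\<bar> \<le> K3 * ((3 * M + proj_const) * ?r)"
    by (rule order_trans[OF K3(2)[OF la comparison_lower[OF n0]] mult_left_mono[OF ac K3(1)]])
  have lc: "grid_lap h (comparison (Suc n)) i j k = lap_diff h (\<Phi> (tm (Suc n))) ?x"
  proof -
    have "grid_lap h (comparison (Suc n)) i j k = grid_lap h (grid_proj h (\<Phi> (tm (Suc n)))) i j k"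
      by (simp add: comparison_def grid_lap_def)
    then show ?thesis by (simp only: grid_lap_grid_proj)
  qed
  have sl: "\<bar>laplacian (\<Phi> t) ?x - grid_lap h (comparison (Suc n)) i j k\<bar> \<le> (3 * B + 9 * M) * ?r"
  proof -
    have "bounded_class_C 4 B (\<Phi> t)" using bounded_class_C_le[of 6 B "\<Phi> t" 4] t(1) by (simp add: good_time_def)
    from lap_diff_error[OF this h, of ?x] have l1: "\<bar>lap_diff h (\<Phi> t) ?x - laplacian (\<Phi> t) ?x\<bar> \<le> 3 * B * h\<^sup>2" .
    have "\<bar>lap_diff h (\<Phi> t) ?x - lap_diff h (\<Phi> (tm (Suc n))) ?x\<bar> \<le> 9 * M * \<bar>t - tm (Suc n)\<bar>"
      by (rule sol_lap_lipschitz[OF tm_in[OF n] t0 h])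
    also have "\<dots> \<le> 9 * M * \<Delta>t" using M t' nS by (intro mult_left_mono) auto
    finally have "\<bar>laplacian (\<Phi> t) ?x - grid_lap h (comparison (Suc n)) i j k\<bar> \<le> 3 * B * h\<^sup>2 + 9 * M * \<Delta>t"
      using l1 unfolding lc by (simp add: abs_le_iff)
    also have "\<dots> \<le> (3 * B + 9 * M) * h\<^sup>2 + (3 * B + 9 * M) * \<Delta>t"
      using M B dt by (intro add_mono mult_right_mono) auto
    finally show ?thesis by (simp add: distrib_left add.commute)
  qed
  have comb: "\<bar>(- (8/3) * (a9 - a3) - e * la) - (- (8/3) * b9 + 8/3 * c3 - e * lb)\<bar> \<le> 8/3 * X + 8/3 * Y + e * Z"
    if "\<bar>a9 - b9\<bar> \<le> X" "\<bar>a3 - c3\<bar> \<le> Y" "\<bar>la - lb\<bar> \<le> Z" "e \<ge> 0" for a9 a3 la b9 c3 lb e X Y Z :: real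
  proof -
    have "\<bar>e * (la - lb)\<bar> \<le> e * Z" using that by (simp add: abs_mult mult_left_mono)
    then show ?thesis using that(1,2) unfolding right_diff_distrib abs_le_iff by argo
  qed
  have "\<bar>grid_proj h (chem_pot \<epsilon> (\<Phi> t)) i j k - grid_chem_pot \<epsilon> h (comparison (Suc n)) (comparison n) i j k\<bar>
    \<le> 8/3 * (K9 * ((3 * M + proj_const) * ?r)) + 8/3 * (K3 * ((3 * M + proj_const) * ?r)) + \<epsilon>\<^sup>2 * ((3 * B + 9 * M) * ?r)"
    unfolding grid_proj_def chem_pot_def grid_chem_pot_def by (rule comb[OF s9 s3 sl]) simp
  also have "\<dots> = residual_const * ?r" by (simp add: residual_const_def algebra_simps)
  finally show ?thesis .
qed

lemma grid_chem_pot_per: "u \<in> grid_per N \<Longrightarrow> v \<in> grid_per N \<Longrightarrow> grid_chem_pot \<epsilon> h u v \<in> grid_per N"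
  using grid_lap_in_grid_per[of u N h] by (simp add: grid_per_def grid_chem_pot_def)

lemma dissipation_inner:
  "dissipation m = grid_inner L N (\<lambda>i j k. \<phi> m i j k powi (-9) - comparison m i j k powi (-9)) (gap m)"
  by (simp add: dissipation_def grid_inner_gsum flip: h_def)

lemma residual_pairing:
  fixes n
  defines "e \<equiv> gap (Suc n)"
    and "U \<equiv> grid_chem_pot \<epsilon> h (\<phi> (Suc n)) (\<phi> n)"
    and "W \<equiv> grid_chem_pot \<epsilon> h (comparison (Suc n)) (comparison n)"
  assumes n: "tm (Suc n) \<le> T"
  shows "grid_inner L N U e - grid_inner L N W e
    = - (8/3) * dissipation (Suc n)
      + 8/3 * grid_inner L N (\<lambda>i j k. \<phi> n i j k powi (-3) - comparison n i j k powi (-3)) e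
      - \<epsilon>\<^sup>2 * grid_grad_sq L N e"
proof -
  let ?v9 = "\<lambda>i j k. \<phi> (Suc n) i j k powi (-9) - comparison (Suc n) i j k powi (-9)"
  let ?v3 = "\<lambda>i j k. \<phi> n i j k powi (-3) - comparison n i j k powi (-3)"
  have lap: "grid_lap h e i j k = grid_lap h (comparison (Suc n)) i j k - grid_lap h (\<phi> (Suc n)) i j k" for i j k
    by (simp add: e_def gap_def grid_lap_def algebra_simps)
  have pt: "U i j k * e i j k - W i j k * e i j k
    = (- (8/3)) * (?v9 i j k * e i j k) + 8/3 * (?v3 i j k * e i j k) + \<epsilon>\<^sup>2 * (grid_lap h e i j k * e i j k)" for i j k
    unfolding U_def W_def grid_chem_pot_def lap by (simp add: algebra_simps)
  have "grid_inner L N U e - grid_inner L N W e = (- (8/3)) * grid_inner L N ?v9 e + 8/3 * grid_inner L N ?v3 e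
    + \<epsilon>\<^sup>2 * grid_inner L N (grid_lap h e) e"
    unfolding grid_inner_gsum right_diff_distrib[symmetric] gsum_diff[symmetric] pt gsum_add gsum_cmult
    by (simp only: distrib_left mult.left_commute[of "mesh L N ^ 3"])
  moreover have "grid_inner L N (grid_lap h e) e = - grid_grad_sq L N e"
    unfolding grid_grad_sq_eq[OF L N] e_def
    by (rule grid_inner_lap_left[OF L N gap_per[OF n] gap_per[OF n], folded h_def])
  ultimately show ?thesis by (simp add: dissipation_inner e_def)
qed

text \<open>The error equation tested with \<open>\<psi> = (-\<Delta>\<^sub>h)\<^sup>-\<^sup>1 e\<close>.
  Since \<open>\<psi>\<close> has mean zero, the shifts of the two time levels drop out, and all
  discrete Laplacians turn into \<open>- e\<close>.\<close>

lemma energy_inequality: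
  fixes n
  defines "e \<equiv> gap (Suc n)"
  assumes n: "tm (Suc n) \<le> T"
  shows "(neg_norm L N e)\<^sup>2 / 2 - (neg_norm L N (gap n))\<^sup>2 / 2
    \<le> \<Delta>t * (- (8/3) * dissipation (Suc n)
        + 8/3 * grid_inner L N (\<lambda>i j k. \<phi> n i j k powi (-3) - comparison n i j k powi (-3)) e
        - \<epsilon>\<^sup>2 * grid_grad_sq L N e)
      + \<Delta>t * (source * (\<Delta>t + h\<^sup>2)\<^sup>2 + 3 * L\<^sup>2 * ((neg_norm L N e)\<^sup>2 / 2) + grid_inner L N e e / 2)"
proof -
  have nS: "tm (Suc n) - tm n = \<Delta>t" by (simp add: algebra_simps)
  have n0: "tm n \<le> T" using n nS dt by linarith
  note e = gap_per[OF n] gsum_gap[of "Suc n"]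
  define \<psi> where "\<psi> = inv_neg_lap L N e"
  define U where "U = grid_chem_pot \<epsilon> h (\<phi> (Suc n)) (\<phi> n)"
  define W where "W = grid_chem_pot \<epsilon> h (comparison (Suc n)) (comparison n)"
  define P where "P m = grid_proj h (\<Phi> (tm m))" for m
  let ?r = "\<Delta>t + h\<^sup>2"
  have \<psi>: "\<psi> \<in> grid_per N" "gsum N \<psi> = 0" and lap: "grid_lap h \<psi> = (\<lambda>i j k. - e i j k)"
    using inv_neg_lap_spec[OF L N e] unfolding \<psi>_def e_def h_def by (auto simp: fun_eq_iff) (metis add.inverse_inverse)
  have U: "U \<in> grid_per N" unfolding U_def by (intro grid_chem_pot_per phi_per)
  have W: "W \<in> grid_per N" unfolding W_def by (intro grid_chem_pot_per comparison_per n n0)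
  have gp: "gap m i j k = P m i j k - shift m - \<phi> m i j k" for m i j k
    by (simp add: gap_def comparison_def P_def)
  have pt: "(e i j k - gap n i j k) * \<psi> i j k = P (Suc n) i j k * \<psi> i j k - P n i j k * \<psi> i j k
      - (shift (Suc n) - shift n) * \<psi> i j k - \<Delta>t * (grid_lap h U i j k * \<psi> i j k)" for i j k
  proof -
    have "e i j k - gap n i j k = P (Suc n) i j k - P n i j k - (shift (Suc n) - shift n) - \<Delta>t * grid_lap h U i j k"
      unfolding e_def gp U_def phi_step(4)[of n i j k, symmetric] by simp
    then show ?thesis by (simp add: left_diff_distrib)
  qed
  have inc: "grid_inner L N (\<lambda>i j k. e i j k - gap n i j k) \<psi>
    = grid_inner L N (P (Suc n)) \<psi> - grid_inner L N (P n) \<psi> - \<Delta>t * grid_inner L N (grid_lap h U) \<psi>"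
    unfolding grid_inner_gsum pt gsum_diff gsum_cmult \<psi>(2) by (simp add: right_diff_distrib mult.left_commute)
  have neg: "grid_inner L N V (grid_lap h \<psi>) = - grid_inner L N V e" for V
    unfolding lap grid_inner_gsum using gsum_cmult[of N "-1" "\<lambda>i j k. V i j k * e i j k"] by simp
  have sym: "grid_inner L N (grid_lap h V) \<psi> = - grid_inner L N V e" if "V \<in> grid_per N" for V
    using grid_inner_lap_symmetric[OF L N that \<psi>(1)] neg[of V] unfolding h_def by simp
  have sq: "grid_inner L N (grid_lap h \<psi>) (grid_lap h \<psi>) = grid_inner L N e e"
    unfolding lap grid_inner_gsum by simp
  have "\<bar>grid_inner L N (P (Suc n)) \<psi> - grid_inner L N (P n) \<psi> - (tm (Suc n) - tm n) * grid_inner L N (grid_lap h W) \<psi>\<bar>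
    \<le> (tm (Suc n) - tm n) * ((1 / 2 * (L ^ 3 * (3 * M * h\<^sup>2)\<^sup>2) + 1 / (2 * 1) * grid_inner L N \<psi> \<psi>)
       + (1 / 2 * (L ^ 3 * (residual_const * ?r)\<^sup>2) + 1 / (2 * 1) * grid_inner L N (grid_lap h \<psi>) (grid_lap h \<psi>)))"
    unfolding P_def
  proof (rule consistency[OF N h_def])
    show "0 \<le> tm n" "tm n \<le> tm (Suc n)" using dt by simp_all
    show "\<bar>grid_proj h (chem_pot \<epsilon> (\<Phi> t)) i j k - W i j k\<bar> \<le> residual_const * ?r"
      if "good_time B t" "t \<in> {tm n<..<tm (Suc n)}" for t i j k
      unfolding W_def by (rule chem_pot_residual[OF n that])
  qed (use n W \<psi> in auto)
  then have cons: "grid_inner L N (P (Suc n)) \<psi> - grid_inner L N (P n) \<psi> - \<Delta>t * grid_inner L N (grid_lap h W) \<psi>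
    \<le> \<Delta>t * ((1 / 2 * (L ^ 3 * (3 * M * h\<^sup>2)\<^sup>2) + 1 / 2 * grid_inner L N \<psi> \<psi>)
       + (1 / 2 * (L ^ 3 * (residual_const * ?r)\<^sup>2) + 1 / 2 * grid_inner L N e e))"
    unfolding nS sq by simp
  have src: "1 / 2 * (L ^ 3 * (3 * M * h\<^sup>2)\<^sup>2) + 1 / 2 * (L ^ 3 * (residual_const * ?r)\<^sup>2) \<le> source * ?r\<^sup>2"
  proof -
    have "(h\<^sup>2)\<^sup>2 \<le> ?r\<^sup>2" using dt by (intro power_mono) auto
    then have "L ^ 3 / 2 * (9 * M\<^sup>2) * (h\<^sup>2)\<^sup>2 \<le> L ^ 3 / 2 * (9 * M\<^sup>2) * ?r\<^sup>2" using L by (intro mult_left_mono) auto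
    moreover have "1 / 2 * (L ^ 3 * (3 * M * h\<^sup>2)\<^sup>2) = L ^ 3 / 2 * (9 * M\<^sup>2) * (h\<^sup>2)\<^sup>2"
      "1 / 2 * (L ^ 3 * (residual_const * ?r)\<^sup>2) = L ^ 3 / 2 * residual_const\<^sup>2 * ?r\<^sup>2"
      by (simp_all add: power_mult_distrib)
    moreover have "source * ?r\<^sup>2 = L ^ 3 / 2 * (9 * M\<^sup>2) * ?r\<^sup>2 + L ^ 3 / 2 * residual_const\<^sup>2 * ?r\<^sup>2"
      by (simp only: source_def distrib_left distrib_right)
    ultimately show ?thesis by linarith
  qed
  have psi2: "1 / 2 * grid_inner L N \<psi> \<psi> \<le> 3 * L\<^sup>2 * ((neg_norm L N e)\<^sup>2 / 2)"
    using inv_neg_lap_l2[OF L N e] unfolding \<psi>_def e_def by simp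
  have main: "(neg_norm L N e)\<^sup>2 / 2 - (neg_norm L N (gap n))\<^sup>2 / 2
    \<le> \<Delta>t * (grid_inner L N U e - grid_inner L N W e)
      + \<Delta>t * (source * ?r\<^sup>2 + 3 * L\<^sup>2 * ((neg_norm L N e)\<^sup>2 / 2) + grid_inner L N e e / 2)"
  proof -
    have a: "(1 / 2 * (L ^ 3 * (3 * M * h\<^sup>2)\<^sup>2) + 1 / 2 * grid_inner L N \<psi> \<psi>)
       + (1 / 2 * (L ^ 3 * (residual_const * ?r)\<^sup>2) + 1 / 2 * grid_inner L N e e)
      \<le> source * ?r\<^sup>2 + 3 * L\<^sup>2 * ((neg_norm L N e)\<^sup>2 / 2) + grid_inner L N e e / 2"
      using src psi2 by argo
    from mult_left_mono[OF a less_imp_le[OF dt]] cons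
    have b: "grid_inner L N (P (Suc n)) \<psi> - grid_inner L N (P n) \<psi> - \<Delta>t * grid_inner L N (grid_lap h W) \<psi>
      \<le> \<Delta>t * (source * ?r\<^sup>2 + 3 * L\<^sup>2 * ((neg_norm L N e)\<^sup>2 / 2) + grid_inner L N e e / 2)" by (rule order_trans[rotated])
    have "(neg_norm L N e)\<^sup>2 / 2 - (neg_norm L N (gap n))\<^sup>2 / 2 \<le> grid_inner L N (\<lambda>i j k. e i j k - gap n i j k) \<psi>"
      unfolding \<psi>_def e_def by (rule neg_norm_increment[OF L N e gap_per[OF n0] gsum_gap])
    with b show ?thesis unfolding inc sym[OF U] sym[OF W] right_diff_distrib by linarith
  qed
  show ?thesis using main residual_pairing[OF n] unfolding e_def U_def W_def by simp
qed

text \<open>Young's inequality with weight \<open>1 / C1\<close>: it charges the dissipation of the old time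
  level with the coefficient \<open>4/3\<close>, half of what the scheme produces there.\<close>

lemma explicit_term_bound:
  "8/3 * grid_inner L N (\<lambda>i j k. \<phi> n i j k powi (-3) - comparison n i j k powi (-3)) e
    \<le> 4/3 * (dissipation n + grid_inner L N (gap n) (gap n)) + 4/3 * C1 * grid_inner L N e e"
  if n: "tm n \<le> T"
proof -
  let ?v = "\<lambda>i j k. \<phi> n i j k powi (-3) - comparison n i j k powi (-3)"
  have "gsum N (\<lambda>i j k. ?v i j k * ?v i j k)
    \<le> gsum N (\<lambda>i j k. C1 * ((\<phi> n i j k powi (-9) - comparison n i j k powi (-9)) * gap n i j k + gap n i j k * gap n i j k))"
    using C1(2)[OF phi_pos comparison_lower[OF n]] by (intro gsum_mono) (simp add: gap_def power2_eq_square)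
  then have "(mesh L N)^3 * gsum N (\<lambda>i j k. ?v i j k * ?v i j k) \<le> (mesh L N)^3 * (C1 *
      (gsum N (\<lambda>i j k. (\<phi> n i j k powi (-9) - comparison n i j k powi (-9)) * gap n i j k) + gsum N (\<lambda>i j k. gap n i j k * gap n i j k)))"
    unfolding gsum_cmult gsum_add using mesh_pos[OF L N] by (intro mult_left_mono) auto
  then have vv: "grid_inner L N ?v ?v \<le> C1 * (dissipation n + grid_inner L N (gap n) (gap n))"
    unfolding dissipation_inner grid_inner_gsum by (simp add: distrib_left mult.left_commute)
  have "grid_inner L N ?v e \<le> 1 / C1 / 2 * grid_inner L N ?v ?v + 1 / (2 * (1 / C1)) * grid_inner L N e e"
    using C1(1) by (intro grid_inner_young[OF L N]) simp
  also have "1 / C1 / 2 * grid_inner L N ?v ?v \<le> 1 / C1 / 2 * (C1 * (dissipation n + grid_inner L N (gap n) (gap n)))"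
    using C1(1) by (intro mult_left_mono vv) simp
  also have "\<dots> = (dissipation n + grid_inner L N (gap n) (gap n)) / 2" using C1(1) by simp
  finally have "grid_inner L N ?v e \<le> (dissipation n + grid_inner L N (gap n) (gap n)) / 2 + C1 / 2 * grid_inner L N e e" by simp
  then show ?thesis by argo
qed

text \<open>Each step produces \<open>8/3\<close> of the dissipation at its own level, of which
  \<open>4/3\<close> are kept to pay for the explicit term of the following step. The gradient
  term is kept for the same purpose, through interpolation of the \<open>l\<^sup>2\<close> norm.\<close>

definition energy :: "nat \<Rightarrow> real" where
  "energy m = (neg_norm L N (gap m))\<^sup>2 / 2 + \<Delta>t * (4/3 * dissipation m) + \<Delta>t * (\<epsilon>\<^sup>2 / 4 * grid_grad_sq L N (gap m))"

lemma neg_norm_le_energy: "tm m \<le> T \<Longrightarrow> (neg_norm L N (gap m))\<^sup>2 / 2 \<le> energy m"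
  using dissipation_nonneg[of m] dt grid_grad_sq_nonneg[OF L N, of "gap m"] by (simp add: energy_def)

lemma energy_step:
  assumes n: "tm (Suc n) \<le> T"
  shows "energy (Suc n) + \<Delta>t * (\<epsilon>\<^sup>2 / 2 * grid_grad_sq L N (gap (Suc n)))
    \<le> energy n + \<Delta>t * (growth * (energy n + energy (Suc n))) + \<Delta>t * (source * (\<Delta>t + h\<^sup>2)\<^sup>2)"
proof -
  have nS: "tm (Suc n) - tm n = \<Delta>t" by (simp add: algebra_simps)
  have n0: "tm n \<le> T" using n nS dt by linarith
  let ?e = "gap (Suc n)" and ?g = "gap n"
  let ?X' = "(neg_norm L N ?e)\<^sup>2 / 2" and ?X = "(neg_norm L N ?g)\<^sup>2 / 2"
  let ?S' = "grid_inner L N ?e ?e" and ?S = "grid_inner L N ?g ?g"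
  let ?G' = "grid_grad_sq L N ?e" and ?G = "grid_grad_sq L N ?g"
  let ?D' = "dissipation (Suc n)" and ?D = "dissipation n"
  let ?Q = "grid_inner L N (\<lambda>i j k. \<phi> n i j k powi (-3) - comparison n i j k powi (-3)) ?e"
  let ?F = "source * (\<Delta>t + h\<^sup>2)\<^sup>2"
  have e2: "\<epsilon>\<^sup>2 > 0" using eps by simp
  have S: "4/3 * ?S \<le> \<epsilon>\<^sup>2 / 4 * ?G + 32 / (9 * \<epsilon>\<^sup>2) * ?X"
  proof -
    have "?S \<le> (3 * \<epsilon>\<^sup>2 / 8) / 2 * ?G + 1 / (2 * (3 * \<epsilon>\<^sup>2 / 8)) * (neg_norm L N ?g)\<^sup>2"
      using e2 by (intro l2_interpolation[OF L N gap_per[OF n0] gsum_gap]) simp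
    then have "4/3 * ?S \<le> 4/3 * ((3 * \<epsilon>\<^sup>2 / 8) / 2 * ?G + 1 / (2 * (3 * \<epsilon>\<^sup>2 / 8)) * (neg_norm L N ?g)\<^sup>2)"
      by (rule mult_left_mono) simp
    also have "\<dots> = \<epsilon>\<^sup>2 / 4 * ?G + 32 / (9 * \<epsilon>\<^sup>2) * ?X" using e2 by (simp add: field_simps)
    finally show ?thesis .
  qed
  have S': "\<kappa> * ?S' \<le> \<epsilon>\<^sup>2 / 4 * ?G' + 2 * \<kappa>\<^sup>2 / \<epsilon>\<^sup>2 * ?X'"
  proof -
    have "?S' \<le> (\<epsilon>\<^sup>2 / (2 * \<kappa>)) / 2 * ?G' + 1 / (2 * (\<epsilon>\<^sup>2 / (2 * \<kappa>))) * (neg_norm L N ?e)\<^sup>2"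
      using e2 \<kappa>_pos by (intro l2_interpolation[OF L N gap_per[OF n] gsum_gap]) simp
    then have "\<kappa> * ?S' \<le> \<kappa> * ((\<epsilon>\<^sup>2 / (2 * \<kappa>)) / 2 * ?G' + 1 / (2 * (\<epsilon>\<^sup>2 / (2 * \<kappa>))) * (neg_norm L N ?e)\<^sup>2)"
      using \<kappa>_pos by (intro mult_left_mono) auto
    also have "\<dots> = \<epsilon>\<^sup>2 / 4 * ?G' + 2 * \<kappa>\<^sup>2 / \<epsilon>\<^sup>2 * ?X'" using e2 \<kappa>_pos by (simp add: field_simps power2_eq_square)
    finally show ?thesis .
  qed
  define a b where "a = 32 / (9 * \<epsilon>\<^sup>2)" and "b = 2 * \<kappa>\<^sup>2 / \<epsilon>\<^sup>2"
  have ab: "a \<ge> 0" "b \<ge> 0" by (simp_all add: a_def b_def)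
  have gr: "growth = a + b + 3 * L\<^sup>2" by (simp add: growth_def a_def b_def)
  have E: "?X \<le> energy n" "?X' \<le> energy (Suc n)" by (rule neg_norm_le_energy[OF n0], rule neg_norm_le_energy[OF n])
  have E0: "0 \<le> energy n" "0 \<le> energy (Suc n)" by (rule order_trans[OF _ E(1)], simp, rule order_trans[OF _ E(2)], simp)
  have t: "a * ?X + b * ?X' + 3 * L\<^sup>2 * ?X' \<le> growth * (energy n + energy (Suc n))"
  proof -
    have "a * ?X \<le> growth * energy n"
      using E(1) E0 ab by (intro mult_mono) (auto simp: gr)
    moreover have "(b + 3 * L\<^sup>2) * ?X' \<le> growth * energy (Suc n)"
      using E(2) E0 ab by (intro mult_mono) (auto simp: gr)
    ultimately show ?thesis by (simp add: distrib_left distrib_right)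
  qed
  have q: "8/3 * ?Q + ?S' / 2 + 3 * L\<^sup>2 * ?X'
    \<le> 4/3 * ?D + \<epsilon>\<^sup>2 / 4 * ?G + \<epsilon>\<^sup>2 / 4 * ?G' + growth * (energy n + energy (Suc n))"
  proof -
    have "\<kappa> * ?S' = 4/3 * C1 * ?S' + ?S' / 2" by (simp add: \<kappa>_def distrib_right)
    then show ?thesis
      using explicit_term_bound[OF n0, of ?e] S[folded a_def] S'[folded b_def] t by argo
  qed
  have "?X' - ?X \<le> \<Delta>t * (- (8/3) * ?D' + 8/3 * ?Q - \<epsilon>\<^sup>2 * ?G') + \<Delta>t * (?F + 3 * L\<^sup>2 * ?X' + ?S' / 2)"
    by (rule energy_inequality[OF n])
  also have "\<dots> = \<Delta>t * (- (8/3) * ?D' - \<epsilon>\<^sup>2 * ?G' + ?F) + \<Delta>t * (8/3 * ?Q + ?S' / 2 + 3 * L\<^sup>2 * ?X')"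
    unfolding distrib_left[symmetric] by (rule arg_cong[where f = "\<lambda>x. \<Delta>t * x"]) argo
  also have "\<dots> \<le> \<Delta>t * (- (8/3) * ?D' - \<epsilon>\<^sup>2 * ?G' + ?F)
      + \<Delta>t * (4/3 * ?D + \<epsilon>\<^sup>2 / 4 * ?G + \<epsilon>\<^sup>2 / 4 * ?G' + growth * (energy n + energy (Suc n)))"
    using dt by (intro add_left_mono mult_left_mono q) simp
  finally have s: "?X' - ?X \<le> \<Delta>t * (- (8/3) * ?D' - \<epsilon>\<^sup>2 * ?G' + ?F)
      + \<Delta>t * (4/3 * ?D + \<epsilon>\<^sup>2 / 4 * ?G + \<epsilon>\<^sup>2 / 4 * ?G' + growth * (energy n + energy (Suc n)))" .
  have D': "\<Delta>t * ?D' \<ge> 0" using dissipation_nonneg[OF n] dt by simp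
  \<comment> \<open>Of \<open>\<epsilon>\<^sup>2 \<parallel>\<nabla>\<^sub>h e\<parallel>\<^sup>2\<close>, one
     quarter is spent on interpolation, one quarter goes into the new energy, and one half
     remains to be summed.\<close>
  have lin: "X' + t * (4/3 * D') + t * (c / 4 * G') + t * (c / 2 * G')
     \<le> X + t * (4/3 * D) + t * (c / 4 * G) + t * H + t * F"
    if "X' - X \<le> t * (- (8/3) * D' - c * G' + F) + t * (4/3 * D + c / 4 * G + c / 4 * G' + H)" "t * D' \<ge> 0"
    for X X' D D' G G' t c F H :: real
    using that by (simp add: algebra_simps)
  show ?thesis using lin[OF s D'] unfolding energy_def[of "Suc n", symmetric] energy_def[of n, symmetric] .
qed

text \<open>The initial gap is a projection error, so it is \<open>O(h\<^sup>2)\<close> together with its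
  difference quotients. Its dissipation is quadratic in it because the projected initial data lie
  above \<open>\<delta> / 2\<close>.\<close>

lemma initial_energy:
  assumes dt1: "\<Delta>t \<le> 1"
  shows "energy 0 \<le> initial_const * (\<Delta>t + h\<^sup>2)\<^sup>2"
proof -
  have t0: "tm 0 \<le> T" using T by simp
  let ?s = "4 * L ^ 3 * proj_const\<^sup>2" and ?g = "3 * L ^ 3 * proj_grad_const\<^sup>2" and ?r = "\<Delta>t + h\<^sup>2"
  let ?e = "gap 0"
  have b: "\<bar>gap 0 i j k\<bar> \<le> 2 * proj_const * h\<^sup>2"
    "\<bar>gap 0 (i+1) j k - gap 0 i j k\<bar> \<le> proj_grad_const * h\<^sup>2 * mesh L N"
    "\<bar>gap 0 i (j+1) k - gap 0 i j k\<bar> \<le> proj_grad_const * h\<^sup>2 * mesh L N"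
    "\<bar>gap 0 i j (k+1) - gap 0 i j k\<bar> \<le> proj_grad_const * h\<^sup>2 * mesh L N" for i j k
    using proj_gap_bounds[OF t0, of i j k] by (simp_all add: gap_0 abs_minus_commute)
  have S: "grid_inner L N ?e ?e \<le> ?s * (h\<^sup>2)\<^sup>2"
    using grid_inner_sq_le_sup[OF L N b(1)] by (simp add: power_mult_distrib algebra_simps)
  have G: "grid_grad_sq L N ?e \<le> ?g * (h\<^sup>2)\<^sup>2"
    using grid_grad_sq_le_sup[OF L N, of "gap 0" "proj_grad_const * h\<^sup>2", OF b(2-4)] by (simp add: power_mult_distrib algebra_simps)
  have X: "(neg_norm L N ?e)\<^sup>2 / 2 \<le> 3 * L\<^sup>2 / 2 * (?s * (h\<^sup>2)\<^sup>2)"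
  proof -
    have "(neg_norm L N ?e)\<^sup>2 \<le> 3 * L\<^sup>2 * grid_inner L N ?e ?e"
      by (rule neg_norm_le_l2[OF L N gap_per[OF t0] gsum_gap])
    also have "\<dots> \<le> 3 * L\<^sup>2 * (?s * (h\<^sup>2)\<^sup>2)" by (intro mult_left_mono S) simp
    finally have "(neg_norm L N ?e)\<^sup>2 \<le> 3 * L\<^sup>2 * (?s * (h\<^sup>2)\<^sup>2)" .
    then show ?thesis by argo
  qed
  have D: "dissipation 0 \<le> K9 * (?s * (h\<^sup>2)\<^sup>2)"
  proof -
    have lo: "\<delta> / 2 \<le> \<phi> 0 i j k" for i j k
    proof -
      have "\<delta> \<le> \<Phi> 0 x" for x using lower[of 0 x] T by simp
      then show ?thesis
        using proj_error[OF t0, of "vector [node h i, node h j, node h k]"] h_small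
        unfolding init grid_proj_def proj_const_def[symmetric] of_nat_0 mult_zero_left
        by (smt (verit) field_sum_of_halves)
    qed
    have "(\<phi> 0 i j k powi (-9) - comparison 0 i j k powi (-9)) * gap 0 i j k \<le> K9 * (gap 0 i j k * gap 0 i j k)" for i j k
    proof -
      have "(\<phi> 0 i j k powi (-9) - comparison 0 i j k powi (-9)) * gap 0 i j k
        \<le> \<bar>\<phi> 0 i j k powi (-9) - comparison 0 i j k powi (-9)\<bar> * \<bar>gap 0 i j k\<bar>"
        unfolding abs_mult[symmetric] by (rule abs_ge_self)
      also have "\<dots> \<le> (K9 * \<bar>\<phi> 0 i j k - comparison 0 i j k\<bar>) * \<bar>gap 0 i j k\<bar>"
        by (rule mult_right_mono[OF K9(2)[OF lo comparison_lower[OF t0]] abs_ge_zero])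
      also have "\<dots> = K9 * (gap 0 i j k * gap 0 i j k)"
        unfolding gap_def abs_minus_commute[of "\<phi> 0 i j k"] by (simp add: mult.assoc)
      finally show ?thesis .
    qed
    then have "gsum N (\<lambda>i j k. (\<phi> 0 i j k powi (-9) - comparison 0 i j k powi (-9)) * gap 0 i j k)
      \<le> gsum N (\<lambda>i j k. K9 * (gap 0 i j k * gap 0 i j k))" by (rule gsum_mono)
    then have "dissipation 0 \<le> (mesh L N)^3 * (K9 * gsum N (\<lambda>i j k. gap 0 i j k * gap 0 i j k))"
      unfolding dissipation_inner grid_inner_gsum gsum_cmult using mesh_pos[OF L N] by (intro mult_left_mono) auto
    also have "\<dots> = K9 * grid_inner L N ?e ?e" by (simp add: grid_inner_gsum)
    also have "\<dots> \<le> K9 * (?s * (h\<^sup>2)\<^sup>2)" by (intro mult_left_mono S K9)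
    finally show ?thesis .
  qed
  have 1: "\<Delta>t * (4/3 * dissipation 0) \<le> 1 * (4/3 * (K9 * (?s * (h\<^sup>2)\<^sup>2)))"
    using D dt1 dissipation_nonneg[OF t0] by (intro mult_mono) auto
  have 2: "\<Delta>t * (\<epsilon>\<^sup>2 / 4 * grid_grad_sq L N ?e) \<le> 1 * (\<epsilon>\<^sup>2 / 4 * (?g * (h\<^sup>2)\<^sup>2))"
    using G dt1 grid_grad_sq_nonneg[OF L N, of ?e] by (intro mult_mono mult_left_mono) auto
  have "energy 0 \<le> 3 * L\<^sup>2 / 2 * (?s * (h\<^sup>2)\<^sup>2) + 1 * (4/3 * (K9 * (?s * (h\<^sup>2)\<^sup>2))) + 1 * (\<epsilon>\<^sup>2 / 4 * (?g * (h\<^sup>2)\<^sup>2))"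
    unfolding energy_def by (intro add_mono X 1 2)
  also have "\<dots> = initial_const * (h\<^sup>2)\<^sup>2" unfolding initial_const_def distrib_right mult.assoc mult_1 ..
  also have "\<dots> \<le> initial_const * ?r\<^sup>2"
    using dt L K9 by (intro mult_left_mono power_mono) (auto simp: initial_const_def)
  finally show ?thesis .
qed

lemma energy_bound:
  assumes dt1: "\<Delta>t \<le> 1" "\<Delta>t * growth \<le> 1 / 2" and m: "tm m \<le> T"
  shows "energy m + \<Delta>t * (\<epsilon>\<^sup>2 / 2) * (\<Sum>n=1..m. grid_grad_sq L N (gap n)) \<le> energy_const * (\<Delta>t + h\<^sup>2)\<^sup>2"
proof -
  let ?r = "\<Delta>t + h\<^sup>2"
  define Z where "Z m = \<Delta>t * (\<epsilon>\<^sup>2 / 2) * (\<Sum>n=1..m. grid_grad_sq L N (gap n))" for m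
  have Z: "Z n \<ge> 0" for n
    unfolding Z_def using dt by (intro mult_nonneg_nonneg sum_nonneg grid_grad_sq_nonneg[OF L N]) auto
  have tn: "tm n \<le> T" if "n \<le> m" for n
  proof -
    have "tm n \<le> tm m" using that dt by (intro mult_right_mono) auto
    then show ?thesis using m by simp
  qed
  have E: "energy n \<ge> 0" if "n \<le> m" for n
    by (rule order_trans[OF _ neg_norm_le_energy[OF tn[OF that]]]) simp
  have "energy m + Z m \<le> exp (4 * growth * T) * ((energy 0 + Z 0) + 2 * T * (source * ?r\<^sup>2))"
  proof (rule discrete_gronwall[where \<tau> = \<Delta>t and Y = "\<lambda>m. energy m + Z m"])
    fix n assume n: "n < m"
    have "energy (Suc n) + Z (Suc n) = (energy (Suc n) + \<Delta>t * (\<epsilon>\<^sup>2 / 2 * grid_grad_sq L N (gap (Suc n)))) + Z n"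
      by (simp add: Z_def distrib_left mult.assoc)
    also have "\<dots> \<le> (energy n + \<Delta>t * (growth * (energy n + energy (Suc n))) + \<Delta>t * (source * ?r\<^sup>2)) + Z n"
      using n by (intro add_right_mono energy_step tn) simp
    also have "\<Delta>t * (growth * (energy n + energy (Suc n))) \<le> \<Delta>t * (growth * ((energy n + Z n) + (energy (Suc n) + Z (Suc n))))"
      using Z[of n] Z[of "Suc n"] dt growth_pos by (intro mult_left_mono) auto
    finally show "energy (Suc n) + Z (Suc n)
      \<le> energy n + Z n + \<Delta>t * growth * (energy n + Z n + (energy (Suc n) + Z (Suc n))) + \<Delta>t * (source * ?r\<^sup>2)"
      by (simp only: mult.assoc) simp
  qed (use E Z growth_pos dt dt1 source_nonneg m in auto)
  also have "\<dots> \<le> exp (4 * growth * T) * (initial_const * ?r\<^sup>2 + 2 * T * (source * ?r\<^sup>2))"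
    using initial_energy[OF dt1(1)] by (intro mult_left_mono) (auto simp: Z_def)
  also have "\<dots> = energy_const * ?r\<^sup>2" by (simp add: energy_const_def algebra_simps)
  finally show ?thesis by (simp add: Z_def)
qed

lemma err_eq: "err L K \<Delta>t \<Phi> \<phi> m = (\<lambda>i j k. gap m i j k + proj_gap m i j k)"
proof -
  have "mesh L (2 * K + 1) = h" by (simp only: h_def N_def)
  then have "err L K \<Delta>t \<Phi> \<phi> m i j k = grid_proj h (fourier_proj L K (\<Phi> (tm m))) i j k - \<phi> m i j k" for i j k
    by (simp only: err_def)
  then show ?thesis by (simp add: fun_eq_iff gap_def proj_gap_def)
qed

lemma error_bound:
  assumes dt1: "\<Delta>t \<le> 1" "\<Delta>t * growth \<le> 1 / 2" and m: "tm m \<le> T"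
  shows "neg_norm L N (err L K \<Delta>t \<Phi> \<phi> m)
    + sqrt (\<epsilon>\<^sup>2 * \<Delta>t * (\<Sum>n=1..m. grid_grad_sq L N (err L K \<Delta>t \<Phi> \<phi> n)))
    \<le> error_const * (\<Delta>t + h\<^sup>2)"
proof -
  let ?r = "\<Delta>t + h\<^sup>2" and ?e = "err L K \<Delta>t \<Phi> \<phi>"
  let ?s = "4 * L ^ 3 * proj_const\<^sup>2" and ?g = "3 * L ^ 3 * proj_grad_const\<^sup>2"
  let ?G = "\<Sum>n=1..m. grid_grad_sq L N (gap n)"
  have r: "?r \<ge> 0" "(h\<^sup>2)\<^sup>2 \<le> ?r\<^sup>2" using dt by (simp, intro power_mono) auto
  have tn: "tm n \<le> T" if "n \<le> m" for n
  proof -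
    have "tm n \<le> tm m" using that dt by (intro mult_right_mono) auto
    then show ?thesis using m by simp
  qed
  note eb = energy_bound[OF dt1 m]
  have G0: "\<Delta>t * (\<epsilon>\<^sup>2 / 2) * ?G \<ge> 0"
    using dt by (intro mult_nonneg_nonneg sum_nonneg grid_grad_sq_nonneg[OF L N]) auto
  have E0: "energy m \<ge> 0" by (rule order_trans[OF _ neg_norm_le_energy[OF m]]) simp
  have X: "(neg_norm L N (gap m))\<^sup>2 \<le> 2 * (energy_const * ?r\<^sup>2)"
    using eb G0 neg_norm_le_energy[OF m] by linarith
  have Gg: "\<epsilon>\<^sup>2 * \<Delta>t * ?G \<le> 2 * (energy_const * ?r\<^sup>2)"
  proof -
    have "\<epsilon>\<^sup>2 * \<Delta>t * ?G = 2 * (\<Delta>t * (\<epsilon>\<^sup>2 / 2) * ?G)" by simp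
    then show ?thesis using eb E0 by linarith
  qed
  have Xp: "(neg_norm L N (proj_gap m))\<^sup>2 \<le> 3 * L\<^sup>2 * (?s * ?r\<^sup>2)"
  proof -
    have "grid_inner L N (proj_gap m) (proj_gap m) \<le> ?s * (h\<^sup>2)\<^sup>2"
      using grid_inner_sq_le_sup[OF L N proj_gap_bounds(1)[OF m]] by (simp add: power_mult_distrib algebra_simps)
    also have "\<dots> \<le> ?s * ?r\<^sup>2" using L by (intro mult_left_mono r) auto
    finally have "3 * L\<^sup>2 * grid_inner L N (proj_gap m) (proj_gap m) \<le> 3 * L\<^sup>2 * (?s * ?r\<^sup>2)"
      by (rule mult_left_mono) simp
    then show ?thesis using neg_norm_le_l2[OF L N proj_gap_per[OF m] gsum_proj_gap[OF m]] by simp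
  qed
  have first: "(neg_norm L N (?e m))\<^sup>2 \<le> (4 * energy_const + 6 * L\<^sup>2 * ?s) * ?r\<^sup>2"
  proof -
    have "(neg_norm L N (?e m))\<^sup>2 \<le> 2 * (neg_norm L N (gap m))\<^sup>2 + 2 * (neg_norm L N (proj_gap m))\<^sup>2"
      unfolding err_eq by (rule neg_norm_sq_add_le[OF L N gap_per[OF m] gsum_gap proj_gap_per[OF m] gsum_proj_gap[OF m]])
    also have "\<dots> \<le> 2 * (2 * (energy_const * ?r\<^sup>2)) + 2 * (3 * L\<^sup>2 * (?s * ?r\<^sup>2))"
      by (intro add_mono mult_left_mono X Xp) auto
    also have "\<dots> = (4 * energy_const + 6 * L\<^sup>2 * ?s) * ?r\<^sup>2" by (simp add: distrib_right)
    finally show ?thesis .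
  qed
  have grad: "grid_grad_sq L N (?e n) \<le> 2 * grid_grad_sq L N (gap n) + 2 * (?g * ?r\<^sup>2)" if n: "n \<le> m" for n
  proof -
    have "grid_grad_sq L N (proj_gap n) \<le> 3 * L ^ 3 * (proj_grad_const * h\<^sup>2)\<^sup>2"
      by (rule grid_grad_sq_le_sup[OF L N, of "proj_gap n" "proj_grad_const * h\<^sup>2", OF proj_gap_bounds(2-4)[OF tn[OF n]]])
    also have "\<dots> = ?g * (h\<^sup>2)\<^sup>2" by (simp add: power_mult_distrib)
    also have "\<dots> \<le> ?g * ?r\<^sup>2" using L by (intro mult_left_mono r) auto
    finally show ?thesis using grid_grad_sq_add_le[OF L N, of "gap n" "proj_gap n"] unfolding err_eq by linarith
  qed
  have second: "\<epsilon>\<^sup>2 * \<Delta>t * (\<Sum>n=1..m. grid_grad_sq L N (?e n)) \<le> (4 * energy_const + 2 * \<epsilon>\<^sup>2 * T * ?g) * ?r\<^sup>2"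
  proof -
    have "(\<Sum>n=1..m. grid_grad_sq L N (?e n)) \<le> (\<Sum>n=1..m. 2 * grid_grad_sq L N (gap n) + 2 * (?g * ?r\<^sup>2))"
      by (intro sum_mono grad) simp
    also have "\<dots> = 2 * ?G + real m * (2 * (?g * ?r\<^sup>2))" by (simp add: sum.distrib sum_distrib_left)
    finally have "\<epsilon>\<^sup>2 * \<Delta>t * (\<Sum>n=1..m. grid_grad_sq L N (?e n)) \<le> \<epsilon>\<^sup>2 * \<Delta>t * (2 * ?G + real m * (2 * (?g * ?r\<^sup>2)))"
      using dt by (intro mult_left_mono) auto
    also have "\<dots> = 2 * (\<epsilon>\<^sup>2 * \<Delta>t * ?G) + \<epsilon>\<^sup>2 * (2 * (?g * ?r\<^sup>2)) * tm m"
      by (simp only: distrib_left mult_ac)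
    also have "\<dots> \<le> 2 * (2 * (energy_const * ?r\<^sup>2)) + \<epsilon>\<^sup>2 * (2 * (?g * ?r\<^sup>2)) * T"
      using L by (intro add_mono mult_left_mono Gg m) auto
    also have "\<dots> = (4 * energy_const + 2 * \<epsilon>\<^sup>2 * T * ?g) * ?r\<^sup>2" by (simp add: distrib_right)
    finally show ?thesis .
  qed
  have rt: "sqrt (c * ?r\<^sup>2) = sqrt c * ?r" for c using r(1) by (simp add: real_sqrt_mult)
  have "neg_norm L N (?e m) \<le> sqrt (4 * energy_const + 6 * L\<^sup>2 * ?s) * ?r"
    unfolding rt[symmetric] by (rule real_le_rsqrt[OF first])
  moreover have "sqrt (\<epsilon>\<^sup>2 * \<Delta>t * (\<Sum>n=1..m. grid_grad_sq L N (?e n))) \<le> sqrt (4 * energy_const + 2 * \<epsilon>\<^sup>2 * T * ?g) * ?r"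
    unfolding rt[symmetric] by (rule real_sqrt_le_mono[OF second])
  ultimately show ?thesis unfolding error_const_def distrib_right by (rule add_mono)
qed

end

lemma (in film_solution) ex_film_constants: "\<exists>\<delta> B M K3 K9 C1. film_constants L T \<epsilon> \<Phi> \<delta> B M K3 K9 C1"
proof -
  obtain \<delta> B M where b: "film_bounds L T \<epsilon> \<Phi> \<delta> B M" using ex_film_bounds by blast
  then have d: "\<delta> / 2 > 0" by (simp add: film_bounds_def film_bounds_axioms_def)
  obtain K3 where K3: "K3 \<ge> 0" "\<forall>a b. \<delta> / 2 \<le> a \<longrightarrow> \<delta> / 2 \<le> b \<longrightarrow> \<bar>a powi (-3) - b powi (-3)\<bar> \<le> K3 * \<bar>a - b\<bar>"
    using powi_lipschitz[OF d, of "-3"] by auto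
  obtain K9 where K9: "K9 \<ge> 0" "\<forall>a b. \<delta> / 2 \<le> a \<longrightarrow> \<delta> / 2 \<le> b \<longrightarrow> \<bar>a powi (-9) - b powi (-9)\<bar> \<le> K9 * \<bar>a - b\<bar>"
    using powi_lipschitz[OF d, of "-9"] by auto
  obtain C1 where C1: "C1 > 0" "\<forall>a b. a > 0 \<longrightarrow> \<delta> / 2 \<le> b \<longrightarrow>
      (a powi (-3) - b powi (-3))\<^sup>2 \<le> C1 * ((a powi (-9) - b powi (-9)) * (b - a) + (b - a)\<^sup>2)"
    using explicit_term_controlled[OF d] by blast
  have "film_constants L T \<epsilon> \<Phi> \<delta> B M K3 K9 C1"
    using b K3 K9 C1 by (simp add: film_constants_def film_constants_axioms_def)
  then show ?thesis by blast
qed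

theorem theorem3p3:
  fixes L T \<epsilon> :: real and \<Phi> :: "real \<Rightarrow> real^3 \<Rightarrow> real"
  assumes "L > 0" and "\<epsilon> > 0" and "T > 0"
    and "\<Phi> 0 \<in> C_per L 6"
    and "\<And>t x. t \<in> {0..T} \<Longrightarrow> \<Phi> t x > 0"
    and "\<Phi> \<in> reg_class L T"
    and "pde_solution \<epsilon> T \<Phi>"
  shows "\<exists>C>0. \<exists>\<Delta>t\<^sub>0>0. \<exists>h\<^sub>0>0. \<forall>(K::nat) (N::nat) (h::real) (\<Delta>t::real) (\<phi>::nat \<Rightarrow> grid_fun).
     N = 2 * K + 1 \<longrightarrow> h = mesh L N \<longrightarrow> h \<le> h\<^sub>0 \<longrightarrow> 0 < \<Delta>t \<longrightarrow> \<Delta>t \<le> \<Delta>t\<^sub>0 \<longrightarrow>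
     \<phi> 0 = grid_proj h (fourier_proj L K (\<Phi> 0)) \<longrightarrow>
     scheme_solution \<epsilon> L N \<Delta>t \<phi> \<longrightarrow>
     (\<forall>n::nat. n \<ge> 1 \<longrightarrow> real n * \<Delta>t \<le> T \<longrightarrow>
        neg_norm L N (err L K \<Delta>t \<Phi> \<phi> n)
        + sqrt (\<epsilon>\<^sup>2 * \<Delta>t * (\<Sum>m=1..n. grid_grad_sq L N (err L K \<Delta>t \<Phi> \<phi> m)))
        \<le> C * (\<Delta>t + h\<^sup>2))"
proof -
  have "film_solution L T \<epsilon> \<Phi>" using assms by unfold_locales auto
  then obtain \<delta> B M K3 K9 C1 where "film_constants L T \<epsilon> \<Phi> \<delta> B M K3 K9 C1"
    using film_solution.ex_film_constants by blast
  then interpret film_constants L T \<epsilon> \<Phi> \<delta> B M K3 K9 C1 .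
  define C where "C = \<bar>error_const\<bar> + 1"
  \<comment> \<open>The second bound is the step size condition of the Gronwall inequality.\<close>
  define \<Delta>t0 where "\<Delta>t0 = min 1 (1 / (2 * growth))"
  \<comment> \<open>The bound \<open>L / 3\<close> excludes the one-point grid \<open>N = 1\<close>; the last
     bound yields \<open>h_small\<close>, as \<open>h\<^sup>2 \<le> h\<close> for \<open>h \<le>
     1\<close>.\<close>
  define h0 where "h0 = min (L / 3) (min 1 (\<delta> / (2 * (proj_const + 1))))"
  have pos: "C > 0" "\<Delta>t0 > 0" "h0 > 0"
    using growth_pos L \<delta> proj_const_nonneg by (auto simp: C_def \<Delta>t0_def h0_def)
  have bound: "neg_norm L N (err L K \<Delta>t \<Phi> \<phi> n)
        + sqrt (\<epsilon>\<^sup>2 * \<Delta>t * (\<Sum>m=1..n. grid_grad_sq L N (err L K \<Delta>t \<Phi> \<phi> m))) \<le> C * (\<Delta>t + h\<^sup>2)"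
    if N: "N = 2 * K + 1" and h: "h = mesh L N" "h \<le> h0" and dt: "0 < \<Delta>t" "\<Delta>t \<le> \<Delta>t0"
      and init: "\<phi> 0 = grid_proj h (fourier_proj L K (\<Phi> 0))" and sch: "scheme_solution \<epsilon> L N \<Delta>t \<phi>"
      and n: "real n * \<Delta>t \<le> T" for K N h \<Delta>t \<phi> n
  proof -
    have "h \<le> L / 3" "h \<le> 1" "h \<le> \<delta> / (2 * (proj_const + 1))" using h(2) by (simp_all add: h0_def)
    have "K \<noteq> 0"
    proof
      assume "K = 0"
      then show False using \<open>h \<le> L / 3\<close> h(1) N L by (simp add: mesh_def)
    qed
    have h0: "h > 0" unfolding h(1) using N by (intro mesh_pos[OF L]) simp
    have "324 * B * L ^ 4 * h\<^sup>2 \<le> \<delta> / 2"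
    proof -
      have "proj_const * h\<^sup>2 \<le> (proj_const + 1) * h" using proj_const_nonneg h0 \<open>h \<le> 1\<close>
        by (intro mult_mono) (auto simp: power2_eq_square mult_left_le)
      also have "\<dots> \<le> (proj_const + 1) * (\<delta> / (2 * (proj_const + 1)))"
        using proj_const_nonneg by (intro mult_left_mono \<open>h \<le> \<delta> / (2 * (proj_const + 1))\<close>) simp
      also have "\<dots> = \<delta> / 2" using proj_const_nonneg by (simp add: nonzero_eq_divide_eq divide_simps add_nonneg_eq_0_iff)
      finally show ?thesis by (simp add: proj_const_def)
    qed
    then interpret film_scheme L T \<epsilon> \<Phi> \<delta> B M K3 K9 C1 K N h \<Delta>t \<phi>
      using \<open>K \<noteq> 0\<close> N h(1) dt(1) init sch by unfold_locales auto
    have "\<Delta>t \<le> 1" and dg: "\<Delta>t \<le> 1 / (2 * growth)" using \<open>\<Delta>t \<le> \<Delta>t0\<close> unfolding \<Delta>t0_def by simp_all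
    moreover have "\<Delta>t * growth \<le> 1 / 2"
      using mult_right_mono[OF dg less_imp_le[OF growth_pos]] growth_pos by simp
    ultimately have "\<Delta>t \<le> 1" "\<Delta>t * growth \<le> 1 / 2" by simp_all
    from error_bound[OF this n]
    have "neg_norm L N (err L K \<Delta>t \<Phi> \<phi> n)
        + sqrt (\<epsilon>\<^sup>2 * \<Delta>t * (\<Sum>m=1..n. grid_grad_sq L N (err L K \<Delta>t \<Phi> \<phi> m))) \<le> error_const * (\<Delta>t + h\<^sup>2)" .
    also have "\<dots> \<le> C * (\<Delta>t + h\<^sup>2)" using dt by (intro mult_right_mono) (auto simp: C_def)
    finally show ?thesis .
  qed
  show ?thesis
    by (rule exI[of _ C], rule conjI[OF pos(1)], rule exI[of _ \<Delta>t0], rule conjI[OF pos(2)],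
        rule exI[of _ h0], rule conjI[OF pos(3)], intro allI impI) (rule bound)
qed

end
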